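(* Let $M$ be a compact connected complex manifold without boundary of complex dimension $1$, and let $g_1,g_2$ be two $J$-invariant Riemannian metrics on the real tangent bundle of $M$. Then $\Omega^{g_1,g_2}_{\overline\partial}(f_1,f_2)=0$ for all $f_1,f_2\in C^\infty(M)$.
   Context: Let $M$ have complex dimension $n$ (here $n=1$), let $p+q=n$, and let $A^{p,q}$ be the smooth $(p,q)$-forms. A $J$-invariant Riemannian metric $g$ ($J$ the complex structure) induces a pointwise Hermitian inner product on $(p,q)$-forms and, by integration against the volume form, an $L^2$ inner product; $L^2(A^{p,q})$ is the completion. Let $P^{g}_{\mathrm{Im}\,\overline\partial}$ be the orthogonal projection of $L^2(A^{p,q})$ onto the (closure of the) image of $\overline\partial:A^{p,q-1}\to A^{p,q}$ and $F^{g}_{\overline\partial}=2P^{g}_{\mathrm{Im}\,\overline\partial}-\mathrm{Id}$, a pseudodifferential operator of order $0$. The $2n$-form $\Omega^{g_1,g_2}_{\overline\partial}(f_1,f_2)$ is defined by $$\mathrm{Wres}\big(f_0[F^{g_1}_{\overline\partial},f_1][F^{g_2}_{\overline\partial},f_2]\big)=\int_M f_0\,\Omega^{g_1,g_2}_{\overline\partial}(f_1,f_2)\qquad\text{for all } f_0\in C^\infty(M),$$ where functions act by multiplication and $[F,f]=Ff-fF$. For $n=1$ the operators act on $\wedge^{0,1}$, i.e. $(p,q)=(0,1)$. Wodzicki residue: for a classical pseudodifferential operator $P$ on sections of a vector bundle over a compact manifold of real dimension $k$ (here $k=2n=2$), $\mathrm{Wres}(P)=\int_M\int_{|\xi|=1}\mathrm{Tr}(\sigma_{-k}(P)(x,\xi))\,\sigma(\xi)\,dx$,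 where $\sigma_{-k}(P)$ is the order $-k$ component of the symbol in local coordinates, $\mathrm{Tr}$ is the fibrewise trace, and $\sigma(\xi)$ is the canonical volume on the $(k-1)$-sphere. *)

theory Defs
  imports "HOL-Analysis.Analysis"
begin

section \<open>Smooth functions on Euclidean spaces\<close>

definition iter_deriv ::
    "'a::euclidean_space list \<Rightarrow> ('a \<Rightarrow> 'b::euclidean_space) \<Rightarrow> 'a \<Rightarrow> 'b" where
  "iter_deriv vs f = foldr (\<lambda>v h x. frechet_derivative h (at x) v) vs f"

text \<open>Only used for open sets: every iterated directional derivative exists and is again
  differentiable.\<close>

definition smooth_on :: "'a::euclidean_space set \<Rightarrow> ('a \<Rightarrow> 'b::euclidean_space) \<Rightarrow> bool" where
  "smooth_on S f \<longleftrightarrow> (\<forall>vs. \<forall>x\<in>S. iter_deriv vs f differentiable (at x))"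

definition test_functions :: "complex set \<Rightarrow> (complex \<Rightarrow> complex) set" where
  "test_functions V = {u. smooth_on UNIV u \<and> compact (closure {x. u x \<noteq> 0}) \<and>
     closure {x. u x \<noteq> 0} \<subseteq> V}"

section \<open>Complex manifolds of complex dimension one\<close>

text \<open>The manifold is the whole type \<open>'a\<close>.  A chart is a domain together with its
  complex coordinate.\<close>

type_synonym 'a chart = "'a set \<times> ('a \<Rightarrow> complex)"

abbreviation dom :: "'a chart \<Rightarrow> 'a set" where "dom \<equiv> fst"
abbreviation coord :: "'a chart \<Rightarrow> 'a \<Rightarrow> complex" where "coord \<equiv> snd"

definition img :: "'a chart \<Rightarrow> complex set" where "img c = coord c ` dom c"

definition param :: "'a chart \<Rightarrow> complex \<Rightarrow> 'a" where
  "param c = inv_into (dom c) (coord c)"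

definition is_chart :: "'a::topological_space chart \<Rightarrow> bool" where
  "is_chart c \<longleftrightarrow> open (dom c) \<and> open (img c) \<and>
     homeomorphism (dom c) (img c) (coord c) (param c)"

definition compatible :: "'a chart \<Rightarrow> 'a chart \<Rightarrow> bool" where
  "compatible c d \<longleftrightarrow>
     (coord d \<circ> param c) holomorphic_on (coord c ` (dom c \<inter> dom d)) \<and>
     (coord c \<circ> param d) holomorphic_on (coord d ` (dom c \<inter> dom d))"

definition complex_atlas :: "'a::topological_space chart set \<Rightarrow> bool" where
  "complex_atlas A \<longleftrightarrow> (\<forall>c\<in>A. is_chart c) \<and> (\<forall>c\<in>A. \<forall>d\<in>A. compatible c d) \<and>
     (\<Union>c\<in>A. dom c) = UNIV"

text \<open>The maximal atlas.  Chart domains are arbitrary open sets, in particular they may be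
  disconnected; this matters in the definition of pseudodifferential operators, since it
  makes any two distinct points of the manifold lie in a common chart.\<close>

definition charts :: "'a::topological_space chart set \<Rightarrow> 'a chart set" where
  "charts A = {c. is_chart c \<and> (\<forall>d\<in>A. compatible c d)}"

definition Cinf :: "'a::topological_space chart set \<Rightarrow> ('a \<Rightarrow> 'b::euclidean_space) set" where
  "Cinf A = {f. \<forall>c\<in>charts A. smooth_on (img c) (f \<circ> param c)}"

section \<open>Tangent vectors and tensor fields\<close>

text \<open>A preferred chart around each point identifies the real tangent space at \<open>p\<close> with
  \<open>\<complex>\<close>.  As all transition maps are holomorphic, the complex structure \<open>J\<close> is
  multiplication by \<open>\<i>\<close> under this identification, whatever the preferred charts are.
  Tensor fields are given pointwise through this identification; their smoothness and
  measurability are always tested in the components with respect to a chart, obtained by pulling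
  back along \<open>param c\<close>.\<close>

definition chart_at :: "'a chart set \<Rightarrow> 'a \<Rightarrow> 'a chart" where
  "chart_at A p = (SOME c. c \<in> A \<and> p \<in> dom c)"

text \<open>\<open>vec_of_chart A c x v\<close> is the tangent vector at \<open>param c x\<close> with coordinate vector
  \<open>v\<close> in the chart \<open>c\<close>; \<open>vec_in_chart\<close> is the inverse operation.\<close>

definition vec_of_chart :: "'a chart set \<Rightarrow> 'a chart \<Rightarrow> complex \<Rightarrow> complex \<Rightarrow> complex" where
  "vec_of_chart A c x v = deriv (coord (chart_at A (param c x)) \<circ> param c) x * v"

definition vec_in_chart :: "'a chart set \<Rightarrow> 'a chart \<Rightarrow> 'a \<Rightarrow> complex \<Rightarrow> complex" where
  "vec_in_chart A c p v = deriv (coord c \<circ> param (chart_at A p)) (coord (chart_at A p) p) * v"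

type_synonym 'a form1 = "'a \<Rightarrow> complex \<Rightarrow> complex"
type_synonym 'a form2 = "'a \<Rightarrow> complex \<Rightarrow> complex \<Rightarrow> complex"
type_synonym 'a metric = "'a \<Rightarrow> complex \<Rightarrow> complex \<Rightarrow> real"

definition fun_mult :: "('a \<Rightarrow> complex) \<Rightarrow> 'a form1 \<Rightarrow> 'a form1" where
  "fun_mult f \<omega> = (\<lambda>p v. f p * \<omega> p v)"

text \<open>For a form \<open>\<omega>\<close> of type (0,1) this is the function \<open>w\<close> with
  \<open>\<omega> = w d\<zbar>\<close> in the chart \<open>c\<close> with coordinate \<open>z\<close>.\<close>

definition coeff01 :: "'a chart set \<Rightarrow> 'a chart \<Rightarrow> 'a form1 \<Rightarrow> complex \<Rightarrow> complex" where
  "coeff01 A c \<omega> x = \<omega> (param c x) (vec_of_chart A c x 1)"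

text \<open>Conversely, the form \<open>h d\<zbar>\<close> on the domain of \<open>c\<close>, extended by zero.\<close>

definition form01_of_coeff :: "'a chart set \<Rightarrow> 'a chart \<Rightarrow> (complex \<Rightarrow> complex) \<Rightarrow> 'a form1" where
  "form01_of_coeff A c h = (\<lambda>p v. if p \<in> dom c
     then h (coord c p) * cnj (vec_in_chart A c p v) else 0)"

text \<open>The coefficient of \<open>dx \<and> dy\<close> in the chart \<open>c\<close> with coordinate \<open>x + \<i> y\<close>.\<close>

definition coeff2 :: "'a chart set \<Rightarrow> 'a chart \<Rightarrow> 'a form2 \<Rightarrow> complex \<Rightarrow> complex" where
  "coeff2 A c \<eta> x = \<eta> (param c x) (vec_of_chart A c x 1) (vec_of_chart A c x \<i>)"

definition type01 :: "(complex \<Rightarrow> complex) \<Rightarrow> bool" where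
  "type01 \<alpha> \<longleftrightarrow> (\<exists>w. \<forall>v. \<alpha> v = w * cnj v)"

definition dxdy :: "complex \<Rightarrow> complex \<Rightarrow> real" where
  "dxdy u v = Re u * Im v - Im u * Re v"

text \<open>The smooth (0,1)-forms and the smooth complex-valued 2-forms.\<close>

definition A01 :: "'a::topological_space chart set \<Rightarrow> 'a form1 set" where
  "A01 A = {\<omega>. (\<forall>p. type01 (\<omega> p)) \<and> (\<forall>c\<in>charts A. smooth_on (img c) (coeff01 A c \<omega>))}"

definition smooth_2forms :: "'a::topological_space chart set \<Rightarrow> 'a form2 set" where
  "smooth_2forms A = {\<eta>. (\<forall>p. \<exists>w. \<forall>u v. \<eta> p u v = w * of_real (dxdy u v)) \<and>
     (\<forall>c\<in>charts A. smooth_on (img c) (coeff2 A c \<eta>))}"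

text \<open>The differential of a function, and \<open>\<partial>\<bar>f\<close> as the (0,1)-part of it.\<close>

definition differential :: "'a chart set \<Rightarrow> ('a \<Rightarrow> complex) \<Rightarrow> 'a form1" where
  "differential A f p v =
     frechet_derivative (f \<circ> param (chart_at A p)) (at (coord (chart_at A p) p)) v"

definition dbar :: "'a chart set \<Rightarrow> ('a \<Rightarrow> complex) \<Rightarrow> 'a form1" where
  "dbar A f p v = (differential A f p v + \<i> * differential A f p (\<i> * v)) / 2"

section \<open>Integration\<close>

definition partition_of_unity ::
    "'a::topological_space chart set \<Rightarrow> ('a chart \<times> ('a \<Rightarrow> real)) set \<Rightarrow> bool" where
  "partition_of_unity A S \<longleftrightarrow> finite S \<and>
     (\<forall>(c,h)\<in>S. c \<in> charts A \<and> h \<in> Cinf A \<and> (\<forall>p. 0 \<le> h p) \<and>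
        closure {p. h p \<noteq> 0} \<subseteq> dom c) \<and>
     (\<forall>p. (\<Sum>(c,h)\<in>S. h p) = 1)"

text \<open>Integral over a compact manifold of a density \<open>\<rho>\<close>, given by its expression
  \<open>\<rho> c\<close> in each chart \<open>c\<close>.  The partition of unity is immaterial when \<open>\<rho>\<close>
  transforms as a density.\<close>

definition density_integral ::
    "'a::topological_space chart set \<Rightarrow> ('a chart \<Rightarrow> complex \<Rightarrow> complex) \<Rightarrow> complex" where
  "density_integral A \<rho> =
     (\<Sum>(c,h)\<in>(SOME S. partition_of_unity A S).
        LINT x : img c | lborel. of_real (h (param c x)) * \<rho> c x)"

definition form_integral :: "'a::topological_space chart set \<Rightarrow> 'a form2 \<Rightarrow> complex" where
  "form_integral A \<eta> = density_integral A (\<lambda>c. coeff2 A c \<eta>)"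

section \<open>J-invariant metrics and the projection onto the image of \<open>\<partial>\<bar>\<close>\<close>

definition riemannian_metric :: "'a::topological_space chart set \<Rightarrow> 'a metric \<Rightarrow> bool" where
  "riemannian_metric A g \<longleftrightarrow>
     (\<forall>p. bilinear (g p) \<and> (\<forall>u v. g p u v = g p v u) \<and> (\<forall>v. v \<noteq> 0 \<longrightarrow> g p v v > 0)) \<and>
     (\<forall>c\<in>charts A. \<forall>u v. smooth_on (img c)
        (\<lambda>x. g (param c x) (vec_of_chart A c x u) (vec_of_chart A c x v)))"

definition J_invariant :: "'a metric \<Rightarrow> bool" where
  "J_invariant g \<longleftrightarrow> (\<forall>p u v. g p (\<i> * u) (\<i> * v) = g p u v)"

definition gram_det :: "(complex \<Rightarrow> complex \<Rightarrow> real) \<Rightarrow> real" where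
  "gram_det G = G 1 1 * G \<i> \<i> - G 1 \<i> * G 1 \<i>"

text \<open>The Hermitian inner product \<open>\<Sum> G\<^sup>i\<^sup>j \<alpha>(e\<^sub>i) cnj (\<beta>(e\<^sub>j))\<close> on complex covectors
  induced by a real inner product \<open>G\<close>, for the basis \<open>1, \<i>\<close> and the inverse Gram matrix
  \<open>G\<^sup>i\<^sup>j\<close>.\<close>

definition covector_inner ::
    "(complex \<Rightarrow> complex \<Rightarrow> real) \<Rightarrow> (complex \<Rightarrow> complex) \<Rightarrow> (complex \<Rightarrow> complex) \<Rightarrow> complex" where
  "covector_inner G \<alpha> \<beta> =
     (of_real (G \<i> \<i>) * \<alpha> 1 * cnj (\<beta> 1)
      - of_real (G 1 \<i>) * (\<alpha> 1 * cnj (\<beta> \<i>) + \<alpha> \<i> * cnj (\<beta> 1))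
      + of_real (G 1 1) * \<alpha> \<i> * cnj (\<beta> \<i>)) / of_real (gram_det G)"

definition volume_form :: "'a metric \<Rightarrow> 'a form2" where
  "volume_form g p u v = of_real (sqrt (gram_det (g p)) * dxdy u v)"

definition inner_form :: "'a metric \<Rightarrow> 'a form1 \<Rightarrow> 'a form1 \<Rightarrow> 'a form2" where
  "inner_form g \<alpha> \<beta> p u v = covector_inner (g p) (\<alpha> p) (\<beta> p) * volume_form g p u v"

definition L2_inner ::
    "'a::topological_space chart set \<Rightarrow> 'a metric \<Rightarrow> 'a form1 \<Rightarrow> 'a form1 \<Rightarrow> complex" where
  "L2_inner A g \<alpha> \<beta> = form_integral A (inner_form g \<alpha> \<beta>)"

text \<open>Square-integrable measurable (0,1)-forms; elements of the Hilbert space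
  \<open>L\<^sup>2(A\<^sup>0\<^sup>,\<^sup>1)\<close> are these forms up to equality almost everywhere.  As the manifold is compact,
  integrability may be tested on compact subsets of chart domains.\<close>

definition L2_forms :: "'a::topological_space chart set \<Rightarrow> 'a metric \<Rightarrow> 'a form1 set" where
  "L2_forms A g = {\<omega>. (\<forall>p. type01 (\<omega> p)) \<and>
     (\<forall>c\<in>charts A. set_borel_measurable lborel (img c) (coeff01 A c \<omega>) \<and>
        (\<forall>K. compact K \<and> K \<subseteq> img c \<longrightarrow>
           set_integrable lborel K (coeff2 A c (inner_form g \<omega> \<omega>))))}"

definition ae_eq :: "'a::topological_space chart set \<Rightarrow> 'a form1 \<Rightarrow> 'a form1 \<Rightarrow> bool" where
  "ae_eq A \<alpha> \<beta> \<longleftrightarrow> (\<forall>c\<in>charts A. AE x in lborel.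
     x \<in> img c \<longrightarrow> \<alpha> (param c x) = \<beta> (param c x))"

text \<open>The closure in \<open>L\<^sup>2(A\<^sup>0\<^sup>,\<^sup>1)\<close> of the image of \<open>\<partial>\<bar>\<close> on smooth functions.\<close>

definition closure_Im_dbar :: "'a::topological_space chart set \<Rightarrow> 'a metric \<Rightarrow> 'a form1 set" where
  "closure_Im_dbar A g = {\<omega> \<in> L2_forms A g. \<forall>\<epsilon>>0. \<exists>f\<in>Cinf A.
     Re (L2_inner A g (\<omega> - dbar A f) (\<omega> - dbar A f)) < \<epsilon>}"

text \<open>Orthogonal projection.  The value is unique up to equality almost everywhere, and
  arguments that agree almost everywhere have the same value (not merely almost everywhere), so
  this is a well-defined operator on \<open>L\<^sup>2(A\<^sup>0\<^sup>,\<^sup>1)\<close>.\<close>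

definition proj_Im_dbar ::
    "'a::topological_space chart set \<Rightarrow> 'a metric \<Rightarrow> 'a form1 \<Rightarrow> 'a form1" where
  "proj_Im_dbar A g u = (SOME v. v \<in> closure_Im_dbar A g \<and>
     (\<forall>w\<in>closure_Im_dbar A g. L2_inner A g (u - v) w = 0))"

definition F_op :: "'a::topological_space chart set \<Rightarrow> 'a metric \<Rightarrow> 'a form1 \<Rightarrow> 'a form1" where
  "F_op A g u = fun_mult (\<lambda>_. 2) (proj_Im_dbar A g u) - u"

definition commutator ::
    "('a form1 \<Rightarrow> 'a form1) \<Rightarrow> ('a \<Rightarrow> complex) \<Rightarrow> 'a form1 \<Rightarrow> 'a form1" where
  "commutator F f u = F (fun_mult f u) - fun_mult f (F u)"

section \<open>Classical pseudodifferential operators and the Wodzicki residue\<close>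

text \<open>Symbols are functions of \<open>(x, \<xi>)\<close> with \<open>x, \<xi> \<in> \<complex> = \<real>\<^sup>2\<close>.\<close>

type_synonym symb = "complex \<times> complex \<Rightarrow> complex"

definition symb_deriv :: "complex list \<Rightarrow> complex list \<Rightarrow> symb \<Rightarrow> symb" where
  "symb_deriv vs ws a = iter_deriv (map (\<lambda>v. (v, 0)) vs @ map (\<lambda>w. (0, w)) ws) a"

definition symbol_class :: "int \<Rightarrow> symb set" where
  "symbol_class m = {a. smooth_on UNIV a \<and>
     (\<forall>vs ws. \<exists>C. \<forall>x \<xi>. norm (symb_deriv vs ws a (x, \<xi>)) \<le>
        C * (1 + norm \<xi>) powr (of_int m - real (length ws)))}"

text \<open>\<open>a\<close> is a classical symbol of order \<open>m\<close> with asymptotic expansion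
  \<open>a \<sim> b m + b (m-1) + b (m-2) + \<dots>\<close>, where \<open>b k\<close> is positively homogeneous of degree
  \<open>k\<close> in \<open>\<xi> \<noteq> 0\<close>.  The values of \<open>b k\<close> at \<open>\<xi> = 0\<close> play no role.\<close>

definition classical_expansion :: "int \<Rightarrow> symb \<Rightarrow> (int \<Rightarrow> symb) \<Rightarrow> bool" where
  "classical_expansion m a b \<longleftrightarrow> a \<in> symbol_class m \<and>
     (\<forall>k. smooth_on {(x, \<xi>). \<xi> \<noteq> 0} (b k)) \<and>
     (\<forall>k x \<xi> t. \<xi> \<noteq> 0 \<and> t > 0 \<longrightarrow> b k (x, of_real t * \<xi>) = of_real (t powi k) * b k (x, \<xi>)) \<and>
     (\<forall>k>m. \<forall>x \<xi>. \<xi> \<noteq> 0 \<longrightarrow> b k (x, \<xi>) = 0) \<and>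
     (\<forall>N vs ws. \<exists>C. \<forall>x \<xi>. norm \<xi> \<ge> 1 \<longrightarrow>
        norm (symb_deriv vs ws (\<lambda>y. a y - (\<Sum>j<N. b (m - int j) y)) (x, \<xi>)) \<le>
          C * norm \<xi> powr (of_int m - real N - real (length ws)))"

definition fourier :: "(complex \<Rightarrow> complex) \<Rightarrow> complex \<Rightarrow> complex" where
  "fourier u \<xi> = (LINT y|lborel. cis (- (y \<bullet> \<xi>)) * u y)"

definition Op :: "symb \<Rightarrow> (complex \<Rightarrow> complex) \<Rightarrow> complex \<Rightarrow> complex" where
  "Op a u x = (LINT \<xi>|lborel. cis (x \<bullet> \<xi>) * a (x, \<xi>) * fourier u \<xi>) / of_real ((2 * pi)\<^sup>2)"

text \<open>In the chart \<open>c\<close>, with the bundle of (0,1)-covectors trivialised by \<open>d\<zbar>\<close>, the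
  operator \<open>\<phi> P \<psi>\<close> is given by the symbol \<open>a\<close>.\<close>

definition local_symbol ::
    "'a::topological_space chart set \<Rightarrow> ('a form1 \<Rightarrow> 'a form1) \<Rightarrow> 'a chart \<Rightarrow>
      (complex \<Rightarrow> complex) \<Rightarrow> (complex \<Rightarrow> complex) \<Rightarrow> symb \<Rightarrow> bool" where
  "local_symbol A P c \<phi> \<psi> a \<longleftrightarrow> (\<forall>u\<in>test_functions UNIV. AE x in lborel.
     \<phi> x * coeff01 A c (P (form01_of_coeff A c (\<lambda>y. \<psi> y * u y))) x = Op a u x)"

text \<open>Operators on (0,1)-forms up to equality almost everywhere.\<close>

definition classical_psido ::
    "'a::topological_space chart set \<Rightarrow> int \<Rightarrow> ('a form1 \<Rightarrow> 'a form1) \<Rightarrow> bool" where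
  "classical_psido A m P \<longleftrightarrow>
     (\<forall>\<alpha>\<in>A01 A. \<forall>\<beta>\<in>A01 A. \<forall>s t.
        ae_eq A (P (\<lambda>p v. s * \<alpha> p v + t * \<beta> p v)) (\<lambda>p v. s * P \<alpha> p v + t * P \<beta> p v)) \<and>
     (\<forall>c\<in>charts A. \<forall>\<phi>\<in>test_functions (img c). \<forall>\<psi>\<in>test_functions (img c).
        \<exists>a b. classical_expansion m a b \<and> local_symbol A P c \<phi> \<psi> a)"

text \<open>The homogeneous component of degree \<open>k\<close> of the symbol of \<open>P\<close> in the chart
  \<open>c\<close> at \<open>(x, \<xi>)\<close>: that of \<open>\<phi> P \<psi>\<close> for any cutoffs \<open>\<phi>, \<psi>\<close> that are 1
  near \<open>x\<close>.\<close>

definition symbol_component ::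
    "'a::topological_space chart set \<Rightarrow> ('a form1 \<Rightarrow> 'a form1) \<Rightarrow> 'a chart \<Rightarrow> int \<Rightarrow>
      complex \<Rightarrow> complex \<Rightarrow> complex" where
  "symbol_component A P c k x \<xi> = (THE s. \<exists>\<phi>\<in>test_functions (img c). \<exists>\<psi>\<in>test_functions (img c).
     \<exists>m a b. (\<forall>\<^sub>F y in nhds x. \<phi> y = 1 \<and> \<psi> y = 1) \<and>
       classical_expansion m a b \<and> local_symbol A P c \<phi> \<psi> a \<and> s = b k (x, \<xi>))"

text \<open>The real dimension is 2, so the component of degree \<open>-2\<close> is integrated over the unit
  circle.  The bundle has rank one, so the fibrewise trace of the symbol is the symbol itself.
  The residue is left unspecified for operators that are not classical pseudodifferential
  operators of integer order.\<close>

definition Wres :: "'a::topological_space chart set \<Rightarrow> ('a form1 \<Rightarrow> 'a form1) \<Rightarrow> complex" where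
  "Wres A P = (if \<exists>m. classical_psido A m P
     then density_integral A
       (\<lambda>c x. LINT \<theta> : {0..2 * pi} | lborel. symbol_component A P c (-2) x (cis \<theta>))
     else undefined)"

definition Omega ::
    "'a::topological_space chart set \<Rightarrow> 'a metric \<Rightarrow> 'a metric \<Rightarrow>
      ('a \<Rightarrow> complex) \<Rightarrow> ('a \<Rightarrow> complex) \<Rightarrow> 'a form2" where
  "Omega A g1 g2 f1 f2 = (THE \<eta>. \<eta> \<in> smooth_2forms A \<and>
     (\<forall>f0\<in>Cinf A.
        Wres A (\<lambda>u. fun_mult f0 (commutator (F_op A g1) f1 (commutator (F_op A g2) f2 u))) =
        form_integral A (\<lambda>p u v. f0 p * \<eta> p u v)))"

end

theory Submission
  imports Defs "HOL-Complex_Analysis.Complex_Analysis" "HOL-Probability.Probability"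
begin

text \<open>On a curve the \<open>L\<^sup>2\<close> inner product of \<open>(0,1)\<close>-forms does not depend on the J-invariant
  metric, so both operators \<open>F\<close> equal \<open>Id - 2\<Pi>\<close>, where \<open>\<Pi>\<close> is the orthogonal projection onto the
  complement of the image of \<open>\<partial>\<bar>\<close>.  By Weyl's lemma this complement consists of smooth forms, and a
  reproducing kernel with Bessel's inequality shows that it is finite-dimensional.  Hence the
  commutators with functions are smoothing operators of finite rank; their symbols decay rapidly
  and the Wodzicki residue vanishes.\<close>

section \<open>Smooth functions\<close>

text \<open>A J-invariant metric in complex dimension one is a function \<open>\<lambda>\<close>
  times the Euclidean metric of a coordinate: norms of covectors scale by
  \<open>1 / \<lambda>\<close> and areas by \<open>\<lambda>\<close> when squared norms are
  integrated, so the factor cancels. The identity commutes with functions, hence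
  \<open>[F, f] = -2 [\<Pi>, f]\<close> for either metric. Regularity enters only through local
  reproducing kernels that depend on the radius alone. Evaluation of harmonic coefficients is
  therefore bounded uniformly on compact sets, and integrating Bessel's inequality over the curve
  bounds the length of every orthonormal family of harmonic forms. The definitions by choice and by
  description shape the rest. The projection is a choice among forms that agree almost everywhere,
  so operators are compared only up to null sets. Symbol components and \<open>Omega\<close> are
  definite descriptions, so vanishing alone does not suffice: a symbol must be shown to be
  determined by its operator, and a smooth 2-form by its integrals against smooth functions.\<close>

fun diff_times :: "nat \<Rightarrow> 'a::euclidean_space set \<Rightarrow> ('a \<Rightarrow> 'b::euclidean_space) \<Rightarrow> bool" where
  "diff_times 0 S f \<longleftrightarrow> (\<forall>x\<in>S. f differentiable (at x))"
| "diff_times (Suc n) S f \<longleftrightarrow> (\<forall>x\<in>S. f differentiable (at x)) \<and>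
     (\<forall>v. diff_times n S (\<lambda>x. frechet_derivative f (at x) v))"

lemma iter_deriv_Nil [simp]: "iter_deriv [] f = f"
  by (simp add: iter_deriv_def)

lemma iter_deriv_Cons: "iter_deriv (v # vs) f = (\<lambda>x. frechet_derivative (iter_deriv vs f) (at x) v)"
  by (simp add: iter_deriv_def)

lemma iter_deriv_snoc: "iter_deriv (vs @ [v]) f = iter_deriv vs (\<lambda>x. frechet_derivative f (at x) v)"
  by (simp add: iter_deriv_def)

text \<open>The recursion of \<open>diff_times\<close> takes one derivative and asks for the rest of
  it, which suits induction on the order. In \<open>iter_deriv\<close> the innermost derivative is
  the last list element, so lists have to be split at their end.\<close>

lemma diff_times_iff:
  "diff_times n S f \<longleftrightarrow> (\<forall>vs. length vs \<le> n \<longrightarrow> (\<forall>x\<in>S. iter_deriv vs f differentiable (at x)))"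
proof (induction n arbitrary: f)
  case (Suc n)
  show ?case (is "?l \<longleftrightarrow> ?r")
  proof
    assume l: ?l
    show ?r
    proof (intro allI impI)
      fix vs :: "'a list" assume "length vs \<le> Suc n"
      then show "\<forall>x\<in>S. iter_deriv vs f differentiable (at x)"
        using l by (cases vs rule: rev_cases) (auto simp: iter_deriv_snoc Suc.IH)
    qed
  next
    assume r: ?r
    have "\<forall>x\<in>S. f differentiable (at x)"
      using r[rule_format, of "[]"] by simp
    moreover have "diff_times n S (\<lambda>x. frechet_derivative f (at x) v)" for v
      using r[rule_format, of "_ @ [v]"] by (auto simp: iter_deriv_snoc Suc.IH)
    ultimately show ?l by simp
  qed
qed simp

lemma smooth_on_iff_diff_times: "smooth_on S f \<longleftrightarrow> (\<forall>n. diff_times n S f)"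
  unfolding smooth_on_def diff_times_iff by blast

lemma diff_times_differentiable: "diff_times n S f \<Longrightarrow> x \<in> S \<Longrightarrow> f differentiable (at x)"
  by (cases n) auto

lemma diff_times_Suc_imp: "diff_times (Suc n) S f \<Longrightarrow> diff_times n S f"
  unfolding diff_times_iff by simp

lemma differentiable_transform_open:
  assumes "open S" "x \<in> S" "\<And>x. x \<in> S \<Longrightarrow> f x = g x" "f differentiable (at x)"
  shows "g differentiable (at x)"
proof -
  obtain D where "(f has_derivative D) (at x)"
    using assms(4) by (auto simp: differentiable_def)
  from has_derivative_transform_within_open[OF this assms(1,2)] assms(3)
  show ?thesis by (auto simp: differentiable_def)
qed

lemma diff_times_cong:
  assumes "open S" "\<And>x. x \<in> S \<Longrightarrow> f x = g x" "diff_times n S f"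
  shows "diff_times n S g"
  using assms(2,3)
proof (induction n arbitrary: f g)
  case 0
  then show ?case
    by (auto intro: differentiable_transform_open[OF \<open>open S\<close>, of _ f g])
next
  case (Suc n)
  have d: "f differentiable (at x)" if "x \<in> S" for x
    using Suc.prems(2) that by simp
  have e: "frechet_derivative f (at x) = frechet_derivative g (at x)" if "x \<in> S" for x
    using frechet_derivative_transform_within_open[OF d[OF that] \<open>open S\<close> that] Suc.prems(1) by blast
  have "g differentiable (at x)" if "x \<in> S" for x
    using differentiable_transform_open[OF \<open>open S\<close> that _ d[OF that]] Suc.prems(1) by simp
  moreover have "diff_times n S (\<lambda>x. frechet_derivative g (at x) v)" for v
    using Suc.prems(2) e by (auto intro: Suc.IH[of "\<lambda>x. frechet_derivative f (at x) v" "\<lambda>x. frechet_derivative g (at x) v"])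
  ultimately show ?case by simp
qed

text \<open>The working rule for all closure properties: any explicit derivative formula may replace
  \<open>frechet_derivative\<close>. Openness of \<open>S\<close> lets the equality of the two be
  differentiated further.\<close>

lemma diff_times_SucI:
  assumes "open S" "\<And>x. x \<in> S \<Longrightarrow> (f has_derivative f' x) (at x)" "\<And>v. diff_times n S (\<lambda>x. f' x v)"
  shows "diff_times (Suc n) S f"
proof -
  have "frechet_derivative f (at x) = f' x" if "x \<in> S" for x
    using frechet_derivative_at[OF assms(2)[OF that]] by simp
  then have "diff_times n S (\<lambda>x. frechet_derivative f (at x) v)" for v
    by (intro diff_times_cong[OF assms(1) _ assms(3)[of v]]) simp
  then show ?thesis
    using assms(2) by (auto simp: differentiable_def)
qed

lemma diff_times_has_derivative:
  "diff_times n S f \<Longrightarrow> x \<in> S \<Longrightarrow> (f has_derivative frechet_derivative f (at x)) (at x)"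
  using diff_times_differentiable frechet_derivative_works by blast

lemma diff_times_deriv:
  "diff_times (Suc n) S f \<Longrightarrow> diff_times n S (\<lambda>x. frechet_derivative f (at x) v)"
  by simp

lemma diff_times_const: "diff_times n S (\<lambda>x. c)"
proof (induction n arbitrary: c)
  case (Suc n)
  have "frechet_derivative (\<lambda>x. c) (at x) = (\<lambda>v. 0)" for x :: 'a
    by (simp add: frechet_derivative_const)
  then show ?case using Suc by simp
qed simp

lemma diff_times_add:
  assumes "open S" "diff_times n S f" "diff_times n S g"
  shows "diff_times n S (\<lambda>x. f x + g x)"
  using assms(2,3)
proof (induction n arbitrary: f g)
  case (Suc n)
  show ?case
    using diff_times_has_derivative[OF Suc.prems(1)] diff_times_has_derivative[OF Suc.prems(2)]
    by (-) (rule diff_times_SucI[OF \<open>open S\<close>, where f'="\<lambda>x v. frechet_derivative f (at x) v + frechet_derivative g (at x) v"]; use Suc in \<open>auto intro!: has_derivative_add Suc.IH\<close>)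
qed (auto intro!: differentiable_add)

lemma diff_times_sum:
  assumes "open S" "finite I" "\<And>i. i \<in> I \<Longrightarrow> diff_times n S (f i)"
  shows "diff_times n S (\<lambda>x. \<Sum>i\<in>I. f i x)"
  using assms(2,3) by (induction) (auto intro!: diff_times_const diff_times_add \<open>open S\<close>)

lemma diff_times_bilinear:
  assumes "open S" "bounded_bilinear B" "diff_times n S f" "diff_times n S g"
  shows "diff_times n S (\<lambda>x. B (f x) (g x))"
  using assms(3,4)
proof (induction n arbitrary: f g)
  case 0
  then show ?case
    using bounded_bilinear.FDERIV[OF assms(2)] unfolding diff_times.simps differentiable_def by fast
next
  case (Suc n)
  show ?case
  proof (rule diff_times_SucI[OF \<open>open S\<close>])
    show "((\<lambda>x. B (f x) (g x)) has_derivative (\<lambda>v. B (f x) (frechet_derivative g (at x) v)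
         + B (frechet_derivative f (at x) v) (g x))) (at x)" if "x \<in> S" for x
      using bounded_bilinear.FDERIV[OF assms(2) diff_times_has_derivative[OF Suc.prems(1) that]
          diff_times_has_derivative[OF Suc.prems(2) that]] .
    show "diff_times n S (\<lambda>x. B (f x) (frechet_derivative g (at x) v)
         + B (frechet_derivative f (at x) v) (g x))" for v
      using Suc.prems Suc.prems[THEN diff_times_Suc_imp]
      by (intro diff_times_add[OF \<open>open S\<close>] Suc.IH) auto
  qed
qed

lemma diff_times_linear:
  assumes "open S" "bounded_linear L" "diff_times n S f"
  shows "diff_times n S (\<lambda>x. L (f x))"
  using assms(3)
proof (induction n arbitrary: f)
  case 0
  then show ?case
    using bounded_linear.has_derivative[OF assms(2)] unfolding diff_times.simps differentiable_def by fast
next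
  case (Suc n)
  show ?case
    using bounded_linear.has_derivative[OF assms(2) diff_times_has_derivative[OF Suc.prems]]
    by (-) (rule diff_times_SucI[OF \<open>open S\<close>, where f'="\<lambda>x v. L (frechet_derivative f (at x) v)"]; use Suc in \<open>auto intro!: Suc.IH\<close>)
qed

lemma diff_times_id: "open S \<Longrightarrow> diff_times n S (\<lambda>x. x)"
  by (cases n) (auto intro!: diff_times_SucI[where f'="\<lambda>_ v. v"] diff_times_const derivative_intros simp del: diff_times.simps(2))

text \<open>In the chain rule the direction \<open>g' x v\<close> fed to the derivative of
  \<open>f\<close> varies with \<open>x\<close>, so the induction hypothesis does not apply to it
  directly. Expanding this direction in the basis leaves sums of scalars times compositions of
  \<open>g\<close> with derivatives of \<open>f\<close> in fixed directions.\<close>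

lemma diff_times_compose:
  assumes "open S" "open T" "\<And>x. x \<in> S \<Longrightarrow> g x \<in> T" "diff_times n T f" "diff_times n S g"
  shows "diff_times n S (\<lambda>x. f (g x))"
  using assms(4,5)
proof (induction n arbitrary: f)
  case 0
  then show ?case
    using assms(3) by (auto intro: differentiable_compose differentiable_at_withinI)
next
  case (Suc n)
  have fd: "(f has_derivative frechet_derivative f (at (g x))) (at (g x))" if "x \<in> S" for x
    using diff_times_has_derivative[OF Suc.prems(1) assms(3)[OF that]] .
  have gd: "(g has_derivative frechet_derivative g (at x)) (at x)" if "x \<in> S" for x
    using diff_times_has_derivative[OF Suc.prems(2) that] .
  let ?D = "\<lambda>x v. \<Sum>b\<in>Basis. (frechet_derivative g (at x) v \<bullet> b) *\<^sub>R frechet_derivative f (at (g x)) b"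
  show ?case
  proof (rule diff_times_SucI[OF \<open>open S\<close>, where f'="?D"])
    fix x assume x: "x \<in> S"
    have lin: "linear (frechet_derivative f (at (g x)))"
      using fd[OF x] has_derivative_linear by blast
    have "frechet_derivative f (at (g x)) (frechet_derivative g (at x) v) = ?D x v" for v
    proof -
      have "frechet_derivative f (at (g x)) (frechet_derivative g (at x) v)
        = frechet_derivative f (at (g x)) (\<Sum>b\<in>Basis. (frechet_derivative g (at x) v \<bullet> b) *\<^sub>R b)"
        by (simp add: euclidean_representation)
      also have "\<dots> = ?D x v"
        using lin by (simp add: linear_sum linear_scale)
      finally show ?thesis .
    qed
    then have "((frechet_derivative f (at (g x))) \<circ> (frechet_derivative g (at x))) = ?D x"
      by (auto simp: fun_eq_iff)
    then show "((\<lambda>x. f (g x)) has_derivative ?D x) (at x)"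
      using diff_chain_at[OF gd[OF x] fd[OF x]] by (simp add: o_def)
  next
    fix v
    have gn: "diff_times n S g" using Suc.prems(2) by (rule diff_times_Suc_imp)
    have "diff_times n S (\<lambda>x. frechet_derivative g (at x) v \<bullet> b)" for b
      using diff_times_deriv[OF Suc.prems(2)] bounded_linear_inner_left diff_times_linear \<open>open S\<close> by blast
    moreover have "diff_times n S (\<lambda>x. frechet_derivative f (at (g x)) b)" for b
      by (rule Suc.IH[OF diff_times_deriv[OF Suc.prems(1)] gn])
    ultimately show "diff_times n S (\<lambda>x. ?D x v)"
      by (intro diff_times_sum[OF \<open>open S\<close>] diff_times_bilinear[OF \<open>open S\<close> bounded_bilinear_scaleR]) auto
  qed
qed

text \<open>The derivative \<open>- f' / f^2\<close> contains the inverse itself, so the induction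
  hypothesis for order \<open>n\<close> is exactly what the product rule needs for order
  \<open>Suc n\<close>.\<close>

lemma diff_times_inverse:
  fixes f :: "'a::euclidean_space \<Rightarrow> 'b::{euclidean_space, real_normed_field}"
  assumes "open S" "\<And>x. x \<in> S \<Longrightarrow> f x \<noteq> 0" "diff_times n S f"
  shows "diff_times n S (\<lambda>x. inverse (f x))"
  using assms(3)
proof (induction n)
  case 0
  then show ?case
    using assms(2) by (auto intro!: differentiable_inverse)
next
  case (Suc n)
  have "diff_times n S (\<lambda>x. inverse (f x))"
    using Suc diff_times_Suc_imp by blast
  moreover have "((\<lambda>x. inverse (f x)) has_derivative
      (\<lambda>v. - (inverse (f x) * frechet_derivative f (at x) v * inverse (f x)))) (at x)" if "x \<in> S" for x
    by (rule Deriv.has_derivative_inverse[OF assms(2)[OF that] diff_times_has_derivative[OF Suc.prems that]])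
  ultimately show ?case
    by (-) (rule diff_times_SucI[OF \<open>open S\<close>, where f'="\<lambda>x v. - (inverse (f x) * frechet_derivative f (at x) v * inverse (f x))"]; auto intro!: diff_times_linear[OF \<open>open S\<close> bounded_linear_minus[OF bounded_linear_ident]] diff_times_bilinear[OF \<open>open S\<close> bounded_bilinear_mult] diff_times_deriv[OF Suc.prems, simplified])
qed

section \<open>Closure properties of smooth functions\<close>

lemma smooth_on_subset: "smooth_on S f \<Longrightarrow> T \<subseteq> S \<Longrightarrow> smooth_on T f"
  unfolding smooth_on_def by blast

lemma smooth_on_cong:
  "open S \<Longrightarrow> smooth_on S f \<Longrightarrow> (\<And>x. x \<in> S \<Longrightarrow> f x = g x) \<Longrightarrow> smooth_on S g"
  unfolding smooth_on_iff_diff_times using diff_times_cong by metis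

lemma smooth_on_local:
  assumes "\<And>x. x \<in> S \<Longrightarrow> \<exists>T. open T \<and> x \<in> T \<and> smooth_on T f"
  shows "smooth_on S f"
  using assms unfolding smooth_on_def by blast

lemma smooth_on_deriv:
  "smooth_on S f \<Longrightarrow> smooth_on S (\<lambda>x. frechet_derivative f (at x) v)"
  unfolding smooth_on_iff_diff_times using diff_times_deriv by blast

lemma smooth_on_differentiable: "smooth_on S f \<Longrightarrow> x \<in> S \<Longrightarrow> f differentiable (at x)"
  unfolding smooth_on_iff_diff_times using diff_times_differentiable by blast

lemma smooth_on_has_derivative:
  "smooth_on S f \<Longrightarrow> x \<in> S \<Longrightarrow> (f has_derivative frechet_derivative f (at x)) (at x)"
  using smooth_on_differentiable frechet_derivative_works by blast

lemma smooth_on_continuous: "smooth_on S f \<Longrightarrow> continuous_on S f"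
  using smooth_on_differentiable differentiable_imp_continuous_within
  by (metis continuous_at_imp_continuous_on)

lemma smooth_on_const [simp, intro]: "smooth_on S (\<lambda>x. c)"
  unfolding smooth_on_iff_diff_times using diff_times_const by blast

lemma smooth_on_id [intro]: "open S \<Longrightarrow> smooth_on S (\<lambda>x. x)"
  unfolding smooth_on_iff_diff_times using diff_times_id by blast

lemma smooth_on_add:
  "open S \<Longrightarrow> smooth_on S f \<Longrightarrow> smooth_on S g \<Longrightarrow> smooth_on S (\<lambda>x. f x + g x)"
  unfolding smooth_on_iff_diff_times using diff_times_add by blast

lemma smooth_on_sum:
  "open S \<Longrightarrow> finite I \<Longrightarrow> (\<And>i. i \<in> I \<Longrightarrow> smooth_on S (f i)) \<Longrightarrow> smooth_on S (\<lambda>x. \<Sum>i\<in>I. f i x)"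
  unfolding smooth_on_iff_diff_times using diff_times_sum by metis

lemma smooth_on_linear:
  "open S \<Longrightarrow> bounded_linear L \<Longrightarrow> smooth_on S f \<Longrightarrow> smooth_on S (\<lambda>x. L (f x))"
  unfolding smooth_on_iff_diff_times using diff_times_linear by blast

lemma smooth_on_uminus: "open S \<Longrightarrow> smooth_on S f \<Longrightarrow> smooth_on S (\<lambda>x. - f x)"
  using smooth_on_linear[OF _ bounded_linear_minus[OF bounded_linear_ident]] by blast

lemma smooth_on_diff:
  "open S \<Longrightarrow> smooth_on S f \<Longrightarrow> smooth_on S g \<Longrightarrow> smooth_on S (\<lambda>x. f x - g x)"
  using smooth_on_add[of S f "\<lambda>x. - g x"] smooth_on_uminus by auto

lemma smooth_on_mult:
  fixes f g :: "'a::euclidean_space \<Rightarrow> 'b::{euclidean_space, real_normed_algebra}"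
  shows "open S \<Longrightarrow> smooth_on S f \<Longrightarrow> smooth_on S g \<Longrightarrow> smooth_on S (\<lambda>x. f x * g x)"
  unfolding smooth_on_iff_diff_times using diff_times_bilinear[OF _ bounded_bilinear_mult] by blast

lemma smooth_on_inner:
  "open S \<Longrightarrow> smooth_on S f \<Longrightarrow> smooth_on S g \<Longrightarrow> smooth_on S (\<lambda>x. f x \<bullet> g x)"
  unfolding smooth_on_iff_diff_times using diff_times_bilinear[OF _ bounded_bilinear_inner] by blast

lemma smooth_on_of_real:
  "open S \<Longrightarrow> smooth_on S f \<Longrightarrow> smooth_on S (\<lambda>x. complex_of_real (f x))"
  using smooth_on_linear[OF _ bounded_linear_of_real] by blast

lemma smooth_on_cnj: "open S \<Longrightarrow> smooth_on S f \<Longrightarrow> smooth_on S (\<lambda>x. cnj (f x))"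
  using smooth_on_linear[OF _ bounded_linear_cnj] by blast

lemma smooth_on_compose:
  "open S \<Longrightarrow> open T \<Longrightarrow> (\<And>x. x \<in> S \<Longrightarrow> g x \<in> T) \<Longrightarrow> smooth_on T f \<Longrightarrow> smooth_on S g \<Longrightarrow>
    smooth_on S (\<lambda>x. f (g x))"
  unfolding smooth_on_iff_diff_times using diff_times_compose by metis

lemma smooth_on_inverse:
  fixes f :: "'a::euclidean_space \<Rightarrow> 'b::{euclidean_space, real_normed_field}"
  shows "open S \<Longrightarrow> (\<And>x. x \<in> S \<Longrightarrow> f x \<noteq> 0) \<Longrightarrow> smooth_on S f \<Longrightarrow> smooth_on S (\<lambda>x. inverse (f x))"
  unfolding smooth_on_iff_diff_times using diff_times_inverse by metis

lemma smooth_on_divide: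
  fixes f :: "'a::euclidean_space \<Rightarrow> 'b::{euclidean_space, real_normed_field}"
  shows "open S \<Longrightarrow> (\<And>x. x \<in> S \<Longrightarrow> g x \<noteq> 0) \<Longrightarrow> smooth_on S f \<Longrightarrow> smooth_on S g \<Longrightarrow>
    smooth_on S (\<lambda>x. f x / g x)"
  by (simp add: divide_inverse smooth_on_mult smooth_on_inverse)

lemma holomorphic_diff_times:
  assumes "open S" "f holomorphic_on S"
  shows "diff_times n S f"
  using assms(2)
proof (induction n arbitrary: f)
  case 0
  then show ?case
    using \<open>open S\<close> by (auto simp: holomorphic_on_open field_differentiable_def
      dest!: bspec has_field_derivative_imp_has_derivative intro: differentiableI)
next
  case (Suc n)
  show ?case
  proof (rule diff_times_SucI[OF \<open>open S\<close>, where f'="\<lambda>x v. deriv f x * v"])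
    show "(f has_derivative (*) (deriv f x)) (at x)" if "x \<in> S" for x
      using holomorphic_derivI[OF Suc.prems \<open>open S\<close> that] by (rule has_field_derivative_imp_has_derivative)
    show "diff_times n S (\<lambda>x. deriv f x * v)" for v
      by (intro Suc.IH holomorphic_on_mult holomorphic_deriv Suc.prems \<open>open S\<close> holomorphic_on_const)
  qed
qed

lemma holomorphic_imp_smooth_on: "open S \<Longrightarrow> f holomorphic_on S \<Longrightarrow> smooth_on S f"
  unfolding smooth_on_iff_diff_times using holomorphic_diff_times by blast

section \<open>Bump functions and convolution\<close>

text \<open>The power of \<open>t\<close> is a parameter because it makes the family closed under
  differentiation: the derivative of one member is a combination of the members with indices
  \<open>n + 1\<close> and \<open>n + 2\<close>.\<close>

definition flat_exp :: "nat \<Rightarrow> real \<Rightarrow> real" where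
  "flat_exp n t = (if 0 < t then exp (- 1 / t) / t ^ n else 0)"

lemma flat_exp_tendsto_0: "(flat_exp n \<longlongrightarrow> 0) (at_right 0)"
proof -
  have "((\<lambda>t. inverse t ^ n / exp (inverse t)) \<longlongrightarrow> (0::real)) (at_right 0)"
    by (rule filterlim_compose[OF tendsto_power_div_exp_0 filterlim_inverse_at_top_right])
  moreover have "\<forall>\<^sub>F t in at_right 0. inverse t ^ n / exp (inverse t) = flat_exp n (t::real)"
    by (auto simp: eventually_at_filter flat_exp_def field_simps exp_minus power_inverse)
  ultimately show ?thesis
    by (rule Lim_transform_eventually)
qed

lemma flat_exp_has_real_derivative:
  "(flat_exp n has_real_derivative flat_exp (n + 2) t - real n * flat_exp (n + 1) t) (at t)"
proof -
  consider "t > 0" | "t < 0" | "t = 0" by linarith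
  then show ?thesis
  proof cases
    case 1
    have "((\<lambda>t. exp (- 1 / t) / t ^ n) has_real_derivative
        ((exp (- 1 / t) * (1 / t\<^sup>2)) * t ^ n - exp (- 1 / t) * (real n * t ^ (n - 1))) / (t ^ n * t ^ n)) (at t)"
      using 1 by (auto intro!: derivative_eq_intros simp: power2_eq_square field_simps)
    moreover have "((exp (- 1 / t) * (1 / t\<^sup>2)) * t ^ n - exp (- 1 / t) * (real n * t ^ (n - 1))) / (t ^ n * t ^ n)
        = flat_exp (n + 2) t - real n * flat_exp (n + 1) t"
      using 1 by (cases n) (auto simp: flat_exp_def field_simps power2_eq_square)
    ultimately have "((\<lambda>t. exp (- 1 / t) / t ^ n) has_real_derivative
        flat_exp (n + 2) t - real n * flat_exp (n + 1) t) (at t)" by simp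
    then show ?thesis
      by (rule DERIV_cong_ev[THEN iffD1, rotated -1])
        (use 1 eventually_nhds_in_open[of "{0<..}" t] in \<open>auto simp: flat_exp_def elim!: eventually_mono\<close>)
  next
    case 2
    have "((\<lambda>t. 0) has_real_derivative 0) (at t)" by simp
    then have "(flat_exp n has_real_derivative 0) (at t)"
      by (rule DERIV_cong_ev[THEN iffD1, rotated -1])
        (use 2 eventually_nhds_in_open[of "{..<0}" t] in \<open>auto simp: flat_exp_def elim!: eventually_mono\<close>)
    then show ?thesis using 2 by (simp add: flat_exp_def)
  next
    case 3
    \<comment> \<open>On the right the difference quotient at 0 is again a member of the family,
      \<open>flat_exp (Suc n)\<close>; on the left it is 0.\<close>
    have "((\<lambda>h. flat_exp n h / h) \<longlongrightarrow> 0) (at_right 0)"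
      using flat_exp_tendsto_0[of "Suc n"]
      by (rule Lim_transform_eventually) (auto simp: eventually_at_filter flat_exp_def)
    moreover have "((\<lambda>h. flat_exp n h / h) \<longlongrightarrow> 0) (at_left 0)"
      by (rule tendsto_eventually) (auto simp: eventually_at_filter flat_exp_def)
    ultimately have "((\<lambda>h. flat_exp n h / h) \<longlongrightarrow> 0) (at 0)"
      by (simp add: filterlim_split_at)
    then show ?thesis using 3 by (simp add: DERIV_def flat_exp_def)
  qed
qed

lemma flat_exp_diff_times: "diff_times k UNIV (flat_exp n)"
proof (induction k arbitrary: n)
  case 0
  show ?case
    using flat_exp_has_real_derivative has_field_derivative_imp_has_derivative
    by (metis diff_times.simps(1) differentiable_def)
next
  case (Suc k)
  show ?case
  proof (rule diff_times_SucI[where f'="\<lambda>t v. (flat_exp (n + 2) t - real n * flat_exp (n + 1) t) * v"])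
    show "diff_times k UNIV (\<lambda>t. (flat_exp (n + 2) t - real n * flat_exp (n + 1) t) * v)" for v
    proof -
      have "diff_times k UNIV (\<lambda>t. v * flat_exp (n + 2) t + (- v * real n) * flat_exp (n + 1) t)"
        by (intro diff_times_add open_UNIV Suc diff_times_linear[OF _ bounded_linear_mult_right])
      then show ?thesis by (simp add: algebra_simps)
    qed
  qed (use flat_exp_has_real_derivative in \<open>auto simp: has_field_derivative_def\<close>)
qed

lemma smooth_on_flat_exp: "smooth_on UNIV (flat_exp n)"
  by (simp add: smooth_on_iff_diff_times flat_exp_diff_times)

definition smooth_step :: "real \<Rightarrow> real" where
  "smooth_step t = flat_exp 0 t / (flat_exp 0 t + flat_exp 0 (1 - t))"

text \<open>At least one of \<open>t\<close> and \<open>1 - t\<close> is positive, so the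
  denominator of \<open>smooth_step\<close> never vanishes.\<close>

lemma flat_exp_sum_pos: "flat_exp 0 t + flat_exp 0 (1 - t) > 0"
  by (auto simp: flat_exp_def add_pos_pos)

lemma smooth_on_smooth_step: "smooth_on UNIV smooth_step"
proof -
  have "smooth_on UNIV (\<lambda>t. flat_exp 0 (1 - t))"
    by (rule smooth_on_compose[OF _ _ _ smooth_on_flat_exp]) (auto intro!: smooth_on_diff)
  then have "smooth_on UNIV (\<lambda>t. flat_exp 0 t / (flat_exp 0 t + flat_exp 0 (1 - t)))"
    by (intro smooth_on_divide smooth_on_add smooth_on_flat_exp)
      (use flat_exp_sum_pos less_irrefl in \<open>auto, metis\<close>)
  then show ?thesis by (simp add: smooth_step_def[abs_def])
qed

lemma smooth_step_range: "0 \<le> smooth_step t" "smooth_step t \<le> 1"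
  using flat_exp_sum_pos[of t] by (auto simp: smooth_step_def flat_exp_def divide_simps)

lemma smooth_step_eq_0: "t \<le> 0 \<Longrightarrow> smooth_step t = 0"
  and smooth_step_eq_1: "1 \<le> t \<Longrightarrow> smooth_step t = 1"
  by (auto simp: smooth_step_def flat_exp_def)

lemma ex_bump:
  fixes a :: "'a::euclidean_space"
  assumes "0 < r" "r < R"
  obtains \<psi> :: "'a \<Rightarrow> real" where "smooth_on UNIV \<psi>" "\<And>z. 0 \<le> \<psi> z" "\<And>z. \<psi> z \<le> 1"
    "\<And>z. z \<in> cball a r \<Longrightarrow> \<psi> z = 1" "\<And>z. z \<notin> ball a R \<Longrightarrow> \<psi> z = 0"
proof
  \<comment> \<open>At least 1 exactly on the closed ball of radius \<open>r\<close>, at most 0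
    exactly outside the open ball of radius \<open>R\<close>. Using the inner product in place of
    the norm keeps it smooth at \<open>a\<close>.\<close>
  let ?q = "\<lambda>z. (R\<^sup>2 - (z - a) \<bullet> (z - a)) / (R\<^sup>2 - r\<^sup>2)"
  have p: "R\<^sup>2 - r\<^sup>2 > 0" using assms by (simp add: power_strict_mono)
  have "smooth_on UNIV (\<lambda>z. ?q z)"
    by (rule smooth_on_linear[OF open_UNIV bounded_linear_divide]) (auto intro!: smooth_on_diff smooth_on_inner)
  then show "smooth_on UNIV (\<lambda>z. smooth_step (?q z))"
    by (intro smooth_on_compose[OF _ _ _ smooth_on_smooth_step]) auto
  show "0 \<le> smooth_step (?q z)" "smooth_step (?q z) \<le> 1" for z by (rule smooth_step_range)+
  show "smooth_step (?q z) = 1" if "z \<in> cball a r" for z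
  proof (rule smooth_step_eq_1)
    have "(z - a) \<bullet> (z - a) \<le> r\<^sup>2"
      using that by (auto simp: dot_square_norm dist_norm norm_minus_commute intro!: power_mono)
    then show "1 \<le> ?q z" using p by (simp add: field_simps)
  qed
  show "smooth_step (?q z) = 0" if "z \<notin> ball a R" for z
  proof (rule smooth_step_eq_0)
    have "(z - a) \<bullet> (z - a) \<ge> R\<^sup>2"
      using that assms by (auto simp: dot_square_norm dist_norm norm_minus_commute intro!: power_mono)
    then show "?q z \<le> 0" using p by (simp add: field_simps)
  qed
qed

section \<open>Compactly supported smooth functions\<close>

lemma test_functionsI:
  assumes "smooth_on UNIV u" "compact K" "K \<subseteq> V" "\<And>x. x \<notin> K \<Longrightarrow> u x = 0"
  shows "u \<in> test_functions V"
proof -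
  have "closure {x. u x \<noteq> 0} \<subseteq> K"
    using assms(2,4) by (intro closure_minimal compact_imp_closed) auto
  moreover from this have "compact (closure {x. u x \<noteq> 0})"
    using compact_Int_closed[OF assms(2) closed_closure, of "{x. u x \<noteq> 0}"] by (simp add: inf_absorb2)
  ultimately show ?thesis using assms by (auto simp: test_functions_def)
qed

lemma test_functionsE:
  assumes "u \<in> test_functions V"
  obtains K where "compact K" "K \<subseteq> V" "\<And>x. x \<notin> K \<Longrightarrow> u x = 0" "smooth_on UNIV u"
proof
  show "u x = 0" if "x \<notin> closure {x. u x \<noteq> 0}" for x
    using that closure_subset[of "{x. u x \<noteq> 0}"] by blast
qed (use assms in \<open>auto simp: test_functions_def\<close>)

lemma test_functions_smooth: "u \<in> test_functions V \<Longrightarrow> smooth_on S u"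
  by (auto simp: test_functions_def intro: smooth_on_subset)

lemma test_functions_mono: "V \<subseteq> W \<Longrightarrow> u \<in> test_functions V \<Longrightarrow> u \<in> test_functions W"
  by (auto simp: test_functions_def)

lemma test_functions_outside: "u \<in> test_functions V \<Longrightarrow> x \<notin> V \<Longrightarrow> u x = 0"
  by (metis subsetD test_functionsE)

lemma test_functions_add:
  assumes "u \<in> test_functions V" "v \<in> test_functions V"
  shows "(\<lambda>x. u x + v x) \<in> test_functions V"
proof -
  obtain K where K: "compact K" "K \<subseteq> V" "\<And>x. x \<notin> K \<Longrightarrow> u x = 0" "smooth_on UNIV u"
    using assms(1) test_functionsE by metis
  obtain L where L: "compact L" "L \<subseteq> V" "\<And>x. x \<notin> L \<Longrightarrow> v x = 0" "smooth_on UNIV v"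
    using assms(2) test_functionsE by metis
  show ?thesis
    by (rule test_functionsI[of _ "K \<union> L"]) (use K L in \<open>auto intro!: smooth_on_add\<close>)
qed

text \<open>The values of \<open>g\<close> outside \<open>V\<close> are arbitrary: the product
  vanishes off a compact \<open>K\<close> inside \<open>V\<close>, so \<open>V\<close> and the
  complement of \<open>K\<close> form an open cover on each member of which it is smooth.\<close>

lemma test_functions_mult_smooth:
  assumes "u \<in> test_functions V" "open V" "smooth_on V g"
  shows "(\<lambda>x. u x * g x) \<in> test_functions V"
proof -
  obtain K where K: "compact K" "K \<subseteq> V" "\<And>x. x \<notin> K \<Longrightarrow> u x = 0" "smooth_on UNIV u"
    using assms(1) test_functionsE by metis
  have "smooth_on UNIV (\<lambda>x. u x * g x)"
  proof (rule smooth_on_local)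
    fix x
    show "\<exists>T. open T \<and> x \<in> T \<and> smooth_on T (\<lambda>x. u x * g x)"
    proof (cases "x \<in> K")
      case True
      have "smooth_on V (\<lambda>x. u x * g x)"
        using K assms by (intro smooth_on_mult) (auto intro: smooth_on_subset)
      then show ?thesis using True K assms by blast
    next
      case False
      have "open (- K)" using K by (simp add: compact_imp_closed open_Compl)
      moreover then have "smooth_on (- K) (\<lambda>x. u x * g x)"
        by (rule smooth_on_cong[OF _ smooth_on_const[of _ 0]]) (use K in auto)
      ultimately show ?thesis using False by blast
    qed
  qed
  then show ?thesis by (rule test_functionsI[OF _ K(1,2)]) (use K in auto)
qed

lemma test_functions_mult_const: "u \<in> test_functions V \<Longrightarrow> (\<lambda>x. c * u x) \<in> test_functions V"
  by (rule test_functionsE[of u V], assumption, rule test_functionsI, rule smooth_on_mult) auto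

lemma test_functions_zero: "(\<lambda>x. 0) \<in> test_functions V"
  by (rule test_functionsI[of _ "{}"]) auto

lemma test_functions_uminus: "u \<in> test_functions V \<Longrightarrow> (\<lambda>x. - u x) \<in> test_functions V"
  using test_functions_mult_const[of u V "-1"] by simp

lemma test_functions_cnj: "u \<in> test_functions V \<Longrightarrow> (\<lambda>x. cnj (u x)) \<in> test_functions V"
  by (rule test_functionsE[of u V], assumption, rule test_functionsI, rule smooth_on_cnj) auto

lemma test_functions_deriv:
  assumes "u \<in> test_functions V"
  shows "(\<lambda>x. frechet_derivative u (at x) v) \<in> test_functions V"
proof -
  obtain K where K: "compact K" "K \<subseteq> V" "\<And>x. x \<notin> K \<Longrightarrow> u x = 0" "smooth_on UNIV u"
    using assms(1) test_functionsE by metis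
  show ?thesis
  proof (rule test_functionsI[OF smooth_on_deriv[OF K(4)] K(1,2)])
    fix x assume x: "x \<notin> K"
    have "open (- K)" using K by (simp add: compact_imp_closed open_Compl)
    with K x have "(u has_derivative (\<lambda>v. 0)) (at x)"
      by (auto intro: has_derivative_transform_within_open[of "\<lambda>x. 0" "\<lambda>v. 0" x UNIV "- K"])
    then show "frechet_derivative u (at x) v = 0"
      using frechet_derivative_at by metis
  qed
qed

lemma test_functions_reflect:
  assumes "u \<in> test_functions UNIV"
  shows "(\<lambda>y. u (x - y)) \<in> test_functions UNIV"
proof -
  obtain K where K: "compact K" "\<And>x. x \<notin> K \<Longrightarrow> u x = 0" "smooth_on UNIV u"
    using assms(1) test_functionsE by metis
  show ?thesis
  proof (rule test_functionsI[of _ "(\<lambda>y. x - y) ` K"])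
    show "smooth_on UNIV (\<lambda>y. u (x - y))"
      by (rule smooth_on_compose[OF _ _ _ K(3)]) (auto intro!: smooth_on_diff)
    show "compact ((\<lambda>y. x - y) ` K)"
      by (intro compact_continuous_image continuous_intros K)
    show "u (x - y) = 0" if "y \<notin> (\<lambda>y. x - y) ` K" for y
      using that K(2)[of "x - y"] by (metis diff_diff_eq2 add_diff_cancel_left' image_eqI)
  qed auto
qed

lemma test_functions_bounded:
  assumes "u \<in> test_functions V"
  obtains C where "0 < C" "\<And>x. norm (u x) \<le> C"
proof -
  obtain K where K: "compact K" "\<And>x. x \<notin> K \<Longrightarrow> u x = 0" "smooth_on UNIV u"
    using assms(1) test_functionsE by metis
  have "bounded (u ` K)"
    by (rule compact_imp_bounded[OF compact_continuous_image[OF smooth_on_continuous[OF smooth_on_subset[OF K(3)]] K(1)]]) auto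
  then obtain C where "0 < C" "\<forall>x\<in>K. norm (u x) \<le> C" by (auto simp: bounded_pos)
  then show ?thesis using K(2) that[of C] by (metis less_imp_le norm_zero)
qed

lemma test_functions_continuous: "u \<in> test_functions V \<Longrightarrow> continuous_on S u"
  by (intro smooth_on_continuous test_functions_smooth)

lemma test_functions_measurable: "u \<in> test_functions V \<Longrightarrow> u \<in> borel_measurable borel"
  by (intro borel_measurable_continuous_onI test_functions_continuous)

lemma test_functions_integrable:
  assumes "u \<in> test_functions V" shows "integrable lborel u"
proof -
  obtain K where K: "compact K" "\<And>x. x \<notin> K \<Longrightarrow> u x = 0" "smooth_on UNIV u"
    using assms(1) test_functionsE by metis
  have "set_integrable lborel K u"
    using borel_integrable_compact[OF K(1) test_functions_continuous[OF assms]] by (simp add: set_integrable_def indicator_scaleR_eq_if if_distrib cong: if_cong)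
  moreover have "(\<lambda>x. indicator K x *\<^sub>R u x) = u"
    using K(2) by (auto simp: fun_eq_iff indicator_def)
  ultimately show ?thesis by (simp add: set_integrable_def)
qed

section \<open>Differentiation under the integral sign and convolution\<close>

lemma integrable_mult_bounded:
  fixes f g :: "'a \<Rightarrow> complex"
  assumes "integrable M f" "g \<in> borel_measurable M" "\<And>x. x \<in> space M \<Longrightarrow> norm (g x) \<le> C"
  shows "integrable M (\<lambda>x. f x * g x)" "integrable M (\<lambda>x. g x * f x)"
proof -
  have "integrable M (\<lambda>x. C * norm (f x))" using assms(1) by simp
  then show "integrable M (\<lambda>x. f x * g x)"
  proof (rule Bochner_Integration.integrable_bound)
    show "AE x in M. norm (f x * g x) \<le> norm (C * norm (f x))"
    proof (rule AE_I2)
      fix x assume "x \<in> space M"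
      then have "norm (f x) * norm (g x) \<le> norm (f x) * C"
        using assms(3) by (intro mult_left_mono) auto
      also have "\<dots> \<le> norm (C * norm (f x))" by (simp add: abs_mult mult.commute mult_right_mono)
      finally show "norm (f x * g x) \<le> norm (C * norm (f x))" by (simp add: norm_mult)
    qed
  qed (use assms in measurable)
  then show "integrable M (\<lambda>x. g x * f x)" by (simp add: mult.commute)
qed

text \<open>By the mean value inequality the remainder quotients are dominated by
  \<open>2 * g\<close>, so dominated convergence along an arbitrary null sequence of increments
  gives the derivative.\<close>

lemma has_derivative_under_integral:
  fixes f :: "'a::euclidean_space \<Rightarrow> 'b \<Rightarrow> 'c::euclidean_space"
  assumes r: "0 < r"
    and int: "\<And>x. x \<in> ball x0 r \<Longrightarrow> integrable M (f x)"
    and der: "\<And>x y. x \<in> ball x0 r \<Longrightarrow> y \<in> space M \<Longrightarrow> ((\<lambda>x. f x y) has_derivative D x y) (at x)"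
    and bound: "\<And>x y v. x \<in> ball x0 r \<Longrightarrow> y \<in> space M \<Longrightarrow> norm (D x y v) \<le> g y * norm v"
    and g: "integrable M g"
    and meas: "\<And>v. (\<lambda>y. D x0 y v) \<in> borel_measurable M"
  shows "((\<lambda>x. \<integral>y. f x y \<partial>M) has_derivative (\<lambda>v. \<integral>y. D x0 y v \<partial>M)) (at x0)"
proof -
  have x0: "x0 \<in> ball x0 r" using r by simp
  have intD: "integrable M (\<lambda>y. D x0 y v)" for v
  proof (rule Bochner_Integration.integrable_bound)
    show "integrable M (\<lambda>y. g y * norm v)" using g by simp
    show "AE y in M. norm (D x0 y v) \<le> norm (g y * norm v)"
      using order_trans[OF bound[OF x0] abs_ge_self] by auto
  qed (rule meas)
  have lin: "linear (D x0 y)" if "y \<in> space M" for y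
    using der[OF x0 that] has_derivative_linear by blast
  have "bounded_linear (\<lambda>v. \<integral>y. D x0 y v \<partial>M)"
  proof (rule bounded_linear_intro)
    show "(\<integral>y. D x0 y (v + w) \<partial>M) = (\<integral>y. D x0 y v \<partial>M) + (\<integral>y. D x0 y w \<partial>M)" for v w
      by (subst Bochner_Integration.integral_add[OF intD intD, symmetric])
        (auto intro!: Bochner_Integration.integral_cong simp: linear_add[OF lin])
    show "(\<integral>y. D x0 y (c *\<^sub>R v) \<partial>M) = c *\<^sub>R (\<integral>y. D x0 y v \<partial>M)" for c v
    proof -
      have "(\<integral>y. D x0 y (c *\<^sub>R v) \<partial>M) = (\<integral>y. c *\<^sub>R D x0 y v \<partial>M)"
        by (intro Bochner_Integration.integral_cong) (auto simp: linear_scale[OF lin])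
      then show ?thesis by simp
    qed
    show "norm (\<integral>y. D x0 y v \<partial>M) \<le> norm v * (\<integral>y. g y \<partial>M)" for v
    proof -
      have "norm (\<integral>y. D x0 y v \<partial>M) \<le> (\<integral>y. norm (D x0 y v) \<partial>M)" by (rule integral_norm_bound)
      also have "\<dots> \<le> (\<integral>y. g y * norm v \<partial>M)"
        using bound[OF x0] intD g by (intro integral_mono) auto
      finally show ?thesis by (simp add: mult.commute)
    qed
  qed
  moreover have "((\<lambda>h. norm ((\<integral>y. f (x0 + h) y \<partial>M) - (\<integral>y. f x0 y \<partial>M) - (\<integral>y. D x0 y h \<partial>M)) / norm h) \<longlongrightarrow> 0) (at 0)"
    unfolding tendsto_at_iff_sequentially
  proof (intro allI impI)
    fix X :: "nat \<Rightarrow> 'a"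
    assume X: "\<forall>i. X i \<in> UNIV - {0}" "X \<longlonglongrightarrow> 0"
    \<comment> \<open>The hypotheses control \<open>f\<close> only in the ball around
      \<open>x0\<close>; setting the quotient to 0 for large increments changes finitely many
      terms.\<close>
    let ?e = "\<lambda>n y. if norm (X n) < r then (f (x0 + X n) y - f x0 y - D x0 y (X n)) /\<^sub>R norm (X n) else 0"
    have ev: "\<forall>\<^sub>F n in sequentially. norm (X n) < r"
      using X(2) r by (auto simp: tendsto_iff dist_norm)
    have "(\<lambda>n. \<integral>y. ?e n y \<partial>M) \<longlonglongrightarrow> (\<integral>y. 0 \<partial>M)"
    proof (rule integral_dominated_convergence[where w="\<lambda>y. 2 * g y"])
      show "(\<lambda>y. ?e n y) \<in> borel_measurable M" for n
      proof (cases "norm (X n) < r")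
        case True
        then have "x0 + X n \<in> ball x0 r" by (simp add: dist_norm)
        then show ?thesis
          using True int[OF x0] int[of "x0 + X n"] meas by auto
      qed simp
      show "integrable M (\<lambda>y. 2 * g y)" using g by simp
      show "AE y in M. (\<lambda>n. ?e n y) \<longlonglongrightarrow> 0"
      proof (rule AE_I2)
        fix y assume y: "y \<in> space M"
        have "((\<lambda>h. norm (f (x0 + h) y - f x0 y - D x0 y h) / norm h) \<longlongrightarrow> 0) (at 0)"
          using der[OF x0 y] by (simp add: has_derivative_at)
        then have "((\<lambda>h. norm (f (x0 + h) y - f x0 y - D x0 y h) / norm h) \<circ> X) \<longlonglongrightarrow> 0"
          using X unfolding tendsto_at_iff_sequentially by blast
        then have "(\<lambda>n. norm ((f (x0 + X n) y - f x0 y - D x0 y (X n)) /\<^sub>R norm (X n))) \<longlonglongrightarrow> 0"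
          by (simp add: o_def divide_inverse mult.commute)
        then have "(\<lambda>n. (f (x0 + X n) y - f x0 y - D x0 y (X n)) /\<^sub>R norm (X n)) \<longlonglongrightarrow> 0"
          by (rule tendsto_norm_zero_cancel)
        then show "(\<lambda>n. ?e n y) \<longlonglongrightarrow> 0"
          by (rule Lim_transform_eventually) (use ev in \<open>auto elim!: eventually_mono\<close>)
      qed
      show "AE y in M. norm (?e n y) \<le> 2 * g y" for n
      proof (rule AE_I2)
        fix y assume y: "y \<in> space M"
        \<comment> \<open>The bound on the derivative in the nonzero direction \<open>X n\<close>
          forces \<open>g y\<close> to be nonnegative.\<close>
        have g0: "0 \<le> g y"
        proof -
          have "norm (D x0 y (X n)) \<le> g y * norm (X n)" using bound[OF x0 y] .
          then have "0 \<le> g y * norm (X n)" using norm_ge_zero order_trans by blast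
          then show ?thesis using X(1) by (metis DiffD2 insertI1 zero_le_mult_iff zero_less_norm_iff not_less)
        qed
        show "norm (?e n y) \<le> 2 * g y"
        proof (cases "norm (X n) < r")
          case True
          then have x1: "x0 + X n \<in> ball x0 r" by (simp add: dist_norm)
          have "norm (f (x0 + X n) y - f x0 y) \<le> g y * norm (x0 + X n - x0)"
            by (rule differentiable_bound[of "ball x0 r" _ "\<lambda>x. D x y"])
              (use der y x0 x1 bound g0 in \<open>auto intro!: onorm_bound has_derivative_at_withinI[OF der]\<close>)
          moreover have "norm (D x0 y (X n)) \<le> g y * norm (X n)" using bound[OF x0 y] .
          ultimately have "norm (f (x0 + X n) y - f x0 y - D x0 y (X n)) \<le> 2 * g y * norm (X n)"
            using norm_triangle_ineq4[of "f (x0 + X n) y - f x0 y" "D x0 y (X n)"] by simp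
          then show ?thesis using True X(1)
            by (simp add: divide_simps mult.commute)
        qed (use g0 in simp)
      qed
    qed simp
    then have "(\<lambda>n. norm (\<integral>y. ?e n y \<partial>M)) \<longlonglongrightarrow> 0"
      using tendsto_norm_zero by auto
    then show "((\<lambda>h. norm ((\<integral>y. f (x0 + h) y \<partial>M) - (\<integral>y. f x0 y \<partial>M) - (\<integral>y. D x0 y h \<partial>M)) / norm h) \<circ> X) \<longlonglongrightarrow> 0"
    proof (rule Lim_transform_eventually)
      show "\<forall>\<^sub>F n in sequentially. norm (\<integral>y. ?e n y \<partial>M) =
        ((\<lambda>h. norm ((\<integral>y. f (x0 + h) y \<partial>M) - (\<integral>y. f x0 y \<partial>M) - (\<integral>y. D x0 y h \<partial>M)) / norm h) \<circ> X) n"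
        using ev
      proof eventually_elim
        case (elim n)
        then have x1: "x0 + X n \<in> ball x0 r" by (simp add: dist_norm)
        have "(\<integral>y. ?e n y \<partial>M) = ((\<integral>y. f (x0 + X n) y \<partial>M) - (\<integral>y. f x0 y \<partial>M) - (\<integral>y. D x0 y (X n) \<partial>M)) /\<^sub>R norm (X n)"
          using elim int[OF x0] int[OF x1] intD by simp
        then show ?case by (simp add: divide_inverse mult.commute)
      qed
    qed
  qed
  ultimately show ?thesis by (simp add: has_derivative_at)
qed

lemma test_functions_deriv_bound:
  assumes "u \<in> test_functions V"
  obtains C where "0 < C" "\<And>x v. norm (frechet_derivative u (at x) v) \<le> C * norm v"
proof -
  obtain C1 where C1: "0 < C1" "\<And>x. norm (frechet_derivative u (at x) 1) \<le> C1"
    using test_functions_bounded[OF test_functions_deriv[OF assms]] by metis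
  obtain C2 where C2: "0 < C2" "\<And>x. norm (frechet_derivative u (at x) \<i>) \<le> C2"
    using test_functions_bounded[OF test_functions_deriv[OF assms]] by metis
  have "norm (frechet_derivative u (at x) v) \<le> (C1 + C2) * norm v" for x v
  proof -
    have "(u has_derivative frechet_derivative u (at x)) (at x)"
      using smooth_on_has_derivative[OF test_functions_smooth[OF assms]] by blast
    then have lin: "linear (frechet_derivative u (at x))" using has_derivative_linear by blast
    have "v = Re v *\<^sub>R 1 + Im v *\<^sub>R \<i>" by (simp add: complex_eq_iff)
    then have "frechet_derivative u (at x) v = frechet_derivative u (at x) (Re v *\<^sub>R 1 + Im v *\<^sub>R \<i>)" by simp
    also have "\<dots> = Re v *\<^sub>R frechet_derivative u (at x) 1 + Im v *\<^sub>R frechet_derivative u (at x) \<i>"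
      by (simp only: linear_add[OF lin] linear_scale[OF lin])
    finally have "frechet_derivative u (at x) v = Re v *\<^sub>R frechet_derivative u (at x) 1 + Im v *\<^sub>R frechet_derivative u (at x) \<i>" .
    then have "norm (frechet_derivative u (at x) v) \<le> \<bar>Re v\<bar> * C1 + \<bar>Im v\<bar> * C2"
      using C1 C2 by (auto intro!: norm_triangle_le add_mono mult_left_mono)
    also have "\<dots> \<le> norm v * C1 + norm v * C2"
      using C1 C2 by (intro add_mono mult_right_mono) (auto simp: abs_Re_le_cmod abs_Im_le_cmod)
    finally show ?thesis by (simp add: algebra_simps)
  qed
  then show ?thesis using that[of "C1 + C2"] C1 C2 by simp
qed

text \<open>The derivative falls on the kernel, which has bounded derivatives, so integrability of
  \<open>w\<close> suffices. Iterating this makes the convolution smooth.\<close>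

lemma convolution_has_derivative:
  assumes w: "integrable lborel (w :: complex \<Rightarrow> complex)" and k: "k \<in> test_functions UNIV"
  shows "((\<lambda>x. \<integral>y. w y * k (x - y) \<partial>lborel) has_derivative
    (\<lambda>v. \<integral>y. w y * frechet_derivative k (at (x - y)) v \<partial>lborel)) (at x)"
proof -
  obtain C where C: "0 < C" "\<And>x v. norm (frechet_derivative k (at x) v) \<le> C * norm v"
    using test_functions_deriv_bound[OF k] by metis
  obtain B where B: "0 < B" "\<And>x. norm (k x) \<le> B" using test_functions_bounded[OF k] by metis
  have [measurable]: "w \<in> borel_measurable borel" using w by auto
  have [measurable]: "k \<in> borel_measurable borel" by (rule test_functions_measurable[OF k])
  have [measurable]: "(\<lambda>x. frechet_derivative k (at x) v) \<in> borel_measurable borel" for v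
    by (rule test_functions_measurable[OF test_functions_deriv[OF k]])
  show ?thesis
  proof (rule has_derivative_under_integral[where r=1 and g="\<lambda>y. C * norm (w y)"])
    show "integrable lborel (\<lambda>y. w y * k (x - y))" for x
      by (rule integrable_mult_bounded[OF w, where C=B]) (use B in auto)
    show "((\<lambda>x. w y * k (x - y)) has_derivative (\<lambda>v. w y * frechet_derivative k (at (x - y)) v)) (at x)" for x y
    proof (rule has_derivative_mult_right)
      have "(k has_derivative frechet_derivative k (at (x - y))) (at (x - y))"
        using smooth_on_has_derivative[OF test_functions_smooth[OF k]] by blast
      then show "((\<lambda>x. k (x - y)) has_derivative frechet_derivative k (at (x - y))) (at x)"
        by (intro has_derivative_compose[of "\<lambda>x. x - y" "\<lambda>v. v" x UNIV k]) (auto intro!: derivative_eq_intros)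
    qed
    show "norm (w y * frechet_derivative k (at (x - y)) v) \<le> C * norm (w y) * norm v" for x y v
      using mult_left_mono[OF C(2)[of "x - y" v] norm_ge_zero[of "w y"]] by (simp add: norm_mult mult_ac)
  qed (use w in auto)
qed

lemma smooth_on_convolution:
  assumes w: "integrable lborel (w :: complex \<Rightarrow> complex)" and k: "k \<in> test_functions UNIV"
  shows "smooth_on UNIV (\<lambda>x. \<integral>y. w y * k (x - y) \<partial>lborel)"
proof -
  have "diff_times n UNIV (\<lambda>x. \<integral>y. w y * k (x - y) \<partial>lborel)" for n
    using k
  proof (induction n arbitrary: k)
    case 0
    then show ?case using convolution_has_derivative[OF w 0] by (auto simp: differentiable_def)
  next
    case (Suc n)
    show ?case
      by (rule diff_times_SucI[OF open_UNIV convolution_has_derivative[OF w Suc.prems]])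
        (rule Suc.IH[OF test_functions_deriv[OF Suc.prems]])
  qed
  then show ?thesis by (simp add: smooth_on_iff_diff_times)
qed

text \<open>The factor \<open>-1\<close> has Jacobian 1 in the plane. Measurability of
  \<open>f\<close> is not assumed: reflection is an involution, so integrability of either side
  yields it, and otherwise both Bochner integrals take the default value 0.\<close>

lemma lborel_integral_reflect:
  fixes f :: "complex \<Rightarrow> complex"
  shows "(\<integral>y. f (x - y) \<partial>lborel) = (\<integral>y. f y \<partial>lborel)"
    and lborel_integrable_reflect: "integrable lborel (\<lambda>y. f (x - y)) \<longleftrightarrow> integrable lborel f"
proof -
  have d: "distr lborel borel (\<lambda>y. x - y) = (lborel :: complex measure)" for x
    using lborel_affine[of "-1" x] by (simp add: density_1 one_ennreal_def[symmetric])
  have i: "integrable lborel (\<lambda>y. g (x - y)) \<Longrightarrow> integrable lborel g" for g :: "complex \<Rightarrow> complex" and x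
  proof -
    assume a: "integrable lborel (\<lambda>y. g (x - y))"
    then have "(\<lambda>y. g (x - y)) \<in> borel_measurable borel" by auto
    then have "(\<lambda>z. (\<lambda>y. g (x - y)) (x - z)) \<in> borel_measurable borel"
      by (rule measurable_compose[rotated]) simp
    then have [measurable]: "g \<in> borel_measurable borel" by simp
    show ?thesis using integrable_distr_eq[of "\<lambda>y. x - y" lborel borel g] a d by simp
  qed
  show ii: "integrable lborel (\<lambda>y. f (x - y)) \<longleftrightarrow> integrable lborel f"
    using i[of f x] i[of "\<lambda>y. f (x - y)" x] by auto
  show "(\<integral>y. f (x - y) \<partial>lborel) = (\<integral>y. f y \<partial>lborel)"
  proof (cases "integrable lborel f")
    case True
    then have [measurable]: "f \<in> borel_measurable borel" by auto
    show ?thesis using integral_distr[of "\<lambda>y. x - y" lborel borel f] d[of x] by simp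
  next
    case False
    then show ?thesis using ii by (simp add: not_integrable_integral_eq)
  qed
qed

lemma integrable_indicator_cball:
  "integrable lborel (\<lambda>y. indicator (cball a r) y :: complex)" for a :: complex
proof -
  have "integrable lborel (indicator (cball a r) :: complex \<Rightarrow> real)"
    by (intro integrable_real_indicator emeasure_bounded_finite) auto
  then have "integrable lborel (\<lambda>y. complex_of_real (indicator (cball a r) y))"
    by (rule integrable_of_real)
  also have "(\<lambda>y. complex_of_real (indicator (cball a r) y)) = indicator (cball a r)"
    by (auto simp: fun_eq_iff indicator_def)
  finally show ?thesis .
qed

text \<open>The integral of \<open>h(x - y)\<close> over all \<open>y\<close> does not depend on \<open>x\<close>; for \<open>x\<close> near \<open>0\<close>
  it is a convolution of \<open>h\<close> with the indicator of a large ball.\<close>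

lemma integral_deriv_test_function:
  assumes h: "h \<in> test_functions V"
  shows "(\<integral>y. frechet_derivative h (at y) v \<partial>lborel) = 0"
proof -
  obtain K where K: "compact K" "\<And>x. x \<notin> K \<Longrightarrow> h x = 0"
    using h test_functionsE by metis
  obtain R where R: "0 < R" "\<And>x. x \<in> K \<Longrightarrow> norm x \<le> R"
    using compact_imp_bounded[OF K(1)] by (auto simp: bounded_pos)
  have h': "h \<in> test_functions UNIV" using h test_functions_mono by blast
  \<comment> \<open>Radius \<open>R + 1\<close> because \<open>x\<close> will range over the unit
    ball: \<open>x - y\<close> in \<open>K\<close> then forces \<open>norm y\<close> below
    \<open>R + 1\<close>, so the indicator is 1 wherever the integrand is nonzero.\<close>
  let ?w = "\<lambda>y. indicator (cball (0::complex) (R + 1)) y :: complex"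
  have w: "integrable lborel ?w"
    by (rule integrable_indicator_cball)
  let ?F = "\<lambda>x. \<integral>y. ?w y * h (x - y) \<partial>lborel"
  have eq: "?w y * k (x - y) = k (x - y)" if "norm x < 1" "\<And>x. x \<notin> K \<Longrightarrow> k x = 0" for x y k
  proof (cases "x - y \<in> K")
    case True
    have "norm y \<le> norm x + norm (x - y)" by (metis add.commute norm_minus_commute norm_triangle_sub)
    then have "norm y \<le> R + 1" using R(2)[OF True] that by linarith
    then show ?thesis by simp
  qed (use that in simp)
  have F: "?F x = (\<integral>y. h y \<partial>lborel)" if "x \<in> ball 0 1" for x
  proof -
    have "?w y * h (x - y) = h (x - y)" for y
      by (rule eq) (use that K in auto)
    then show ?thesis using lborel_integral_reflect[of h x] by presburger
  qed
  have z: "frechet_derivative h (at x) v = 0" if "x \<notin> K" for x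
  proof -
    have "open (- K)" using K by (simp add: compact_imp_closed open_Compl)
    with K that have "(h has_derivative (\<lambda>v. 0)) (at x)"
      by (auto intro: has_derivative_transform_within_open[of "\<lambda>x. 0" "\<lambda>v. 0" x UNIV "- K"])
    then show "frechet_derivative h (at x) v = 0"
      using frechet_derivative_at by metis
  qed
  have "(?F has_derivative (\<lambda>v. \<integral>y. ?w y * frechet_derivative h (at (0 - y)) v \<partial>lborel)) (at 0)"
    by (rule convolution_has_derivative[OF w h'])
  moreover have "(?F has_derivative (\<lambda>v. 0)) (at 0)"
    by (rule has_derivative_transform_within_open[of "\<lambda>x. \<integral>y. h y \<partial>lborel" "\<lambda>v. 0" 0 UNIV "ball 0 1"])
       (use F in auto)
  ultimately have "(\<integral>y. ?w y * frechet_derivative h (at (0 - y)) v \<partial>lborel) = 0"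
    using has_derivative_unique by (metis (mono_tags, lifting))
  moreover have "?w y * frechet_derivative h (at (0 - y)) v = frechet_derivative h (at (0 - y)) v" for y
    by (rule eq[of 0 "\<lambda>x. frechet_derivative h (at x) v"]) (use z in auto)
  ultimately show ?thesis
    using lborel_integral_reflect(1)[of "\<lambda>x. frechet_derivative h (at x) v" 0] by (simp only:)
qed

section \<open>The Fourier transform of test functions\<close>

lemma integrable_prod_mult:
  fixes p :: "'a \<Rightarrow> 'c::{real_normed_field, banach, second_countable_topology}" and q :: "'b \<Rightarrow> 'c"
  assumes "sigma_finite_measure M1" "sigma_finite_measure M2" "integrable M1 p" "integrable M2 q"
  shows "integrable (M1 \<Otimes>\<^sub>M M2) (\<lambda>(x, y). p x * q y)"
proof -
  interpret pair_sigma_finite M1 M2 using assms(1,2) by (simp add: pair_sigma_finite_def)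
  have [measurable]: "p \<in> borel_measurable M1" "q \<in> borel_measurable M2" using assms by auto
  show ?thesis
  proof (rule Fubini_integrable)
    have "(\<lambda>x. \<integral>y. norm (case (x, y) of (x, y) \<Rightarrow> p x * q y) \<partial>M2) = (\<lambda>x. norm (p x) * (\<integral>y. norm (q y) \<partial>M2))"
      by (auto simp: norm_mult fun_eq_iff)
    then show "integrable M1 (\<lambda>x. \<integral>y. norm (case (x, y) of (x, y) \<Rightarrow> p x * q y) \<partial>M2)"
      using assms(3) by simp
    show "AE x in M1. integrable M2 (\<lambda>y. case (x, y) of (x, y) \<Rightarrow> p x * q y)"
      using assms(4) by simp
  qed measurable
qed

lemma lborel_Fubini_dominated:
  fixes f :: "complex \<Rightarrow> complex \<Rightarrow> complex" and p q :: "complex \<Rightarrow> real"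
  assumes f[measurable]: "case_prod f \<in> borel_measurable (borel \<Otimes>\<^sub>M borel)"
    and pq: "integrable lborel p" "integrable lborel q"
    and bound: "\<And>x y. norm (f x y) \<le> p x * q y"
  shows "(\<integral>y. (\<integral>x. f x y \<partial>lborel) \<partial>lborel) = (\<integral>x. (\<integral>y. f x y \<partial>lborel) \<partial>lborel)"
proof -
  have "integrable (lborel \<Otimes>\<^sub>M lborel) (\<lambda>(x, y). p x * q y)"
    by (intro integrable_prod_mult pq lborel.sigma_finite_measure_axioms)
  then have "integrable (lborel \<Otimes>\<^sub>M lborel) (case_prod f)"
  proof (rule Bochner_Integration.integrable_bound)
    show "AE x in lborel \<Otimes>\<^sub>M lborel. norm (case_prod f x) \<le> norm (case x of (x, y) \<Rightarrow> p x * q y)"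
      using bound by (auto intro!: AE_I2 order_trans[OF bound abs_ge_self])
  qed measurable
  then show ?thesis using lborel_pair.Fubini_integral[of f] by simp
qed

text \<open>Checked on boxes, which determine Lebesgue measure. It reduces Gaussian and Cauchy type
  integrals over the plane to one real variable.\<close>

lemma lborel_complex: "lborel = distr (lborel \<Otimes>\<^sub>M lborel) borel (\<lambda>(a, b). Complex a b)"
proof (rule lborel_eqI)
  have [measurable]: "(\<lambda>(a, b). Complex a b) \<in> borel \<Otimes>\<^sub>M borel \<rightarrow>\<^sub>M borel"
    unfolding borel_prod Complex_eq by (intro borel_measurable_continuous_onI) (auto simp: split_beta intro!: continuous_intros)
  fix l u :: complex assume le: "\<And>b. b \<in> Basis \<Longrightarrow> l \<bullet> b \<le> u \<bullet> b"
  have le': "Re l \<le> Re u" "Im l \<le> Im u" using le[of 1] le[of \<i>] by (auto simp: Basis_complex_def)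
  have "(\<lambda>(a, b). Complex a b) -` box l u \<inter> space (lborel \<Otimes>\<^sub>M lborel) = {Re l<..<Re u} \<times> {Im l<..<Im u}"
    by (auto simp: box_def Basis_complex_def space_pair_measure)
  then show "emeasure (distr (lborel \<Otimes>\<^sub>M lborel) borel (\<lambda>(a, b). Complex a b)) (box l u)
      = ennreal (\<Prod>b\<in>Basis. (u - l) \<bullet> b)"
    using le' by (subst emeasure_distr)
      (auto simp: lborel.emeasure_pair_measure_Times Basis_complex_def ennreal_mult')
qed simp

lemma lborel_complex_prod_integral:
  fixes f g :: "real \<Rightarrow> complex"
  assumes "integrable lborel f" "integrable lborel g"
  shows "integrable lborel (\<lambda>z. f (Re z) * g (Im z))"
    and "(\<integral>z. f (Re z) * g (Im z) \<partial>lborel) = (\<integral>x. f x \<partial>lborel) * (\<integral>y. g y \<partial>lborel)"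
proof -
  have [measurable]: "(\<lambda>(a, b). Complex a b) \<in> borel \<Otimes>\<^sub>M borel \<rightarrow>\<^sub>M borel"
    unfolding borel_prod Complex_eq by (intro borel_measurable_continuous_onI) (auto simp: split_beta intro!: continuous_intros)
  have [measurable]: "f \<in> borel_measurable borel" "g \<in> borel_measurable borel" using assms by auto
  have [measurable]: "Re \<in> borel_measurable borel" "Im \<in> borel_measurable borel"
    by (intro borel_measurable_continuous_onI continuous_intros)+
  have i: "integrable (lborel \<Otimes>\<^sub>M lborel) (\<lambda>(x, y). f x * g y)"
    by (intro integrable_prod_mult assms lborel.sigma_finite_measure_axioms)
  have e: "(\<lambda>p. f (Re (case p of (a, b) \<Rightarrow> Complex a b)) * g (Im (case p of (a, b) \<Rightarrow> Complex a b)))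
     = (\<lambda>(x, y). f x * g y)"
    by auto
  show "integrable lborel (\<lambda>z. f (Re z) * g (Im z))"
    by (subst lborel_complex, subst integrable_distr_eq) (simp_all add: e i)
  have "(\<integral>z. f (Re z) * g (Im z) \<partial>lborel) = integral\<^sup>L (lborel \<Otimes>\<^sub>M lborel) (\<lambda>(x, y). f x * g y)"
    by (subst lborel_complex, subst integral_distr) (simp_all add: e)
  also have "\<dots> = (\<integral>x. (\<integral>y. f x * g y \<partial>lborel) \<partial>lborel)"
    using lborel_pair.integral_fst'[OF i] by simp
  also have "\<dots> = (\<integral>x. f x \<partial>lborel) * (\<integral>y. g y \<partial>lborel)" by simp
  finally show "(\<integral>z. f (Re z) * g (Im z) \<partial>lborel) = (\<integral>x. f x \<partial>lborel) * (\<integral>y. g y \<partial>lborel)" .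
qed

text \<open>The square of \<open>c\<close> is the Jacobian in real dimension 2. As with reflection,
  the equality of integrals covers functions that are not measurable, because scaling can be
  undone.\<close>

lemma lborel_integral_scale:
  fixes f :: "complex \<Rightarrow> complex"
  assumes "0 < (c::real)"
  shows "(\<integral>x. f (of_real c * x) \<partial>lborel) = (\<integral>x. f x \<partial>lborel) / of_real (c\<^sup>2)"
    and "integrable lborel f \<Longrightarrow> integrable lborel (\<lambda>x. f (of_real c * x))"
proof -
  let ?s = "\<lambda>x::complex. of_real c * x"
  have [measurable]: "?s \<in> borel_measurable borel" by simp
  have d: "lborel = density (distr lborel borel ?s) (\<lambda>_. ennreal (c\<^sup>2))"
    using lborel_affine[where 'a=complex and c=c and t=0] assms by (simp add: scaleR_conv_of_real[abs_def])
  have d': "distr lborel borel ?s = density lborel (\<lambda>_. ennreal (1 / c\<^sup>2))"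
    using assms by (subst (2) d, subst density_density_eq)
      (auto simp: density_1 ennreal_mult'[symmetric] simp flip: one_ennreal_def)
  have *: "integrable lborel (\<lambda>x. f (?s x)) \<longleftrightarrow> integrable lborel f" if [measurable]: "f \<in> borel_measurable borel"
  proof -
    have "integrable lborel (\<lambda>x. f (?s x)) \<longleftrightarrow> integrable (density lborel (\<lambda>_. ennreal (1 / c\<^sup>2))) f"
      by (subst d'[symmetric], subst integrable_distr_eq) simp_all
    also have "\<dots> \<longleftrightarrow> integrable lborel f"
    proof -
      have "integrable lborel (\<lambda>x. (1 / c\<^sup>2) *\<^sub>R f x) \<longleftrightarrow> integrable lborel f"
        using assms integrable_scaleR_right[of "c\<^sup>2" lborel "\<lambda>x. (1 / c\<^sup>2) *\<^sub>R f x"] by auto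
      then show ?thesis by (subst integrable_density) auto
    qed
    finally show ?thesis .
  qed
  show "integrable lborel f \<Longrightarrow> integrable lborel (\<lambda>x. f (?s x))"
    using * by auto
  show "(\<integral>x. f (?s x) \<partial>lborel) = (\<integral>x. f x \<partial>lborel) / of_real (c\<^sup>2)"
  proof (cases "f \<in> borel_measurable borel")
    case True
    note [measurable] = True
    have "(\<integral>x. f (?s x) \<partial>lborel) = (\<integral>x. f x \<partial>density lborel (\<lambda>_. ennreal (1 / c\<^sup>2)))"
      by (subst d'[symmetric], subst integral_distr) simp_all
    also have "\<dots> = (\<integral>x. (1 / c\<^sup>2) *\<^sub>R f x \<partial>lborel)"
      by (subst integral_density) auto
    finally show ?thesis by (simp add: scaleR_conv_of_real)
  next
    case False
    have "(\<lambda>x. f (?s x)) \<notin> borel_measurable borel"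
    proof
      assume "(\<lambda>x. f (?s x)) \<in> borel_measurable borel"
      then have "(\<lambda>x. (\<lambda>x. f (?s x)) (x / of_real c)) \<in> borel_measurable borel"
        by (rule measurable_compose[rotated]) simp
      with False assms show False by simp
    qed
    with False have "\<not> integrable lborel f" "\<not> integrable lborel (\<lambda>x. f (?s x))"
      by (auto dest: borel_measurable_integrable)
    then show ?thesis by (simp add: not_integrable_integral_eq)
  qed
qed

section \<open>The Gaussian as an eigenfunction of the Fourier transform\<close>

lemma gaussian_fourier_real:
  "integrable lborel (\<lambda>x. cis (- (t * x)) * of_real (exp (- x\<^sup>2 / 2)))"
  "(\<integral>x. cis (- (t * x)) * of_real (exp (- x\<^sup>2 / 2)) \<partial>lborel) = of_real (sqrt (2 * pi) * exp (- t\<^sup>2 / 2))"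
proof -
  have g: "exp (- x\<^sup>2 / 2) = sqrt (2 * pi) * std_normal_density x" for x
    by (simp add: std_normal_density_def)
  have "integrable lborel std_normal_density" by simp
  then have g1: "integrable lborel (\<lambda>x. complex_of_real (exp (- x\<^sup>2 / 2)))"
    unfolding g by (intro integrable_of_real) simp
  show "integrable lborel (\<lambda>x. cis (- (t * x)) * of_real (exp (- x\<^sup>2 / 2)))"
    by (rule integrable_mult_bounded[OF g1, where C=1])
      (auto intro!: borel_measurable_continuous_onI continuous_intros)
  have "(\<integral>x. cis (- (t * x)) * of_real (exp (- x\<^sup>2 / 2)) \<partial>lborel)
    = (\<integral>x. of_real (sqrt (2 * pi)) * (std_normal_density x *\<^sub>R iexp (- t * x)) \<partial>lborel)"
    unfolding g by (intro Bochner_Integration.integral_cong) (simp_all add: cis_conv_exp scaleR_conv_of_real mult_ac)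
  also have "\<dots> = of_real (sqrt (2 * pi)) * (\<integral>x. std_normal_density x *\<^sub>R iexp (- t * x) \<partial>lborel)"
    by (rule integral_mult_right_zero)
  \<comment> \<open>After normalisation the integral is the characteristic function of the standard
    normal law at \<open>- t\<close>, whose closed form is known.\<close>
  also have "\<dots> = of_real (sqrt (2 * pi)) * char std_normal_distribution (- t)"
    unfolding char_def
    by (subst integral_density) (auto intro!: borel_measurable_continuous_onI continuous_intros simp: normal_density_nonneg)
  finally show "(\<integral>x. cis (- (t * x)) * of_real (exp (- x\<^sup>2 / 2)) \<partial>lborel) = of_real (sqrt (2 * pi) * exp (- t\<^sup>2 / 2))"
    by (simp add: char_std_normal_distribution)
qed

definition gaussian :: "complex \<Rightarrow> complex" where
  "gaussian z = of_real (exp (- (norm z)\<^sup>2 / 2))"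

lemma gaussian_eq: "gaussian z = of_real (exp (- (Re z)\<^sup>2 / 2)) * of_real (exp (- (Im z)\<^sup>2 / 2))"
  by (simp add: gaussian_def cmod_power2 add_divide_distrib mult_exp_exp flip: of_real_mult)

lemma gaussian_fourier: "fourier gaussian y = 2 * pi * gaussian y"
proof -
  have "fourier gaussian y = (\<integral>z. (cis (- (Re y * Re z)) * of_real (exp (- (Re z)\<^sup>2 / 2))) *
    (cis (- (Im y * Im z)) * of_real (exp (- (Im z)\<^sup>2 / 2))) \<partial>lborel)"
    unfolding fourier_def gaussian_eq
    by (intro Bochner_Integration.integral_cong) (simp_all add: inner_complex_def cis_mult mult_ac algebra_simps)
  also have "\<dots> = of_real (sqrt (2 * pi) * exp (- (Re y)\<^sup>2 / 2)) * of_real (sqrt (2 * pi) * exp (- (Im y)\<^sup>2 / 2))"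
    using lborel_complex_prod_integral(2)[OF gaussian_fourier_real(1)[of "Re y"] gaussian_fourier_real(1)[of "Im y"]]
    by (simp only: gaussian_fourier_real(2))
  also have "\<dots> = of_real (sqrt (2 * pi) * sqrt (2 * pi)) * gaussian y"
    unfolding gaussian_eq of_real_mult by (simp only: mult_ac)
  also have "sqrt (2 * pi) * sqrt (2 * pi) = 2 * pi" by simp
  finally show ?thesis by simp
qed

lemma gaussian_integrable: "integrable lborel gaussian"
  using lborel_complex_prod_integral(1)[OF gaussian_fourier_real(1)[of 0] gaussian_fourier_real(1)[of 0]]
  unfolding gaussian_eq[abs_def] by simp

lemma gaussian_integral: "(\<integral>z. gaussian z \<partial>lborel) = 2 * pi"
  using gaussian_fourier[of 0] by (simp add: fourier_def gaussian_def)

lemma gaussian_measurable [measurable]: "gaussian \<in> borel_measurable borel"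
  using gaussian_integrable by auto

section \<open>Derivatives and decay of Fourier transforms\<close>

lemma cis_inner_measurable [measurable (raw)]:
  "f \<in> borel_measurable M \<Longrightarrow> (\<lambda>x. cis (f x)) \<in> borel_measurable M"
  by (rule measurable_compose[where g=cis and N=borel]) (auto intro!: borel_measurable_continuous_onI continuous_intros)

lemma fourier_integrand_integrable:
  assumes "integrable lborel f" shows "integrable lborel (\<lambda>y. cis (- (y \<bullet> \<xi>)) * f y)"
  by (rule integrable_mult_bounded(2)[OF assms, where C=1]) auto

lemma fourier_norm_le:
  assumes "integrable lborel f" shows "norm (fourier f \<xi>) \<le> (\<integral>y. norm (f y) \<partial>lborel)"
proof -
  have "norm (fourier f \<xi>) \<le> (\<integral>y. norm (cis (- (y \<bullet> \<xi>)) * f y) \<partial>lborel)"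
    unfolding fourier_def by (rule integral_norm_bound)
  then show ?thesis by (simp add: norm_mult)
qed

lemma test_functions_linear_mult:
  assumes "f \<in> test_functions V" "bounded_linear (L :: complex \<Rightarrow> complex)"
  shows "(\<lambda>y. L y * f y) \<in> test_functions V"
proof -
  obtain K where "compact K" "K \<subseteq> V" "\<And>x. x \<notin> K \<Longrightarrow> f x = 0" "smooth_on UNIV f"
    using assms(1) test_functionsE by metis
  then show ?thesis
    by (intro test_functionsI[of _ K]) (auto intro!: smooth_on_mult smooth_on_linear[OF _ assms(2)])
qed

lemma cis_inner_has_derivative:
  fixes x y :: complex
  shows "((\<lambda>x. cis (- (y \<bullet> x))) has_derivative (\<lambda>w. cis (- (y \<bullet> x)) * (- \<i> * of_real (y \<bullet> w)))) (at x)"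
proof -
  have "((\<lambda>x. exp (\<i> * complex_of_real (- (y \<bullet> x)))) has_derivative
      (\<lambda>w. exp (\<i> * complex_of_real (- (y \<bullet> x))) * (\<i> * complex_of_real (- (y \<bullet> w))))) (at x)"
    by (rule has_derivative_compose[where g=exp and g'="\<lambda>v. exp (\<i> * complex_of_real (- (y \<bullet> x))) * v", unfolded])
      (auto intro!: derivative_eq_intros DERIV_exp[unfolded has_field_derivative_def])
  then show ?thesis by (simp add: cis_conv_exp)
qed

lemma fourier_has_derivative:
  assumes f: "f \<in> test_functions UNIV"
  shows "(fourier f has_derivative (\<lambda>w. fourier (\<lambda>y. - \<i> * of_real (y \<bullet> w) * f y) \<xi>)) (at \<xi>)"
proof -
  have [measurable]: "f \<in> borel_measurable borel" by (rule test_functions_measurable[OF f])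
  have "((\<lambda>\<xi>. \<integral>y. cis (- (y \<bullet> \<xi>)) * f y \<partial>lborel) has_derivative
    (\<lambda>w. \<integral>y. cis (- (y \<bullet> \<xi>)) * (- \<i> * of_real (y \<bullet> w)) * f y \<partial>lborel)) (at \<xi>)"
  proof (rule has_derivative_under_integral[where r=1 and g="\<lambda>y. norm (y * f y)"])
    show "integrable lborel (\<lambda>y. cis (- (y \<bullet> x)) * f y)" for x
      by (rule fourier_integrand_integrable[OF test_functions_integrable[OF f]])
    show "((\<lambda>x. cis (- (y \<bullet> x)) * f y) has_derivative
        (\<lambda>w. cis (- (y \<bullet> x)) * (- \<i> * of_real (y \<bullet> w)) * f y)) (at x)" for x y
      by (intro has_derivative_mult_left cis_inner_has_derivative)
    show "norm (cis (- (y \<bullet> x)) * (- \<i> * of_real (y \<bullet> v)) * f y) \<le> norm (y * f y) * norm v" for x y v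
      using mult_right_mono[OF Cauchy_Schwarz_ineq2[of y v] norm_ge_zero[of "f y"]]
      by (simp add: norm_mult mult_ac)
    show "integrable lborel (\<lambda>y. norm (y * f y))"
      using test_functions_integrable[OF test_functions_linear_mult[OF f bounded_linear_ident]] by simp
  qed auto
  then show ?thesis by (simp add: fourier_def[abs_def] mult_ac)
qed

lemma smooth_on_fourier:
  assumes f: "f \<in> test_functions UNIV"
  shows "smooth_on UNIV (fourier f)"
proof -
  have "diff_times n UNIV (fourier f)" for n
    using f
  proof (induction n arbitrary: f)
    case 0
    then show ?case using fourier_has_derivative[OF 0] by (auto simp: differentiable_def)
  next
    case (Suc n)
    have "(\<lambda>y. - \<i> * of_real (y \<bullet> w) * f y) \<in> test_functions UNIV" for w
      by (rule test_functions_linear_mult[OF Suc.prems])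
        (intro bounded_linear_intros bounded_linear_compose[OF bounded_linear_of_real bounded_linear_inner_left])
    then show ?case
      by (intro diff_times_SucI[OF open_UNIV fourier_has_derivative[OF Suc.prems]] Suc.IH)
  qed
  then show ?thesis by (simp add: smooth_on_iff_diff_times)
qed

lemma fourier_measurable: "f \<in> test_functions UNIV \<Longrightarrow> fourier f \<in> borel_measurable borel"
  by (intro borel_measurable_continuous_onI smooth_on_continuous smooth_on_fourier)

lemma smooth_on_cis_inner: "smooth_on UNIV (\<lambda>y. cis (- (y \<bullet> \<xi>)))"
proof -
  have "smooth_on UNIV (\<lambda>y. exp (\<i> * of_real (- (y \<bullet> \<xi>))))"
    by (rule smooth_on_compose[where g="\<lambda>y. \<i> * of_real (- (y \<bullet> \<xi>))" and f=exp and T=UNIV])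
      (auto intro!: holomorphic_imp_smooth_on holomorphic_intros smooth_on_mult smooth_on_uminus smooth_on_of_real smooth_on_inner)
  then show ?thesis by (simp add: cis_conv_exp)
qed

text \<open>Integration by parts: the derivative of \<open>f\<close> times the character has
  integral 0, and the product rule splits it into the two terms.\<close>

lemma fourier_deriv:
  assumes f: "f \<in> test_functions UNIV"
  shows "fourier (\<lambda>y. frechet_derivative f (at y) v) \<xi> = \<i> * of_real (v \<bullet> \<xi>) * fourier f \<xi>"
proof -
  let ?h = "\<lambda>y. f y * cis (- (y \<bullet> \<xi>))"
  have h: "?h \<in> test_functions UNIV"
    by (rule test_functions_mult_smooth[OF f open_UNIV smooth_on_cis_inner])
  have c: "((\<lambda>y. cis (- (y \<bullet> \<xi>))) has_derivative (\<lambda>v. cis (- (y \<bullet> \<xi>)) * (- \<i> * of_real (v \<bullet> \<xi>)))) (at y)" for y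
    using cis_inner_has_derivative[of \<xi> y] by (simp add: inner_commute)
  have fd: "(f has_derivative frechet_derivative f (at y)) (at y)" for y
    using smooth_on_has_derivative[OF test_functions_smooth[OF f]] by blast
  have "frechet_derivative ?h (at y) v = cis (- (y \<bullet> \<xi>)) * frechet_derivative f (at y) v
      - \<i> * of_real (v \<bullet> \<xi>) * (cis (- (y \<bullet> \<xi>)) * f y)" for y
    using frechet_derivative_at[OF has_derivative_mult[OF fd c], of y]
    by (simp add: fun_eq_iff mult_ac)
  then have "0 = (\<integral>y. cis (- (y \<bullet> \<xi>)) * frechet_derivative f (at y) v
      - \<i> * of_real (v \<bullet> \<xi>) * (cis (- (y \<bullet> \<xi>)) * f y) \<partial>lborel)"
    using integral_deriv_test_function[OF h, of v] by simp
  also have "\<dots> = fourier (\<lambda>y. frechet_derivative f (at y) v) \<xi> - \<i> * of_real (v \<bullet> \<xi>) * fourier f \<xi>"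
    using fourier_integrand_integrable[OF test_functions_integrable[OF f]]
      fourier_integrand_integrable[OF test_functions_integrable[OF test_functions_deriv[OF f]]]
    unfolding fourier_def by simp
  finally show ?thesis by simp
qed

text \<open>One factor \<open>1 + norm \<xi>\<close> is at most
  \<open>1 + |Re \<xi>| + |Im \<xi>|\<close>, and multiplying the transform by these coordinates
  amounts, up to a unit factor, to transforming the two partial derivatives. The induction therefore
  runs over all test functions at once.\<close>

lemma fourier_decay:
  assumes f: "f \<in> test_functions UNIV"
  obtains C where "0 < C" "\<And>\<xi>. (1 + norm \<xi>) ^ N * norm (fourier f \<xi>) \<le> C"
proof -
  have "\<exists>C>0. \<forall>\<xi>. (1 + norm \<xi>) ^ N * norm (fourier f \<xi>) \<le> C"
    using f
  proof (induction N arbitrary: f)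
    case 0
    have "norm (fourier f \<xi>) \<le> (\<integral>y. norm (f y) \<partial>lborel) + 1" for \<xi>
      using fourier_norm_le[OF test_functions_integrable[OF 0], of \<xi>] by linarith
    moreover have "(\<integral>y. norm (f y) \<partial>lborel) + 1 > 0"
      by (simp add: add_nonneg_pos)
    ultimately show ?case by auto
  next
    case (Suc N)
    let ?d = "\<lambda>v y. frechet_derivative f (at y) v"
    obtain C1 where C1: "C1 > 0" "\<And>\<xi>. (1 + norm \<xi>) ^ N * norm (fourier f \<xi>) \<le> C1"
      using Suc.IH[OF Suc.prems] by blast
    obtain C2 where C2: "C2 > 0" "\<And>\<xi>. (1 + norm \<xi>) ^ N * norm (fourier (?d 1) \<xi>) \<le> C2"
      using Suc.IH[OF test_functions_deriv[OF Suc.prems, of 1]] by blast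
    obtain C3 where C3: "C3 > 0" "\<And>\<xi>. (1 + norm \<xi>) ^ N * norm (fourier (?d \<i>) \<xi>) \<le> C3"
      using Suc.IH[OF test_functions_deriv[OF Suc.prems, of \<i>]] by blast
    have "(1 + norm \<xi>) ^ Suc N * norm (fourier f \<xi>) \<le> C1 + C2 + C3" for \<xi>
    proof -
      have "(1 + norm \<xi>) ^ Suc N * norm (fourier f \<xi>)
        \<le> (1 + norm \<xi>) ^ N * ((1 + (\<bar>Re \<xi>\<bar> + \<bar>Im \<xi>\<bar>)) * norm (fourier f \<xi>))"
        unfolding power_Suc2 mult.assoc by (intro mult_left_mono mult_right_mono add_left_mono cmod_le) auto
      also have "\<dots> = (1 + norm \<xi>) ^ N * norm (fourier f \<xi>) + (1 + norm \<xi>) ^ N * norm (fourier (?d 1) \<xi>)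
         + (1 + norm \<xi>) ^ N * norm (fourier (?d \<i>) \<xi>)"
        by (simp add: fourier_deriv[OF Suc.prems] norm_mult inner_complex_def algebra_simps)
      also have "\<dots> \<le> C1 + C2 + C3" by (intro add_mono C1 C2 C3)
      finally show ?thesis .
    qed
    then show ?case using C1 C2 C3 by (intro exI[of _ "C1 + C2 + C3"]) auto
  qed
  then show ?thesis using that by blast
qed

text \<open>Comparison with the product of two one-dimensional Cauchy densities. The first function
  serves the decay estimates for Fourier transforms, the second is the profile of the approximate
  identity in Weyl's lemma.\<close>

lemma integrable_bracket_inverse:
  "integrable lborel (\<lambda>z::complex. inverse ((1 + norm z) ^ 4))"
  "integrable lborel (\<lambda>z::complex. inverse ((1 + (norm z)\<^sup>2)\<^sup>2))"
proof -
  have "integrable lborel (\<lambda>x::real. inverse (1 + x\<^sup>2))"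
    using integrable_inverse_1_plus_square by (simp add: set_integrable_def)
  then have "integrable lborel (\<lambda>x. complex_of_real (inverse (1 + x\<^sup>2)))"
    by (rule integrable_of_real)
  from lborel_complex_prod_integral(1)[OF this this]
  have i: "integrable lborel (\<lambda>z. inverse (1 + (Re z)\<^sup>2) * inverse (1 + (Im z)\<^sup>2))"
    by (simp only: complex_of_real_integrable_eq of_real_mult[symmetric])
  have b: "inverse ((1 + (norm z)\<^sup>2)\<^sup>2) \<le> inverse (1 + (Re z)\<^sup>2) * inverse (1 + (Im z)\<^sup>2)" for z
  proof -
    have "(1 + (Re z)\<^sup>2) * (1 + (Im z)\<^sup>2) \<le> (1 + (norm z)\<^sup>2) * (1 + (norm z)\<^sup>2)"
      by (intro mult_mono) (auto simp: cmod_power2)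
    moreover have "(1 + (Re z)\<^sup>2) * (1 + (Im z)\<^sup>2) > 0"
      by (intro mult_pos_pos add_pos_nonneg) auto
    ultimately have "inverse ((1 + (norm z)\<^sup>2) * (1 + (norm z)\<^sup>2)) \<le> inverse ((1 + (Re z)\<^sup>2) * (1 + (Im z)\<^sup>2))"
      by (rule le_imp_inverse_le)
    then show ?thesis by (simp add: power2_eq_square)
  qed
  show j: "integrable lborel (\<lambda>z::complex. inverse ((1 + (norm z)\<^sup>2)\<^sup>2))"
    by (rule Bochner_Integration.integrable_bound[OF i]) (use b in \<open>auto intro!: AE_I2 simp: norm_mult norm_inverse abs_mult\<close>)
  have "inverse ((1 + norm z) ^ 4) \<le> inverse ((1 + (norm z)\<^sup>2)\<^sup>2)" for z :: complex
  proof (rule le_imp_inverse_le)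
    have "1 + (norm z)\<^sup>2 \<le> (1 + norm z)\<^sup>2" by (simp add: power2_eq_square algebra_simps)
    then have "(1 + (norm z)\<^sup>2)\<^sup>2 \<le> ((1 + norm z)\<^sup>2)\<^sup>2" by (intro power_mono) auto
    then show "(1 + (norm z)\<^sup>2)\<^sup>2 \<le> (1 + norm z) ^ 4" by (simp flip: power_mult)
  qed (intro zero_less_power add_pos_nonneg; simp)
  then show "integrable lborel (\<lambda>z::complex. inverse ((1 + norm z) ^ 4))"
    by (intro Bochner_Integration.integrable_bound[OF j]) (auto intro!: AE_I2)
qed

lemma integrable_polynomial_times_fourier:
  assumes f: "f \<in> test_functions UNIV"
  shows "integrable lborel (\<lambda>\<xi>. (1 + norm \<xi>) ^ N * norm (fourier f \<xi>))"
proof -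
  \<comment> \<open>The four extra powers pay for integrability over the plane.\<close>
  obtain C where C: "0 < C" "\<And>\<xi>. (1 + norm \<xi>) ^ (N + 4) * norm (fourier f \<xi>) \<le> C"
    using fourier_decay[OF f] by metis
  have [measurable]: "fourier f \<in> borel_measurable borel" by (rule fourier_measurable[OF f])
  show ?thesis
  proof (rule Bochner_Integration.integrable_bound)
    show "integrable lborel (\<lambda>z::complex. C * inverse ((1 + norm z) ^ 4))"
      using integrable_bracket_inverse(1) by simp
    have "(1 + norm \<xi>) ^ N * norm (fourier f \<xi>) \<le> C * inverse ((1 + norm \<xi>) ^ 4)" for \<xi>
    proof -
      have "1 + norm \<xi> > 0" by (simp add: add_pos_nonneg)
      then have p: "(1 + norm \<xi>) ^ 4 > 0" by (rule zero_less_power)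
      have "(1 + norm \<xi>) ^ N * norm (fourier f \<xi>) \<le> C / (1 + norm \<xi>) ^ 4"
        using C(2)[of \<xi>] unfolding pos_le_divide_eq[OF p] by (simp add: power_add mult_ac)
      then show ?thesis by (simp add: divide_inverse)
    qed
    then show "AE \<xi> in lborel. norm ((1 + norm \<xi>) ^ N * norm (fourier f \<xi>)) \<le> norm (C * inverse ((1 + norm \<xi>) ^ 4))"
      using C(1) by (auto intro!: AE_I2 simp: abs_mult)
  qed measurable
qed

lemma integrable_fourier: "f \<in> test_functions UNIV \<Longrightarrow> integrable lborel (fourier f)"
  using integrable_polynomial_times_fourier[of f 0] fourier_measurable[of f]
  by (auto simp: integrable_norm_iff)

section \<open>Smoothing symbols\<close>

lemma ex_test_bump:
  assumes "open V" "x \<in> V"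
  obtains h where "h \<in> test_functions V" "\<forall>\<^sub>F y in nhds x. h y = 1"
proof -
  obtain R where R: "0 < R" "cball x R \<subseteq> V"
    using assms open_contains_cball by blast
  obtain \<psi> :: "complex \<Rightarrow> real" where \<psi>: "smooth_on UNIV \<psi>" "\<And>z. 0 \<le> \<psi> z" "\<And>z. \<psi> z \<le> 1"
    "\<And>z. z \<in> cball x (R / 2) \<Longrightarrow> \<psi> z = 1" "\<And>z. z \<notin> ball x R \<Longrightarrow> \<psi> z = 0"
    by (rule ex_bump[of "R / 2" R x]) (use R in simp, use R in simp, rule that)
  show ?thesis
  proof (rule that)
    show "(\<lambda>z. complex_of_real (\<psi> z)) \<in> test_functions V"
      by (rule test_functionsI[of _ "cball x R"]) (use \<psi> R in \<open>auto intro!: smooth_on_of_real\<close>)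
    show "\<forall>\<^sub>F y in nhds x. complex_of_real (\<psi> y) = 1"
      using R \<psi>(4) eventually_nhds_in_open[of "ball x (R / 2)" x] by (auto elim!: eventually_mono)
  qed
qed

text \<open>Gaussian regularisation: \<open>\<integral> f\<hat>(\<xi>) G(\<epsilon>\<xi>) d\<xi> = 2\<pi> \<integral> f(\<epsilon>t) G(t) dt\<close>, then \<open>\<epsilon> \<rightarrow> 0\<close>.\<close>

lemma fourier_gaussian_regularised:
  assumes f: "f \<in> test_functions UNIV" and e: "0 < (e::real)"
  shows "(\<integral>\<xi>. fourier f \<xi> * gaussian (of_real e * \<xi>) \<partial>lborel)
    = 2 * pi * (\<integral>t. f (of_real e * t) * gaussian t \<partial>lborel)"
proof -
  have [measurable]: "f \<in> borel_measurable borel" by (rule test_functions_measurable[OF f])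
  have fi: "integrable lborel f" by (rule test_functions_integrable[OF f])
  let ?h = "\<lambda>\<xi>. fourier f (\<xi> / of_real e) * gaussian \<xi>"
  have "(\<integral>\<xi>. fourier f \<xi> * gaussian (of_real e * \<xi>) \<partial>lborel) = (\<integral>\<xi>. ?h (of_real e * \<xi>) \<partial>lborel)"
    using e by simp
  also have "\<dots> = (\<integral>\<xi>. ?h \<xi> \<partial>lborel) / of_real (e\<^sup>2)"
    by (rule lborel_integral_scale(1)[OF e])
  also have "(\<integral>\<xi>. ?h \<xi> \<partial>lborel) = (\<integral>\<xi>. of_real (e\<^sup>2) * (\<integral>t. cis (- (t \<bullet> \<xi>)) * f (of_real e * t) * gaussian \<xi> \<partial>lborel) \<partial>lborel)"
  proof (intro Bochner_Integration.integral_cong refl)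
    fix \<xi> :: complex
    let ?k = "\<lambda>y. cis (- (y \<bullet> (\<xi> / of_real e))) * f y"
    have "(of_real e * t) \<bullet> (\<xi> / of_real e) = t \<bullet> \<xi>" for t
      using e by (simp add: inner_complex_def)
    then have "(\<integral>t. cis (- (t \<bullet> \<xi>)) * f (of_real e * t) \<partial>lborel) = (\<integral>t. ?k (of_real e * t) \<partial>lborel)"
      by simp
    also have "\<dots> = (\<integral>t. ?k t \<partial>lborel) / of_real (e\<^sup>2)"
      by (rule lborel_integral_scale(1)[OF e])
    finally have "fourier f (\<xi> / of_real e) = of_real (e\<^sup>2) * (\<integral>t. cis (- (t \<bullet> \<xi>)) * f (of_real e * t) \<partial>lborel)"
      using e by (simp add: fourier_def)
    then show "?h \<xi> = of_real (e\<^sup>2) * (\<integral>t. cis (- (t \<bullet> \<xi>)) * f (of_real e * t) * gaussian \<xi> \<partial>lborel)"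
      by simp
  qed
  also have "\<dots> = of_real (e\<^sup>2) * (\<integral>\<xi>. (\<integral>t. cis (- (t \<bullet> \<xi>)) * f (of_real e * t) * gaussian \<xi> \<partial>lborel) \<partial>lborel)"
    by (rule integral_mult_right_zero)
  also have "(\<integral>\<xi>. (\<integral>t. cis (- (t \<bullet> \<xi>)) * f (of_real e * t) * gaussian \<xi> \<partial>lborel) \<partial>lborel)
     = (\<integral>t. (\<integral>\<xi>. cis (- (t \<bullet> \<xi>)) * f (of_real e * t) * gaussian \<xi> \<partial>lborel) \<partial>lborel)"
  proof (rule lborel_Fubini_dominated[where p="\<lambda>t. norm (f (of_real e * t))" and q="\<lambda>\<xi>. norm (gaussian \<xi>)"])
    show "integrable lborel (\<lambda>t. norm (f (of_real e * t)))"
      using lborel_integral_scale(2)[OF e fi] by simp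
  qed (use gaussian_integrable in \<open>auto simp: norm_mult split_beta\<close>)
  also have "\<dots> = (\<integral>t. 2 * pi * (f (of_real e * t) * gaussian t) \<partial>lborel)"
  proof (intro Bochner_Integration.integral_cong refl)
    fix t
    have "(\<integral>\<xi>. cis (- (t \<bullet> \<xi>)) * f (of_real e * t) * gaussian \<xi> \<partial>lborel)
      = (\<integral>\<xi>. f (of_real e * t) * (cis (- (\<xi> \<bullet> t)) * gaussian \<xi>) \<partial>lborel)"
      by (simp add: mult_ac inner_commute)
    also have "\<dots> = f (of_real e * t) * fourier gaussian t"
      unfolding fourier_def by (rule integral_mult_right_zero)
    finally show "(\<integral>\<xi>. cis (- (t \<bullet> \<xi>)) * f (of_real e * t) * gaussian \<xi> \<partial>lborel)
        = 2 * pi * (f (of_real e * t) * gaussian t)"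
      by (simp add: gaussian_fourier)
  qed
  also have "\<dots> = 2 * pi * (\<integral>t. f (of_real e * t) * gaussian t \<partial>lborel)"
    by (rule integral_mult_right_zero)
  finally show ?thesis using e by simp
qed

lemma scaled_tendsto: "(\<lambda>n. of_real (1 / real (Suc n)) * (z::complex)) \<longlonglongrightarrow> 0"
proof -
  have "(\<lambda>n. of_real (1 / real (Suc n)) * z) \<longlonglongrightarrow> of_real 0 * z"
    by (intro tendsto_intros LIMSEQ_Suc lim_1_over_n)
  then show ?thesis by simp
qed

lemma fourier_inversion_0:
  assumes f: "f \<in> test_functions UNIV"
  shows "(\<integral>\<xi>. fourier f \<xi> \<partial>lborel) = of_real ((2 * pi)\<^sup>2) * f 0"
proof -
  have [measurable]: "f \<in> borel_measurable borel" by (rule test_functions_measurable[OF f])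
  have [measurable]: "fourier f \<in> borel_measurable borel" by (rule fourier_measurable[OF f])
  obtain B where B: "0 < B" "\<And>x. norm (f x) \<le> B" using test_functions_bounded[OF f] by metis
  let ?e = "\<lambda>n. 1 / real (Suc n)"
  have g1: "norm (gaussian z) \<le> 1" for z by (simp add: gaussian_def)
  have gc: "isCont gaussian z" for z
    unfolding gaussian_def[abs_def] by (intro continuous_intros) auto
  have fc: "isCont f z" for z
    using test_functions_continuous[OF f] continuous_on_eq_continuous_at by blast
  have "(\<lambda>n. \<integral>\<xi>. fourier f \<xi> * gaussian (of_real (?e n) * \<xi>) \<partial>lborel) \<longlonglongrightarrow> (\<integral>\<xi>. fourier f \<xi> * 1 \<partial>lborel)"
  proof (rule integral_dominated_convergence[where w="\<lambda>\<xi>. norm (fourier f \<xi>)"])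
    show "AE \<xi> in lborel. (\<lambda>n. fourier f \<xi> * gaussian (of_real (?e n) * \<xi>)) \<longlonglongrightarrow> fourier f \<xi> * 1"
    proof (intro AE_I2 tendsto_intros)
      fix \<xi> show "(\<lambda>n. gaussian (of_real (?e n) * \<xi>)) \<longlonglongrightarrow> 1"
        using isCont_tendsto_compose[OF gc scaled_tendsto, of \<xi>] by (simp add: gaussian_def)
    qed
    show "AE \<xi> in lborel. norm (fourier f \<xi> * gaussian (of_real (?e n) * \<xi>)) \<le> norm (fourier f \<xi>)" for n
      using g1 by (auto intro!: AE_I2 mult_left_le simp: norm_mult)
  qed (use integrable_fourier[OF f] in auto)
  moreover have "(\<lambda>n. \<integral>t. f (of_real (?e n) * t) * gaussian t \<partial>lborel) \<longlonglongrightarrow> (\<integral>t. f 0 * gaussian t \<partial>lborel)"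
  proof (rule integral_dominated_convergence[where w="\<lambda>t. B * norm (gaussian t)"])
    show "AE t in lborel. (\<lambda>n. f (of_real (?e n) * t) * gaussian t) \<longlonglongrightarrow> f 0 * gaussian t"
      by (intro AE_I2 tendsto_intros isCont_tendsto_compose[OF fc scaled_tendsto])
    show "AE t in lborel. norm (f (of_real (?e n) * t) * gaussian t) \<le> B * norm (gaussian t)" for n
      using B by (auto intro!: AE_I2 mult_right_mono simp: norm_mult)
  qed (use gaussian_integrable in auto)
  \<comment> \<open>One factor \<open>2 * pi\<close> comes from transforming the Gaussian, the other
    is its total mass; together they give the constant of the inversion formula.\<close>
  then have "(\<lambda>n. 2 * pi * (\<integral>t. f (of_real (?e n) * t) * gaussian t \<partial>lborel)) \<longlonglongrightarrow> 2 * pi * (f 0 * (2 * pi))"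
    by (intro tendsto_intros) (simp add: gaussian_integral)
  then have "(\<lambda>n. \<integral>\<xi>. fourier f \<xi> * gaussian (of_real (?e n) * \<xi>) \<partial>lborel) \<longlonglongrightarrow> 2 * pi * (f 0 * (2 * pi))"
    by (subst fourier_gaussian_regularised[OF f]) auto
  ultimately show ?thesis
    using LIMSEQ_unique by (fastforce simp: power2_eq_square mult_ac)
qed

lemma lborel_integral_translate:
  fixes f :: "complex \<Rightarrow> complex"
  shows "(\<integral>y. f (y + x) \<partial>lborel) = (\<integral>y. f y \<partial>lborel)"
proof -
  have "(\<integral>y. f (y + x) \<partial>lborel) = (\<integral>y. f ((0 - y) + x) \<partial>lborel)"
    using lborel_integral_reflect(1)[of "\<lambda>y. f (y + x)" 0] by simp
  also have "\<dots> = (\<integral>y. f y \<partial>lborel)"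
    using lborel_integral_reflect(1)[of f x] by simp
  finally show ?thesis .
qed

lemma test_functions_translate:
  assumes "u \<in> test_functions UNIV"
  shows "(\<lambda>y. u (y + x)) \<in> test_functions UNIV"
  using test_functions_reflect[OF test_functions_reflect[OF assms], of x 0] by (simp add: add.commute)

lemma fourier_translate: "fourier (\<lambda>y. f (y + x)) \<xi> = cis (x \<bullet> \<xi>) * fourier f \<xi>"
proof -
  have "fourier (\<lambda>y. f (y + x)) \<xi> = (\<integral>y. cis (x \<bullet> \<xi>) * (cis (- ((y + x) \<bullet> \<xi>)) * f (y + x)) \<partial>lborel)"
    unfolding fourier_def
    by (auto intro!: Bochner_Integration.integral_cong simp: cis_mult inner_add_left mult.assoc[symmetric])
  also have "\<dots> = cis (x \<bullet> \<xi>) * (\<integral>y. cis (- ((y + x) \<bullet> \<xi>)) * f (y + x) \<partial>lborel)"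
    by (rule integral_mult_right_zero)
  also have "(\<integral>y. cis (- ((y + x) \<bullet> \<xi>)) * f (y + x) \<partial>lborel) = fourier f \<xi>"
    unfolding fourier_def by (rule lborel_integral_translate[of "\<lambda>y. cis (- (y \<bullet> \<xi>)) * f y"])
  finally show ?thesis .
qed

lemma fourier_inversion:
  assumes f: "f \<in> test_functions UNIV"
  shows "(\<integral>\<xi>. cis (x \<bullet> \<xi>) * fourier f \<xi> \<partial>lborel) = of_real ((2 * pi)\<^sup>2) * f x"
  using fourier_inversion_0[OF test_functions_translate[OF f, of x]] by (simp add: fourier_translate)

text \<open>The bilinear form of Parseval, with a reflection where the Hermitian form has a
  conjugation: it matches the pairing of a kernel factor with the argument of an operator.\<close>

lemma fourier_parseval:
  assumes f: "f \<in> test_functions UNIV" and g: "g \<in> test_functions UNIV"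
  shows "(\<integral>\<xi>. fourier (\<lambda>y. f (- y)) \<xi> * fourier g \<xi> \<partial>lborel) = of_real ((2 * pi)\<^sup>2) * (\<integral>y. f y * g y \<partial>lborel)"
proof -
  have f': "(\<lambda>y. f (- y)) \<in> test_functions UNIV" using test_functions_reflect[OF f, of 0] by simp
  have [measurable]: "f \<in> borel_measurable borel" by (rule test_functions_measurable[OF f])
  have [measurable]: "fourier g \<in> borel_measurable borel" by (rule fourier_measurable[OF g])
  have "(\<integral>\<xi>. fourier (\<lambda>y. f (- y)) \<xi> * fourier g \<xi> \<partial>lborel)
    = (\<integral>\<xi>. (\<integral>y. cis (- (y \<bullet> \<xi>)) * f (- y) * fourier g \<xi> \<partial>lborel) \<partial>lborel)"
    by (simp add: fourier_def)
  also have "\<dots> = (\<integral>y. (\<integral>\<xi>. cis (- (y \<bullet> \<xi>)) * f (- y) * fourier g \<xi> \<partial>lborel) \<partial>lborel)"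
    by (rule lborel_Fubini_dominated[where p="\<lambda>y. norm (f (- y))" and q="\<lambda>\<xi>. norm (fourier g \<xi>)"])
      (use test_functions_integrable[OF f'] integrable_fourier[OF g] in \<open>auto simp: norm_mult split_beta\<close>)
  also have "\<dots> = (\<integral>y. of_real ((2 * pi)\<^sup>2) * (f (- y) * g (- y)) \<partial>lborel)"
  proof (intro Bochner_Integration.integral_cong refl)
    fix y
    have "(\<integral>\<xi>. cis (- (y \<bullet> \<xi>)) * f (- y) * fourier g \<xi> \<partial>lborel)
      = (\<integral>\<xi>. f (- y) * (cis ((- y) \<bullet> \<xi>) * fourier g \<xi>) \<partial>lborel)"
      by (simp add: mult_ac)
    also have "\<dots> = f (- y) * (of_real ((2 * pi)\<^sup>2) * g (- y))"
      unfolding fourier_inversion[OF g, symmetric] by (rule integral_mult_right_zero)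
    finally show "(\<integral>\<xi>. cis (- (y \<bullet> \<xi>)) * f (- y) * fourier g \<xi> \<partial>lborel) = of_real ((2 * pi)\<^sup>2) * (f (- y) * g (- y))"
      by (simp add: mult_ac)
  qed
  also have "\<dots> = of_real ((2 * pi)\<^sup>2) * (\<integral>y. f (- y) * g (- y) \<partial>lborel)"
    by (rule integral_mult_right_zero)
  also have "(\<integral>y. f (- y) * g (- y) \<partial>lborel) = (\<integral>y. f y * g y \<partial>lborel)"
    using lborel_integral_reflect(1)[of "\<lambda>y. f y * g y" 0] by simp
  finally show ?thesis .
qed

text \<open>The full symbols of operators with kernel \<open>\<Sum> \<alpha>\<^sub>j(x) \<beta>\<^sub>j(-y)\<close>.\<close>

inductive smoothing_symbol :: "symb \<Rightarrow> bool" where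
  single: "\<alpha> \<in> test_functions UNIV \<Longrightarrow> \<beta> \<in> test_functions UNIV \<Longrightarrow>
    smoothing_symbol (\<lambda>(x, \<xi>). \<alpha> x * cis (- (x \<bullet> \<xi>)) * fourier \<beta> \<xi>)"
| add: "smoothing_symbol a \<Longrightarrow> smoothing_symbol b \<Longrightarrow> smoothing_symbol (\<lambda>p. a p + b p)"

lemma smoothing_symbol_zero: "smoothing_symbol (\<lambda>p. 0)"
  using single[OF test_functions_zero test_functions_zero] by (simp add: case_prod_unfold)

text \<open>The class is closed under differentiation. In the \<open>x\<close> direction the phase
  produces a factor \<open>\<xi>\<close>, which is absorbed by differentiating
  \<open>\<beta>\<close>; in the \<open>\<xi>\<close> direction the phase multiplies
  \<open>\<alpha>\<close> by a linear function of \<open>x\<close>, and the transform multiplies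
  \<open>\<beta>\<close> by a linear function of \<open>y\<close>. All are test functions again, so
  estimating undifferentiated symbols is enough.\<close>

lemma smoothing_symbol_single_deriv:
  assumes \<alpha>: "\<alpha> \<in> test_functions UNIV" and \<beta>: "\<beta> \<in> test_functions UNIV"
  defines "a \<equiv> \<lambda>(x, \<xi>). \<alpha> x * cis (- (x \<bullet> \<xi>)) * fourier \<beta> \<xi>"
  shows "\<exists>D. \<forall>p. (a has_derivative D p) (at p) \<and> (\<forall>v. smoothing_symbol (\<lambda>p. D p v))"
proof -
  let ?D = "\<lambda>p v. (frechet_derivative \<alpha> (at (fst p)) (fst v) * cis (- (fst p \<bullet> snd p)) * fourier \<beta> (snd p)
    + (- \<alpha> (fst p)) * cis (- (fst p \<bullet> snd p)) * fourier (\<lambda>y. frechet_derivative \<beta> (at y) (fst v)) (snd p))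
    + ((- \<i> * of_real (fst p \<bullet> snd v) * \<alpha> (fst p)) * cis (- (fst p \<bullet> snd p)) * fourier \<beta> (snd p)
    + \<alpha> (fst p) * cis (- (fst p \<bullet> snd p)) * fourier (\<lambda>y. - \<i> * of_real (y \<bullet> snd v) * \<beta> y) (snd p))"
  have l: "bounded_linear (\<lambda>y. - \<i> * complex_of_real (y \<bullet> w))" for w
    by (intro bounded_linear_intros bounded_linear_compose[OF bounded_linear_of_real bounded_linear_inner_left])
  have "smoothing_symbol (\<lambda>p. ?D p v)" for v
  proof -
    have "smoothing_symbol (\<lambda>p. (\<lambda>(x, \<xi>). frechet_derivative \<alpha> (at x) (fst v) * cis (- (x \<bullet> \<xi>)) * fourier \<beta> \<xi>) p
      + (\<lambda>(x, \<xi>). (- \<alpha> x) * cis (- (x \<bullet> \<xi>)) * fourier (\<lambda>y. frechet_derivative \<beta> (at y) (fst v)) \<xi>) p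
      + ((\<lambda>(x, \<xi>). (- \<i> * of_real (x \<bullet> snd v) * \<alpha> x) * cis (- (x \<bullet> \<xi>)) * fourier \<beta> \<xi>) p
      + (\<lambda>(x, \<xi>). \<alpha> x * cis (- (x \<bullet> \<xi>)) * fourier (\<lambda>y. - \<i> * of_real (y \<bullet> snd v) * \<beta> y) \<xi>) p))"
      by (intro smoothing_symbol.intros test_functions_deriv test_functions_uminus \<alpha> \<beta> test_functions_linear_mult[OF _ l])
    then show ?thesis by (simp add: split_beta)
  qed
  moreover have "(a has_derivative ?D p) (at p)" for p
  proof -
    obtain x \<xi> where p: "p = (x, \<xi>)" by force
    have d1: "((\<lambda>p. \<alpha> (fst p)) has_derivative (\<lambda>v. frechet_derivative \<alpha> (at x) (fst v))) (at (x, \<xi>))"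
      by (rule has_derivative_compose[where f=fst and g=\<alpha>])
        (use smooth_on_has_derivative[OF test_functions_smooth[OF \<alpha>], of x UNIV] in \<open>auto intro!: derivative_eq_intros\<close>)
    have d2: "((\<lambda>p. fourier \<beta> (snd p)) has_derivative (\<lambda>v. fourier (\<lambda>y. - \<i> * of_real (y \<bullet> snd v) * \<beta> y) \<xi>)) (at (x, \<xi>))"
      by (rule has_derivative_compose[where f=snd and g="fourier \<beta>"])
        (use fourier_has_derivative[OF \<beta>, of \<xi>] in \<open>auto intro!: derivative_eq_intros\<close>)
    have d3: "((\<lambda>p. cis (- (fst p \<bullet> snd p))) has_derivative
        (\<lambda>v. cis (- (x \<bullet> \<xi>)) * (- \<i> * of_real (x \<bullet> snd v + fst v \<bullet> \<xi>)))) (at (x, \<xi>))"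
    proof -
      have "((\<lambda>p. complex_of_real (fst p \<bullet> snd p)) has_derivative (\<lambda>v. of_real (x \<bullet> snd v + fst v \<bullet> \<xi>))) (at (x, \<xi>))"
        by (auto intro!: derivative_eq_intros)
      \<comment> \<open>The known derivative of the character is reused with frequency 1, composed
        with the real number \<open>x \<bullet> \<xi>\<close> embedded in the complex plane.\<close>
      moreover have "((\<lambda>z. cis (- (1 \<bullet> z))) has_derivative (\<lambda>w. cis (- (1 \<bullet> complex_of_real (x \<bullet> \<xi>))) *
          (- \<i> * complex_of_real (1 \<bullet> w)))) (at (complex_of_real (fst (x, \<xi>) \<bullet> snd (x, \<xi>))))"
        unfolding fst_conv snd_conv by (rule cis_inner_has_derivative)
      ultimately have "((\<lambda>p. cis (- (1 \<bullet> complex_of_real (fst p \<bullet> snd p)))) has_derivative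
          (\<lambda>v. cis (- (1 \<bullet> complex_of_real (x \<bullet> \<xi>))) * (- \<i> * complex_of_real (1 \<bullet> complex_of_real (x \<bullet> snd v + fst v \<bullet> \<xi>))))) (at (x, \<xi>))"
        by (rule has_derivative_compose)
      then show ?thesis by (simp add: inner_complex_def)
    qed
    show ?thesis
      unfolding a_def p split_beta
      by (rule has_derivative_eq_rhs[OF has_derivative_mult[OF has_derivative_mult[OF d1 d3] d2]])
        (simp add: fun_eq_iff fourier_deriv[OF \<beta>] algebra_simps)
  qed
  ultimately show ?thesis
    by (intro exI[of _ ?D]) simp
qed

lemma smoothing_symbol_deriv:
  "smoothing_symbol a \<Longrightarrow> \<exists>D. \<forall>p. (a has_derivative D p) (at p) \<and> (\<forall>v. smoothing_symbol (\<lambda>p. D p v))"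
proof (induction rule: smoothing_symbol.induct)
  case (single \<alpha> \<beta>)
  then show ?case by (rule smoothing_symbol_single_deriv)
next
  case (add a b)
  then obtain D E where "\<forall>p. (a has_derivative D p) (at p) \<and> (\<forall>v. smoothing_symbol (\<lambda>p. D p v))"
    "\<forall>p. (b has_derivative E p) (at p) \<and> (\<forall>v. smoothing_symbol (\<lambda>p. E p v))" by blast
  then show ?case
    by (intro exI[of _ "\<lambda>p v. D p v + E p v"]) (auto intro: has_derivative_add smoothing_symbol.add)
qed

lemma smoothing_symbol_iter_deriv: "smoothing_symbol a \<Longrightarrow> smoothing_symbol (iter_deriv vs a)"
proof (induction vs)
  case (Cons v vs)
  obtain D where D: "\<forall>p. (iter_deriv vs a has_derivative D p) (at p) \<and> (\<forall>v. smoothing_symbol (\<lambda>p. D p v))"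
    using smoothing_symbol_deriv[OF Cons.IH[OF Cons.prems]] by blast
  then have "frechet_derivative (iter_deriv vs a) (at p) = D p" for p
    using frechet_derivative_at by metis
  then have "iter_deriv (v # vs) a = (\<lambda>p. D p v)" by (simp add: iter_deriv_Cons)
  then show ?case using D by metis
qed simp

lemma smoothing_symbol_smooth: "smoothing_symbol a \<Longrightarrow> smooth_on S a"
  unfolding smooth_on_def differentiable_def
  using smoothing_symbol_deriv[OF smoothing_symbol_iter_deriv] by blast

lemma smoothing_symbol_decay:
  "smoothing_symbol a \<Longrightarrow> \<exists>C. \<forall>x \<xi>. (1 + norm \<xi>) ^ N * norm (a (x, \<xi>)) \<le> C"
proof (induction rule: smoothing_symbol.induct)
  case (single \<alpha> \<beta>)
  obtain B where B: "0 < B" "\<And>x. norm (\<alpha> x) \<le> B" using test_functions_bounded[OF single(1)] by metis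
  obtain C where C: "0 < C" "\<And>\<xi>. (1 + norm \<xi>) ^ N * norm (fourier \<beta> \<xi>) \<le> C"
    using fourier_decay[OF single(2)] by metis
  have "(1 + norm \<xi>) ^ N * norm (\<alpha> x * cis (- (x \<bullet> \<xi>)) * fourier \<beta> \<xi>) \<le> B * C" for x \<xi>
    using mult_mono[OF B(2)[of x] C(2)[of \<xi>]] B by (simp add: norm_mult mult_ac)
  then show ?case by auto
next
  case (add a b)
  then obtain C D where CD: "\<And>x \<xi>. (1 + norm \<xi>) ^ N * norm (a (x, \<xi>)) \<le> C"
    "\<And>x \<xi>. (1 + norm \<xi>) ^ N * norm (b (x, \<xi>)) \<le> D" by blast
  have "(1 + norm \<xi>) ^ N * norm (a (x, \<xi>) + b (x, \<xi>)) \<le> C + D" for x \<xi>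
  proof -
    have "(1 + norm \<xi>) ^ N * norm (a (x, \<xi>) + b (x, \<xi>)) \<le> (1 + norm \<xi>) ^ N * (norm (a (x, \<xi>)) + norm (b (x, \<xi>)))"
      by (intro mult_left_mono norm_triangle_ineq) auto
    also have "\<dots> \<le> C + D" using CD[of \<xi> x] by (simp add: distrib_left)
    finally show ?thesis .
  qed
  then show ?case by auto
qed

lemma smoothing_symbol_decay_powr:
  assumes "smoothing_symbol a"
  shows "\<exists>C\<ge>0. \<forall>x \<xi>. norm (a (x, \<xi>)) \<le> C * (1 + norm \<xi>) powr s"
proof -
  obtain N :: nat where N: "- s \<le> real N" using real_arch_simple by blast
  obtain C where C: "\<And>x \<xi>. (1 + norm \<xi>) ^ N * norm (a (x, \<xi>)) \<le> C"
    using smoothing_symbol_decay[OF assms] by blast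
  have C0: "0 \<le> C" using C[of 0 0] norm_ge_zero[of "a (0, 0)"] by (simp del: norm_ge_zero)
  have "norm (a (x, \<xi>)) \<le> C * (1 + norm \<xi>) powr s" for x \<xi>
  proof -
    have p: "0 < 1 + norm \<xi>" by (simp add: add_pos_nonneg)
    have "norm (a (x, \<xi>)) = (1 + norm \<xi>) powr - real N * ((1 + norm \<xi>) ^ N * norm (a (x, \<xi>)))"
      using p by (simp add: powr_minus powr_realpow)
    also have "\<dots> \<le> (1 + norm \<xi>) powr - real N * C" by (intro mult_left_mono C) auto
    also have "\<dots> \<le> (1 + norm \<xi>) powr s * C"
      using N C0 by (intro mult_right_mono powr_mono) auto
    finally show ?thesis by (simp add: mult.commute)
  qed
  with C0 show ?thesis by blast
qed

lemma smoothing_symbol_classical: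
  assumes "smoothing_symbol a"
  shows "classical_expansion m a (\<lambda>k p. 0)"
proof -
  have d: "\<exists>C\<ge>0. \<forall>x \<xi>. norm (symb_deriv vs ws a (x, \<xi>)) \<le> C * (1 + norm \<xi>) powr s" for vs ws s
    unfolding symb_deriv_def by (intro smoothing_symbol_decay_powr smoothing_symbol_iter_deriv assms)
  have "a \<in> symbol_class m"
    unfolding symbol_class_def using d smoothing_symbol_smooth[OF assms] by blast
  moreover have "\<exists>C. \<forall>x \<xi>. norm \<xi> \<ge> 1 \<longrightarrow> norm (symb_deriv vs ws (\<lambda>y. a y - (\<Sum>j<N. 0)) (x, \<xi>)) \<le>
          C * norm \<xi> powr (of_int m - real N - real (length ws))" for N :: nat and vs ws
  proof -
    let ?s = "of_int m - real N - real (length ws)"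
    \<comment> \<open>Passing from \<open>1 + norm \<xi>\<close> to \<open>norm \<xi>\<close>
      enlarges a power only if the exponent is at most 0; hence the detour through
      \<open>- \<bar>?s\<bar>\<close>, which lies below \<open>?s\<close>.\<close>
    obtain C where C: "C \<ge> 0" "\<And>x \<xi>. norm (symb_deriv vs ws a (x, \<xi>)) \<le> C * (1 + norm \<xi>) powr (- \<bar>?s\<bar>)"
      using d[of vs ws "- \<bar>?s\<bar>"] by blast
    have "(1 + norm \<xi>) powr (- \<bar>?s\<bar>) \<le> norm \<xi> powr ?s" if "norm \<xi> \<ge> 1" for \<xi> :: complex
    proof -
      have "(1 + norm \<xi>) powr (- \<bar>?s\<bar>) \<le> norm \<xi> powr (- \<bar>?s\<bar>)"
        using that by (intro powr_mono2') auto
      also have "\<dots> \<le> norm \<xi> powr ?s" using that by (intro powr_mono) auto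
      finally show ?thesis .
    qed
    then have "norm (symb_deriv vs ws a (x, \<xi>)) \<le> C * norm \<xi> powr ?s" if "norm \<xi> \<ge> 1" for x \<xi>
      using order_trans[OF C(2) mult_left_mono[OF _ C(1)]] that by blast
    then show ?thesis by auto
  qed
  ultimately show ?thesis by (simp add: classical_expansion_def)
qed

text \<open>The factor \<open>cis (- (x \<bullet> \<xi>))\<close> of the symbol cancels the phase in
  \<open>Op\<close>. What remains is Parseval, so this is the operator with kernel
  \<open>\<alpha> x * \<beta> y\<close>.\<close>

lemma Op_smoothing_single:
  assumes "\<alpha> \<in> test_functions UNIV" "\<beta> \<in> test_functions UNIV" "u \<in> test_functions UNIV"
  shows "Op (\<lambda>(x, \<xi>). \<alpha> x * cis (- (x \<bullet> \<xi>)) * fourier (\<lambda>y. \<beta> (- y)) \<xi>) u x = \<alpha> x * (\<integral>y. \<beta> y * u y \<partial>lborel)"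
proof -
  have "(\<integral>\<xi>. cis (x \<bullet> \<xi>) * (case (x, \<xi>) of (x, \<xi>) \<Rightarrow> \<alpha> x * cis (- (x \<bullet> \<xi>)) * fourier (\<lambda>y. \<beta> (- y)) \<xi>) * fourier u \<xi> \<partial>lborel)
    = (\<integral>\<xi>. \<alpha> x * (fourier (\<lambda>y. \<beta> (- y)) \<xi> * fourier u \<xi>) \<partial>lborel)"
  proof (intro Bochner_Integration.integral_cong refl)
    fix \<xi>
    have "cis (x \<bullet> \<xi>) * cis (- (x \<bullet> \<xi>)) = 1" by (simp add: cis_mult)
    then show "cis (x \<bullet> \<xi>) * (case (x, \<xi>) of (x, \<xi>) \<Rightarrow> \<alpha> x * cis (- (x \<bullet> \<xi>)) * fourier (\<lambda>y. \<beta> (- y)) \<xi>) * fourier u \<xi>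
      = \<alpha> x * (fourier (\<lambda>y. \<beta> (- y)) \<xi> * fourier u \<xi>)"
      by (simp add: algebra_simps)
  qed
  also have "\<dots> = \<alpha> x * (\<integral>\<xi>. fourier (\<lambda>y. \<beta> (- y)) \<xi> * fourier u \<xi> \<partial>lborel)"
    by (rule integral_mult_right_zero)
  finally show ?thesis by (simp add: Op_def fourier_parseval[OF assms(2,3)])
qed

section \<open>Recovering a function of the frequency from its pairings with Fourier
  transforms\<close>

lemma symbol_integrand_integrable:
  assumes d: "continuous_on UNIV d" "\<And>\<xi>. norm (d \<xi>) \<le> C * (1 + norm \<xi>) ^ N" and u: "u \<in> test_functions UNIV"
  shows "integrable lborel (\<lambda>\<xi>. d \<xi> * fourier u \<xi>)"
proof (rule Bochner_Integration.integrable_bound)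
  have [measurable]: "fourier u \<in> borel_measurable borel" by (rule fourier_measurable[OF u])
  have [measurable]: "d \<in> borel_measurable borel" by (rule borel_measurable_continuous_onI[OF d(1)])
  show "integrable lborel (\<lambda>\<xi>. C * ((1 + norm \<xi>) ^ N * norm (fourier u \<xi>)))"
    using integrable_polynomial_times_fourier[OF u] by simp
  show "(\<lambda>\<xi>. d \<xi> * fourier u \<xi>) \<in> borel_measurable lborel" by measurable
  have "norm (d \<xi> * fourier u \<xi>) \<le> C * ((1 + norm \<xi>) ^ N * norm (fourier u \<xi>))" for \<xi>
    using mult_right_mono[OF d(2)[of \<xi>] norm_ge_zero[of "fourier u \<xi>"]] by (simp add: norm_mult mult_ac)
  then show "AE \<xi> in lborel. norm (d \<xi> * fourier u \<xi>) \<le> norm (C * ((1 + norm \<xi>) ^ N * norm (fourier u \<xi>)))"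
    by (intro AE_I2) (auto intro: order_trans[OF _ abs_ge_self])
qed

lemma test_functions_scale:
  assumes "h \<in> test_functions UNIV" "c \<noteq> (0::real)"
  shows "(\<lambda>y. h (of_real c * y)) \<in> test_functions UNIV"
proof -
  obtain K where K: "compact K" "\<And>x. x \<notin> K \<Longrightarrow> h x = 0" using assms(1) test_functionsE by metis
  show ?thesis
  proof (rule test_functionsI[of _ "(\<lambda>y. y / of_real c) ` K"])
    show "smooth_on UNIV (\<lambda>y. h (of_real c * y))"
      by (rule smooth_on_compose[where T=UNIV, OF _ _ _ test_functions_smooth[OF assms(1)]])
        (simp_all only: open_UNIV UNIV_I smooth_on_linear[OF _ bounded_linear_mult_right smooth_on_id])
    show "compact ((\<lambda>y. y / of_real c) ` K)"
      using assms(2) by (intro compact_continuous_image continuous_intros K) simp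
    show "h (of_real c * y) = 0" if "y \<notin> (\<lambda>y. y / of_real c) ` K" for y
    proof (rule K(2), rule notI)
      assume "of_real c * y \<in> K"
      then have "of_real c * y / of_real c \<in> (\<lambda>y. y / of_real c) ` K" by blast
      with that assms(2) show False by simp
    qed
  qed auto
qed

text \<open>Testing against modulated, rescaled bump functions, whose Fourier transforms concentrate at
  a given frequency.\<close>

lemma fourier_test_separates:
  fixes d :: "complex \<Rightarrow> complex"
  assumes d: "continuous_on UNIV d" "\<And>\<xi>. norm (d \<xi>) \<le> C * (1 + norm \<xi>) ^ N"
    and z: "\<And>u. u \<in> test_functions UNIV \<Longrightarrow> (\<integral>\<xi>. d \<xi> * fourier u \<xi> \<partial>lborel) = 0"
  shows "d \<xi>0 = 0"
proof -
  have C0: "0 \<le> C" using order_trans[OF norm_ge_zero d(2)[of 0]] by simp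
  have [measurable]: "d \<in> borel_measurable borel" by (rule borel_measurable_continuous_onI[OF d(1)])
  obtain h where h: "h \<in> test_functions UNIV" and h0: "h 0 = 1"
    by (rule ex_test_bump[OF open_UNIV UNIV_I[of 0]]) (use eventually_nhds_x_imp_x in blast)
  have [measurable]: "fourier h \<in> borel_measurable borel" by (rule fourier_measurable[OF h])
  let ?e = "\<lambda>n. 1 / real (Suc n)"
  have zn: "(\<integral>\<eta>. d (\<xi>0 + of_real (?e n) * \<eta>) * fourier h \<eta> \<partial>lborel) = 0" for n
  proof -
    let ?u = "\<lambda>y. h (of_real (?e n) * y) * cis (- (y \<bullet> (- \<xi>0)))"
    have e: "0 < ?e n" by simp
    have "(\<lambda>y. h (of_real (?e n) * y)) \<in> test_functions UNIV"
      by (rule test_functions_scale[OF h]) (simp del: of_nat_Suc)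
    then have u: "?u \<in> test_functions UNIV"
      by (rule test_functions_mult_smooth[OF _ open_UNIV smooth_on_cis_inner])
    have fu: "fourier ?u \<xi> = fourier h ((\<xi> - \<xi>0) / of_real (?e n)) / of_real ((?e n)\<^sup>2)" for \<xi>
    proof -
      let ?k = "\<lambda>y. cis (- (y \<bullet> ((\<xi> - \<xi>0) / of_real (?e n)))) * h y"
      have "cis (- (y \<bullet> \<xi>)) * ?u y = ?k (of_real (?e n) * y)" for y
      proof -
        have "(of_real (?e n) * y) \<bullet> ((\<xi> - \<xi>0) / of_real (?e n)) = y \<bullet> (\<xi> - \<xi>0)"
        proof -
          have "c \<noteq> 0 \<Longrightarrow> (of_real c * y) \<bullet> ((\<xi> - \<xi>0) / of_real c) = y \<bullet> (\<xi> - \<xi>0)" for c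
            by (simp add: inner_complex_def)
          then show ?thesis by (metis e less_irrefl)
        qed
        then show ?thesis
          by (simp add: mult.left_commute[of "cis _" "h _"] cis_mult inner_diff_right mult.commute[of "h _"])
      qed
      then have "fourier ?u \<xi> = (\<integral>y. ?k (of_real (?e n) * y) \<partial>lborel)" by (simp only: fourier_def)
      also have "\<dots> = (\<integral>y. ?k y \<partial>lborel) / of_real ((?e n)\<^sup>2)"
        by (rule lborel_integral_scale(1)[OF e])
      finally show ?thesis by (simp only: fourier_def)
    qed
    let ?G = "\<lambda>\<xi>. d \<xi> * fourier ?u \<xi>"
    have "0 = (\<integral>\<xi>. ?G \<xi> \<partial>lborel)" using z[OF u] by simp
    also have "\<dots> = (\<integral>\<xi>. ?G (\<xi> + \<xi>0) \<partial>lborel)" by (rule lborel_integral_translate[symmetric])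
    finally have "0 = (\<integral>\<xi>. ?G (of_real (?e n) * \<xi> + \<xi>0) \<partial>lborel)"
      using lborel_integral_scale(1)[OF e, of "\<lambda>\<xi>. ?G (\<xi> + \<xi>0)"] by simp
    also have "\<dots> = (\<integral>\<eta>. d (\<xi>0 + of_real (?e n) * \<eta>) * fourier h \<eta> / of_real ((?e n)\<^sup>2) \<partial>lborel)"
    proof (intro Bochner_Integration.integral_cong refl)
      fix \<eta>
      have "c \<noteq> 0 \<Longrightarrow> (of_real c * \<eta> + \<xi>0 - \<xi>0) / of_real c = \<eta>" for c :: real by simp
      then have "(of_real (?e n) * \<eta> + \<xi>0 - \<xi>0) / of_real (?e n) = \<eta>" by (metis e less_irrefl)
      then show "?G (of_real (?e n) * \<eta> + \<xi>0) = d (\<xi>0 + of_real (?e n) * \<eta>) * fourier h \<eta> / of_real ((?e n)\<^sup>2)"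
        unfolding fu by (simp only: add.commute times_divide_eq_right)
    qed
    also have "\<dots> = (\<integral>\<eta>. d (\<xi>0 + of_real (?e n) * \<eta>) * fourier h \<eta> \<partial>lborel) / of_real ((?e n)\<^sup>2)"
      by (rule integral_divide_zero)
    finally show ?thesis by (simp del: of_nat_Suc)
  qed
  have "(\<lambda>n. \<integral>\<eta>. d (\<xi>0 + of_real (?e n) * \<eta>) * fourier h \<eta> \<partial>lborel) \<longlonglongrightarrow> (\<integral>\<eta>. d \<xi>0 * fourier h \<eta> \<partial>lborel)"
  proof (rule integral_dominated_convergence[where w="\<lambda>\<eta>. C * (1 + norm \<xi>0) ^ N * ((1 + norm \<eta>) ^ N * norm (fourier h \<eta>))"])
    show "integrable lborel (\<lambda>\<eta>. C * (1 + norm \<xi>0) ^ N * ((1 + norm \<eta>) ^ N * norm (fourier h \<eta>)))"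
      using integrable_polynomial_times_fourier[OF h] by simp
    have dc: "isCont d z" for z
      using d(1) continuous_on_eq_continuous_at by blast
    show "AE \<eta> in lborel. (\<lambda>n. d (\<xi>0 + of_real (?e n) * \<eta>) * fourier h \<eta>) \<longlonglongrightarrow> d \<xi>0 * fourier h \<eta>"
    proof (intro AE_I2 tendsto_intros isCont_tendsto_compose[OF dc])
      fix \<eta> show "(\<lambda>n. \<xi>0 + of_real (?e n) * \<eta>) \<longlonglongrightarrow> \<xi>0"
        using tendsto_add[OF tendsto_const scaled_tendsto, of \<xi>0 \<eta>] by simp
    qed
    show "AE \<eta> in lborel. norm (d (\<xi>0 + of_real (?e n) * \<eta>) * fourier h \<eta>) \<le> C * (1 + norm \<xi>0) ^ N * ((1 + norm \<eta>) ^ N * norm (fourier h \<eta>))" for n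
    proof (rule AE_I2)
      fix \<eta>
      have "norm (\<xi>0 + of_real (?e n) * \<eta>) \<le> norm \<xi>0 + ?e n * norm \<eta>"
        by (rule order_trans[OF norm_triangle_ineq]) (simp add: norm_mult norm_divide del: of_nat_Suc)
      also have "?e n * norm \<eta> \<le> norm \<eta>" by (rule mult_left_le_one_le) auto
      also have "1 + (norm \<xi>0 + norm \<eta>) \<le> (1 + norm \<xi>0) * (1 + norm \<eta>)" by (simp add: algebra_simps)
      finally have "1 + norm (\<xi>0 + of_real (?e n) * \<eta>) \<le> (1 + norm \<xi>0) * (1 + norm \<eta>)" by simp
      then have "(1 + norm (\<xi>0 + of_real (?e n) * \<eta>)) ^ N \<le> ((1 + norm \<xi>0) * (1 + norm \<eta>)) ^ N"
        by (intro power_mono) auto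
      then have "norm (d (\<xi>0 + of_real (?e n) * \<eta>)) \<le> C * ((1 + norm \<xi>0) * (1 + norm \<eta>)) ^ N"
        using d(2)[of "\<xi>0 + of_real (?e n) * \<eta>"] mult_left_mono[OF _ C0] order_trans by blast
      from mult_right_mono[OF this norm_ge_zero[of "fourier h \<eta>"]]
      show "norm (d (\<xi>0 + of_real (?e n) * \<eta>) * fourier h \<eta>) \<le> C * (1 + norm \<xi>0) ^ N * ((1 + norm \<eta>) ^ N * norm (fourier h \<eta>))"
        by (simp only: norm_mult power_mult_distrib mult_ac)
    qed
  qed measurable
  then have "(\<lambda>n. 0) \<longlonglongrightarrow> (\<integral>\<eta>. d \<xi>0 * fourier h \<eta> \<partial>lborel)"
    by (simp only: zn)
  then have "(\<integral>\<eta>. d \<xi>0 * fourier h \<eta> \<partial>lborel) = 0"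
    using LIMSEQ_unique tendsto_const by blast
  \<comment> \<open>By inversion at 0 the total integral of the transform of \<open>h\<close> is a
    nonzero multiple of \<open>h 0 = 1\<close>, so it may be divided out.\<close>
  then show ?thesis
    using fourier_inversion_0[OF h] h0 by simp
qed

section \<open>The Wodzicki residue of a smoothing operator\<close>

lemma AE_eq_imp_eq_on_open:
  fixes f g :: "'a::euclidean_space \<Rightarrow> 'b::real_normed_vector"
  assumes "open U" "continuous_on U f" "continuous_on U g"
    and ae: "AE x in lborel. x \<in> U \<longrightarrow> f x = g x" and "x \<in> U"
  shows "f x = g x"
proof (rule ccontr)
  assume ne: "f x \<noteq> g x"
  let ?V = "U \<inter> (\<lambda>x. f x - g x) -` (- {0})"
  have V: "open ?V"
    using assms(1-3) by (intro continuous_open_preimage continuous_intros) auto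
  have "x \<in> ?V" using ne \<open>x \<in> U\<close> by simp
  have "AE x in lborel. x \<notin> ?V" using ae by eventually_elim auto
  then have "emeasure lborel ?V = 0"
    using V by (subst (asm) AE_iff_measurable[of ?V]) auto
  then have "?V \<in> null_sets lborel" using V by auto
  then have "negligible ?V"
    by (simp add: negligible_iff_null_sets null_sets_completionI)
  then show False using open_not_negligible[OF V] \<open>x \<in> ?V\<close> by blast
qed

lemma symbol_class_polynomial_bound:
  assumes "a \<in> symbol_class m"
  shows "\<exists>C. \<forall>N\<ge>nat m. \<forall>x \<xi>. norm (a (x, \<xi>)) \<le> C * (1 + norm \<xi>) ^ N"
proof -
  have "\<exists>C. \<forall>x \<xi>. norm (symb_deriv [] [] a (x, \<xi>)) \<le> C * (1 + norm \<xi>) powr (of_int m - real (length ([] :: complex list)))"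
    using assms unfolding symbol_class_def by blast
  then obtain C where C: "\<And>x \<xi>. norm (a (x, \<xi>)) \<le> C * (1 + norm \<xi>) powr of_int m"
    by (auto simp: symb_deriv_def)
  have "0 \<le> C * (1 + norm (0::complex)) powr of_int m" using C[of 0 0] norm_ge_zero order_trans by blast
  then have C0: "0 \<le> C" by simp
  have "norm (a (x, \<xi>)) \<le> C * (1 + norm \<xi>) ^ N" if "N \<ge> nat m" for N x \<xi>
  proof -
    have "(1 + norm \<xi>) powr of_int m \<le> (1 + norm \<xi>) powr real N"
      using that by (intro powr_mono) auto
    also have "\<dots> = (1 + norm \<xi>) ^ N" by (simp add: powr_realpow add_pos_nonneg)
    finally show ?thesis using C[of x \<xi>] mult_left_mono[OF _ C0] order_trans by blast
  qed
  then show ?thesis by blast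
qed

text \<open>Makes the definite description in \<open>symbol_component\<close> meaningful. At a fixed
  \<open>x\<close> the values \<open>Op a u x\<close> for all \<open>u\<close> determine
  \<open>cis (x \<bullet> \<xi>) * a (x, \<xi>)\<close> as a function of \<open>\<xi>\<close>. The
  hypothesis concerns almost every \<open>x\<close> only, with an exceptional set depending on
  \<open>u\<close>; continuity in \<open>x\<close> of the difference removes it.\<close>

lemma Op_eq_imp_symbol_eq:
  assumes a: "a \<in> symbol_class m" and b: "b \<in> symbol_class n"
    and eq: "\<And>u. u \<in> test_functions UNIV \<Longrightarrow> AE x in lborel. Op a u x = Op b u x"
  shows "a = b"
proof -
  have ca: "continuous_on UNIV a" and cb: "continuous_on UNIV b"
    using a b by (auto simp: symbol_class_def intro: smooth_on_continuous)
  obtain C1 where C1: "\<forall>N\<ge>nat m. \<forall>x \<xi>. norm (a (x, \<xi>)) \<le> C1 * (1 + norm \<xi>) ^ N"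
    using symbol_class_polynomial_bound[OF a] by blast
  obtain C2 where C2: "\<forall>N\<ge>nat n. \<forall>x \<xi>. norm (b (x, \<xi>)) \<le> C2 * (1 + norm \<xi>) ^ N"
    using symbol_class_polynomial_bound[OF b] by blast
  define N where "N = max (nat m) (nat n)"
  let ?d = "\<lambda>x \<xi>. cis (x \<bullet> \<xi>) * (a (x, \<xi>) - b (x, \<xi>))"
  have ba: "norm (cis (x \<bullet> \<xi>) * a (x, \<xi>)) \<le> C1 * (1 + norm \<xi>) ^ N"
    and bb: "norm (cis (x \<bullet> \<xi>) * b (x, \<xi>)) \<le> C2 * (1 + norm \<xi>) ^ N" for x \<xi>
    using C1 C2 by (auto simp: N_def norm_mult)
  have bd: "norm (?d x \<xi>) \<le> (C1 + C2) * (1 + norm \<xi>) ^ N" for x \<xi>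
    using norm_triangle_ineq4[of "a (x, \<xi>)" "b (x, \<xi>)"] ba[of x \<xi>] bb[of x \<xi>]
    by (simp add: norm_mult distrib_right)
  have cx: "continuous_on UNIV (\<lambda>\<xi>. f (x, \<xi>))" and cxi: "continuous_on UNIV (\<lambda>x. f (x, \<xi>))"
    if "continuous_on UNIV f" for x \<xi> and f :: symb
    using that by (auto intro!: continuous_on_compose2[OF that] continuous_intros)
  have ccis: "continuous_on UNIV (\<lambda>\<xi>. cis (x \<bullet> \<xi>))" "continuous_on UNIV (\<lambda>x. cis (x \<bullet> \<xi>))" for x \<xi> :: complex
    by (intro continuous_intros)+
  note cont = continuous_intros cx[OF ca] cx[OF cb] cxi[OF ca] cxi[OF cb] ccis
  have dz: "?d x \<xi> = 0" for x \<xi>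
  proof (rule fourier_test_separates[where d="?d x"])
    show "continuous_on UNIV (?d x)" by (intro cont)
    show "norm (?d x \<xi>) \<le> (C1 + C2) * (1 + norm \<xi>) ^ N" for \<xi> by (rule bd)
    fix u assume u: "u \<in> test_functions UNIV"
    have [measurable]: "fourier u \<in> borel_measurable borel" by (rule fourier_measurable[OF u])
    have [measurable]: "(\<lambda>\<xi>. a (x, \<xi>)) \<in> borel_measurable borel" "(\<lambda>\<xi>. b (x, \<xi>)) \<in> borel_measurable borel" for x
      by (intro borel_measurable_continuous_onI cx ca cb)+
    let ?g = "\<lambda>x. \<integral>\<xi>. ?d x \<xi> * fourier u \<xi> \<partial>lborel"
    have "continuous_on UNIV ?g"
      unfolding continuous_on_eq_continuous_within
    proof (intro ballI, unfold continuous_within_sequentially o_def, intro allI impI)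
      fix x :: complex and X :: "nat \<Rightarrow> complex" assume X: "(\<forall>n. X n \<in> UNIV) \<and> X \<longlonglongrightarrow> x"
      show "(\<lambda>n. ?g (X n)) \<longlonglongrightarrow> ?g x"
      proof (rule integral_dominated_convergence[where w="\<lambda>\<xi>. (C1 + C2) * ((1 + norm \<xi>) ^ N * norm (fourier u \<xi>))"])
        show "integrable lborel (\<lambda>\<xi>. (C1 + C2) * ((1 + norm \<xi>) ^ N * norm (fourier u \<xi>)))"
          using integrable_polynomial_times_fourier[OF u] by simp
        show "AE \<xi> in lborel. (\<lambda>n. ?d (X n) \<xi> * fourier u \<xi>) \<longlonglongrightarrow> ?d x \<xi> * fourier u \<xi>"
        proof (intro AE_I2 tendsto_mult tendsto_const)
          fix \<xi>
          show "(\<lambda>n. cis (X n \<bullet> \<xi>)) \<longlonglongrightarrow> cis (x \<bullet> \<xi>)"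
            using continuous_on_tendsto_compose[OF ccis(2) conjunct2[OF X]] by simp
          show "(\<lambda>n. a (X n, \<xi>) - b (X n, \<xi>)) \<longlonglongrightarrow> a (x, \<xi>) - b (x, \<xi>)"
            using continuous_on_tendsto_compose[OF cxi[OF ca] conjunct2[OF X]]
              continuous_on_tendsto_compose[OF cxi[OF cb] conjunct2[OF X]] by (auto intro: tendsto_diff)
        qed
        show "AE \<xi> in lborel. norm (?d (X n) \<xi> * fourier u \<xi>) \<le> (C1 + C2) * ((1 + norm \<xi>) ^ N * norm (fourier u \<xi>))" for n
        proof (rule AE_I2)
          fix \<xi>
          show "norm (?d (X n) \<xi> * fourier u \<xi>) \<le> (C1 + C2) * ((1 + norm \<xi>) ^ N * norm (fourier u \<xi>))"
            using mult_right_mono[OF bd[of "X n" \<xi>] norm_ge_zero[of "fourier u \<xi>"]]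
            by (simp only: norm_mult mult.assoc)
        qed
      qed measurable
    qed
    moreover have "?g x = (2 * pi)\<^sup>2 * (Op a u x - Op b u x)" for x
    proof -
      have "integrable lborel (\<lambda>\<xi>. (cis (x \<bullet> \<xi>) * a (x, \<xi>)) * fourier u \<xi>)"
        by (rule symbol_integrand_integrable[OF _ ba u]) (intro cont)
      moreover have "integrable lborel (\<lambda>\<xi>. (cis (x \<bullet> \<xi>) * b (x, \<xi>)) * fourier u \<xi>)"
        by (rule symbol_integrand_integrable[OF _ bb u]) (intro cont)
      ultimately have "?g x = (\<integral>\<xi>. cis (x \<bullet> \<xi>) * a (x, \<xi>) * fourier u \<xi> \<partial>lborel)
        - (\<integral>\<xi>. cis (x \<bullet> \<xi>) * b (x, \<xi>) * fourier u \<xi> \<partial>lborel)"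
        by (subst Bochner_Integration.integral_diff[symmetric]) (simp_all add: algebra_simps)
      then show ?thesis by (simp add: Op_def divide_simps)
    qed
    then have "AE x in lborel. x \<in> UNIV \<longrightarrow> ?g x = 0"
      using eq[OF u] by simp
    ultimately show "?g x = 0"
      by (intro AE_eq_imp_eq_on_open[OF open_UNIV, of ?g "\<lambda>x. 0"]) auto
  qed
  have "a (x, \<xi>) = b (x, \<xi>)" for x \<xi>
    using dz[of x \<xi>] unfolding mult_eq_0_iff by (auto simp del: cis_zero)
  then show ?thesis by (intro ext) (metis surj_pair)
qed

text \<open>Induction on the distance from the leading degree: once the higher components vanish,
  the next one is bounded by a power one below its own degree of homogeneity, which along a ray is
  possible only for 0.\<close>

lemma classical_expansion_smoothing:
  assumes a: "smoothing_symbol a" and ce: "classical_expansion m a b" and "\<xi> \<noteq> 0"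
  shows "b k (x, \<xi>) = 0"
proof (cases "k > m")
  case True
  then show ?thesis using ce \<open>\<xi> \<noteq> 0\<close> by (simp add: classical_expansion_def)
next
  case False
  have "b (m - int j) (x, \<xi>) = 0" if "\<xi> \<noteq> 0" for j x \<xi>
    using that
  proof (induction j arbitrary: x \<xi> rule: less_induct)
    case (less j)
    let ?s = "of_int m - real (Suc j)"
    have ex: "\<exists>C. \<forall>x \<xi>. norm \<xi> \<ge> 1 \<longrightarrow> norm (a (x, \<xi>) - (\<Sum>j<Suc j. b' (m - int j) (x, \<xi>))) \<le> C * norm \<xi> powr ?s"
      if "classical_expansion m a b'" for b'
    proof -
      have "\<exists>C. \<forall>x \<xi>. norm \<xi> \<ge> 1 \<longrightarrow>
        norm (symb_deriv [] [] (\<lambda>y. a y - (\<Sum>j<Suc j. b' (m - int j) y)) (x, \<xi>)) \<le>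
          C * norm \<xi> powr (of_int m - real (Suc j) - real (length ([] :: complex list)))"
        using that unfolding classical_expansion_def by blast
      then show ?thesis by (simp add: symb_deriv_def)
    qed
    obtain C1 where C1: "\<And>x \<xi>. norm \<xi> \<ge> 1 \<Longrightarrow> norm (a (x, \<xi>) - (\<Sum>j<Suc j. b (m - int j) (x, \<xi>))) \<le> C1 * norm \<xi> powr ?s"
      using ex[OF ce] by blast
    obtain C2 where C2: "\<And>x \<xi>. norm \<xi> \<ge> 1 \<Longrightarrow> norm (a (x, \<xi>)) \<le> C2 * norm \<xi> powr ?s"
      using ex[OF smoothing_symbol_classical[OF a]] by auto
    let ?b = "b (m - int j)"
    have bound: "norm (?b (x, \<eta>)) \<le> (C1 + C2) * norm \<eta> powr ?s" if "norm \<eta> \<ge> 1" for \<eta>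
    proof -
      have "\<eta> \<noteq> 0" using that by auto
      then have "(\<Sum>j<Suc j. b (m - int j) (x, \<eta>)) = ?b (x, \<eta>)"
        using less.IH by simp
      then have "norm (?b (x, \<eta>)) \<le> norm (a (x, \<eta>)) + norm (a (x, \<eta>) - (\<Sum>j<Suc j. b (m - int j) (x, \<eta>)))"
        using norm_triangle_ineq4[of "a (x, \<eta>)" "a (x, \<eta>) - ?b (x, \<eta>)"] by simp
      then show ?thesis using C1[OF that, of x] C2[OF that, of x] by (simp add: algebra_simps)
    qed
    define D where "D = (C1 + C2) * norm \<xi> powr ?s"
    \<comment> \<open>The lower bound on \<open>t\<close> puts \<open>t * \<xi>\<close> into the
      range \<open>norm \<ge> 1\<close> of the estimates. The degree \<open>m - j\<close> exceeds
      the exponent \<open>?s\<close> by one, which leaves a single factor \<open>t\<close>.\<close>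
    have key: "norm (?b (x, \<xi>)) * t \<le> D" if t: "t \<ge> 1 / norm \<xi>" "t > 0" for t
    proof -
      have n: "norm (of_real t * \<xi>) = t * norm \<xi>" using t by (simp add: norm_mult)
      have "norm (of_real t * \<xi>) \<ge> 1" using t less.prems unfolding n by (simp add: field_simps)
      from bound[OF this] have "norm (?b (x, of_real t * \<xi>)) \<le> (C1 + C2) * (t * norm \<xi>) powr ?s"
        unfolding n .
      moreover have "?b (x, of_real t * \<xi>) = of_real (t powi (m - int j)) * ?b (x, \<xi>)"
        using ce less.prems t by (simp add: classical_expansion_def)
      moreover have "t powi (m - int j) = t powr ?s * t"
      proof -
        have "t powi (m - int j) = t powr (of_int (m - int j))" by (intro powr_real_of_int'[symmetric]; use t in simp)
        also have "\<dots> = t powr (?s + 1)" by simp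
        also have "\<dots> = t powr ?s * t" using t by (subst powr_add) simp
        finally show ?thesis .
      qed
      moreover have "(t * norm \<xi>) powr ?s = t powr ?s * norm \<xi> powr ?s"
        using t by (simp add: powr_mult)
      ultimately have "t powr ?s * (norm (?b (x, \<xi>)) * t) \<le> t powr ?s * D"
        using t by (simp add: norm_mult D_def mult_ac)
      then show ?thesis using t by simp
    qed
    show ?case
    proof (rule ccontr)
      assume "?b (x, \<xi>) \<noteq> 0"
      then have p: "norm (?b (x, \<xi>)) > 0" by simp
      define t where "t = max (1 / norm \<xi>) ((\<bar>D\<bar> + 1) / norm (?b (x, \<xi>)))"
      have "t > 0" using less.prems by (simp add: t_def less_max_iff_disj)
      then have "norm (?b (x, \<xi>)) * t \<le> D" by (intro key) (simp_all add: t_def)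
      moreover have "norm (?b (x, \<xi>)) * t \<ge> norm (?b (x, \<xi>)) * ((\<bar>D\<bar> + 1) / norm (?b (x, \<xi>)))"
        by (intro mult_left_mono) (simp_all add: t_def)
      ultimately show False using p by simp
    qed
  qed
  then have "b (m - int (nat (m - k))) (x, \<xi>) = 0" using \<open>\<xi> \<noteq> 0\<close> by blast
  then show ?thesis using False by simp
qed

text \<open>A bump equal to 1 near \<open>x\<close> shows that 0 is a value of the description. For
  uniqueness, an arbitrary competing symbol is compared with the smoothing symbol belonging to the
  same pair of cutoffs.\<close>

lemma symbol_component_smoothing:
  assumes sm: "\<And>\<phi> \<psi>. \<phi> \<in> test_functions (img c) \<Longrightarrow> \<psi> \<in> test_functions (img c) \<Longrightarrow>
      \<exists>a. smoothing_symbol a \<and> local_symbol A P c \<phi> \<psi> a"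
    and c: "open (img c)" "x \<in> img c" and \<xi>: "\<xi> \<noteq> 0"
  shows "symbol_component A P c k x \<xi> = 0"
  unfolding symbol_component_def
proof (rule the_equality)
  obtain h where h: "h \<in> test_functions (img c)" "\<forall>\<^sub>F y in nhds x. h y = 1"
    using ex_test_bump[OF c] by metis
  obtain a where a: "smoothing_symbol a" "local_symbol A P c h h a"
    using sm[OF h(1) h(1)] by blast
  show "\<exists>\<phi>\<in>test_functions (img c). \<exists>\<psi>\<in>test_functions (img c). \<exists>m a b.
     (\<forall>\<^sub>F y in nhds x. \<phi> y = 1 \<and> \<psi> y = 1) \<and> classical_expansion m a b \<and>
     local_symbol A P c \<phi> \<psi> a \<and> 0 = b k (x, \<xi>)"
    using h a smoothing_symbol_classical[OF a(1), of 0]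
    by (intro bexI[OF _ h(1)] exI[of _ 0] exI[of _ a] exI[of _ "\<lambda>k p. 0"]) auto
next
  fix s assume "\<exists>\<phi>\<in>test_functions (img c). \<exists>\<psi>\<in>test_functions (img c). \<exists>m a b.
     (\<forall>\<^sub>F y in nhds x. \<phi> y = 1 \<and> \<psi> y = 1) \<and> classical_expansion m a b \<and>
     local_symbol A P c \<phi> \<psi> a \<and> s = b k (x, \<xi>)"
  then obtain \<phi> \<psi> m a b where *: "\<phi> \<in> test_functions (img c)" "\<psi> \<in> test_functions (img c)"
    "classical_expansion m a b" "local_symbol A P c \<phi> \<psi> a" "s = b k (x, \<xi>)" by blast
  obtain a' where a': "smoothing_symbol a'" "local_symbol A P c \<phi> \<psi> a'"
    using sm[OF *(1,2)] by blast
  have "a = a'"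
  proof (rule Op_eq_imp_symbol_eq)
    show "a \<in> symbol_class m" "a' \<in> symbol_class m"
      using *(3) smoothing_symbol_classical[OF a'(1), of m] by (auto simp: classical_expansion_def)
    fix u assume u: "u \<in> test_functions UNIV"
    show "AE x in lborel. Op a u x = Op a' u x"
      using *(4)[unfolded local_symbol_def, rule_format, OF u] a'(2)[unfolded local_symbol_def, rule_format, OF u]
      by eventually_elim simp
  qed
  then show "s = 0" using classical_expansion_smoothing[OF a'(1) _ \<xi>] * by simp
qed

text \<open>Order 0 selects the branch of \<open>Wres\<close> that is an integral. The partition of
  unity guarantees that the charts over which \<open>density_integral\<close> sums are genuine, so
  the vanishing of symbol components applies in each of them.\<close>

lemma Wres_smoothing:
  assumes lin: "\<And>\<alpha> \<beta> s t. \<alpha> \<in> A01 A \<Longrightarrow> \<beta> \<in> A01 A \<Longrightarrow>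
      ae_eq A (P (\<lambda>p v. s * \<alpha> p v + t * \<beta> p v)) (\<lambda>p v. s * P \<alpha> p v + t * P \<beta> p v)"
    and sm: "\<And>c \<phi> \<psi>. c \<in> charts A \<Longrightarrow> \<phi> \<in> test_functions (img c) \<Longrightarrow> \<psi> \<in> test_functions (img c) \<Longrightarrow>
      \<exists>a. smoothing_symbol a \<and> local_symbol A P c \<phi> \<psi> a"
    and pou: "\<exists>S. partition_of_unity A S"
  shows "Wres A P = 0"
proof -
  have "classical_psido A 0 P"
    unfolding classical_psido_def using lin sm smoothing_symbol_classical by blast
  then have W: "Wres A P = density_integral A
       (\<lambda>c x. LINT \<theta> : {0..2 * pi} | lborel. symbol_component A P c (-2) x (cis \<theta>))"
    unfolding Wres_def by auto
  let ?S = "SOME S. partition_of_unity A S"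
  have S: "partition_of_unity A ?S" using pou by (rule someI_ex)
  have "(LINT x : img c | lborel. of_real (h (param c x)) *
      (LINT \<theta> : {0..2 * pi} | lborel. symbol_component A P c (-2) x (cis \<theta>))) = 0" if "(c, h) \<in> ?S" for c h
  proof -
    have c: "c \<in> charts A" using S that by (auto simp: partition_of_unity_def)
    then have o: "open (img c)" by (simp add: charts_def is_chart_def)
    have "(LINT \<theta> : {0..2 * pi} | lborel. symbol_component A P c (-2) x (cis \<theta>)) = 0" if "x \<in> img c" for x
      using symbol_component_smoothing[OF sm[OF c] o that] by (simp add: set_lebesgue_integral_def)
    then have "(\<lambda>x. indicator (img c) x *\<^sub>R (of_real (h (param c x)) *
        (LINT \<theta> : {0..2 * pi} | lborel. symbol_component A P c (-2) x (cis \<theta>)))) = (\<lambda>x. 0)"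
      by (auto simp: fun_eq_iff indicator_def)
    then show ?thesis by (simp only: set_lebesgue_integral_def[of _ "img c"]) simp
  qed
  then show ?thesis
    unfolding W density_integral_def by (intro sum.neutral) auto
qed

section \<open>Wirtinger derivatives and Weyl's lemma\<close>

text \<open>The positive and the negative part of \<open>f\<close> are densities of two measures
  that agree on boxes; boxes are closed under intersection and generate the Borel sets, so the
  measures and then the densities agree.\<close>

lemma integral_boxes_zero_imp_AE_zero:
  fixes f :: "'a::euclidean_space \<Rightarrow> real"
  assumes f: "integrable lborel f"
    and z: "\<And>a b. (\<integral>x. indicator (box a b) x * f x \<partial>lborel) = 0"
  shows "AE x in lborel. f x = 0"
proof -
  have [measurable]: "f \<in> borel_measurable borel" using f by auto
  let ?p = "\<lambda>x. ennreal (max 0 (f x))" and ?n = "\<lambda>x. ennreal (max 0 (- f x))"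
  have ip: "integrable lborel (\<lambda>x. indicator (box a b) x * max 0 (f x))"
    and im: "integrable lborel (\<lambda>x. indicator (box a b) x * max 0 (- f x))"
    and iff: "integrable lborel (\<lambda>x. indicator (box a b) x * f x)" for a b :: 'a
    by (rule Bochner_Integration.integrable_bound[OF f]; auto split: split_indicator)+
  have e: "emeasure (density lborel ?p) (box a b) = emeasure (density lborel ?n) (box a b)"
    and fin: "emeasure (density lborel ?p) (box a b) \<noteq> \<infinity>" for a b
  proof -
    have 1: "emeasure (density lborel ?p) (box a b) = ennreal (\<integral>x. indicator (box a b) x * max 0 (f x) \<partial>lborel)"
      using ip by (subst emeasure_density, simp, simp, subst nn_integral_eq_integral[symmetric])
        (auto intro!: nn_integral_cong simp: ennreal_mult'' ennreal_indicator mult.commute split: split_indicator)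
    have 2: "emeasure (density lborel ?n) (box a b) = ennreal (\<integral>x. indicator (box a b) x * max 0 (- f x) \<partial>lborel)"
      using im by (subst emeasure_density, simp, simp, subst nn_integral_eq_integral[symmetric])
        (auto intro!: nn_integral_cong simp: ennreal_mult'' ennreal_indicator mult.commute split: split_indicator)
    have "(\<integral>x. indicator (box a b) x * max 0 (f x) \<partial>lborel) - (\<integral>x. indicator (box a b) x * max 0 (- f x) \<partial>lborel)
      = (\<integral>x. indicator (box a b) x * f x \<partial>lborel)"
      by (subst Bochner_Integration.integral_diff[OF ip im, symmetric])
        (auto intro!: Bochner_Integration.integral_cong simp: max_def split: split_indicator)
    then show "emeasure (density lborel ?p) (box a b) = emeasure (density lborel ?n) (box a b)"
      using z 1 2 by simp
    show "emeasure (density lborel ?p) (box a b) \<noteq> \<infinity>" using 1 by simp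
  qed
  have "density lborel ?p = density lborel ?n"
  proof (rule measure_eqI_generator_eq)
    let ?E = "range (\<lambda>(a, b). box a b::'a set)"
    show "Int_stable ?E"
      by (auto simp: Int_stable_def box_Int_box)
    show "?E \<subseteq> Pow UNIV" "sets (density lborel ?p) = sigma_sets UNIV ?E" "sets (density lborel ?n) = sigma_sets UNIV ?E"
      by (simp_all add: borel_eq_box)
    let ?A = "\<lambda>n::nat. box (- (real n *\<^sub>R One)) (real n *\<^sub>R One) :: 'a set"
    show "range ?A \<subseteq> ?E" "(\<Union>i. ?A i) = UNIV"
      unfolding UN_box_eq_UNIV by auto
    show "emeasure (density lborel ?p) (?A i) \<noteq> \<infinity>" for i by (rule fin)
    show "X \<in> ?E \<Longrightarrow> emeasure (density lborel ?p) X = emeasure (density lborel ?n) X" for X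
      using e by auto
  qed
  then have "AE x in lborel. ?p x = ?n x"
    by (intro sigma_finite_measure.density_unique[OF lborel.sigma_finite_measure_axioms]) auto
  then show ?thesis
    by eventually_elim (auto simp: max_def split: if_splits)
qed

lemma box_test_functions:
  fixes a b :: complex
  obtains v where "\<And>n. (\<lambda>x. complex_of_real (v n x)) \<in> test_functions (box a b)"
    "\<And>n x. \<bar>v n x\<bar> \<le> 1" "\<And>x. (\<lambda>n. v n x) \<longlonglongrightarrow> (indicator (box a b) x :: real)"
proof
  \<comment> \<open>Zero for \<open>t \<le> 1 / (n + 1)\<close> and one for
    \<open>t \<ge> 2 / (n + 1)\<close>: the first makes the product vanish outside a box shrunk by
    \<open>1 / (n + 1)\<close>, the second gives pointwise convergence.\<close>
  let ?f = "\<lambda>n t. smooth_step (real (Suc n) * t - 1)"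
  let ?v = "\<lambda>n x. (?f n (Re x - Re a) * ?f n (Re b - Re x)) * (?f n (Im x - Im a) * ?f n (Im b - Im x))"
  have f0: "?f n t = 0" if "t \<le> 1 / real (Suc n)" for n t
    using that by (intro smooth_step_eq_0) (simp add: field_simps del: of_nat_Suc)
  show "(\<lambda>x. complex_of_real (?v n x)) \<in> test_functions (box a b)" for n
  proof (rule test_functionsI)
    let ?d = "1 / real (Suc n)"
    let ?K = "cbox (a + Complex ?d ?d) (b - Complex ?d ?d)"
    have s: "smooth_on UNIV (\<lambda>x. ?f n (L x))" if "smooth_on UNIV L" for L :: "complex \<Rightarrow> real"
      by (rule smooth_on_compose[where T=UNIV, OF _ _ _ smooth_on_smooth_step])
        (auto intro!: smooth_on_diff smooth_on_mult that)
    show "smooth_on UNIV (\<lambda>x. complex_of_real (?v n x))"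
      by (intro smooth_on_of_real smooth_on_mult s open_UNIV smooth_on_diff smooth_on_const
          smooth_on_linear[OF _ bounded_linear_Re] smooth_on_linear[OF _ bounded_linear_Im] smooth_on_id)
    show "compact ?K" by (rule compact_cbox)
    have "?d > 0" by simp
    then show "?K \<subseteq> box a b"
      unfolding subset_box by (auto simp: Basis_complex_def)
    show "complex_of_real (?v n x) = 0" if "x \<notin> ?K" for x
    proof -
      have "Re x - Re a \<le> ?d \<or> Re b - Re x \<le> ?d \<or> Im x - Im a \<le> ?d \<or> Im b - Im x \<le> ?d"
        using that unfolding mem_box Basis_complex_def by (simp add: inner_complex_def del: of_nat_Suc) linarith
      then show ?thesis using f0 by auto
    qed
  qed
  show "\<bar>?v n x\<bar> \<le> 1" for n x
    using smooth_step_range by (simp add: abs_mult mult_le_one)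
  show "(\<lambda>n. ?v n x) \<longlonglongrightarrow> (indicator (box a b) x :: real)" for x
  proof -
    have l: "(\<lambda>n. ?f n t) \<longlonglongrightarrow> (if 0 < t then 1 else 0)" for t
    proof (cases "0 < t")
      case True
      have "\<forall>\<^sub>F n in sequentially. ?f n t = 1"
      proof -
        have "filterlim (\<lambda>n. real (Suc n)) at_top sequentially"
          by (rule filterlim_compose[OF filterlim_real_sequentially filterlim_Suc])
        then have "\<forall>\<^sub>F n in sequentially. real (Suc n) \<ge> 2 / t"
          by (simp only: filterlim_at_top)
        then show ?thesis
          by eventually_elim (use True in \<open>auto intro!: smooth_step_eq_1 simp: field_simps simp del: of_nat_Suc\<close>)
      qed
      then show ?thesis using True by (simp add: tendsto_eventually)
    next
      case False
      then have "?f n t = 0" for n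
        using f0[of t n] by (simp add: order_trans[of t 0])
      then show ?thesis using False by simp
    qed
    have "(\<lambda>n. ?v n x) \<longlonglongrightarrow> ((if 0 < Re x - Re a then 1 else 0) * (if 0 < Re b - Re x then 1 else 0))
      * ((if 0 < Im x - Im a then 1 else 0) * (if 0 < Im b - Im x then 1 else 0))"
      by (intro tendsto_mult l)
    then show ?thesis
      by (auto simp: indicator_def mem_box Basis_complex_def inner_complex_def split: if_splits)
  qed
qed

text \<open>Indicators of boxes are bounded pointwise limits of test functions, so the integral of
  \<open>w\<close> over every box inside \<open>box l u\<close> vanishes. Cutting \<open>w\<close>
  off by the indicator of \<open>box l u\<close> reduces all other boxes to these.\<close>

lemma test_functions_dense_AE:
  fixes w :: "complex \<Rightarrow> complex"
  assumes w: "integrable lborel w"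
    and z: "\<And>v. v \<in> test_functions (box l u) \<Longrightarrow> (\<integral>x. w x * v x \<partial>lborel) = 0"
  shows "AE x in lborel. x \<in> box l u \<longrightarrow> w x = 0"
proof -
  have [measurable]: "w \<in> borel_measurable borel" using w by auto
  have b: "(\<integral>x. w x * indicator (box a b) x \<partial>lborel) = 0" if "box a b \<subseteq> box l u" for a b
  proof -
    obtain v where v: "\<And>n. (\<lambda>x. complex_of_real (v n x)) \<in> test_functions (box a b)"
      "\<And>n x. \<bar>v n x\<bar> \<le> 1" "\<And>x. (\<lambda>n. v n x) \<longlonglongrightarrow> (indicator (box a b) x :: real)"
      by (rule box_test_functions[of a b]) (rule that)
    have [measurable]: "(\<lambda>x. complex_of_real (v n x)) \<in> borel_measurable borel" for n
      by (rule test_functions_measurable[OF v(1)])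
    have "(\<lambda>n. \<integral>x. w x * complex_of_real (v n x) \<partial>lborel) \<longlonglongrightarrow> (\<integral>x. w x * complex_of_real (indicator (box a b) x) \<partial>lborel)"
      by (rule integral_dominated_convergence[where w="\<lambda>x. norm (w x)"])
        (use w v(2,3) in \<open>auto intro!: AE_I2 tendsto_intros mult_left_le simp: norm_mult\<close>)
    moreover have "(\<integral>x. w x * complex_of_real (v n x) \<partial>lborel) = 0" for n
      using z[OF test_functions_mono[OF that v(1)]] .
    ultimately show ?thesis
      using LIMSEQ_unique[OF _ tendsto_const] by (simp add: LIMSEQ_const_iff of_real_indicator)
  qed
  let ?g = "\<lambda>x. w x * indicator (box l u) x"
  have g: "integrable lborel ?g"
    by (rule integrable_mult_bounded[OF w, where C=1]) (auto split: split_indicator)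
  have gb: "(\<integral>x. indicator (box a b) x *\<^sub>R ?g x \<partial>lborel) = 0" for a b
  proof -
    obtain a' b' where ab: "box a b \<inter> box l u = box a' b'"
      unfolding box_Int_box by blast
    then have "indicator (box a b) x *\<^sub>R ?g x = w x * indicator (box a' b') x" for x
      by (auto simp flip: ab split: split_indicator)
    then show ?thesis using b[of a' b'] ab by auto
  qed
  have gbi: "integrable lborel (\<lambda>x. indicator (box a b) x *\<^sub>R ?g x)" for a b
    by (rule integrable_mult_indicator[OF _ g]) simp
  have "AE x in lborel. Re (?g x) = 0"
  proof (rule integral_boxes_zero_imp_AE_zero)
    show "integrable lborel (\<lambda>x. Re (?g x))" using g by (rule integrable_Re)
    show "(\<integral>x. indicator (box a b) x * Re (?g x) \<partial>lborel) = 0" for a b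
      using integral_Re[OF gbi[of a b]] gb[of a b] by simp
  qed
  moreover have "AE x in lborel. Im (?g x) = 0"
  proof (rule integral_boxes_zero_imp_AE_zero)
    show "integrable lborel (\<lambda>x. Im (?g x))" using g by (rule integrable_Im)
    show "(\<integral>x. indicator (box a b) x * Im (?g x) \<partial>lborel) = 0" for a b
      using integral_Im[OF gbi[of a b]] gb[of a b] by simp
  qed
  ultimately show ?thesis
    by eventually_elim (auto simp: complex_eq_iff)
qed

section \<open>Wirtinger calculus and the regularised fundamental solution\<close>

definition ddz :: "(complex \<Rightarrow> complex) \<Rightarrow> complex \<Rightarrow> complex" where
  "ddz f z = (frechet_derivative f (at z) 1 - \<i> * frechet_derivative f (at z) \<i>) / 2"

definition ddzbar :: "(complex \<Rightarrow> complex) \<Rightarrow> complex \<Rightarrow> complex" where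
  "ddzbar f z = (frechet_derivative f (at z) 1 + \<i> * frechet_derivative f (at z) \<i>) / 2"

lemma real_linear_complex_decompose:
  assumes "linear (D :: complex \<Rightarrow> complex)"
  shows "D v = (D 1 - \<i> * D \<i>) / 2 * v + (D 1 + \<i> * D \<i>) / 2 * cnj v"
proof -
  have "D v = D (Re v *\<^sub>R 1 + Im v *\<^sub>R \<i>)"
    by (rule arg_cong[of _ _ D]) (simp add: complex_eq_iff)
  also have "\<dots> = Re v *\<^sub>R D 1 + Im v *\<^sub>R D \<i>"
    using assms by (simp only: linear_add linear_scale)
  also have "\<dots> = (D 1 - \<i> * D \<i>) / 2 * v + (D 1 + \<i> * D \<i>) / 2 * cnj v"
    by (simp add: complex_eq_iff field_simps)
  finally show ?thesis .
qed

lemma has_derivative_ddz_ddzbar: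
  assumes "f differentiable (at z)"
  shows "(f has_derivative (\<lambda>v. ddz f z * v + ddzbar f z * cnj v)) (at z)"
proof -
  have d: "(f has_derivative frechet_derivative f (at z)) (at z)"
    using assms frechet_derivative_works by blast
  have "frechet_derivative f (at z) = (\<lambda>v. ddz f z * v + ddzbar f z * cnj v)"
    unfolding ddz_def ddzbar_def by (rule ext) (rule real_linear_complex_decompose[OF has_derivative_linear[OF d]])
  with d show ?thesis by simp
qed

lemma ddz_ddzbar_eqI:
  assumes "(f has_derivative (\<lambda>v. a * v + b * cnj v)) (at z)"
  shows "ddz f z = a" "ddzbar f z = b"
proof -
  have "frechet_derivative f (at z) = (\<lambda>v. a * v + b * cnj v)"
    using frechet_derivative_at[OF assms] by simp
  then show "ddz f z = a" "ddzbar f z = b"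
    by (simp_all add: ddz_def ddzbar_def algebra_simps)
qed

lemma ddz_mult:
  assumes "f differentiable (at z)" "g differentiable (at z)"
  shows "ddz (\<lambda>z. f z * g z) z = ddz f z * g z + f z * ddz g z"
  by (rule ddz_ddzbar_eqI(1)[where b="ddzbar f z * g z + f z * ddzbar g z"],
      rule has_derivative_eq_rhs[OF has_derivative_mult[OF assms[THEN has_derivative_ddz_ddzbar]]])
    (simp add: fun_eq_iff algebra_simps)

lemma ddz_reflect:
  assumes "f differentiable (at (x - y))"
  shows "ddz (\<lambda>y. f (x - y)) y = - ddz f (x - y)"
proof (rule ddz_ddzbar_eqI(1)[where b="- ddzbar f (x - y)"])
  have "((\<lambda>y. x - y) has_derivative (\<lambda>v. - v)) (at y)"
    by (auto intro!: derivative_eq_intros)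
  from has_derivative_compose[OF this has_derivative_ddz_ddzbar[OF assms]]
  show "((\<lambda>y. f (x - y)) has_derivative (\<lambda>v. - ddz f (x - y) * v + - ddzbar f (x - y) * cnj v)) (at y)"
    by simp
qed

lemma ddz_cnj:
  assumes "f differentiable (at z)"
  shows "ddz (\<lambda>z. cnj (f z)) z = cnj (ddzbar f z)"
proof (rule ddz_ddzbar_eqI(1)[where b="cnj (ddz f z)"])
  show "((\<lambda>z. cnj (f z)) has_derivative (\<lambda>v. cnj (ddzbar f z) * v + cnj (ddz f z) * cnj v)) (at z)"
    using bounded_linear.has_derivative[OF bounded_linear_cnj has_derivative_ddz_ddzbar[OF assms]]
    by (simp add: add.commute)
qed

lemma test_functions_ddz: "f \<in> test_functions V \<Longrightarrow> ddz f \<in> test_functions V"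
  and test_functions_ddzbar: "f \<in> test_functions V \<Longrightarrow> ddzbar f \<in> test_functions V"
proof -
  assume f: "f \<in> test_functions V"
  have "(\<lambda>x. (1 / 2) * (frechet_derivative f (at x) 1 + (s * \<i>) * frechet_derivative f (at x) \<i>)) \<in> test_functions V" for s
    by (intro test_functions_mult_const test_functions_add test_functions_deriv f)
  from this[of "-1"] this[of 1] show "ddz f \<in> test_functions V" "ddzbar f \<in> test_functions V"
    by (simp_all add: ddz_def[abs_def] ddzbar_def[abs_def])
qed

text \<open>A regularisation of the fundamental solution \<open>1/(\<pi> cnj z)\<close> of \<open>\<partial>/\<partial>z\<close>, up to a constant factor.\<close>

definition cauchy_reg :: "real \<Rightarrow> complex \<Rightarrow> complex" where
  "cauchy_reg e z = z / of_real ((norm z)\<^sup>2 + e)"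

lemma cauchy_reg_denom: "e > 0 \<Longrightarrow> (norm z)\<^sup>2 + e \<noteq> 0"
  using zero_le_power2[of "norm z"] by linarith

lemma smooth_on_norm2: "smooth_on S (\<lambda>z::complex. (norm z)\<^sup>2 + e)"
proof -
  have "smooth_on UNIV (\<lambda>z::complex. z \<bullet> z + e)"
    by (intro smooth_on_add smooth_on_inner smooth_on_id smooth_on_const open_UNIV)
  then show ?thesis by (auto simp: dot_square_norm intro: smooth_on_subset)
qed

lemma smooth_on_cauchy_reg: "e > 0 \<Longrightarrow> smooth_on UNIV (cauchy_reg e)"
  unfolding cauchy_reg_def[abs_def]
  by (intro smooth_on_divide smooth_on_id smooth_on_of_real smooth_on_norm2 open_UNIV)
    (use cauchy_reg_denom of_real_eq_0_iff in blast)

lemma ddz_cauchy_reg: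
  assumes "e > 0"
  shows "ddz (cauchy_reg e) z = of_real (e / ((norm z)\<^sup>2 + e)\<^sup>2)"
proof -
  let ?q = "\<lambda>z. z * cnj z + of_real e"
  have q: "cauchy_reg e = (\<lambda>z. z / ?q z)"
    by (simp add: cauchy_reg_def fun_eq_iff flip: complex_norm_square)
  have q': "?q z = of_real ((norm z)\<^sup>2 + e)" by (simp only: of_real_add complex_norm_square)
  then have q0: "?q z \<noteq> 0" using cauchy_reg_denom[OF assms, of z] of_real_eq_0_iff by metis
  have dc: "(cnj has_derivative cnj) (at z)"
    using bounded_linear.has_derivative[OF bounded_linear_cnj has_derivative_ident] .
  have dq: "(?q has_derivative (\<lambda>v. z * cnj v + v * cnj z)) (at z)"
    by (auto intro!: derivative_eq_intros dc simp: algebra_simps)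
  have "((\<lambda>z. z / ?q z) has_derivative (\<lambda>v. - z * (inverse (?q z) * (z * cnj v + v * cnj z) * inverse (?q z)) + v / ?q z)) (at z)"
    by (rule has_derivative_divide[where f="\<lambda>z. z" and g="?q", OF has_derivative_ident dq q0])
  then have "((\<lambda>z. z / ?q z) has_derivative (\<lambda>v. (1 / ?q z - z * cnj z / (?q z)\<^sup>2) * v + (- z\<^sup>2 / (?q z)\<^sup>2) * cnj v)) (at z)"
  proof (rule has_derivative_eq_rhs)
    have "- z * (inverse Q * (z * w' + v * w) * inverse Q) + v / Q
      = (1 / Q - z * w / Q\<^sup>2) * v + (- z\<^sup>2 / Q\<^sup>2) * w'" for Q v w w' :: complex
      by (simp add: divide_inverse power2_eq_square algebra_simps)
    then show "(\<lambda>v. - z * (inverse (?q z) * (z * cnj v + v * cnj z) * inverse (?q z)) + v / ?q z) =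
      (\<lambda>v. (1 / ?q z - z * cnj z / (?q z)\<^sup>2) * v + (- z\<^sup>2 / (?q z)\<^sup>2) * cnj v)" by blast
  qed
  from ddz_ddzbar_eqI(1)[OF this] have "ddz (cauchy_reg e) z = 1 / ?q z - z * cnj z / (?q z)\<^sup>2"
    by (simp only: q)
  also have "\<dots> = of_real e / (?q z)\<^sup>2"
  proof -
    have "1 / Q - w / Q\<^sup>2 = (Q - w) / Q\<^sup>2" if "Q \<noteq> 0" for Q w :: complex
      using that by (simp add: field_simps power2_eq_square)
    from this[OF q0, of "z * cnj z"] show ?thesis by simp
  qed
  finally show ?thesis unfolding q' by simp
qed

text \<open>The total mass of the profile of the approximate identity; in polar coordinates it is
  \<open>pi\<close>.\<close>

definition cauchy_const :: real where
  "cauchy_const = (\<integral>z. inverse ((1 + (norm (z :: complex))\<^sup>2)\<^sup>2) \<partial>lborel)"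

lemma cauchy_const_nonzero: "cauchy_const \<noteq> 0"
proof
  assume "cauchy_const = 0"
  then have "AE z in (lborel :: complex measure). inverse ((1 + (norm z)\<^sup>2)\<^sup>2) = 0"
    using integral_nonneg_eq_0_iff_AE[OF integrable_bracket_inverse(2)] by (simp add: cauchy_const_def)
  moreover have "inverse ((1 + (norm z)\<^sup>2)\<^sup>2) \<noteq> 0" for z :: complex
    using cauchy_reg_denom[of 1 z] by (simp add: add.commute)
  ultimately have "AE z in (lborel :: complex measure). False" by simp
  then show False by (simp add: AE_iff_measurable[of UNIV])
qed

text \<open>The derivative of \<open>cauchy_reg (\<delta>\<^sup>2)\<close> is an approximate identity, up to the factor
  \<open>cauchy_const\<close>.\<close>

lemma cauchy_reg_scaled:
  fixes v h :: "complex \<Rightarrow> complex"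
  assumes "0 < d"
  shows "(\<integral>x. v x * (h (x - y) * ddz (cauchy_reg (d\<^sup>2)) (x - y)) \<partial>lborel)
    = (\<integral>s. v (of_real d * s + y) * h (of_real d * s) * of_real (inverse ((1 + (norm s)\<^sup>2)\<^sup>2)) \<partial>lborel)"
proof -
  have dd: "ddz (cauchy_reg (d\<^sup>2)) z = of_real (d\<^sup>2 / ((norm z)\<^sup>2 + d\<^sup>2)\<^sup>2)" for z
    by (rule ddz_cauchy_reg) (use assms in simp)
  let ?k = "\<lambda>z. v (z + y) * (h z * ddz (cauchy_reg (d\<^sup>2)) z)"
  have "(\<integral>x. v x * (h (x - y) * ddz (cauchy_reg (d\<^sup>2)) (x - y)) \<partial>lborel) = (\<integral>z. ?k z \<partial>lborel)"
    using lborel_integral_translate[of "\<lambda>x. v x * (h (x - y) * ddz (cauchy_reg (d\<^sup>2)) (x - y))" y] by simp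
  also have "\<dots> = of_real (d\<^sup>2) * (\<integral>s. ?k (of_real d * s) \<partial>lborel)"
    using lborel_integral_scale(1)[OF assms, of ?k] assms by simp
  also have "\<dots> = (\<integral>s. of_real (d\<^sup>2) * ?k (of_real d * s) \<partial>lborel)"
    by (rule integral_mult_right_zero[symmetric])
  also have "\<dots> = (\<integral>s. v (of_real d * s + y) * h (of_real d * s) * of_real (inverse ((1 + (norm s)\<^sup>2)\<^sup>2)) \<partial>lborel)"
  proof (intro Bochner_Integration.integral_cong refl)
    fix s :: complex
    have "(norm (of_real d * s))\<^sup>2 + d\<^sup>2 = d\<^sup>2 * (1 + (norm s)\<^sup>2)"
      by (simp add: norm_mult power_mult_distrib algebra_simps)
    then have "d\<^sup>2 * (d\<^sup>2 / ((norm (of_real d * s))\<^sup>2 + d\<^sup>2)\<^sup>2) = inverse ((1 + (norm s)\<^sup>2)\<^sup>2)"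
      using assms by (simp add: power_mult_distrib divide_simps power2_eq_square)
    then have eq: "of_real (d\<^sup>2) * ddz (cauchy_reg (d\<^sup>2)) (of_real d * s) = of_real (inverse ((1 + (norm s)\<^sup>2)\<^sup>2))"
      unfolding dd by (metis of_real_mult)
    have rearrange: "c * (a * (b * z)) = a * b * (c * z)" for a b c z :: complex by (simp add: mult_ac)
    show "of_real (d\<^sup>2) * ?k (of_real d * s)
      = v (of_real d * s + y) * h (of_real d * s) * of_real (inverse ((1 + (norm s)\<^sup>2)\<^sup>2))"
      by (rule trans[OF rearrange]) (simp only: eq)
  qed
  finally show ?thesis .
qed

text \<open>After rescaling, all integrands are dominated by one multiple of the profile. The
  uniform bound is a separate claim because the limit is taken a second time under an integral
  against \<open>w\<close>.\<close>

lemma cauchy_reg_approximate_identity: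
  assumes v: "v \<in> test_functions UNIV" and h: "h \<in> test_functions UNIV"
  defines "A \<equiv> \<lambda>n y. \<integral>x. v x * (h (x - y) * ddz (cauchy_reg ((1 / real (Suc n))\<^sup>2)) (x - y)) \<partial>lborel"
  shows "(\<lambda>n. A n y) \<longlonglongrightarrow> v y * h 0 * of_real cauchy_const"
    and "\<exists>B. \<forall>n y. norm (A n y) \<le> B"
proof -
  obtain B where B: "0 < B" "\<And>x. norm (v x) \<le> B" using test_functions_bounded[OF v] by metis
  obtain C where C: "0 < C" "\<And>x. norm (h x) \<le> C" using test_functions_bounded[OF h] by metis
  have [measurable]: "v \<in> borel_measurable borel" "h \<in> borel_measurable borel"
    using test_functions_measurable v h by auto
  let ?b = "\<lambda>s::complex. inverse ((1 + (norm s)\<^sup>2)\<^sup>2)"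
  have A: "A n y = (\<integral>s. v (of_real (1 / real (Suc n)) * s + y) * h (of_real (1 / real (Suc n)) * s) * of_real (?b s) \<partial>lborel)" for n y
    unfolding A_def by (rule cauchy_reg_scaled) simp
  have bd: "norm (v a * h b * complex_of_real (?b s)) \<le> B * C * ?b s" for a b s
  proof -
    have "norm (v a) * norm (h b) * ?b s \<le> B * C * ?b s"
      using B C by (intro mult_mono) auto
    then show ?thesis by (simp only: norm_mult norm_of_real) (simp add: abs_of_nonneg)
  qed
  have i: "integrable lborel (\<lambda>s. B * C * ?b s)" using integrable_bracket_inverse(2) by simp
  have cv: "isCont v z" "isCont h z" for z
    using test_functions_continuous[OF v] test_functions_continuous[OF h] continuous_on_eq_continuous_at by blast+
  have "(\<lambda>n. A n y) \<longlonglongrightarrow> (\<integral>s. v y * h 0 * of_real (?b s) \<partial>lborel)"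
    unfolding A
  proof (rule integral_dominated_convergence[where w="\<lambda>s. B * C * ?b s"])
    have "(\<lambda>n. of_real (1 / real (Suc n)) * s + y) \<longlonglongrightarrow> y" for s
      using tendsto_add[OF scaled_tendsto[of s] tendsto_const[of y]] by (simp only: add_0)
    then show "AE s in lborel. (\<lambda>n. v (of_real (1 / real (Suc n)) * s + y) * h (of_real (1 / real (Suc n)) * s) * complex_of_real (?b s))
      \<longlonglongrightarrow> v y * h 0 * complex_of_real (?b s)"
      by (intro AE_I2 tendsto_mult tendsto_const isCont_tendsto_compose[OF cv(1)] isCont_tendsto_compose[OF cv(2)] scaled_tendsto)
  qed (use i bd in auto)
  also have "(\<integral>s. v y * h 0 * complex_of_real (?b s) \<partial>lborel) = v y * h 0 * of_real cauchy_const"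
    unfolding cauchy_const_def by (subst integral_mult_right_zero, subst integral_complex_of_real) (rule refl)
  finally show "(\<lambda>n. A n y) \<longlonglongrightarrow> v y * h 0 * of_real cauchy_const" .
  have "norm (A n y) \<le> (\<integral>s. B * C * ?b s \<partial>lborel)" for n y
  proof -
    have "norm (A n y) \<le> (\<integral>s. norm (v (of_real (1 / real (Suc n)) * s + y) * h (of_real (1 / real (Suc n)) * s) * complex_of_real (?b s)) \<partial>lborel)"
      unfolding A by (rule integral_norm_bound)
    also have "\<dots> \<le> (\<integral>s. B * C * ?b s \<partial>lborel)"
    proof (rule integral_mono)
      show "integrable lborel (\<lambda>s. norm (v (of_real (1 / real (Suc n)) * s + y) * h (of_real (1 / real (Suc n)) * s) * complex_of_real (?b s)))"
        by (rule Bochner_Integration.integrable_bound[OF i]) (use bd in \<open>auto intro!: AE_I2 order_trans[OF _ abs_ge_self]\<close>)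
    qed (use i bd in auto)
    finally show ?thesis .
  qed
  then show "\<exists>B. \<forall>n y. norm (A n y) \<le> B" by blast
qed

lemma smooth_on_ddz:
  assumes "smooth_on UNIV f" shows "smooth_on UNIV (ddz f)"
proof -
  have "smooth_on UNIV (\<lambda>z. (1 / 2) * (frechet_derivative f (at z) 1 - \<i> * frechet_derivative f (at z) \<i>))"
    by (intro smooth_on_mult smooth_on_diff smooth_on_deriv assms smooth_on_const open_UNIV)
  then show ?thesis by (simp add: ddz_def[abs_def])
qed

lemma test_functions_reflect_into:
  assumes "u \<in> test_functions V" "(\<lambda>y. x - y) ` V \<subseteq> W"
  shows "(\<lambda>y. u (x - y)) \<in> test_functions W"
proof -
  obtain K where K: "compact K" "K \<subseteq> V" "\<And>x. x \<notin> K \<Longrightarrow> u x = 0" "smooth_on UNIV u"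
    using assms(1) test_functionsE by metis
  show ?thesis
  proof (rule test_functionsI[of _ "(\<lambda>y. x - y) ` K"])
    show "smooth_on UNIV (\<lambda>y. u (x - y))"
      by (rule smooth_on_compose[OF _ _ _ K(4)]) (auto intro!: smooth_on_diff)
    show "compact ((\<lambda>y. x - y) ` K)"
      by (intro compact_continuous_image continuous_intros K)
    show "u (x - y) = 0" if "y \<notin> (\<lambda>y. x - y) ` K" for y
    proof (rule K(3), rule notI)
      assume "x - y \<in> K"
      then have "x - (x - y) \<in> (\<lambda>y. x - y) ` K" by blast
      with that show False by simp
    qed
  qed (use K assms in auto)
qed

text \<open>Local reproducing kernels for weak solutions of \<open>\<partial>w/\<partial>z = 0\<close> (Weyl's lemma): the kernel
  depends on the scale only.\<close>

definition reproducing_kernel :: "real \<Rightarrow> (complex \<Rightarrow> complex) \<Rightarrow> bool" where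
  "reproducing_kernel r k \<longleftrightarrow> k \<in> test_functions (ball 0 r) \<and>
    (\<forall>U w x0. cball x0 (2 * r) \<subseteq> U \<and> set_integrable lborel (cball x0 (2 * r)) w \<and>
      (\<forall>f\<in>test_functions U. (\<integral>y. w y * ddz f y \<partial>lborel) = 0) \<longrightarrow>
      (\<exists>V. open V \<and> x0 \<in> V \<and> V \<subseteq> ball x0 r \<and>
        (AE x in lborel. x \<in> V \<longrightarrow> w x = (\<integral>y. w y * k (x - y) \<partial>lborel))))"

text \<open>Let \<open>E = 1 / cnj z\<close> and let \<open>h\<close> be a bump equal to 1 near 0.
  Then \<open>h * E\<close> is a local parametrix: its \<open>z\<close> derivative is a multiple of
  the point mass at 0 plus \<open>ddz h * E\<close>, and this error is smooth because
  \<open>ddz h\<close> vanishes near 0. Convolving a weak solution with the whole derivative gives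
  0, hence the solution is a multiple of its convolution with the error. The singular
  \<open>E\<close> is replaced by \<open>cauchy_reg\<close> until the limit is taken, so that only
  test functions are paired with \<open>w\<close>.\<close>

lemma ex_reproducing_kernel:
  assumes r: "0 < r"
  shows "\<exists>k. reproducing_kernel r k"
proof -
  obtain \<psi> :: "complex \<Rightarrow> real" where \<psi>: "smooth_on UNIV \<psi>" "\<And>z. 0 \<le> \<psi> z" "\<And>z. \<psi> z \<le> 1"
    "\<And>z. z \<in> cball 0 (r / 3) \<Longrightarrow> \<psi> z = 1" "\<And>z. z \<notin> ball 0 (r / 2) \<Longrightarrow> \<psi> z = 0"
    by (rule ex_bump[of "r / 3" "r / 2" 0]) (use r in simp, use r in simp, rule that)
  define h where "h = (\<lambda>z. complex_of_real (\<psi> z))"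
  have h: "h \<in> test_functions (ball 0 r)"
    by (rule test_functionsI[of _ "cball 0 (r / 2)"])
      (use \<psi>(1,5) r in \<open>auto simp: h_def intro!: smooth_on_of_real\<close>)
  have hU: "h \<in> test_functions UNIV" using h test_functions_mono by blast
  have h0: "h 0 = 1" using \<psi>(4)[of 0] r by (simp add: h_def)
  \<comment> \<open>The origin is removed because \<open>inverse (cnj z)\<close> is smooth only away
    from it; \<open>ddz h\<close> is supported in an annulus.\<close>
  let ?V = "ball 0 r - {0::complex}"
  have dh: "ddz h \<in> test_functions ?V"
  proof (rule test_functionsI[of _ "cball 0 (r / 2) - ball 0 (r / 3)"])
    show "smooth_on UNIV (ddz h)" by (rule smooth_on_ddz[OF test_functions_smooth[OF h]])
    show "compact (cball 0 (r / 2) - ball (0::complex) (r / 3))" by (intro compact_diff) auto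
    fix z :: complex assume z: "z \<notin> cball 0 (r / 2) - ball 0 (r / 3)"
    have "(h has_derivative (\<lambda>v. 0 * v + 0 * cnj v)) (at z)"
    proof (cases "z \<in> ball 0 (r / 3)")
      case True
      show ?thesis
        by (rule has_derivative_transform_within_open[of "\<lambda>z. 1" _ _ _ "ball 0 (r / 3)"])
          (use True \<psi>(4) in \<open>auto simp: h_def\<close>)
    next
      case False
      show ?thesis
        by (rule has_derivative_transform_within_open[of "\<lambda>z. 0" _ _ _ "- cball 0 (r / 2)"])
          (use False z \<psi>(5) in \<open>auto simp: h_def\<close>)
    qed
    then show "ddz h z = 0" by (rule ddz_ddzbar_eqI(1))
  qed (use r in auto)
  define k0 where "k0 = (\<lambda>z. ddz h z * inverse (cnj z))"
  have k0V: "k0 \<in> test_functions ?V"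
    unfolding k0_def
    by (rule test_functions_mult_smooth[OF dh])
      (auto intro!: open_delete smooth_on_inverse smooth_on_cnj smooth_on_id)
  then have k0: "k0 \<in> test_functions (ball 0 r)" and k0U: "k0 \<in> test_functions UNIV"
    using test_functions_mono[OF _ k0V] by auto
  have [measurable]: "k0 \<in> borel_measurable borel" by (rule test_functions_measurable[OF k0])
  obtain B where B: "0 < B" "\<And>z. norm (k0 z) \<le> B" using test_functions_bounded[OF k0] by metis
  define k where "k = (\<lambda>z. - inverse (of_real cauchy_const) * k0 z)"
  have k: "k \<in> test_functions (ball 0 r)"
    unfolding k_def by (rule test_functions_mult_const[OF k0])
  have "\<exists>V. open V \<and> x0 \<in> V \<and> V \<subseteq> ball x0 r \<and> (AE x in lborel. x \<in> V \<longrightarrow> w x = (\<integral>y. w y * k (x - y) \<partial>lborel))"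
    if U: "cball x0 (2 * r) \<subseteq> U" and w: "set_integrable lborel (cball x0 (2 * r)) w"
      and weak: "\<And>f. f \<in> test_functions U \<Longrightarrow> (\<integral>y. w y * ddz f y \<partial>lborel) = 0" for U w x0
  proof -
    \<comment> \<open>Truncation makes \<open>w\<close> integrable over the plane. For
      \<open>x\<close> in \<open>ball x0 r\<close> a kernel supported in \<open>ball 0 r\<close>
      sees only the part of \<open>w\<close> inside \<open>cball x0 (2 * r)\<close>, which explains
      the factor 2.\<close>
    define w1 where "w1 = (\<lambda>y. indicator (cball x0 (2 * r)) y *\<^sub>R w y)"
    have w1: "integrable lborel w1" using w by (simp add: w1_def set_integrable_def)
    then have w1m[measurable]: "w1 \<in> borel_measurable borel" by auto
    have sub: "x - y \<in> cball x0 (2 * r)" if "x \<in> ball x0 r" "y \<in> ball 0 r" for x y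
    proof -
      have "dist x0 (x - y) \<le> dist x0 x + norm y"
        by (metis dist_triangle dist_norm add.commute diff_add_cancel norm_minus_commute add_diff_cancel_left' diff_diff_eq2)
      then show ?thesis using that by simp
    qed
    have ww1: "w y * g (x - y) = w1 y * g (x - y)" if "x \<in> ball x0 r" "g \<in> test_functions (ball 0 r)" for x y g
    proof (cases "x - y \<in> ball 0 r")
      case True
      then show ?thesis using sub[OF that(1) True] by (simp add: w1_def)
    qed (simp add: test_functions_outside[OF that(2)])
    let ?e = "\<lambda>n. (1 / real (Suc n))\<^sup>2"
    let ?E = "\<lambda>n. cauchy_reg (?e n)"
    have e: "?e n > 0" for n by simp
    let ?a = "\<lambda>n z. ddz h z * ?E n z" and ?b = "\<lambda>n z. h z * ddz (?E n) z"
    have a: "?a n \<in> test_functions (ball 0 r)" for n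
      using test_functions_mult_smooth[OF test_functions_ddz[OF h] _ smooth_on_subset[OF smooth_on_cauchy_reg[OF e]]] by blast
    have b: "?b n \<in> test_functions (ball 0 r)" for n
      using test_functions_mult_smooth[OF h _ smooth_on_subset[OF smooth_on_ddz[OF smooth_on_cauchy_reg[OF e]]]] by blast
    have [measurable]: "?a n \<in> borel_measurable borel" "?b n \<in> borel_measurable borel" for n
      by (rule test_functions_measurable[OF a], rule test_functions_measurable[OF b])
    have iw: "integrable lborel (\<lambda>y. w1 y * g (x - y))" if g: "g \<in> test_functions (ball 0 r)" for x g
    proof -
      obtain C where "\<And>z. norm (g z) \<le> C" using test_functions_bounded[OF g] by metis
      moreover have [measurable]: "g \<in> borel_measurable borel" by (rule test_functions_measurable[OF g])
      ultimately show ?thesis by (intro integrable_mult_bounded(1)[OF w1, where C=C]) auto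
    qed
    \<comment> \<open>The weak equation tested against the reflected and translated regularised
      parametrix; the product rule yields the error term \<open>?a\<close> and the approximate
      identity \<open>?b\<close>.\<close>
    have eq1: "(\<integral>y. w1 y * ?a n (x - y) \<partial>lborel) = - (\<integral>y. w1 y * ?b n (x - y) \<partial>lborel)" if x: "x \<in> ball x0 r" for n x
    proof -
      have neg_sum: "a = - b" if "0 = - (a + b)" for a b :: complex
        using that by algebra
      let ?f = "\<lambda>z. h z * ?E n z"
      have f: "?f \<in> test_functions (ball 0 r)"
        using test_functions_mult_smooth[OF h _ smooth_on_subset[OF smooth_on_cauchy_reg[OF e]]] by blast
      have df: "?f differentiable (at z)" for z
        using smooth_on_differentiable[OF test_functions_smooth[OF f]] by blast
      have "(\<lambda>y. x - y) ` ball 0 r \<subseteq> U" using sub[OF x] U by auto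
      then have "(\<lambda>y. ?f (x - y)) \<in> test_functions U"
        by (rule test_functions_reflect_into[OF f])
      then have "0 = (\<integral>y. w y * ddz (\<lambda>y. ?f (x - y)) y \<partial>lborel)" using weak by simp
      also have "\<dots> = (\<integral>y. - (w1 y * ?a n (x - y) + w1 y * ?b n (x - y)) \<partial>lborel)"
      proof (intro Bochner_Integration.integral_cong refl)
        fix y
        have "ddz (\<lambda>y. ?f (x - y)) y = - ddz ?f (x - y)" by (rule ddz_reflect[OF df])
        also have "ddz ?f (x - y) = ?a n (x - y) + ?b n (x - y)"
          by (rule ddz_mult[OF smooth_on_differentiable[OF test_functions_smooth[OF h, of UNIV] UNIV_I]
                smooth_on_differentiable[OF smooth_on_cauchy_reg[OF e] UNIV_I]])
        finally show "w y * ddz (\<lambda>y. ?f (x - y)) y = - (w1 y * ?a n (x - y) + w1 y * ?b n (x - y))"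
          using ww1[OF x a, of y n] ww1[OF x b, of y n] by (simp only: distrib_left mult_minus_right)
      qed
      also have "\<dots> = - ((\<integral>y. w1 y * ?a n (x - y) \<partial>lborel) + (\<integral>y. w1 y * ?b n (x - y) \<partial>lborel))"
        by (subst Bochner_Integration.integral_minus, subst Bochner_Integration.integral_add[OF iw[OF a] iw[OF b]]) (rule refl)
      finally show ?thesis by (rule neg_sum)
    qed
    let ?F = "\<lambda>x. \<integral>y. w1 y * k0 (x - y) \<partial>lborel" and ?Fn = "\<lambda>n x. \<integral>y. w1 y * ?a n (x - y) \<partial>lborel"
    have Fc: "continuous_on S ?F" for S
      using smooth_on_continuous[OF smooth_on_convolution[OF w1 k0U]] continuous_on_subset by blast
    have Fnc: "continuous_on S (?Fn n)" for S n
      using smooth_on_continuous[OF smooth_on_convolution[OF w1 test_functions_mono[OF subset_UNIV a]]] continuous_on_subset by blast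
    have Fm[measurable]: "?F \<in> borel_measurable borel" and Fnm[measurable]: "?Fn n \<in> borel_measurable borel" for n
      by (rule borel_measurable_continuous_onI[OF Fc], rule borel_measurable_continuous_onI[OF Fnc])
    \<comment> \<open>Regularisation only decreases \<open>1 / norm z\<close>, so every
      \<open>?a n\<close> is dominated by its limit \<open>k0\<close>.\<close>
    have ab: "norm (?a n z) \<le> norm (k0 z)" for n z
    proof (cases "z = 0")
      case True
      then show ?thesis by (simp add: cauchy_reg_def)
    next
      case False
      then have z: "(norm z)\<^sup>2 > 0" by simp
      have "norm (?E n z) = norm z / ((norm z)\<^sup>2 + ?e n)"
        using e[of n] by (simp only: cauchy_reg_def norm_divide norm_of_real) (simp add: abs_of_nonneg)
      also have "\<dots> \<le> norm z / (norm z)\<^sup>2"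
        by (intro divide_left_mono mult_pos_pos add_pos_pos z e) simp_all
      also have "\<dots> = norm (inverse (cnj z))" using False by (simp add: norm_divide norm_inverse power2_eq_square field_simps)
      finally show ?thesis by (simp add: k0_def norm_mult mult_left_mono)
    qed
    have el: "(\<lambda>n. ?e n) \<longlonglongrightarrow> 0"
    proof -
      have "(\<lambda>n. ?e n) \<longlonglongrightarrow> 0\<^sup>2" by (intro tendsto_power LIMSEQ_Suc lim_1_over_n)
      then show ?thesis unfolding zero_power2 .
    qed
    have al: "(\<lambda>n. ?a n z) \<longlonglongrightarrow> k0 z" for z
    proof (cases "z = 0")
      case True
      then show ?thesis by (simp add: cauchy_reg_def k0_def)
    next
      case False
      then have "(\<lambda>n. z / of_real ((norm z)\<^sup>2 + ?e n)) \<longlonglongrightarrow> z / of_real ((norm z)\<^sup>2 + 0)"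
        by (intro tendsto_intros el) (simp_all del: of_nat_Suc)
      also have "z / of_real ((norm z)\<^sup>2 + 0) = inverse (cnj z)"
        using False unfolding add_0_right complex_norm_square by (simp add: field_simps)
      finally show ?thesis unfolding k0_def cauchy_reg_def by (intro tendsto_mult tendsto_const)
    qed
    have Fn: "(\<lambda>n. ?Fn n x) \<longlonglongrightarrow> ?F x" for x
    proof (rule integral_dominated_convergence[where w="\<lambda>y. B * norm (w1 y)"])
      show "AE y in lborel. (\<lambda>n. w1 y * ?a n (x - y)) \<longlonglongrightarrow> w1 y * k0 (x - y)"
        by (intro AE_I2 tendsto_mult tendsto_const al)
      have "norm (w1 y * ?a n (x - y)) \<le> B * norm (w1 y)" for n y
      proof -
        have "norm (w1 y) * norm (?a n (x - y)) \<le> norm (w1 y) * B"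
          by (intro mult_left_mono order_trans[OF ab B(2)]) auto
        then show ?thesis by (simp only: norm_mult mult.commute)
      qed
      then show "AE y in lborel. norm (w1 y * ?a n (x - y)) \<le> B * norm (w1 y)" for n by simp
      show "(\<lambda>y. w1 y * ?a n (x - y)) \<in> borel_measurable lborel" for n
        using iw[OF a] by (rule borel_measurable_integrable)
    qed (use w1 in auto)
    have Fb: "norm (?Fn n x) \<le> B * (\<integral>y. norm (w1 y) \<partial>lborel)" for n x
    proof -
      have "norm (?Fn n x) \<le> (\<integral>y. norm (w1 y * ?a n (x - y)) \<partial>lborel)" by (rule integral_norm_bound)
      also have "\<dots> \<le> (\<integral>y. B * norm (w1 y) \<partial>lborel)"
      proof (rule integral_mono)
        show "integrable lborel (\<lambda>y. norm (w1 y * ?a n (x - y)))" using iw[OF a] by (rule integrable_norm)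
        show "integrable lborel (\<lambda>y. B * norm (w1 y))" using w1 by simp
        show "norm (w1 y * ?a n (x - y)) \<le> B * norm (w1 y)" for y
        proof -
          have "norm (w1 y) * norm (?a n (x - y)) \<le> norm (w1 y) * B"
            by (intro mult_left_mono order_trans[OF ab B(2)]) auto
          then show ?thesis by (simp only: norm_mult mult.commute)
        qed
      qed
      finally show ?thesis by simp
    qed
    \<comment> \<open>The convolutions of \<open>w1\<close> with \<open>?b n\<close> are understood
      only after pairing with a test function \<open>v\<close>: Fubini moves the approximate
      identity from the merely integrable \<open>w1\<close> onto \<open>v\<close>, where its limit
      is known.\<close>
    have key: "(\<integral>x. v x * ?F x \<partial>lborel) = - (of_real cauchy_const * (\<integral>y. w1 y * v y \<partial>lborel))" if v: "v \<in> test_functions (ball x0 r)" for v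
    proof -
      have vU: "v \<in> test_functions UNIV" using v test_functions_mono by blast
      have vm[measurable]: "v \<in> borel_measurable borel" by (rule test_functions_measurable[OF v])
      have vi: "integrable lborel v" by (rule test_functions_integrable[OF v])
      let ?A = "\<lambda>n y. \<integral>x. v x * ?b n (x - y) \<partial>lborel"
      have "(\<lambda>n. \<integral>x. v x * ?Fn n x \<partial>lborel) \<longlonglongrightarrow> (\<integral>x. v x * ?F x \<partial>lborel)"
      proof (rule integral_dominated_convergence[where w="\<lambda>x. (B * (\<integral>y. norm (w1 y) \<partial>lborel)) * norm (v x)"])
        show "AE x in lborel. (\<lambda>n. v x * ?Fn n x) \<longlonglongrightarrow> v x * ?F x"
          by (intro AE_I2 tendsto_mult tendsto_const Fn)
        have "norm (v x * ?Fn n x) \<le> (B * (\<integral>y. norm (w1 y) \<partial>lborel)) * norm (v x)" for n x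
          using mult_right_mono[OF Fb[where n=n and x=x] norm_ge_zero[of "v x"]] by (simp only: norm_mult mult.commute)
        then show "AE x in lborel. norm (v x * ?Fn n x) \<le> (B * (\<integral>y. norm (w1 y) \<partial>lborel)) * norm (v x)" for n by simp
        show "(\<lambda>x. v x * ?Fn n x) \<in> borel_measurable lborel" for n
          unfolding measurable_lborel2 by (rule borel_measurable_times[OF vm Fnm])
      qed (use vi in auto)
      moreover have "(\<integral>x. v x * ?Fn n x \<partial>lborel) = - (\<integral>y. w1 y * ?A n y \<partial>lborel)" for n
      proof -
        obtain C where C: "0 < C" "\<And>z. norm (?b n z) \<le> C" using test_functions_bounded[OF b] by metis
        have "(\<integral>x. v x * ?Fn n x \<partial>lborel) = (\<integral>x. - (\<integral>y. v x * (w1 y * ?b n (x - y)) \<partial>lborel) \<partial>lborel)"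
        proof (intro Bochner_Integration.integral_cong refl)
          fix x
          show "v x * ?Fn n x = - (\<integral>y. v x * (w1 y * ?b n (x - y)) \<partial>lborel)"
          proof (cases "x \<in> ball x0 r")
            case True
            show ?thesis unfolding eq1[OF True] by (simp only: integral_mult_right_zero mult_minus_right)
          qed (simp add: test_functions_outside[OF v])
        qed
        also have "\<dots> = - (\<integral>x. (\<integral>y. v x * (w1 y * ?b n (x - y)) \<partial>lborel) \<partial>lborel)"
          by (rule Bochner_Integration.integral_minus)
        also have "(\<integral>x. (\<integral>y. v x * (w1 y * ?b n (x - y)) \<partial>lborel) \<partial>lborel)
          = (\<integral>y. (\<integral>x. v x * (w1 y * ?b n (x - y)) \<partial>lborel) \<partial>lborel)"
        proof (rule lborel_Fubini_dominated[symmetric, where p="\<lambda>x. C * norm (v x)" and q="\<lambda>y. norm (w1 y)"])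
          show "norm (v x * (w1 y * ?b n (x - y))) \<le> C * norm (v x) * norm (w1 y)" for x y
          proof -
            have "norm (v x) * norm (w1 y) * norm (?b n (x - y)) \<le> norm (v x) * norm (w1 y) * C"
              by (intro mult_left_mono C) auto
            then show ?thesis by (simp only: norm_mult mult_ac)
          qed
          have "(\<lambda>p. v (fst p) * (w1 (snd p) * ?b n (fst p - snd p))) \<in> borel_measurable (borel \<Otimes>\<^sub>M borel)"
            by (intro borel_measurable_times measurable_compose[OF _ \<open>?b n \<in> borel_measurable borel\<close>]) measurable
          then show "(\<lambda>(x, y). v x * (w1 y * ?b n (x - y))) \<in> borel_measurable (borel \<Otimes>\<^sub>M borel)"
            by (simp add: split_beta)
        qed (use vi w1 in auto)
        also have "\<dots> = (\<integral>y. w1 y * ?A n y \<partial>lborel)"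
        proof (intro Bochner_Integration.integral_cong refl)
          fix y
          have "(\<integral>x. v x * (w1 y * ?b n (x - y)) \<partial>lborel) = (\<integral>x. w1 y * (v x * ?b n (x - y)) \<partial>lborel)"
            by (simp only: mult_ac)
          then show "(\<integral>x. v x * (w1 y * ?b n (x - y)) \<partial>lborel) = w1 y * ?A n y"
            by (simp only: integral_mult_right_zero)
        qed
        finally show ?thesis .
      qed
      moreover have "(\<lambda>n. \<integral>y. w1 y * ?A n y \<partial>lborel) \<longlonglongrightarrow> (\<integral>y. w1 y * (v y * h 0 * of_real cauchy_const) \<partial>lborel)"
      proof -
        obtain D where D: "\<And>n y. norm (?A n y) \<le> D"
          using cauchy_reg_approximate_identity(2)[OF vU hU] by blast
        have Am[measurable]: "(\<lambda>y. ?A n y) \<in> borel_measurable borel" for n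
        proof -
          have "(\<lambda>p. v (snd p) * ?b n (snd p - fst p)) \<in> borel_measurable (borel \<Otimes>\<^sub>M lborel)"
            by (intro borel_measurable_times measurable_compose[OF _ \<open>?b n \<in> borel_measurable borel\<close>]) measurable
          then show ?thesis
            by (intro lborel.borel_measurable_lebesgue_integral) (simp add: split_beta)
        qed
        show ?thesis
        proof (rule integral_dominated_convergence[where w="\<lambda>y. D * norm (w1 y)"])
          show "AE y in lborel. (\<lambda>n. w1 y * ?A n y) \<longlonglongrightarrow> w1 y * (v y * h 0 * of_real cauchy_const)"
            by (intro AE_I2 tendsto_mult tendsto_const cauchy_reg_approximate_identity(1)[OF vU hU])
          have "norm (w1 y * ?A n y) \<le> D * norm (w1 y)" for n y
            using mult_right_mono[OF D[where n=n and y=y] norm_ge_zero[of "w1 y"]] by (simp only: norm_mult mult.commute)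
          then show "AE y in lborel. norm (w1 y * ?A n y) \<le> D * norm (w1 y)" for n by simp
          show "(\<lambda>y. w1 y * ?A n y) \<in> borel_measurable lborel" for n
            unfolding measurable_lborel2 by (rule borel_measurable_times[OF w1m Am])
        next
          have "(\<lambda>y. w1 y * (v y * h 0 * of_real cauchy_const)) \<in> borel_measurable borel" by measurable
          then show "(\<lambda>y. w1 y * (v y * h 0 * of_real cauchy_const)) \<in> borel_measurable lborel" by simp
          show "integrable lborel (\<lambda>y. D * norm (w1 y))" using w1 by simp
        qed
      qed
      then have "(\<lambda>n. - (\<integral>y. w1 y * ?A n y \<partial>lborel)) \<longlonglongrightarrow> - (\<integral>y. w1 y * (v y * h 0 * of_real cauchy_const) \<partial>lborel)"
        by (rule tendsto_minus)
      ultimately have "(\<integral>x. v x * ?F x \<partial>lborel) = - (\<integral>y. w1 y * (v y * h 0 * of_real cauchy_const) \<partial>lborel)"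
        using LIMSEQ_unique by simp
      also have "(\<integral>y. w1 y * (v y * h 0 * of_real cauchy_const) \<partial>lborel) = (\<integral>y. of_real cauchy_const * (w1 y * v y) \<partial>lborel)"
        by (simp add: h0 mult_ac)
      also have "\<dots> = of_real cauchy_const * (\<integral>y. w1 y * v y \<partial>lborel)" by (rule integral_mult_right_zero)
      finally show ?thesis .
    qed
    \<comment> \<open>The neighbourhood \<open>V\<close> is taken to be a box, the kind of set on
      which vanishing pairings with test functions give vanishing almost everywhere.\<close>
    obtain l u where lu: "box l u \<subseteq> ball x0 r" "x0 \<in> box l u"
      by (rule open_contains_box[OF open_ball, of x0 x0 r]) (use r in simp, rule that)
    let ?g = "\<lambda>x. indicator (cball x0 r) x *\<^sub>R ?F x + of_real cauchy_const * w1 x"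
    have Fi: "integrable lborel (\<lambda>x. indicator (cball x0 r) x *\<^sub>R ?F x)"
      using borel_integrable_compact[OF compact_cball Fc, of x0 r] by (simp add: indicator_scaleR_eq_if if_distrib cong: if_cong)
    have "AE x in lborel. x \<in> box l u \<longrightarrow> ?g x = 0"
    proof (rule test_functions_dense_AE)
      show "integrable lborel ?g" using Fi w1 by simp
      fix v assume v: "v \<in> test_functions (box l u)"
      then have v': "v \<in> test_functions (ball x0 r)" using lu test_functions_mono by blast
      obtain C where C: "\<And>z. norm (v z) \<le> C" using test_functions_bounded[OF v] by metis
      have [measurable]: "v \<in> borel_measurable borel" by (rule test_functions_measurable[OF v])
      have "(\<integral>x. ?g x * v x \<partial>lborel) = (\<integral>x. (indicator (cball x0 r) x *\<^sub>R ?F x) * v x + of_real cauchy_const * (w1 x * v x) \<partial>lborel)"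
        by (simp only: distrib_right mult.assoc)
      also have "\<dots> = (\<integral>x. (indicator (cball x0 r) x *\<^sub>R ?F x) * v x \<partial>lborel) + (\<integral>x. of_real cauchy_const * (w1 x * v x) \<partial>lborel)"
        by (intro Bochner_Integration.integral_add integrable_mult_right integrable_mult_bounded(1)[OF Fi, where C=C]
            integrable_mult_bounded(1)[OF w1, where C=C]) (use C in auto)
      also have "(\<integral>x. (indicator (cball x0 r) x *\<^sub>R ?F x) * v x \<partial>lborel) = (\<integral>x. v x * ?F x \<partial>lborel)"
      proof (intro Bochner_Integration.integral_cong refl)
        show "(indicator (cball x0 r) x *\<^sub>R ?F x) * v x = v x * ?F x" for x
          using test_functions_outside[OF v', of x] by (cases "x \<in> ball x0 r") (auto simp: indicator_def)
      qed
      also have "(\<integral>x. of_real cauchy_const * (w1 x * v x) \<partial>lborel) = of_real cauchy_const * (\<integral>x. w1 x * v x \<partial>lborel)"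
        by (rule integral_mult_right_zero)
      finally show "(\<integral>x. ?g x * v x \<partial>lborel) = 0" by (simp add: key[OF v'])
    qed
    then have "AE x in lborel. x \<in> box l u \<longrightarrow> w x = (\<integral>y. w y * k (x - y) \<partial>lborel)"
    proof eventually_elim
      case (elim x)
      show ?case
      proof
        assume x: "x \<in> box l u"
        then have xb: "x \<in> ball x0 r" using lu by blast
        have w1x: "w1 x = w x" using xb r by (auto simp: w1_def indicator_def)
        have ind: "(indicator (cball x0 r) x :: real) = 1" using xb by simp
        have F0: "?F x + of_real cauchy_const * w x = 0"
          using elim[rule_format, OF x] unfolding w1x ind by simp
        have "b = - inverse c * a" if "a + c * b = 0" "c \<noteq> 0" for a b c :: complex
          using that by (simp add: field_simps add_eq_0_iff)
        from this[OF F0] have "w x = - inverse (of_real cauchy_const) * ?F x"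
          using cauchy_const_nonzero by simp
        also have "\<dots> = (\<integral>y. - inverse (of_real cauchy_const) * (w1 y * k0 (x - y)) \<partial>lborel)"
          by (rule integral_mult_right_zero[symmetric])
        also have "\<dots> = (\<integral>y. w y * k (x - y) \<partial>lborel)"
        proof (intro Bochner_Integration.integral_cong refl)
          fix y
          have "- c * (a * b) = a * (- c * b)" for a b c :: complex by simp
          from this[of "inverse (of_real cauchy_const)" "w1 y" "k0 (x - y)"]
          show "- inverse (of_real cauchy_const) * (w1 y * k0 (x - y)) = w y * k (x - y)"
            unfolding ww1[OF xb k] unfolding k_def .
        qed
        finally show "w x = (\<integral>y. w y * k (x - y) \<partial>lborel)" .
      qed
    qed
    with lu show ?thesis by (intro exI[of _ "box l u"] conjI open_box)
  qed
  with k have "reproducing_kernel r k"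
    unfolding reproducing_kernel_def by auto
  then show ?thesis by blast
qed

section \<open>Holomorphic change of variables\<close>

text \<open>Change of variables with Jacobian determinants lives on \<open>real ^ 2\<close>; this
  pair of measure preserving linear isomorphisms carries integrals there and back.\<close>

definition of_vec2 :: "real ^ 2 \<Rightarrow> complex" where
  "of_vec2 v = Complex (v $ 1) (v $ 2)"

definition to_vec2 :: "complex \<Rightarrow> real ^ 2" where
  "to_vec2 z = vector [Re z, Im z]"

lemma of_to_vec2 [simp]: "of_vec2 (to_vec2 z) = z"
  by (simp add: of_vec2_def to_vec2_def)

lemma to_of_vec2 [simp]: "to_vec2 (of_vec2 v) = v"
  by (simp add: of_vec2_def to_vec2_def vec_eq_iff forall_2)

lemma bounded_linear_of_vec2: "bounded_linear of_vec2"
  by (intro linear_conv_bounded_linear[THEN iffD1] linearI) (simp_all add: of_vec2_def complex_eq_iff)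

lemma bounded_linear_to_vec2: "bounded_linear to_vec2"
  by (intro linear_conv_bounded_linear[THEN iffD1] linearI) (simp_all add: to_vec2_def vec_eq_iff forall_2)

lemma of_vec2_measurable [measurable]: "of_vec2 \<in> borel_measurable borel"
  and to_vec2_measurable [measurable]: "to_vec2 \<in> borel_measurable borel"
  by (intro borel_measurable_continuous_onI linear_continuous_on bounded_linear_of_vec2 bounded_linear_to_vec2)+

lemma lborel_distr_of_vec2: "distr lborel borel of_vec2 = lborel"
proof (rule lborel_eqI[symmetric])
  fix l u :: complex assume le: "\<And>b. b \<in> Basis \<Longrightarrow> l \<bullet> b \<le> u \<bullet> b"
  have B: "(Basis :: (real ^ 2) set) = {axis 1 1, axis 2 1}"
    by (auto simp: Basis_vec_def UNIV_2)
  have ne: "axis 1 1 \<noteq> (axis 2 1 :: real ^ 2)" by (simp add: axis_eq_axis)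
  have "of_vec2 -` box l u \<inter> space lborel = box (to_vec2 l) (to_vec2 u)"
    by (auto simp: mem_box B Basis_complex_def inner_axis of_vec2_def to_vec2_def inner_axis')
  then show "emeasure (distr lborel borel of_vec2) (box l u) = ennreal (\<Prod>b\<in>Basis. (u - l) \<bullet> b)"
    using le[of 1] le[of \<i>] ne
    by (subst emeasure_distr)
      (auto simp: emeasure_lborel_box_eq B Basis_complex_def inner_axis to_vec2_def)
qed simp

lemma of_vec2_integrable:
  fixes f :: "complex \<Rightarrow> 'b::euclidean_space"
  assumes [measurable]: "f \<in> borel_measurable borel"
  shows "integrable lborel (\<lambda>v. f (of_vec2 v)) \<longleftrightarrow> integrable lborel f"
    and "(\<integral>v. f (of_vec2 v) \<partial>lborel) = (\<integral>z. f z \<partial>lborel)"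
  using integrable_distr_eq[of of_vec2 lborel borel f] integral_distr[of of_vec2 lborel borel f]
  by (simp_all add: lborel_distr_of_vec2)

lemma det_complex_mult:
  "det (matrix (\<lambda>v. to_vec2 (a * of_vec2 v))) = (norm a)\<^sup>2"
  unfolding cmod_power2
  by (simp add: det_2 matrix_def to_vec2_def of_vec2_def axis_def power2_eq_square)

text \<open>Borel measurability of the cut-off integrand is what lets integrals over the completed
  measure be read over \<open>lborel\<close>.\<close>

lemma set_integrable_lebesgue_iff_lborel:
  fixes f :: "'a::euclidean_space \<Rightarrow> 'b::euclidean_space"
  assumes "(\<lambda>x. indicator S x *\<^sub>R f x) \<in> borel_measurable borel"
  shows "f absolutely_integrable_on S \<longleftrightarrow> set_integrable lborel S f"
    and "set_integrable lborel S f \<Longrightarrow> integral S f = (LINT x:S|lborel. f x)"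
proof -
  show i: "f absolutely_integrable_on S \<longleftrightarrow> set_integrable lborel S f"
    unfolding set_integrable_def using assms by (simp add: integrable_completion)
  assume "set_integrable lborel S f"
  then have "integral S f = (LINT x:S|lebesgue. f x)"
    using i set_lebesgue_integral_eq_integral(2)[of S f] by simp
  then show "integral S f = (LINT x:S|lborel. f x)"
    unfolding set_lebesgue_integral_def using assms by (simp add: integral_completion)
qed

lemma holomorphic_change_of_variables:
  fixes f :: "complex \<Rightarrow> complex"
  assumes S: "open S" and \<phi>: "\<phi> holomorphic_on S" "inj_on \<phi> S"
    and f: "set_borel_measurable lborel (\<phi> ` S) f"
  shows "set_integrable lborel S (\<lambda>x. f (\<phi> x) * of_real ((norm (deriv \<phi> x))\<^sup>2)) \<longleftrightarrow> set_integrable lborel (\<phi> ` S) f"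
    and "(LINT x:S|lborel. f (\<phi> x) * of_real ((norm (deriv \<phi> x))\<^sup>2)) = (LINT x:\<phi> ` S|lborel. f x)"
    and "set_borel_measurable lborel S (\<lambda>x. f (\<phi> x) * of_real ((norm (deriv \<phi> x))\<^sup>2))"
proof -
  have T: "open (\<phi> ` S)" by (rule open_mapping_thm3[OF \<phi>(1) S \<phi>(2)])
  define F where "F = (\<lambda>x. indicator (\<phi> ` S) x *\<^sub>R f x)"
  have F[measurable]: "F \<in> borel_measurable borel" using f by (simp add: F_def set_borel_measurable_def)
  define G where "G = (\<lambda>x. indicator S x *\<^sub>R (f (\<phi> x) * of_real ((norm (deriv \<phi> x))\<^sup>2)))"
  have G[measurable]: "G \<in> borel_measurable borel"
  proof -
    have [measurable]: "(\<lambda>x. if x \<in> S then \<phi> x else 0) \<in> borel_measurable borel"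
      using S holomorphic_on_imp_continuous_on[OF \<phi>(1)] by (intro borel_measurable_continuous_on_if) auto
    have [measurable]: "(\<lambda>x. if x \<in> S then deriv \<phi> x else 0) \<in> borel_measurable borel"
      using S holomorphic_on_imp_continuous_on[OF holomorphic_deriv[OF \<phi>(1) S]]
      by (intro borel_measurable_continuous_on_if) auto
    \<comment> \<open>Extending both the map and its derivative by 0 presents \<open>G\<close> as a
      composition of Borel functions; nothing is known about \<open>f\<close> outside the
      image.\<close>
    have "G = (\<lambda>x. F (if x \<in> S then \<phi> x else 0) * of_real ((norm (if x \<in> S then deriv \<phi> x else 0))\<^sup>2))"
      by (auto simp: G_def F_def fun_eq_iff)
    then show ?thesis by simp
  qed
  then show "set_borel_measurable lborel S (\<lambda>x. f (\<phi> x) * of_real ((norm (deriv \<phi> x))\<^sup>2))"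
    by (simp add: set_borel_measurable_def G_def)
  let ?S = "to_vec2 ` S"
  let ?g = "\<lambda>v. to_vec2 (\<phi> (of_vec2 v))" and ?g' = "\<lambda>v h. to_vec2 (deriv \<phi> (of_vec2 v) * of_vec2 h)"
  \<comment> \<open>The values are moved to \<open>real ^ 2\<close> as well, the format of the
    change of variables theorem.\<close>
  let ?f = "\<lambda>v. to_vec2 (f (of_vec2 v))"
  have gS: "?g ` ?S = to_vec2 ` (\<phi> ` S)" by (simp add: image_image)
  have vS: "v \<in> to_vec2 ` R \<longleftrightarrow> of_vec2 v \<in> R" for v R
    by (metis image_iff of_to_vec2 to_of_vec2)
  have oS: "open ?S"
  proof -
    have "?S = of_vec2 -` S" using vS by auto
    then show ?thesis
      using S continuous_open_vimage[OF S, of of_vec2] bounded_linear_of_vec2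
      by (metis linear_continuous_at)
  qed
  have der: "(?g has_derivative ?g' v) (at v within ?S)" if "v \<in> ?S" for v
  proof -
    have "(\<phi> has_derivative (*) (deriv \<phi> (of_vec2 v))) (at (of_vec2 v))"
      using holomorphic_derivI[OF \<phi>(1) S] that unfolding vS by (simp add: has_field_derivative_def)
    from has_derivative_compose[OF bounded_linear_imp_has_derivative[OF bounded_linear_of_vec2] this]
    have "((\<lambda>v. \<phi> (of_vec2 v)) has_derivative (\<lambda>h. deriv \<phi> (of_vec2 v) * of_vec2 h)) (at v within ?S)" .
    from bounded_linear.has_derivative[OF bounded_linear_to_vec2 this] show ?thesis .
  qed
  have inj: "inj_on ?g ?S"
    using \<phi>(2) by (auto simp: inj_on_def) (metis of_to_vec2)
  have det: "\<bar>det (matrix (?g' v))\<bar> = (norm (deriv \<phi> (of_vec2 v)))\<^sup>2" for v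
    by (simp add: det_complex_mult)
  have "?S \<in> sets lebesgue" using oS by simp
  note cv = has_absolute_integral_change_of_variables[OF this der inj, where f="?f"]
  let ?L = "\<lambda>v. \<bar>det (matrix (?g' v))\<bar> *\<^sub>R ?f (?g v)"
  have mult_of_real: "z * of_real t = t *\<^sub>R z" for z :: complex and t
    by (simp add: scaleR_conv_of_real mult.commute)
  have eL: "(\<lambda>v. indicator ?S v *\<^sub>R ?L v) = (\<lambda>v. to_vec2 (G (of_vec2 v)))"
  proof
    fix v
    have "indicator ?S v = (indicator S (of_vec2 v) :: real)" using vS by (auto simp: indicator_def)
    then show "indicator ?S v *\<^sub>R ?L v = to_vec2 (G (of_vec2 v))"
      unfolding det G_def mult_of_real
      by (simp only: of_to_vec2 linear_scale[OF bounded_linear.linear[OF bounded_linear_to_vec2]])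
  qed
  have eR: "(\<lambda>v. indicator (?g ` ?S) v *\<^sub>R ?f v) = (\<lambda>v. to_vec2 (F (of_vec2 v)))"
  proof
    fix v
    have "indicator (?g ` ?S) v = (indicator (\<phi> ` S) (of_vec2 v) :: real)"
      unfolding gS using vS[of v "\<phi> ` S"] by (simp add: indicator_def)
    then show "indicator (?g ` ?S) v *\<^sub>R ?f v = to_vec2 (F (of_vec2 v))"
      by (simp add: F_def linear_scale[OF bounded_linear.linear[OF bounded_linear_to_vec2]])
  qed
  have mL: "(\<lambda>v. indicator ?S v *\<^sub>R ?L v) \<in> borel_measurable borel" unfolding eL by measurable
  have mR: "(\<lambda>v. indicator (?g ` ?S) v *\<^sub>R ?f v) \<in> borel_measurable borel" unfolding eR by measurable
  have vec_int: "integrable lborel (\<lambda>v. to_vec2 (H (of_vec2 v))) \<longleftrightarrow> integrable lborel H"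
    "(\<integral>v. to_vec2 (H (of_vec2 v)) \<partial>lborel) = to_vec2 (\<integral>z. H z \<partial>lborel)"
    if [measurable]: "H \<in> borel_measurable borel" for H :: "complex \<Rightarrow> complex"
  proof -
    have 1: "integrable lborel (\<lambda>v. to_vec2 (H (of_vec2 v))) \<longleftrightarrow> integrable lborel (\<lambda>z. to_vec2 (H z))"
      by (rule of_vec2_integrable(1)) simp
    have 2: "integrable lborel (\<lambda>z. to_vec2 (H z)) \<longleftrightarrow> integrable lborel H"
      using integrable_bounded_linear[OF bounded_linear_to_vec2, of lborel H]
        integrable_bounded_linear[OF bounded_linear_of_vec2, of lborel "\<lambda>z. to_vec2 (H z)"] by auto
    show i: "integrable lborel (\<lambda>v. to_vec2 (H (of_vec2 v))) \<longleftrightarrow> integrable lborel H" using 1 2 by simp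
    have "(\<integral>v. to_vec2 (H (of_vec2 v)) \<partial>lborel) = (\<integral>z. to_vec2 (H z) \<partial>lborel)"
      by (rule of_vec2_integrable(2)) simp
    also have "\<dots> = to_vec2 (\<integral>z. H z \<partial>lborel)"
    proof (cases "integrable lborel H")
      case True then show ?thesis by (rule integral_bounded_linear[OF bounded_linear_to_vec2])
    next
      case False
      then show ?thesis using 2
        by (simp add: not_integrable_integral_eq linear_0[OF bounded_linear.linear[OF bounded_linear_to_vec2]])
    qed
    finally show "(\<integral>v. to_vec2 (H (of_vec2 v)) \<partial>lborel) = to_vec2 (\<integral>z. H z \<partial>lborel)" .
  qed
  have "?L absolutely_integrable_on ?S \<longleftrightarrow> ?f absolutely_integrable_on (?g ` ?S)" using cv by blast
  then have "set_integrable lborel ?S ?L \<longleftrightarrow> set_integrable lborel (?g ` ?S) ?f"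
    using set_integrable_lebesgue_iff_lborel(1)[OF mL] set_integrable_lebesgue_iff_lborel(1)[OF mR] by simp
  then have iGF: "integrable lborel G \<longleftrightarrow> integrable lborel F"
    unfolding set_integrable_def eL eR using vec_int(1)[OF G] vec_int(1)[OF F] by simp
  then show "set_integrable lborel S (\<lambda>x. f (\<phi> x) * of_real ((norm (deriv \<phi> x))\<^sup>2)) \<longleftrightarrow> set_integrable lborel (\<phi> ` S) f"
    by (simp add: set_integrable_def G_def F_def)
  have "(\<integral>x. G x \<partial>lborel) = (\<integral>x. F x \<partial>lborel)"
  proof (cases "integrable lborel F")
    case True
    then have iL: "set_integrable lborel ?S ?L" and iR: "set_integrable lborel (?g ` ?S) ?f"
      unfolding set_integrable_def eL eR using vec_int(1)[OF G] vec_int(1)[OF F] iGF by simp_all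
    have "integral ?S ?L = integral (?g ` ?S) ?f"
      using cv set_integrable_lebesgue_iff_lborel(1)[OF mL] iL by blast
    then have "(LINT x:?S|lborel. ?L x) = (LINT x:?g ` ?S|lborel. ?f x)"
      using set_integrable_lebesgue_iff_lborel(2)[OF mL iL] set_integrable_lebesgue_iff_lborel(2)[OF mR iR] by simp
    then have "to_vec2 (\<integral>x. G x \<partial>lborel) = to_vec2 (\<integral>x. F x \<partial>lborel)"
      unfolding set_lebesgue_integral_def eL eR using vec_int(2)[OF G] vec_int(2)[OF F] by simp
    then show ?thesis by (metis of_to_vec2)
  next
    case False
    then show ?thesis using iGF by (simp add: not_integrable_integral_eq)
  qed
  then show "(LINT x:S|lborel. f (\<phi> x) * of_real ((norm (deriv \<phi> x))\<^sup>2)) = (LINT x:\<phi> ` S|lborel. f x)"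
    by (simp add: set_lebesgue_integral_def G_def F_def)
qed

section \<open>Compact complex curves\<close>

definition overlap :: "'a chart \<Rightarrow> 'a chart \<Rightarrow> complex set" where
  "overlap c d = coord c ` (dom c \<inter> dom d)"

abbreviation transition :: "'a chart \<Rightarrow> 'a chart \<Rightarrow> complex \<Rightarrow> complex" where
  "transition c d \<equiv> coord d \<circ> param c"

lemma is_chart_param:
  assumes "is_chart c"
  shows "x \<in> img c \<Longrightarrow> param c x \<in> dom c" "x \<in> img c \<Longrightarrow> coord c (param c x) = x"
    "p \<in> dom c \<Longrightarrow> param c (coord c p) = p" "p \<in> dom c \<Longrightarrow> coord c p \<in> img c"
proof -
  have h: "homeomorphism (dom c) (img c) (coord c) (param c)" using assms by (simp add: is_chart_def)
  show "x \<in> img c \<Longrightarrow> param c x \<in> dom c" "x \<in> img c \<Longrightarrow> coord c (param c x) = x"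
    "p \<in> dom c \<Longrightarrow> param c (coord c p) = p" "p \<in> dom c \<Longrightarrow> coord c p \<in> img c"
    using h by (auto simp: homeomorphism_def)
qed

lemma mem_overlap: "is_chart c \<Longrightarrow> x \<in> overlap c d \<longleftrightarrow> x \<in> img c \<and> param c x \<in> dom d"
  unfolding overlap_def img_def using is_chart_param[of c] by (auto simp: img_def)

lemma overlap_subset: "overlap c d \<subseteq> img c"
  by (auto simp: overlap_def img_def)

lemma open_image_coord:
  assumes "is_chart c" "open V" "V \<subseteq> dom c"
  shows "open (coord c ` V)"
proof -
  have "openin (top_of_set (img c)) (coord c ` V)"
    using assms by (intro homeomorphism_imp_open_map[where S="dom c" and g="param c"])
      (auto simp: is_chart_def openin_open_eq)
  then show ?thesis using assms(1) openin_open_trans by (auto simp: is_chart_def)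
qed

lemma open_overlap: "is_chart c \<Longrightarrow> is_chart d \<Longrightarrow> open (overlap c d)"
  unfolding overlap_def by (intro open_image_coord) (auto simp: is_chart_def)

lemma transition_image: "is_chart c \<Longrightarrow> is_chart d \<Longrightarrow> transition c d ` overlap c d = overlap d c"
proof -
  assume c: "is_chart c" "is_chart d"
  have "transition c d ` overlap c d = coord d ` (\<lambda>p. param c (coord c p)) ` (dom c \<inter> dom d)"
    by (simp add: overlap_def image_image)
  also have "(\<lambda>p. param c (coord c p)) ` (dom c \<inter> dom d) = dom c \<inter> dom d"
    using is_chart_param(3)[OF c(1)] by force
  finally show ?thesis by (simp add: overlap_def Int_commute)
qed

lemma transition_mem: "is_chart c \<Longrightarrow> is_chart d \<Longrightarrow> x \<in> overlap c d \<Longrightarrow> transition c d x \<in> overlap d c"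
  using transition_image[of c d] by (metis imageI)

lemma inj_on_transition: "is_chart c \<Longrightarrow> is_chart d \<Longrightarrow> inj_on (transition c d) (overlap c d)"
  by (rule inj_on_inverseI[of _ "transition d c"]) (auto simp: mem_overlap is_chart_param)

lemma param_continuous: "is_chart c \<Longrightarrow> continuous_on (img c) (param c)"
  by (simp add: is_chart_def homeomorphism_def)

locale compact_curve =
  fixes A :: "'a::{t2_space, second_countable_topology} chart set"
  assumes atlas: "complex_atlas A" and compact_UNIV: "compact (UNIV :: 'a set)"
begin

lemma charts_is_chart: "c \<in> charts A \<Longrightarrow> is_chart c"
  by (simp add: charts_def)

lemmas chart_param = is_chart_param[OF charts_is_chart]

lemma charts_open: "c \<in> charts A \<Longrightarrow> open (dom c)" "c \<in> charts A \<Longrightarrow> open (img c)"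
  by (auto simp: charts_def is_chart_def)

lemma atlas_subset_charts: "c \<in> A \<Longrightarrow> c \<in> charts A"
  using atlas by (auto simp: complex_atlas_def charts_def)

lemma chart_at: "chart_at A p \<in> A" "p \<in> dom (chart_at A p)" "chart_at A p \<in> charts A"
proof -
  have "\<exists>c. c \<in> A \<and> p \<in> dom c" using atlas UNIV_I[of p] unfolding complex_atlas_def by blast
  then have "chart_at A p \<in> A \<and> p \<in> dom (chart_at A p)" unfolding chart_at_def by (rule someI_ex)
  then show "chart_at A p \<in> A" "p \<in> dom (chart_at A p)" "chart_at A p \<in> charts A"
    using atlas_subset_charts by auto
qed

text \<open>Members of \<open>charts A\<close> are assumed compatible with \<open>A\<close> only.
  Near each point the transition between two of them factors through a chart of \<open>A\<close>
  around that point.\<close>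

lemma transition_holomorphic:
  assumes c: "c \<in> charts A" and d: "d \<in> charts A"
  shows "transition c d holomorphic_on overlap c d"
proof -
  have cc: "is_chart c" "is_chart d" using c d charts_is_chart by auto
  have "transition c d field_differentiable (at x)" if x: "x \<in> overlap c d" for x
  proof -
    define a where "a = chart_at A (param c x)"
    have a: "a \<in> A" "param c x \<in> dom a" "is_chart a" using chart_at charts_is_chart by (auto simp: a_def)
    let ?W = "coord c ` (dom c \<inter> dom d \<inter> dom a)"
    have W: "open ?W"
      using cc a by (intro open_image_coord) (auto simp: is_chart_def)
    have xW: "x \<in> ?W" using x a cc(1) by (auto simp: mem_overlap is_chart_param intro!: image_eqI[of _ _ "param c x"])
    have h1: "transition c a holomorphic_on overlap c a"
      using c a by (auto simp: charts_def compatible_def overlap_def)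
    have h2: "transition a d holomorphic_on overlap a d"
      using d a by (auto simp: charts_def compatible_def overlap_def Int_commute)
    have "?W \<subseteq> overlap c a" by (auto simp: overlap_def)
    moreover have "transition c a ` ?W \<subseteq> overlap a d"
      using cc a by (auto simp: overlap_def is_chart_param)
    ultimately have "(transition a d \<circ> transition c a) holomorphic_on ?W"
      using h1 h2 by (intro holomorphic_on_compose_gen[of _ _ _ "overlap a d"]) (auto intro: holomorphic_on_subset)
    moreover have "(transition a d \<circ> transition c a) y = transition c d y" if "y \<in> ?W" for y
      using that cc a by (auto simp: is_chart_param)
    ultimately have "transition c d holomorphic_on ?W"
      using holomorphic_cong by blast
    then show ?thesis using W xW holomorphic_on_imp_differentiable_at by blast
  qed
  then show ?thesis
    by (auto simp: holomorphic_on_def field_differentiable_at_within)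
qed

lemma deriv_transition_chain:
  assumes c: "c \<in> charts A" and d: "d \<in> charts A" and e: "e \<in> charts A"
    and x: "x \<in> overlap c d" "x \<in> overlap c e"
  shows "deriv (transition c e) x = deriv (transition d e) (transition c d x) * deriv (transition c d) x"
proof -
  note cc = c[THEN charts_is_chart] d[THEN charts_is_chart] e[THEN charts_is_chart]
  have y: "transition c d x \<in> overlap d e"
    using x cc by (auto simp: mem_overlap is_chart_param)
  have "(transition c d has_field_derivative deriv (transition c d) x) (at x)"
    using holomorphic_derivI[OF transition_holomorphic[OF c d] open_overlap x(1)] cc by blast
  moreover have "(transition d e has_field_derivative deriv (transition d e) (transition c d x)) (at (transition c d x))"
    using holomorphic_derivI[OF transition_holomorphic[OF d e] open_overlap y] cc by blast
  ultimately have "((transition d e \<circ> transition c d) has_field_derivative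
      deriv (transition d e) (transition c d x) * deriv (transition c d) x) (at x)"
    by (rule DERIV_chain[rotated])
  then have "(transition c e has_field_derivative
      deriv (transition d e) (transition c d x) * deriv (transition c d) x) (at x)"
  proof (rule has_field_derivative_transform_within_open)
    show "open (overlap c d)" "x \<in> overlap c d" by (rule open_overlap[OF cc(1,2)], rule x(1))
    show "(transition d e \<circ> transition c d) z = transition c e z" if "z \<in> overlap c d" for z
      using that cc by (auto simp: mem_overlap is_chart_param)
  qed
  then show ?thesis by (rule DERIV_imp_deriv)
qed

lemma deriv_transition_self:
  assumes c: "c \<in> charts A" and x: "x \<in> img c"
  shows "deriv (transition c c) x = 1"
proof -
  have "((\<lambda>z. z) has_field_derivative 1) (at x)" by (rule DERIV_ident)
  then have "(transition c c has_field_derivative 1) (at x)"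
    by (rule has_field_derivative_transform_within_open[OF _ charts_open(2)[OF c] x])
      (use c chart_param in auto)
  then show ?thesis by (rule DERIV_imp_deriv)
qed

lemma deriv_transition_inverse:
  assumes c: "c \<in> charts A" and d: "d \<in> charts A" and x: "x \<in> overlap c d"
  shows "deriv (transition d c) (transition c d x) * deriv (transition c d) x = 1"
proof -
  have "x \<in> overlap c c" "x \<in> img c" using x mem_overlap[OF charts_is_chart[OF c]] chart_param(1)[OF c] by auto
  then show ?thesis
    using deriv_transition_chain[OF c d c x] deriv_transition_self[OF c] by simp
qed

text \<open>The coordinate vector 1 of the chart \<open>c\<close>, read in the preferred chart of
  the base point. As the preferred chart may jump from point to point, regularity in
  \<open>x\<close> is sought for chart coefficients and not for \<open>frame\<close>.\<close>

definition frame :: "'a chart \<Rightarrow> complex \<Rightarrow> complex" where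
  "frame c x = deriv (transition c (chart_at A (param c x))) x"

lemma overlap_chart_at: "c \<in> charts A \<Longrightarrow> x \<in> img c \<Longrightarrow> x \<in> overlap c (chart_at A (param c x))"
  by (simp add: mem_overlap charts_is_chart chart_at)

lemma vec_of_chart_frame: "vec_of_chart A c x v = frame c x * v"
  by (simp add: vec_of_chart_def frame_def)

lemma frame_transition:
  assumes c: "c \<in> charts A" and d: "d \<in> charts A" and x: "x \<in> overlap c d"
  shows "frame c x = frame d (transition c d x) * deriv (transition c d) x"
proof -
  have x': "x \<in> img c" using x overlap_subset by blast
  have "param d (transition c d x) = param c x"
    using x c d by (auto simp: mem_overlap charts_is_chart chart_param)
  then show ?thesis
    unfolding frame_def using deriv_transition_chain[OF c d chart_at(3) x overlap_chart_at[OF c x']] by simp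
qed

lemma frame_nonzero:
  assumes c: "c \<in> charts A" and x: "x \<in> img c"
  shows "frame c x \<noteq> 0"
  unfolding frame_def
  using deriv_transition_inverse[OF c chart_at(3) overlap_chart_at[OF c x]] by auto

lemma vec_in_chart_frame:
  assumes c: "c \<in> charts A" and x: "x \<in> img c"
  shows "vec_in_chart A c (param c x) (frame c x * v) = v"
proof -
  let ?a = "chart_at A (param c x)"
  have "coord ?a (param c x) = transition c ?a x" by simp
  then have "vec_in_chart A c (param c x) (frame c x * v) =
      (deriv (transition ?a c) (transition c ?a x) * deriv (transition c ?a) x) * v"
    unfolding vec_in_chart_def frame_def by simp
  then show ?thesis
    using deriv_transition_inverse[OF c chart_at(3) overlap_chart_at[OF c x]] by simp
qed

lemma coeff01_eq: "coeff01 A c \<omega> x = \<omega> (param c x) (frame c x)"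
  by (simp add: coeff01_def vec_of_chart_frame)

text \<open>Conjugate linearity of a (0,1)-covector pulls the derivative of the transition out as
  its conjugate.\<close>

lemma coeff01_transition:
  assumes c: "c \<in> charts A" and d: "d \<in> charts A" and x: "x \<in> overlap c d" and t: "\<And>p. type01 (\<omega> p)"
  shows "coeff01 A c \<omega> x = coeff01 A d \<omega> (transition c d x) * cnj (deriv (transition c d) x)"
proof -
  obtain w where w: "\<And>v. \<omega> (param c x) v = w * cnj v" using t[of "param c x"] by (auto simp: type01_def)
  have p: "param d (transition c d x) = param c x"
    using x c d by (auto simp: mem_overlap charts_is_chart chart_param)
  show ?thesis
    unfolding coeff01_eq p frame_transition[OF c d x] w by simp
qed

lemma type01_eqI:
  assumes "type01 \<alpha>" "type01 \<beta>" "\<alpha> v = \<beta> v" "v \<noteq> 0"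
  shows "\<alpha> = \<beta>"
  using assms by (auto simp: type01_def)

lemma form_eqI:
  assumes "\<And>p. type01 (\<alpha> p)" "\<And>p. type01 (\<beta> p)"
    and c: "c \<in> charts A" "x \<in> img c" and "coeff01 A c \<alpha> x = coeff01 A c \<beta> x"
  shows "\<alpha> (param c x) = \<beta> (param c x)"
  using type01_eqI[OF assms(1,2) _ frame_nonzero[OF c]] assms(5) by (simp add: coeff01_eq)

text \<open>The tool for extending by zero. The image of \<open>K\<close> is compact, hence closed
  in a Hausdorff space, so its complement and the overlap with \<open>c\<close> form an open cover
  of the other chart.\<close>

lemma smooth_on_chart_extension:
  assumes c: "c \<in> charts A" and d: "d \<in> charts A" and K: "compact K" "K \<subseteq> img c"
    and s: "smooth_on (overlap d c) G" and z: "\<And>x. x \<in> img d \<Longrightarrow> param d x \<notin> param c ` K \<Longrightarrow> G x = 0"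
  shows "smooth_on (img d) G"
proof (rule smooth_on_local)
  fix x assume x: "x \<in> img d"
  have "compact (param c ` K)"
    using K continuous_on_subset[OF param_continuous[OF charts_is_chart[OF c]]] by (intro compact_continuous_image) auto
  then have o: "open (dom d - param c ` K)" by (rule open_Diff[OF charts_open(1)[OF d] compact_imp_closed])
  show "\<exists>T. open T \<and> x \<in> T \<and> smooth_on T G"
  proof (cases "param d x \<in> param c ` K")
    case True
    then have "param d x \<in> dom c" using K chart_param(1)[OF c] by auto
    then have "x \<in> overlap d c" using x by (simp add: mem_overlap charts_is_chart d)
    then show ?thesis using s open_overlap[OF charts_is_chart[OF d] charts_is_chart[OF c]] by blast
  next
    case False
    let ?T = "coord d ` (dom d - param c ` K)"
    have T: "open ?T" using o by (intro open_image_coord charts_is_chart d) auto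
    have "smooth_on ?T G"
      by (rule smooth_on_cong[OF T smooth_on_const[of _ 0]]) (use z chart_param[OF d] in force)
    moreover have "x \<in> ?T"
      using False x chart_param[OF d] by (auto intro!: image_eqI[of _ _ "param d x"])
    ultimately show ?thesis using T by blast
  qed
qed

lemma smooth_on_transition: "c \<in> charts A \<Longrightarrow> d \<in> charts A \<Longrightarrow> smooth_on (overlap c d) (transition c d)"
  by (intro holomorphic_imp_smooth_on open_overlap charts_is_chart transition_holomorphic)

lemma smooth_on_deriv_transition:
  "c \<in> charts A \<Longrightarrow> d \<in> charts A \<Longrightarrow> smooth_on (overlap c d) (\<lambda>x. deriv (transition c d) x)"
  by (intro holomorphic_imp_smooth_on open_overlap charts_is_chart holomorphic_deriv transition_holomorphic)

section \<open>Extension by zero from a chart, and dbar in coordinates\<close>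

definition ext_fun :: "'a chart \<Rightarrow> (complex \<Rightarrow> 'b::zero) \<Rightarrow> 'a \<Rightarrow> 'b" where
  "ext_fun c h p = (if p \<in> dom c then h (coord c p) else 0)"

lemma ext_fun_smooth:
  fixes h :: "complex \<Rightarrow> 'b::euclidean_space"
  assumes c: "c \<in> charts A" and K: "compact K" "K \<subseteq> img c" "\<And>x. x \<notin> K \<Longrightarrow> h x = 0" and h: "smooth_on UNIV h"
  shows "ext_fun c h \<in> Cinf A"
  unfolding Cinf_def
proof (intro CollectI ballI)
  fix d assume d: "d \<in> charts A"
  have o: "open (overlap d c)" by (rule open_overlap[OF charts_is_chart[OF d] charts_is_chart[OF c]])
  show "smooth_on (img d) (ext_fun c h \<circ> param d)"
  proof (rule smooth_on_chart_extension[OF c d K(1,2)])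
    have "smooth_on (overlap d c) (\<lambda>x. h (transition d c x))"
      by (rule smooth_on_compose[OF o open_UNIV _ h smooth_on_transition[OF d c]]) simp
    then show "smooth_on (overlap d c) (ext_fun c h \<circ> param d)"
      by (rule smooth_on_cong[OF o]) (simp add: ext_fun_def mem_overlap[OF charts_is_chart[OF d]])
    fix x assume x: "x \<in> img d" "param d x \<notin> param c ` K"
    show "(ext_fun c h \<circ> param d) x = 0"
    proof (cases "param d x \<in> dom c")
      case True
      then have "coord c (param d x) \<notin> K" using x chart_param(3)[OF c True] by (metis image_eqI)
      then show ?thesis using K by (simp add: ext_fun_def)
    qed (simp add: ext_fun_def)
  qed
qed

lemma form01_type01: "type01 (form01_of_coeff A c h p)"
proof (cases "p \<in> dom c")
  case True
  then have "form01_of_coeff A c h p v =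
      h (coord c p) * cnj (deriv (transition (chart_at A p) c) (coord (chart_at A p) p)) * cnj v" for v
    by (simp add: form01_of_coeff_def vec_in_chart_def)
  then show ?thesis unfolding type01_def by blast
next
  case False
  then have "form01_of_coeff A c h p v = 0 * cnj v" for v by (simp add: form01_of_coeff_def)
  then show ?thesis unfolding type01_def by blast
qed

lemma coeff01_form01_same:
  assumes c: "c \<in> charts A" and x: "x \<in> img c"
  shows "coeff01 A c (form01_of_coeff A c h) x = h x"
  using vec_in_chart_frame[OF assms, of 1] chart_param[OF c] x
  by (simp add: coeff01_eq form01_of_coeff_def)

lemma coeff01_form01:
  assumes c: "c \<in> charts A" and d: "d \<in> charts A" and x: "x \<in> img d"
  shows "coeff01 A d (form01_of_coeff A c h) x =
    (if x \<in> overlap d c then h (transition d c x) * cnj (deriv (transition d c) x) else 0)"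
proof (cases "x \<in> overlap d c")
  case True
  have "transition d c x \<in> img c" using transition_mem[OF charts_is_chart[OF d] charts_is_chart[OF c] True] overlap_subset by blast
  then show ?thesis
    using True coeff01_transition[OF d c True, of "form01_of_coeff A c h"] coeff01_form01_same[OF c, of _ h]
    by (simp add: form01_type01)
next
  case False
  then have "param d x \<notin> dom c" using x by (simp add: mem_overlap charts_is_chart d)
  then show ?thesis using False by (simp add: coeff01_eq form01_of_coeff_def)
qed

lemma form01_A01:
  assumes c: "c \<in> charts A" and h: "h \<in> test_functions (img c)"
  shows "form01_of_coeff A c h \<in> A01 A"
proof -
  obtain K where K: "compact K" "K \<subseteq> img c" "\<And>x. x \<notin> K \<Longrightarrow> h x = 0" "smooth_on UNIV h"
    using h test_functionsE by metis
  have "smooth_on (img d) (coeff01 A d (form01_of_coeff A c h))" if d: "d \<in> charts A" for d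
  proof (rule smooth_on_chart_extension[OF c d K(1,2)])
    have o: "open (overlap d c)" by (rule open_overlap[OF charts_is_chart[OF d] charts_is_chart[OF c]])
    have "smooth_on (overlap d c) (\<lambda>x. h (transition d c x) * cnj (deriv (transition d c) x))"
      by (intro smooth_on_mult o smooth_on_cnj smooth_on_deriv_transition c d
          smooth_on_compose[OF o open_UNIV _ K(4) smooth_on_transition[OF d c]]) auto
    then show "smooth_on (overlap d c) (coeff01 A d (form01_of_coeff A c h))"
      by (rule smooth_on_cong[OF o]) (use coeff01_form01[OF c d] overlap_subset in \<open>metis subsetD\<close>)
    fix x assume x: "x \<in> img d" "param d x \<notin> param c ` K"
    show "coeff01 A d (form01_of_coeff A c h) x = 0"
    proof (cases "param d x \<in> dom c")
      case True
      then have "coord c (param d x) \<notin> K" using x chart_param(3)[OF c True] by (metis image_eqI)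
      then show ?thesis using K by (simp add: coeff01_form01[OF c d x(1)])
    next
      case False
      then show ?thesis by (simp add: coeff01_form01[OF c d x(1)] mem_overlap[OF charts_is_chart[OF d]])
    qed
  qed
  then show ?thesis by (auto simp: A01_def form01_type01)
qed

lemma Cinf_smooth: "f \<in> Cinf A \<Longrightarrow> c \<in> charts A \<Longrightarrow> smooth_on (img c) (f \<circ> param c)"
  by (simp add: Cinf_def)

lemma differential_frame:
  assumes f: "f \<in> Cinf A" and c: "c \<in> charts A" and x: "x \<in> img c"
  shows "differential A f (param c x) (frame c x * v) = frechet_derivative (f \<circ> param c) (at x) v"
    and "linear (differential A f (param c x))"
proof -
  let ?a = "chart_at A (param c x)"
  have xo: "x \<in> overlap c ?a" by (rule overlap_chart_at[OF c x])
  note cc = charts_is_chart[OF c] charts_is_chart[OF chart_at(3)[of "param c x"]]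
  have y: "transition c ?a x \<in> img ?a" using transition_mem[OF cc xo] overlap_subset by blast
  have d1: "((f \<circ> param ?a) has_derivative frechet_derivative (f \<circ> param ?a) (at (transition c ?a x))) (at (transition c ?a x))"
    by (rule smooth_on_has_derivative[OF Cinf_smooth[OF f chart_at(3)] y])
  then show "linear (differential A f (param c x))"
    using has_derivative_linear unfolding differential_def[abs_def] by fastforce
  have d2: "(transition c ?a has_derivative (*) (frame c x)) (at x)"
    using holomorphic_derivI[OF transition_holomorphic[OF c chart_at(3)] open_overlap[OF cc] xo]
    by (simp add: has_field_derivative_def frame_def)
  have "((\<lambda>y. (f \<circ> param ?a) (transition c ?a y)) has_derivative
      (\<lambda>v. frechet_derivative (f \<circ> param ?a) (at (transition c ?a x)) (frame c x * v))) (at x)"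
    by (rule has_derivative_compose[OF d2 d1])
  then have "((f \<circ> param c) has_derivative
      (\<lambda>v. frechet_derivative (f \<circ> param ?a) (at (transition c ?a x)) (frame c x * v))) (at x)"
    by (rule has_derivative_transform_within_open[OF _ open_overlap[OF cc] xo])
      (use cc in \<open>auto simp: mem_overlap is_chart_param\<close>)
  then have "frechet_derivative (f \<circ> param c) (at x) =
      (\<lambda>v. frechet_derivative (f \<circ> param ?a) (at (transition c ?a x)) (frame c x * v))"
    using frechet_derivative_at by metis
  then show "differential A f (param c x) (frame c x * v) = frechet_derivative (f \<circ> param c) (at x) v"
    by (simp add: differential_def)
qed

lemma dbar_type01:
  assumes f: "f \<in> Cinf A" shows "type01 (dbar A f p)"
proof -
  let ?c = "chart_at A p"
  have p: "p = param ?c (coord ?c p)" "coord ?c p \<in> img ?c" using chart_param[OF chart_at(3)] chart_at by auto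
  have lin: "linear (differential A f p)"
    using differential_frame(2)[OF f chart_at(3) p(2)] p(1) by simp
  let ?D = "differential A f p"
  have "dbar A f p v = (?D 1 + \<i> * ?D \<i>) / 2 * cnj v" for v
    unfolding dbar_def real_linear_complex_decompose[OF lin, of v] real_linear_complex_decompose[OF lin, of "\<i> * v"]
    by (simp add: field_simps)
  then show ?thesis unfolding type01_def by blast
qed

lemma coeff01_dbar:
  assumes f: "f \<in> Cinf A" and c: "c \<in> charts A" and x: "x \<in> img c"
  shows "coeff01 A c (dbar A f) x = ddzbar (f \<circ> param c) x"
  using differential_frame(1)[OF assms, of 1] differential_frame(1)[OF assms, of \<i>]
  by (simp add: coeff01_eq dbar_def ddzbar_def mult.commute)

lemma dbar_A01:
  assumes f: "f \<in> Cinf A" shows "dbar A f \<in> A01 A"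
proof -
  have "smooth_on (img c) (coeff01 A c (dbar A f))" if c: "c \<in> charts A" for c
  proof -
    have o: "open (img c)" by (rule charts_open(2)[OF c])
    let ?D = "\<lambda>v x. frechet_derivative (f \<circ> param c) (at x) v"
    have "smooth_on (img c) (\<lambda>x. (1 / 2) * (?D 1 x + \<i> * ?D \<i> x))"
      by (intro smooth_on_mult smooth_on_add smooth_on_deriv Cinf_smooth f c o smooth_on_const)
    then show ?thesis
      by (rule smooth_on_cong[OF o]) (simp add: coeff01_dbar[OF f c] ddzbar_def)
  qed
  then show ?thesis using dbar_type01[OF f] by (simp add: A01_def)
qed

lemma ext_fun_Cinf: "c \<in> charts A \<Longrightarrow> h \<in> test_functions (img c) \<Longrightarrow> ext_fun c h \<in> Cinf A"
  by (metis test_functionsE ext_fun_smooth)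

text \<open>The bridge from global orthogonality to the image of dbar to a weak equation in one
  chart. Outside \<open>dom c\<close> the extended function vanishes in a whole neighbourhood,
  because the support is compact and hence closed.\<close>

lemma dbar_ext_fun:
  assumes c: "c \<in> charts A" and h: "h \<in> test_functions (img c)"
  shows "dbar A (ext_fun c h) = form01_of_coeff A c (ddzbar h)"
proof
  fix p
  obtain K where K: "compact K" "K \<subseteq> img c" "\<And>x. x \<notin> K \<Longrightarrow> h x = 0" "smooth_on UNIV h"
    using h test_functionsE by metis
  note f = ext_fun_Cinf[OF assms]
  show "dbar A (ext_fun c h) p = form01_of_coeff A c (ddzbar h) p"
  proof (cases "p \<in> dom c")
    case True
    let ?x = "coord c p"
    have x: "?x \<in> img c" "param c ?x = p" using True chart_param[OF c] by auto
    have "frechet_derivative (ext_fun c h \<circ> param c) (at ?x) = frechet_derivative h (at ?x)"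
      by (rule frechet_derivative_transform_within_open[symmetric, OF smooth_on_differentiable[OF K(4)] charts_open(2)[OF c] x(1)])
        (use chart_param[OF c] in \<open>auto simp: ext_fun_def\<close>)
    then have "coeff01 A c (dbar A (ext_fun c h)) ?x = coeff01 A c (form01_of_coeff A c (ddzbar h)) ?x"
      unfolding coeff01_dbar[OF f c x(1)] coeff01_form01_same[OF c x(1)] by (simp add: ddzbar_def)
    from form_eqI[OF dbar_type01[OF f] form01_type01 c x(1) this] show ?thesis by (simp add: x)
  next
    case False
    let ?a = "chart_at A p"
    have "compact (param c ` K)"
      using K continuous_on_subset[OF param_continuous[OF charts_is_chart[OF c]]] by (intro compact_continuous_image) auto
    then have "open (dom ?a - param c ` K)" by (rule open_Diff[OF charts_open(1)[OF chart_at(3)] compact_imp_closed])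
    then have o: "open (coord ?a ` (dom ?a - param c ` K))"
      by (intro open_image_coord charts_is_chart chart_at) auto
    have "p \<notin> param c ` K" using False K chart_param(1)[OF c] by auto
    then have m: "coord ?a p \<in> coord ?a ` (dom ?a - param c ` K)" using chart_at by auto
    have "((ext_fun c h \<circ> param ?a) has_derivative (\<lambda>v. 0)) (at (coord ?a p))"
    proof (rule has_derivative_transform_within_open[OF _ o m])
      show "((\<lambda>y. 0) has_derivative (\<lambda>v. 0)) (at (coord ?a p))" by simp
      show "0 = (ext_fun c h \<circ> param ?a) y" if y: "y \<in> coord ?a ` (dom ?a - param c ` K)" for y
      proof -
        obtain q where q: "y = coord ?a q" "q \<in> dom ?a" "q \<notin> param c ` K" using y by auto
        then have pq: "param ?a y = q" using chart_param(3)[OF chart_at(3)] by simp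
        show ?thesis
        proof (cases "q \<in> dom c")
          case True
          then have "coord c q \<notin> K" using q(3) chart_param(3)[OF c True] by (metis image_eqI)
          then show ?thesis using K by (simp add: ext_fun_def pq)
        qed (simp add: ext_fun_def pq)
      qed
    qed
    then have "frechet_derivative (ext_fun c h \<circ> param ?a) (at (coord ?a p)) = (\<lambda>v. 0)"
      using frechet_derivative_at by metis
    then have "dbar A (ext_fun c h) p = (\<lambda>v. 0)"
      by (simp add: dbar_def[abs_def] differential_def)
    then show ?thesis using False by (simp add: form01_of_coeff_def[abs_def])
  qed
qed

text \<open>An arbitrary covering family of charts is allowed so that the partition can later be
  subordinate to charts chosen for a property of a form.\<close>

lemma ex_partition_of_unity:
  assumes C: "C \<subseteq> charts A" "(\<Union>c\<in>C. dom c) = UNIV"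
  shows "\<exists>S. partition_of_unity A S \<and> fst ` S \<subseteq> C"
proof -
  define T where "T = {(c, h). c \<in> C \<and> h \<in> Cinf A \<and> (\<forall>p. 0 \<le> (h p :: real)) \<and> closure {p. h p \<noteq> 0} \<subseteq> dom c}"
  define V where "V = (\<lambda>(c :: 'a chart, h :: 'a \<Rightarrow> real). interior {p. h p = 1})"
  have "\<exists>t\<in>T. p \<in> V t" for p
  proof -
    obtain c where c: "c \<in> C" "p \<in> dom c" using C(2) by blast
    then have cA: "c \<in> charts A" using C by blast
    have x: "coord c p \<in> img c" using chart_param(4)[OF cA c(2)] .
    obtain R where R: "0 < R" "cball (coord c p) R \<subseteq> img c"
      using charts_open(2)[OF cA] x open_contains_cball by blast
    obtain \<psi> :: "complex \<Rightarrow> real" where \<psi>: "smooth_on UNIV \<psi>" "\<And>z. 0 \<le> \<psi> z" "\<And>z. \<psi> z \<le> 1"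
      "\<And>z. z \<in> cball (coord c p) (R / 2) \<Longrightarrow> \<psi> z = 1" "\<And>z. z \<notin> ball (coord c p) R \<Longrightarrow> \<psi> z = 0"
      by (rule ex_bump[of "R / 2" R "coord c p"]) (use R in simp, use R in simp, rule that)
    let ?K = "cball (coord c p) R"
    have zK: "\<psi> z = 0" if "z \<notin> ?K" for z using that \<psi>(5)[of z] by auto
    have "ext_fun c \<psi> \<in> Cinf A" by (rule ext_fun_smooth[OF cA compact_cball R(2) zK \<psi>(1)])
    moreover have "0 \<le> ext_fun c \<psi> q" for q using \<psi>(2) by (simp add: ext_fun_def)
    moreover have "closure {q. ext_fun c \<psi> q \<noteq> 0} \<subseteq> dom c"
    proof -
      have k1: "compact (param c ` ?K)"
        using R continuous_on_subset[OF param_continuous[OF charts_is_chart[OF cA]]] by (intro compact_continuous_image) auto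
      have k2: "{q. ext_fun c \<psi> q \<noteq> 0} \<subseteq> param c ` ?K"
      proof
        fix q assume "q \<in> {q. ext_fun c \<psi> q \<noteq> 0}"
        then have "q \<in> dom c" "coord c q \<in> ?K" using zK by (auto simp: ext_fun_def split: if_splits)
        then show "q \<in> param c ` ?K" using chart_param(3)[OF cA] by (metis image_eqI)
      qed
      have "param c ` ?K \<subseteq> dom c" using R chart_param(1)[OF cA] by auto
      then show ?thesis using closure_minimal[OF k2 compact_imp_closed[OF k1]] by blast
    qed
    ultimately have T: "(c, ext_fun c \<psi>) \<in> T" using c by (simp add: T_def)
    let ?N = "dom c \<inter> coord c -` ball (coord c p) (R / 2)"
    have "continuous_on (dom c) (coord c)"
      using charts_is_chart[OF cA] by (simp add: is_chart_def homeomorphism_def)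
    then have "open ?N" using charts_open(1)[OF cA] by (intro continuous_open_preimage) auto
    moreover have "p \<in> ?N" using c R by simp
    moreover have "?N \<subseteq> {q. ext_fun c \<psi> q = 1}" using \<psi>(4) by (auto simp: ext_fun_def)
    ultimately have "p \<in> V (c, ext_fun c \<psi>)" unfolding V_def by (auto intro: interiorI)
    then show ?thesis using T by blast
  qed
  then have "UNIV \<subseteq> (\<Union>t\<in>T. V t)" by blast
  moreover have "\<And>t. t \<in> T \<Longrightarrow> open (V t)" by (auto simp: V_def split: prod.split)
  ultimately obtain S0 where S0: "S0 \<subseteq> T" "finite S0" "UNIV \<subseteq> (\<Union>t\<in>S0. V t)"
    using compactE_image[OF compact_UNIV] by metis
  define H where "H = (\<lambda>p. \<Sum>t\<in>S0. snd t p)"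
  have S0T: "fst t \<in> C" "snd t \<in> Cinf A" "snd t p \<ge> 0" "closure {p. snd t p \<noteq> 0} \<subseteq> dom (fst t)" if "t \<in> S0" for t p
    using subsetD[OF S0(1) that] by (simp_all add: T_def split_beta)
  note pos = S0T(3)
  have H: "H p > 0" for p
  proof -
    obtain t where t: "t \<in> S0" "p \<in> V t" using S0(3) by blast
    have "V t \<subseteq> {p. snd t p = 1}" unfolding V_def split_beta by (rule interior_subset)
    with t have "snd t p = 1" by blast
    then have "1 \<le> H p" unfolding H_def using member_le_sum[OF t(1) _ S0(2), of "\<lambda>t. snd t p"] pos by simp
    then show ?thesis by simp
  qed
  have Hs: "smooth_on (img d) (H \<circ> param d)" if d: "d \<in> charts A" for d
  proof -
    have "smooth_on (img d) (\<lambda>x. \<Sum>t\<in>S0. (snd t \<circ> param d) x)"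
      by (intro smooth_on_sum charts_open d S0(2) Cinf_smooth S0T(2))
    then show ?thesis by (simp add: H_def comp_def)
  qed
  let ?q = "\<lambda>t. (fst t, \<lambda>p. snd t p / H p)"
  \<comment> \<open>A partition is a set of pairs; normalising must not identify two of them, or the
    sum would drop a term.\<close>
  have inj: "inj_on ?q S0"
  proof (rule inj_onI)
    fix s t assume "?q s = ?q t"
    then have "fst s = fst t" "\<And>p. snd s p / H p = snd t p / H p" by (auto simp: fun_eq_iff)
    moreover have "snd s p = snd t p" for p using calculation(2)[of p] H[of p] by auto
    ultimately show "s = t" by (simp add: prod_eq_iff fun_eq_iff)
  qed
  have "partition_of_unity A (?q ` S0)"
    unfolding partition_of_unity_def
  proof (intro conjI)
    show "finite (?q ` S0)" using S0 by simp
    show "\<forall>(c, h)\<in>?q ` S0. c \<in> charts A \<and> h \<in> Cinf A \<and> (\<forall>p. 0 \<le> h p) \<and> closure {p. h p \<noteq> 0} \<subseteq> dom c"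
    proof -
      have "fst t \<in> charts A \<and> (\<lambda>p. snd t p / H p) \<in> Cinf A \<and> (\<forall>p. 0 \<le> snd t p / H p) \<and>
          closure {p. snd t p / H p \<noteq> 0} \<subseteq> dom (fst t)" if t: "t \<in> S0" for t
      proof (intro conjI)
        note T = S0T[OF t]
        show "fst t \<in> charts A" using T(1) C by auto
        show "(\<lambda>p. snd t p / H p) \<in> Cinf A"
          unfolding Cinf_def
        proof (intro CollectI ballI)
          fix d assume d: "d \<in> charts A"
          have nz: "(H \<circ> param d) x \<noteq> 0" if "x \<in> img d" for x using H[of "param d x"] by simp
          have "smooth_on (img d) (\<lambda>x. (snd t \<circ> param d) x / (H \<circ> param d) x)"
            by (rule smooth_on_divide[OF charts_open(2)[OF d] nz Cinf_smooth[OF T(2) d] Hs[OF d]])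
          then show "smooth_on (img d) ((\<lambda>p. snd t p / H p) \<circ> param d)" by (simp add: comp_def)
        qed
        show "\<forall>p. 0 \<le> snd t p / H p" using T(3) H by (auto intro!: divide_nonneg_pos)
        have "{p. snd t p / H p \<noteq> 0} \<subseteq> {p. snd t p \<noteq> 0}" by auto
        from closure_mono[OF this] T(4)
        show "closure {p. snd t p / H p \<noteq> 0} \<subseteq> dom (fst t)" by simp
      qed
      then show ?thesis by (intro ballI, elim imageE, simp only: prod.case)
    qed
    show "\<forall>p. (\<Sum>(c, h)\<in>?q ` S0. h p) = 1"
    proof
      fix p
      have "(\<Sum>(c, h)\<in>?q ` S0. h p) = (\<Sum>t\<in>S0. snd t p / H p)"
        by (simp add: sum.reindex[OF inj] split_beta)
      also have "\<dots> = 1" using H[of p] by (simp add: H_def flip: sum_divide_distrib)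
      finally show "(\<Sum>(c, h)\<in>?q ` S0. h p) = 1" .
    qed
  qed
  moreover have "fst ` ?q ` S0 \<subseteq> C" using S0T(1) by auto
  ultimately show ?thesis by blast
qed

lemma ex_partition_of_unity_atlas: "\<exists>S. partition_of_unity A S"
proof -
  have "A \<subseteq> charts A" using atlas_subset_charts by (rule subsetI)
  moreover have "(\<Union>c\<in>A. dom c) = UNIV" using atlas by (simp add: complex_atlas_def)
  ultimately show ?thesis using ex_partition_of_unity[of A] by blast
qed

end

section \<open>The Hilbert space of square-integrable forms\<close>

text \<open>Multiplication by \<open>\<i>\<close> maps the pair \<open>1, \<i>\<close> to
  \<open>\<i>, -1\<close>. Invariance makes both vectors equally long and their product equal to its
  own negative, so the metric is conformal to the Euclidean one.\<close>

lemma J_invariant_metric: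
  assumes "riemannian_metric A g" "J_invariant g"
  shows "g p \<i> \<i> = g p 1 1" "g p 1 \<i> = 0" "g p 1 1 > 0" "g p u u = g p 1 1 * (norm u)\<^sup>2"
proof -
  have bil: "bilinear (g p)" and sym: "\<And>u v. g p u v = g p v u" and pos: "\<And>v. v \<noteq> 0 \<Longrightarrow> g p v v > 0"
    using assms(1) by (auto simp: riemannian_metric_def)
  have J: "g p (\<i> * u) (\<i> * v) = g p u v" for u v using assms(2) by (simp add: J_invariant_def)
  show 1: "g p \<i> \<i> = g p 1 1" using J[of 1 1] by simp
  have "g p 1 \<i> = g p \<i> (- 1)" using J[of 1 \<i>] by simp
  also have "\<dots> = - g p 1 \<i>" using bilinear_rneg[OF bil, of \<i> 1] sym[of \<i> 1] by simp
  finally show 2: "g p 1 \<i> = 0" by simp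
  show "g p 1 1 > 0" using pos by simp
  have "u = Re u *\<^sub>R 1 + Im u *\<^sub>R \<i>" by (simp add: complex_eq_iff)
  then have "g p u u = g p (Re u *\<^sub>R 1 + Im u *\<^sub>R \<i>) (Re u *\<^sub>R 1 + Im u *\<^sub>R \<i>)" by simp
  also have "\<dots> = g p 1 1 * (norm u)\<^sup>2"
    unfolding bilinear_ladd[OF bil] bilinear_radd[OF bil] bilinear_lmul[OF bil] bilinear_rmul[OF bil]
    unfolding cmod_power2 using 1 2 sym[of \<i> 1] by (simp add: power2_eq_square algebra_simps)
  finally show "g p u u = g p 1 1 * (norm u)\<^sup>2" .
qed

context compact_curve
begin

text \<open>The reason the metric disappears: with conformal factor \<open>l\<close> the inner
  product of covectors carries \<open>1 / l\<close> and the volume form carries \<open>l\<close>.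
  The 2 is the squared Euclidean length of the covector \<open>cnj\<close>, and the area factor of
  the frame is absorbed into the two coefficients.\<close>

lemma coeff2_inner_form:
  assumes g: "riemannian_metric A g" "J_invariant g" and t: "\<And>p. type01 (\<alpha> p)" "\<And>p. type01 (\<beta> p)"
  shows "coeff2 A c (inner_form g \<alpha> \<beta>) x = 2 * (coeff01 A c \<alpha> x * cnj (coeff01 A c \<beta> x))"
proof -
  let ?p = "param c x" and ?f = "frame c x"
  obtain a where a: "\<And>v. \<alpha> ?p v = a * cnj v" using t(1)[of ?p] unfolding type01_def by blast
  obtain b where b: "\<And>v. \<beta> ?p v = b * cnj v" using t(2)[of ?p] unfolding type01_def by blast
  define l where "l = g ?p 1 1"
  have l: "l > 0" "g ?p \<i> \<i> = l" "g ?p 1 1 = l" "g ?p 1 \<i> = 0"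
    unfolding l_def by (rule J_invariant_metric[OF g] refl)+
  have gd: "gram_det (g ?p) = l * l" by (simp add: gram_det_def l)
  then have sq: "sqrt (gram_det (g ?p)) = l" using l by simp
  have dx: "dxdy ?f (?f * \<i>) = (norm ?f)\<^sup>2" unfolding cmod_power2 by (simp add: dxdy_def power2_eq_square)
  have ci: "covector_inner (g ?p) (\<alpha> ?p) (\<beta> ?p) = 2 * a * cnj b / of_real l"
    unfolding covector_inner_def gd using l by (simp add: a b field_simps)
  have "coeff2 A c (inner_form g \<alpha> \<beta>) x = (2 * a * cnj b / of_real l) * of_real (l * (norm ?f)\<^sup>2)"
    unfolding coeff2_def inner_form_def volume_form_def vec_of_chart_frame ci sq mult_1_right dx ..
  also have "\<dots> = 2 * a * cnj b * (?f * cnj ?f)"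
    using l by (simp add: complex_norm_square[symmetric])
  finally show ?thesis by (simp add: coeff01_eq a b)
qed

text \<open>Literally the choice made inside \<open>density_integral\<close>, so integrals unfold to
  sums over one fixed partition.\<close>

definition pou :: "('a chart \<times> ('a \<Rightarrow> real)) set" where
  "pou = (SOME S. partition_of_unity A S)"

lemma partition_of_unity_pou: "partition_of_unity A pou"
  unfolding pou_def by (rule someI_ex[OF ex_partition_of_unity_atlas])

lemma finite_pou: "finite pou"
  using partition_of_unity_pou by (simp add: partition_of_unity_def)

lemma pou_mem:
  assumes "(c, h) \<in> pou"
  shows "c \<in> charts A" "h \<in> Cinf A" "0 \<le> h p" "closure {p. h p \<noteq> 0} \<subseteq> dom c"
  using partition_of_unity_pou assms by (auto simp: partition_of_unity_def)

lemma pou_sum: "(\<Sum>(c, h)\<in>pou. h p) = 1"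
  using partition_of_unity_pou by (simp add: partition_of_unity_def)

lemma pou_le_1: assumes "(c, h) \<in> pou" shows "h p \<le> 1"
proof -
  have "snd (c, h) p \<le> (\<Sum>t\<in>pou. snd t p)"
  proof (rule member_le_sum[OF assms _ finite_pou])
    show "0 \<le> snd t p" if "t \<in> pou - {(c, h)}" for t
      using that pou_mem(3)[of "fst t" "snd t"] by simp
  qed
  also have "\<dots> = 1" using pou_sum[of p] by (simp add: split_beta)
  finally show ?thesis by simp
qed

lemma pou_outside: "(c, h) \<in> pou \<Longrightarrow> p \<notin> dom c \<Longrightarrow> h p = 0"
  using pou_mem(4)[of c h] closure_subset[of "{p. h p \<noteq> 0}"] by blast

lemma Cinf_measurable:
  assumes f: "f \<in> Cinf A" and c: "c \<in> charts A"
  shows "set_borel_measurable lborel (img c) (\<lambda>x. f (param c x))"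
  using borel_measurable_continuous_on_indicator[OF _ smooth_on_continuous[OF Cinf_smooth[OF f c]]] charts_open(2)[OF c]
  by (simp add: set_borel_measurable_def comp_def)

definition measurable_forms :: "'a form1 set" where
  "measurable_forms = {\<omega>. (\<forall>p. type01 (\<omega> p)) \<and>
     (\<forall>c\<in>charts A. set_borel_measurable lborel (img c) (coeff01 A c \<omega>))}"

text \<open>Together with \<open>form_ip\<close> this is the Hilbert space structure with the metric
  cancelled, shared by all J-invariant metrics.\<close>

definition L2 :: "'a form1 set" where
  "L2 = {\<omega> \<in> measurable_forms. \<forall>c\<in>charts A. \<forall>K. compact K \<and> K \<subseteq> img c \<longrightarrow>
     set_integrable lborel K (\<lambda>x. coeff01 A c \<omega> x * cnj (coeff01 A c \<omega> x))}"

definition form_ip :: "'a form1 \<Rightarrow> 'a form1 \<Rightarrow> complex" where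
  "form_ip \<alpha> \<beta> = 2 * (\<Sum>(c, h)\<in>pou. LINT x:img c|lborel.
     of_real (h (param c x)) * (coeff01 A c \<alpha> x * cnj (coeff01 A c \<beta> x)))"

lemma L2_forms_eq:
  assumes g: "riemannian_metric A g" "J_invariant g"
  shows "L2_forms A g = L2"
proof -
  have "set_integrable lborel K (coeff2 A c (inner_form g \<omega> \<omega>)) \<longleftrightarrow>
      set_integrable lborel K (\<lambda>x. coeff01 A c \<omega> x * cnj (coeff01 A c \<omega> x))"
    if "\<And>p. type01 (\<omega> p)" for \<omega> c K
    unfolding coeff2_inner_form[OF g that that, abs_def] by simp
  then show ?thesis
    unfolding L2_forms_def L2_def measurable_forms_def by auto
qed

lemma L2_inner_eq:
  assumes g: "riemannian_metric A g" "J_invariant g" and t: "\<And>p. type01 (\<alpha> p)" "\<And>p. type01 (\<beta> p)"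
  shows "L2_inner A g \<alpha> \<beta> = form_ip \<alpha> \<beta>"
proof -
  have e: "(LINT x:S|lborel. complex_of_real (k x) * (2 * F x)) = 2 * (LINT x:S|lborel. complex_of_real (k x) * F x)"
    for S and k :: "complex \<Rightarrow> real" and F :: "complex \<Rightarrow> complex"
    unfolding set_lebesgue_integral_def by (subst integral_mult_right_zero[symmetric]) (simp add: mult_ac)
  show ?thesis
    unfolding L2_inner_def form_integral_def density_integral_def form_ip_def pou_def[symmetric]
      coeff2_inner_form[OF g t] by (simp only: e sum_distrib_left case_prod_unfold)
qed

lemma type01_L2: "\<omega> \<in> L2 \<Longrightarrow> type01 (\<omega> p)" and type01_measurable: "\<omega> \<in> measurable_forms \<Longrightarrow> type01 (\<omega> p)"
  and L2_measurable: "\<omega> \<in> L2 \<Longrightarrow> \<omega> \<in> measurable_forms"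
  by (auto simp: L2_def measurable_forms_def)

lemma set_borel_measurable_mult:
  fixes f g :: "_ \<Rightarrow> complex"
  assumes "set_borel_measurable M S f" "set_borel_measurable M S g"
  shows "set_borel_measurable M S (\<lambda>x. f x * g x)"
proof -
  have "(\<lambda>x. (indicator S x *\<^sub>R f x) * (indicator S x *\<^sub>R g x)) \<in> borel_measurable M"
    using assms unfolding set_borel_measurable_def by (rule borel_measurable_times)
  also have "(\<lambda>x. (indicator S x *\<^sub>R f x) * (indicator S x *\<^sub>R g x)) = (\<lambda>x. indicator S x *\<^sub>R (f x * g x))"
    by (auto simp: fun_eq_iff indicator_def)
  finally show ?thesis by (simp add: set_borel_measurable_def)
qed

lemma set_borel_measurable_cnj:
  fixes f :: "_ \<Rightarrow> complex"
  assumes "set_borel_measurable M S f" shows "set_borel_measurable M S (\<lambda>x. cnj (f x))"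
proof -
  have "(\<lambda>x. cnj (indicator S x *\<^sub>R f x)) \<in> borel_measurable M"
    using assms unfolding set_borel_measurable_def
    by (rule measurable_compose) (intro borel_measurable_continuous_onI continuous_intros)
  then show ?thesis by (simp add: set_borel_measurable_def)
qed

lemma pou_measurable:
  assumes h: "h \<in> Cinf A" and c: "c \<in> charts A"
  shows "set_borel_measurable lborel (img c) (\<lambda>x. complex_of_real (h (param c x)))"
  using Cinf_measurable[OF assms] unfolding set_borel_measurable_def
  by (auto simp: scaleR_conv_of_real simp flip: of_real_mult)

lemma product_measurable:
  assumes "\<alpha> \<in> measurable_forms" "\<beta> \<in> measurable_forms" "c \<in> charts A"
  shows "set_borel_measurable lborel (img c) (\<lambda>x. coeff01 A c \<alpha> x * cnj (coeff01 A c \<beta> x))"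
  using assms by (intro set_borel_measurable_mult set_borel_measurable_cnj) (auto simp: measurable_forms_def)

text \<open>The two conjugate factors from \<open>coeff01_transition\<close> multiply to
  \<open>(norm (deriv \<phi>))^2\<close>, which is exactly the Jacobian of the holomorphic
  transition \<open>\<phi>\<close>. Since \<open>h\<close> vanishes off \<open>dom d\<close>, the
  integral over \<open>img c\<close> sees only the overlap.\<close>

lemma pou_transfer:
  assumes dh: "(d, h) \<in> pou" and c: "c \<in> charts A" and ab: "\<alpha> \<in> measurable_forms" "\<beta> \<in> measurable_forms"
  defines "\<rho> \<equiv> \<lambda>c x. complex_of_real (h (param c x)) * (coeff01 A c \<alpha> x * cnj (coeff01 A c \<beta> x))"
  shows "set_integrable lborel (overlap d c) (\<rho> d) \<longleftrightarrow> set_integrable lborel (img c) (\<rho> c)"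
    and "(LINT x:overlap d c|lborel. \<rho> d x) = (LINT x:img c|lborel. \<rho> c x)"
proof -
  have d: "d \<in> charts A" by (rule pou_mem(1)[OF dh])
  note cd = charts_is_chart[OF c] charts_is_chart[OF d]
  let ?\<phi> = "transition d c"
  have im: "?\<phi> ` overlap d c = overlap c d" by (rule transition_image[OF cd(2,1)])
  have m: "set_borel_measurable lborel (img c) (\<rho> c)"
    unfolding \<rho>_def by (intro set_borel_measurable_mult pou_measurable[OF pou_mem(2)[OF dh] c] product_measurable ab c)
  have mo: "set_borel_measurable lborel (overlap c d) (\<rho> c)"
    by (rule set_borel_measurable_subset[OF m _ overlap_subset]) (simp add: open_overlap cd)
  have tr: "\<rho> d x = \<rho> c (?\<phi> x) * of_real ((norm (deriv ?\<phi> x))\<^sup>2)" if x: "x \<in> overlap d c" for x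
  proof -
    have "param c (?\<phi> x) = param d x"
      using x cd by (auto simp: mem_overlap is_chart_param)
    then show ?thesis
      unfolding \<rho>_def coeff01_transition[OF d c x type01_measurable[OF ab(1)]]
        coeff01_transition[OF d c x type01_measurable[OF ab(2)]] complex_norm_square
      by (simp add: mult_ac)
  qed
  note cv = holomorphic_change_of_variables[OF open_overlap[OF cd(2,1)] transition_holomorphic[OF d c]
      inj_on_transition[OF cd(2,1)], unfolded im, OF mo]
  have z: "\<rho> c x = 0" if "x \<in> img c - overlap c d" for x
    using that pou_outside[OF dh, of "param c x"] by (auto simp: \<rho>_def mem_overlap[OF cd(1)])
  have ind: "(\<lambda>x. indicator (img c) x *\<^sub>R \<rho> c x) = (\<lambda>x. indicator (overlap c d) x *\<^sub>R \<rho> c x)"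
    using z overlap_subset[of c d] by (auto simp: fun_eq_iff indicator_def)
  have ind': "(\<lambda>x. indicator (overlap d c) x *\<^sub>R \<rho> d x) =
      (\<lambda>x. indicator (overlap d c) x *\<^sub>R (\<rho> c (?\<phi> x) * of_real ((norm (deriv ?\<phi> x))\<^sup>2)))"
    using tr by (auto simp: fun_eq_iff indicator_def)
  show "set_integrable lborel (overlap d c) (\<rho> d) \<longleftrightarrow> set_integrable lborel (img c) (\<rho> c)"
    using cv(1) unfolding set_integrable_def ind ind' .
  show "(LINT x:overlap d c|lborel. \<rho> d x) = (LINT x:img c|lborel. \<rho> c x)"
    using cv(2) unfolding set_lebesgue_integral_def ind ind' .
qed

lemma set_integrable_bounded_mult:
  fixes f g :: "complex \<Rightarrow> complex"
  assumes "set_integrable lborel S f" "set_borel_measurable lborel S g" "\<And>x. x \<in> S \<Longrightarrow> norm (g x) \<le> C"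
  shows "set_integrable lborel S (\<lambda>x. g x * f x)"
proof -
  have "integrable lborel (\<lambda>x. (indicator S x *\<^sub>R g x) * (indicator S x *\<^sub>R f x))"
  proof (rule integrable_mult_bounded(2))
    show "integrable lborel (\<lambda>x. indicator S x *\<^sub>R f x)" using assms(1) by (simp add: set_integrable_def)
    show "(\<lambda>x. indicator S x *\<^sub>R g x) \<in> borel_measurable lborel" using assms(2) by (simp add: set_borel_measurable_def)
    show "norm (indicator S x *\<^sub>R g x) \<le> max C 0" for x using assms(3)[of x] by (auto simp: indicator_def)
  qed
  also have "(\<lambda>x. (indicator S x *\<^sub>R g x) * (indicator S x *\<^sub>R f x)) = (\<lambda>x. indicator S x *\<^sub>R (g x * f x))"
    by (auto simp: fun_eq_iff indicator_def)
  finally show ?thesis by (simp add: set_integrable_def)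
qed

text \<open>Weighted integrability in the charts of the partition is carried to any chart
  \<open>c\<close> and summed. As the weights add up to 1, it gives integrability on all of
  \<open>img c\<close>, more than the compact subsets in the definition of
  \<open>L2\<close>.\<close>

lemma measurable_L2I:
  assumes m: "\<omega> \<in> measurable_forms"
    and i: "\<And>c h. (c, h) \<in> pou \<Longrightarrow> set_integrable lborel (img c)
      (\<lambda>x. of_real (h (param c x)) * (coeff01 A c \<omega> x * cnj (coeff01 A c \<omega> x)))"
  shows "\<omega> \<in> L2" and "c \<in> charts A \<Longrightarrow> set_integrable lborel (img c) (\<lambda>x. coeff01 A c \<omega> x * cnj (coeff01 A c \<omega> x))"
proof -
  have *: "set_integrable lborel (img c) (\<lambda>x. coeff01 A c \<omega> x * cnj (coeff01 A c \<omega> x))" if c: "c \<in> charts A" for c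
  proof -
    let ?\<rho> = "\<lambda>x. coeff01 A c \<omega> x * cnj (coeff01 A c \<omega> x)"
    have "set_integrable lborel (img c) (\<lambda>x. of_real (snd t (param c x)) * ?\<rho> x)" if t: "t \<in> pou" for t
    proof -
      have dh: "(fst t, snd t) \<in> pou" using t by simp
      have "set_integrable lborel (overlap (fst t) c)
          (\<lambda>x. of_real (snd t (param (fst t) x)) * (coeff01 A (fst t) \<omega> x * cnj (coeff01 A (fst t) \<omega> x)))"
        by (rule set_integrable_subset[OF i[OF dh] _ overlap_subset])
          (simp add: open_overlap charts_is_chart c pou_mem(1)[OF dh])
      then show ?thesis using pou_transfer(1)[OF dh c m m] by simp
    qed
    then have "set_integrable lborel (img c) (\<lambda>x. \<Sum>t\<in>pou. of_real (snd t (param c x)) * ?\<rho> x)"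
      unfolding set_integrable_def scaleR_sum_right by (rule Bochner_Integration.integrable_sum)
    moreover have "(\<Sum>t\<in>pou. of_real (snd t (param c x)) * ?\<rho> x) = ?\<rho> x" for x
    proof -
      have "(\<Sum>t\<in>pou. of_real (snd t (param c x)) * ?\<rho> x) = of_real (\<Sum>(d, h)\<in>pou. h (param c x)) * ?\<rho> x"
        by (simp add: sum_distrib_right split_beta)
      then show ?thesis by (simp add: pou_sum)
    qed
    ultimately show ?thesis by simp
  qed
  then show "c \<in> charts A \<Longrightarrow> set_integrable lborel (img c) (\<lambda>x. coeff01 A c \<omega> x * cnj (coeff01 A c \<omega> x))" by blast
  show "\<omega> \<in> L2"
    unfolding L2_def
  proof (intro CollectI conjI ballI allI impI m)
    fix c K assume "c \<in> charts A" "compact K \<and> K \<subseteq> img c"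
    then show "set_integrable lborel K (\<lambda>x. coeff01 A c \<omega> x * cnj (coeff01 A c \<omega> x))"
      by (intro set_integrable_subset[OF *[of c]]) (auto simp: compact_imp_closed)
  qed
qed

lemma L2_pou_integrable:
  assumes w: "\<omega> \<in> L2" and ch: "(c, h) \<in> pou"
  shows "set_integrable lborel (img c) (\<lambda>x. of_real (h (param c x)) * (coeff01 A c \<omega> x * cnj (coeff01 A c \<omega> x)))"
proof -
  have c: "c \<in> charts A" by (rule pou_mem(1)[OF ch])
  let ?P = "closure {p. h p \<noteq> 0}" and ?\<rho> = "\<lambda>x. coeff01 A c \<omega> x * cnj (coeff01 A c \<omega> x)"
  let ?K = "coord c ` ?P"
  have "compact ?P" using compact_Int_closed[OF compact_UNIV, of ?P] by simp
  moreover have "continuous_on ?P (coord c)"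
    using charts_is_chart[OF c] pou_mem(4)[OF ch] by (auto simp: is_chart_def homeomorphism_def intro: continuous_on_subset)
  ultimately have K: "compact ?K" by (rule compact_continuous_image[rotated])
  have Ki: "?K \<subseteq> img c" using pou_mem(4)[OF ch] by (auto simp: img_def)
  have "set_integrable lborel ?K (\<lambda>x. of_real (h (param c x)) * ?\<rho> x)"
  proof (rule set_integrable_bounded_mult)
    show "set_integrable lborel ?K ?\<rho>" using w c K Ki by (auto simp: L2_def)
    show "set_borel_measurable lborel ?K (\<lambda>x. complex_of_real (h (param c x)))"
      by (rule set_borel_measurable_subset[OF pou_measurable[OF pou_mem(2)[OF ch] c] _ Ki])
        (use K in \<open>simp add: compact_imp_closed\<close>)
    show "norm (complex_of_real (h (param c x))) \<le> 1" for x
      using pou_le_1[OF ch] pou_mem(3)[OF ch] by simp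
  qed
  moreover have "h (param c x) = 0" if "x \<in> img c - ?K" for x
  proof (rule ccontr)
    assume "h (param c x) \<noteq> 0"
    then have "param c x \<in> {p. h p \<noteq> 0}" by simp
    then have "param c x \<in> ?P" by (rule subsetD[OF closure_subset])
    then have "coord c (param c x) \<in> ?K" by blast
    then show False using that chart_param(2)[OF c] by auto
  qed
  then have "(\<lambda>x. indicator (img c) x *\<^sub>R (of_real (h (param c x)) * ?\<rho> x)) = (\<lambda>x. indicator ?K x *\<^sub>R (of_real (h (param c x)) * ?\<rho> x))"
    using Ki by (auto simp: fun_eq_iff indicator_def)
  ultimately show ?thesis by (simp add: set_integrable_def)
qed

lemma L2_chart_integrable:
  "\<omega> \<in> L2 \<Longrightarrow> c \<in> charts A \<Longrightarrow> set_integrable lborel (img c) (\<lambda>x. coeff01 A c \<omega> x * cnj (coeff01 A c \<omega> x))"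
  using measurable_L2I(2)[OF L2_measurable L2_pou_integrable] by blast

lemma set_integrable_product:
  fixes f g :: "complex \<Rightarrow> complex"
  assumes "set_integrable lborel S (\<lambda>x. f x * cnj (f x))" "set_integrable lborel S (\<lambda>x. g x * cnj (g x))"
    and "set_borel_measurable lborel S f" "set_borel_measurable lborel S g"
  shows "set_integrable lborel S (\<lambda>x. f x * cnj (g x))"
proof -
  have "integrable lborel (\<lambda>x. norm (indicator S x *\<^sub>R (f x * cnj (f x))) + norm (indicator S x *\<^sub>R (g x * cnj (g x))))"
    using assms(1,2) unfolding set_integrable_def by (intro Bochner_Integration.integrable_add integrable_norm)
  then show ?thesis
    unfolding set_integrable_def
  proof (rule Bochner_Integration.integrable_bound)
    show "(\<lambda>x. indicator S x *\<^sub>R (f x * cnj (g x))) \<in> borel_measurable lborel"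
      using set_borel_measurable_mult[OF assms(3) set_borel_measurable_cnj[OF assms(4)]] by (simp add: set_borel_measurable_def)
    have "norm a * norm b \<le> norm a * norm a + norm b * norm b" for a b :: complex
      using sum_squares_bound[of "norm a" "norm b"] mult_nonneg_nonneg[OF norm_ge_zero[of a] norm_ge_zero[of b]]
      unfolding power2_eq_square by linarith
    then show "AE x in lborel. norm (indicator S x *\<^sub>R (f x * cnj (g x)))
        \<le> norm (norm (indicator S x *\<^sub>R (f x * cnj (f x))) + norm (indicator S x *\<^sub>R (g x * cnj (g x))))"
      by (auto intro!: AE_I2 simp: indicator_def norm_mult)
  qed
qed

lemma coeff_measurable: "\<omega> \<in> measurable_forms \<Longrightarrow> c \<in> charts A \<Longrightarrow> set_borel_measurable lborel (img c) (coeff01 A c \<omega>)"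
  by (simp add: measurable_forms_def)

lemma L2_product_integrable:
  assumes "\<alpha> \<in> L2" "\<beta> \<in> L2" "c \<in> charts A"
  shows "set_integrable lborel (img c) (\<lambda>x. coeff01 A c \<alpha> x * cnj (coeff01 A c \<beta> x))"
  by (rule set_integrable_product[OF L2_chart_integrable[OF assms(1,3)] L2_chart_integrable[OF assms(2,3)]
      coeff_measurable[OF L2_measurable[OF assms(1)] assms(3)] coeff_measurable[OF L2_measurable[OF assms(2)] assms(3)]])

lemma L2_pou_product_integrable:
  assumes "\<alpha> \<in> L2" "\<beta> \<in> L2" "(c, h) \<in> pou"
  shows "set_integrable lborel (img c) (\<lambda>x. of_real (h (param c x)) * (coeff01 A c \<alpha> x * cnj (coeff01 A c \<beta> x)))"
  by (rule set_integrable_bounded_mult[where C=1, OF L2_product_integrable pou_measurable])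
    (use assms pou_mem pou_le_1 in auto)

lemma coeff01_lincomb: "coeff01 A c (\<lambda>p v. s * \<alpha> p v + t * \<beta> p v) x = s * coeff01 A c \<alpha> x + t * coeff01 A c \<beta> x"
  by (simp add: coeff01_def)

lemma coeff01_fun_mult: "coeff01 A c (fun_mult f \<omega>) x = f (param c x) * coeff01 A c \<omega> x"
  by (simp add: coeff01_def fun_mult_def)

lemma type01_lincomb: "type01 \<alpha> \<Longrightarrow> type01 \<beta> \<Longrightarrow> type01 (\<lambda>v. s * \<alpha> v + t * \<beta> v)"
proof -
  assume "type01 \<alpha>" "type01 \<beta>"
  then obtain a b where "\<And>v. \<alpha> v = a * cnj v" "\<And>v. \<beta> v = b * cnj v" unfolding type01_def by blast
  then have "s * \<alpha> v + t * \<beta> v = (s * a + t * b) * cnj v" for v by (simp add: algebra_simps)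
  then show ?thesis unfolding type01_def by blast
qed

lemma type01_fun_mult: "type01 (\<omega> p) \<Longrightarrow> type01 (fun_mult f \<omega> p)"
  unfolding type01_def fun_mult_def by (metis mult.assoc)

lemma L2_fun_mult:
  assumes f: "f \<in> Cinf A" and w: "\<omega> \<in> L2"
  shows "fun_mult f \<omega> \<in> L2"
  unfolding L2_def measurable_forms_def
proof (intro CollectI conjI allI ballI impI)
  show "type01 (fun_mult f \<omega> p)" for p by (rule type01_fun_mult[OF type01_L2[OF w]])
  fix c assume c: "c \<in> charts A"
  show m: "set_borel_measurable lborel (img c) (coeff01 A c (fun_mult f \<omega>))"
    unfolding coeff01_fun_mult[abs_def]
    by (intro set_borel_measurable_mult Cinf_measurable f c coeff_measurable L2_measurable w)
  fix K assume K: "compact K \<and> K \<subseteq> img c"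
  have "bounded ((f \<circ> param c) ` K)"
    using K smooth_on_continuous[OF Cinf_smooth[OF f c]] by (intro compact_imp_bounded compact_continuous_image) (auto intro: continuous_on_subset)
  then obtain B where B: "0 < B" "\<And>x. x \<in> K \<Longrightarrow> norm (f (param c x)) \<le> B" by (auto simp: bounded_pos)
  have fm: "set_borel_measurable lborel K (\<lambda>x. f (param c x))"
    by (rule set_borel_measurable_subset[OF Cinf_measurable[OF f c]]) (use K in \<open>auto simp: compact_imp_closed\<close>)
  have "set_integrable lborel K (\<lambda>x. (f (param c x) * cnj (f (param c x))) * (coeff01 A c \<omega> x * cnj (coeff01 A c \<omega> x)))"
  proof (rule set_integrable_bounded_mult[where C="B * B"])
    show "set_integrable lborel K (\<lambda>x. coeff01 A c \<omega> x * cnj (coeff01 A c \<omega> x))" using w c K by (auto simp: L2_def)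
    show "set_borel_measurable lborel K (\<lambda>x. f (param c x) * cnj (f (param c x)))"
      by (intro set_borel_measurable_mult set_borel_measurable_cnj fm)
    show "norm (f (param c x) * cnj (f (param c x))) \<le> B * B" if "x \<in> K" for x
      using mult_mono[OF B(2)[OF that] B(2)[OF that]] B(1) by (simp add: norm_mult)
  qed
  then show "set_integrable lborel K (\<lambda>x. coeff01 A c (fun_mult f \<omega>) x * cnj (coeff01 A c (fun_mult f \<omega>) x))"
    by (simp add: coeff01_fun_mult mult_ac)
qed

lemma L2_lincomb:
  assumes "\<alpha> \<in> L2" "\<beta> \<in> L2"
  shows "(\<lambda>p v. s * \<alpha> p v + t * \<beta> p v) \<in> L2"
  unfolding L2_def measurable_forms_def
proof (intro CollectI conjI allI ballI impI)
  show "type01 (\<lambda>v. s * \<alpha> p v + t * \<beta> p v)" for p using assms type01_L2 type01_lincomb by blast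
  fix c assume c: "c \<in> charts A"
  let ?a = "coeff01 A c \<alpha>" and ?b = "coeff01 A c \<beta>"
  have ma: "set_borel_measurable lborel (img c) ?a" and mb: "set_borel_measurable lborel (img c) ?b"
    using assms c coeff_measurable L2_measurable by auto
  have "(\<lambda>x. s * (indicator (img c) x *\<^sub>R ?a x) + t * (indicator (img c) x *\<^sub>R ?b x)) \<in> borel_measurable lborel"
    using ma mb unfolding set_borel_measurable_def
    by (intro borel_measurable_add borel_measurable_times borel_measurable_const)
  also have "(\<lambda>x. s * (indicator (img c) x *\<^sub>R ?a x) + t * (indicator (img c) x *\<^sub>R ?b x)) =
      (\<lambda>x. indicator (img c) x *\<^sub>R (s * ?a x + t * ?b x))"
    by (auto simp: fun_eq_iff indicator_def)
  finally show "set_borel_measurable lborel (img c) (coeff01 A c (\<lambda>p v. s * \<alpha> p v + t * \<beta> p v))"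
    unfolding coeff01_lincomb[abs_def] set_borel_measurable_def .
  fix K assume K: "compact K \<and> K \<subseteq> img c"
  have "set_integrable lborel (img c) (\<lambda>x. s * cnj s * (?a x * cnj (?a x)) + s * cnj t * (?a x * cnj (?b x))
     + (t * cnj s * (?b x * cnj (?a x)) + t * cnj t * (?b x * cnj (?b x))))"
    by (intro set_integral_add set_integrable_mult_right L2_product_integrable assms c)
  then have "set_integrable lborel (img c) (\<lambda>x. (s * ?a x + t * ?b x) * cnj (s * ?a x + t * ?b x))"
    by (simp add: algebra_simps)
  then have "set_integrable lborel K (\<lambda>x. (s * ?a x + t * ?b x) * cnj (s * ?a x + t * ?b x))"
    by (rule set_integrable_subset) (use K in \<open>auto simp: compact_imp_closed\<close>)
  then show "set_integrable lborel K (\<lambda>x. coeff01 A c (\<lambda>p v. s * \<alpha> p v + t * \<beta> p v) x *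
      cnj (coeff01 A c (\<lambda>p v. s * \<alpha> p v + t * \<beta> p v) x))"
    by (simp add: coeff01_lincomb)
qed

lemma form_ip_lincomb:
  assumes "\<alpha> \<in> L2" "\<beta> \<in> L2" "\<gamma> \<in> L2"
  shows "form_ip (\<lambda>p v. s * \<alpha> p v + t * \<beta> p v) \<gamma> = s * form_ip \<alpha> \<gamma> + t * form_ip \<beta> \<gamma>"
proof -
  let ?I = "\<lambda>c h \<alpha>. LINT x:img c|lborel. of_real (h (param c x)) * (coeff01 A c \<alpha> x * cnj (coeff01 A c \<gamma> x))"
  have I: "?I c h (\<lambda>p v. s * \<alpha> p v + t * \<beta> p v) = s * ?I c h \<alpha> + t * ?I c h \<beta>" if ch: "(c, h) \<in> pou" for c h
  proof -
    let ?i = "\<lambda>\<alpha> x. of_real (h (param c x)) * (coeff01 A c \<alpha> x * cnj (coeff01 A c \<gamma> x))"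
    have "?I c h (\<lambda>p v. s * \<alpha> p v + t * \<beta> p v) = (LINT x:img c|lborel. s * ?i \<alpha> x + t * ?i \<beta> x)"
      by (simp add: coeff01_lincomb algebra_simps)
    also have "\<dots> = (LINT x:img c|lborel. s * ?i \<alpha> x) + (LINT x:img c|lborel. t * ?i \<beta> x)"
      by (rule set_integral_add(2)[OF set_integrable_mult_right set_integrable_mult_right])
        (rule L2_pou_product_integrable[OF assms(1,3) ch] L2_pou_product_integrable[OF assms(2,3) ch])+
    also have "\<dots> = s * ?I c h \<alpha> + t * ?I c h \<beta>" by simp
    finally show ?thesis .
  qed
  have "(\<Sum>(c, h)\<in>pou. ?I c h (\<lambda>p v. s * \<alpha> p v + t * \<beta> p v)) = (\<Sum>(c, h)\<in>pou. s * ?I c h \<alpha> + t * ?I c h \<beta>)"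
    by (rule sum.cong[OF refl]) (use I in \<open>auto simp: case_prod_unfold\<close>)
  also have "\<dots> = s * (\<Sum>(c, h)\<in>pou. ?I c h \<alpha>) + t * (\<Sum>(c, h)\<in>pou. ?I c h \<beta>)"
    by (simp only: case_prod_unfold sum.distrib sum_distrib_left)
  finally show ?thesis unfolding form_ip_def by (simp add: algebra_simps)
qed

lemma form_ip_cnj: "form_ip \<beta> \<alpha> = cnj (form_ip \<alpha> \<beta>)"
proof -
  let ?I = "\<lambda>c h \<alpha> \<beta>. LINT x:img c|lborel. of_real (h (param c x)) * (coeff01 A c \<alpha> x * cnj (coeff01 A c \<beta> x))"
  have "?I c h \<beta> \<alpha> = cnj (?I c h \<alpha> \<beta>)" for c h
    unfolding set_lebesgue_integral_def by (subst Bochner_Integration.integral_cnj[symmetric]) (simp add: mult_ac)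
  then show ?thesis unfolding form_ip_def by (simp add: split_beta)
qed

text \<open>If one factor is supported in \<open>dom c\<close>, every summand of the global product
  can be computed in \<open>c\<close>, and there the weights sum to 1. This turns inner products
  into plane integrals.\<close>

lemma form_ip_localize:
  assumes a: "\<alpha> \<in> L2" and c: "c \<in> charts A" and b: "\<beta> \<in> L2" "\<And>p v. p \<notin> dom c \<Longrightarrow> \<beta> p v = 0"
  shows "form_ip \<alpha> \<beta> = 2 * (LINT x:img c|lborel. coeff01 A c \<alpha> x * cnj (coeff01 A c \<beta> x))"
proof -
  let ?\<rho> = "\<lambda>x. coeff01 A c \<alpha> x * cnj (coeff01 A c \<beta> x)"
  have "(LINT x:img d|lborel. of_real (h (param d x)) * (coeff01 A d \<alpha> x * cnj (coeff01 A d \<beta> x)))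
    = (LINT x:img c|lborel. of_real (h (param c x)) * ?\<rho> x)" if dh: "(d, h) \<in> pou" for d h
  proof -
    have "coeff01 A d \<beta> x = 0" if "x \<in> img d - overlap d c" for x
      using that b(2)[of "param d x"] by (auto simp: mem_overlap charts_is_chart pou_mem(1)[OF dh] coeff01_def)
    then have "(\<lambda>x. indicator (img d) x *\<^sub>R (of_real (h (param d x)) * (coeff01 A d \<alpha> x * cnj (coeff01 A d \<beta> x))))
      = (\<lambda>x. indicator (overlap d c) x *\<^sub>R (of_real (h (param d x)) * (coeff01 A d \<alpha> x * cnj (coeff01 A d \<beta> x))))"
      using overlap_subset[of d c] by (auto simp: fun_eq_iff indicator_def)
    then show ?thesis
      using pou_transfer(2)[OF dh c L2_measurable[OF a] L2_measurable[OF b(1)]]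
      unfolding set_lebesgue_integral_def by simp
  qed
  then have "form_ip \<alpha> \<beta> = 2 * (\<Sum>(d, h)\<in>pou. LINT x:img c|lborel. of_real (h (param c x)) * ?\<rho> x)"
    unfolding form_ip_def by (intro arg_cong[of _ _ "(*) 2"] sum.cong) auto
  also have "(\<Sum>(d, h)\<in>pou. LINT x:img c|lborel. of_real (h (param c x)) * ?\<rho> x)
     = (LINT x:img c|lborel. \<Sum>t\<in>pou. of_real (snd t (param c x)) * ?\<rho> x)"
    unfolding set_lebesgue_integral_def split_beta scaleR_sum_right
  proof (rule Bochner_Integration.integral_sum[symmetric])
    fix t assume t: "t \<in> pou"
    then have t': "(fst t, snd t) \<in> pou" by simp
    have "set_integrable lborel (img c) (\<lambda>x. complex_of_real (snd t (param c x)) * ?\<rho> x)"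
      by (rule set_integrable_bounded_mult[where C=1, OF L2_product_integrable[OF a b(1) c] pou_measurable[OF pou_mem(2)[OF t'] c]])
        (use pou_le_1[OF t'] pou_mem(3)[OF t'] in simp)
    then show "integrable lborel (\<lambda>x. indicator (img c) x *\<^sub>R (complex_of_real (snd t (param c x)) * ?\<rho> x))"
      by (simp add: set_integrable_def)
  qed
  also have "(\<lambda>x. \<Sum>t\<in>pou. of_real (snd t (param c x)) * ?\<rho> x) = ?\<rho>"
  proof
    fix x
    have "(\<Sum>t\<in>pou. of_real (snd t (param c x)) * ?\<rho> x) = of_real (\<Sum>(d, h)\<in>pou. h (param c x)) * ?\<rho> x"
      by (simp add: sum_distrib_right split_beta)
    then show "(\<Sum>t\<in>pou. of_real (snd t (param c x)) * ?\<rho> x) = ?\<rho> x" by (simp add: pou_sum)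
  qed
  finally show ?thesis .
qed

lemma A01_L2:
  assumes "\<omega> \<in> A01 A" shows "\<omega> \<in> L2"
proof -
  have s: "continuous_on (img c) (coeff01 A c \<omega>)" if "c \<in> charts A" for c
    using assms that smooth_on_continuous by (auto simp: A01_def)
  have "set_borel_measurable lborel (img c) (coeff01 A c \<omega>)" if c: "c \<in> charts A" for c
    using borel_measurable_continuous_on_indicator[OF _ s[OF c]] charts_open(2)[OF c] by (simp add: set_borel_measurable_def)
  moreover have "set_integrable lborel K (\<lambda>x. coeff01 A c \<omega> x * cnj (coeff01 A c \<omega> x))"
    if c: "c \<in> charts A" and K: "compact K" "K \<subseteq> img c" for c K
  proof -
    have "continuous_on K (\<lambda>x. coeff01 A c \<omega> x * cnj (coeff01 A c \<omega> x))"
      by (intro continuous_intros continuous_on_subset[OF s[OF c] K(2)])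
    then show ?thesis
      unfolding set_integrable_def by (rule borel_integrable_compact[OF K(1)])
  qed
  ultimately show ?thesis using assms by (auto simp: L2_def measurable_forms_def A01_def)
qed

lemma form_ip_form01:
  assumes a: "\<alpha> \<in> L2" and c: "c \<in> charts A" and h: "h \<in> test_functions (img c)"
  shows "form_ip \<alpha> (form01_of_coeff A c h) = 2 * (LINT x|lborel. coeff01 A c \<alpha> x * cnj (h x))"
proof -
  have "form_ip \<alpha> (form01_of_coeff A c h) =
      2 * (LINT x:img c|lborel. coeff01 A c \<alpha> x * cnj (coeff01 A c (form01_of_coeff A c h) x))"
    by (rule form_ip_localize[OF a c A01_L2[OF form01_A01[OF c h]]]) (simp add: form01_of_coeff_def)
  also have "(\<lambda>x. indicator (img c) x *\<^sub>R (coeff01 A c \<alpha> x * cnj (coeff01 A c (form01_of_coeff A c h) x)))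
    = (\<lambda>x. coeff01 A c \<alpha> x * cnj (h x))"
    using test_functions_outside[OF h] coeff01_form01_same[OF c, of _ h] by (auto simp: fun_eq_iff indicator_def)
  then have "(LINT x:img c|lborel. coeff01 A c \<alpha> x * cnj (coeff01 A c (form01_of_coeff A c h) x)) = (LINT x|lborel. coeff01 A c \<alpha> x * cnj (h x))"
    by (simp add: set_lebesgue_integral_def)
  finally show ?thesis .
qed

end

text \<open>The pointwise half of Riesz-Fischer. The rate \<open>4^(-n)\<close> is split: weights
  \<open>2^n\<close> still leave a convergent sum of integrals, so almost everywhere the squared
  increments are at most a constant times \<open>2^(-n)\<close>, and the increments are
  summable.\<close>

lemma AE_convergent_of_fast_Cauchy:
  fixes f :: "nat \<Rightarrow> 'a \<Rightarrow> complex"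
  assumes f[measurable]: "\<And>n. f n \<in> borel_measurable M"
    and bound: "\<And>n. (\<integral>\<^sup>+x. ennreal ((norm (f (Suc n) x - f n x))\<^sup>2) \<partial>M) \<le> ennreal ((1 / 4) ^ n)"
  shows "AE x in M. convergent (\<lambda>n. f n x)"
proof -
  let ?d = "\<lambda>n x. (norm (f (Suc n) x - f n x))\<^sup>2"
  let ?g = "\<lambda>n x. ennreal (2 ^ n * ?d n x)"
  have g: "(\<integral>\<^sup>+x. ?g n x \<partial>M) \<le> ennreal ((1 / 2) ^ n)" for n
  proof -
    have "(\<integral>\<^sup>+x. ?g n x \<partial>M) = ennreal (2 ^ n) * (\<integral>\<^sup>+x. ennreal (?d n x) \<partial>M)"
      by (subst nn_integral_cmult[symmetric]) (auto simp: ennreal_mult')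
    also have "\<dots> \<le> ennreal (2 ^ n) * ennreal ((1 / 4) ^ n)" by (intro mult_left_mono bound) simp
    also have "\<dots> = ennreal ((1 / 2) ^ n)"
      by (simp flip: ennreal_mult power_mult_distrib)
    finally show ?thesis .
  qed
  have "(\<integral>\<^sup>+x. (\<Sum>n. ?g n x) \<partial>M) = (\<Sum>n. \<integral>\<^sup>+x. ?g n x \<partial>M)"
    by (rule nn_integral_suminf) measurable
  also have "\<dots> \<le> (\<Sum>n. ennreal ((1 / 2) ^ n))" by (rule suminf_le[OF g]) auto
  also have "\<dots> = ennreal (\<Sum>n. (1 / 2) ^ n)" by (rule suminf_ennreal2) (auto intro: summable_geometric)
  finally have "(\<integral>\<^sup>+x. (\<Sum>n. ?g n x) \<partial>M) \<noteq> \<infinity>" by (auto simp: top_unique)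
  then have "AE x in M. (\<Sum>n. ?g n x) \<noteq> \<infinity>"
    by (intro nn_integral_noteq_infinite) measurable
  then show ?thesis
  proof eventually_elim
    case (elim x)
    then have "summable (\<lambda>n. 2 ^ n * ?d n x)"
      by (intro summable_suminf_not_top) auto
    then have "bounded (range (\<lambda>n. 2 ^ n * ?d n x))"
      by (intro convergent_imp_bounded) (auto dest: summable_LIMSEQ_zero simp: convergent_def)
    then obtain B where B: "0 < B" "\<And>n. norm (2 ^ n * ?d n x) \<le> B" by (auto simp: bounded_pos)
    have nb: "norm (f (Suc n) x - f n x) \<le> sqrt B * sqrt (1 / 2) ^ n" for n
    proof (rule power2_le_imp_le)
      have "?d n x \<le> B * (1 / 2) ^ n" using B(2)[of n] by (simp add: field_simps power_one_over)
      also have "\<dots> = (sqrt B * sqrt (1 / 2) ^ n)\<^sup>2"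
      proof -
        have "(sqrt (1 / 2) ^ n)\<^sup>2 = ((sqrt (1 / 2))\<^sup>2) ^ n" by (simp only: power_mult[symmetric] mult.commute)
        also have "(sqrt (1 / 2))\<^sup>2 = 1 / 2" by (rule real_sqrt_pow2) simp
        finally show ?thesis using B(1) by (simp add: power_mult_distrib)
      qed
      finally show "(norm (f (Suc n) x - f n x))\<^sup>2 \<le> (sqrt B * sqrt (1 / 2) ^ n)\<^sup>2" .
    qed (use B in simp)
    have "sqrt (1 / 2) < 1" by (rule real_less_lsqrt) auto
    then have "summable (\<lambda>n. sqrt B * sqrt (1 / 2) ^ n)"
      by (intro summable_mult summable_geometric) simp
    then have "summable (\<lambda>n. f (Suc n) x - f n x)"
      by (rule summable_comparison_test'[where N=0]) (rule nb)
    then have "convergent (\<lambda>n. \<Sum>k<n. f (Suc k) x - f k x)"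
      by (simp add: summable_iff_convergent)
    then have "convergent (\<lambda>n. f n x - f 0 x)" unfolding sum_lessThan_telescope[of "\<lambda>k. f k x"] .
    then have "convergent (\<lambda>n. (f n x - f 0 x) + f 0 x)" by (intro convergent_add convergent_const)
    then show ?case by simp
  qed
qed

section \<open>The seminorm, Cauchy-Schwarz and completeness\<close>

context compact_curve
begin

definition weight :: "'a chart \<Rightarrow> ('a \<Rightarrow> real) \<Rightarrow> complex \<Rightarrow> real" where
  "weight c h x = indicator (img c) x * h (param c x)"

definition loc_norm :: "'a chart \<Rightarrow> ('a \<Rightarrow> real) \<Rightarrow> 'a form1 \<Rightarrow> real" where
  "loc_norm c h \<alpha> = (LINT x|lborel. weight c h x * (norm (coeff01 A c \<alpha> x))\<^sup>2)"

definition sq_norm :: "'a form1 \<Rightarrow> real" where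
  "sq_norm \<alpha> = 2 * (\<Sum>(c, h)\<in>pou. loc_norm c h \<alpha>)"

lemma weight_nonneg: "(c, h) \<in> pou \<Longrightarrow> 0 \<le> weight c h x"
  using pou_mem(3) by (simp add: weight_def)

lemma weight_integrand:
  "indicator (img c) x *\<^sub>R (complex_of_real (h (param c x)) * (z * cnj z)) = of_real (weight c h x * (norm z)\<^sup>2)"
  by (simp add: weight_def complex_norm_square[symmetric] scaleR_conv_of_real)

lemma loc_norm_integrable:
  assumes "\<alpha> \<in> L2" "(c, h) \<in> pou"
  shows "integrable lborel (\<lambda>x. weight c h x * (norm (coeff01 A c \<alpha> x))\<^sup>2)"
  using L2_pou_integrable[OF assms] unfolding set_integrable_def weight_integrand complex_of_real_integrable_eq .

lemma form_ip_self: "form_ip \<alpha> \<alpha> = of_real (sq_norm \<alpha>)"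
  unfolding form_ip_def set_lebesgue_integral_def weight_integrand sq_norm_def loc_norm_def
  by (simp only: integral_complex_of_real case_prod_unfold of_real_mult[of 2] of_real_sum of_real_numeral)

lemma loc_norm_nonneg: "(c, h) \<in> pou \<Longrightarrow> 0 \<le> loc_norm c h \<alpha>"
  unfolding loc_norm_def by (intro integral_nonneg_AE AE_I2 mult_nonneg_nonneg weight_nonneg) auto

lemma sq_norm_nonneg: "0 \<le> sq_norm \<alpha>"
  unfolding sq_norm_def using loc_norm_nonneg by (intro mult_nonneg_nonneg sum_nonneg) auto

lemma loc_norm_le: assumes "(c, h) \<in> pou" shows "loc_norm c h \<alpha> \<le> sq_norm \<alpha>"
proof -
  have "(\<lambda>(c, h). loc_norm c h \<alpha>) (c, h) \<le> (\<Sum>(c, h)\<in>pou. loc_norm c h \<alpha>)"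
    by (rule member_le_sum[OF assms]) (use loc_norm_nonneg finite_pou in auto)
  then have "2 * loc_norm c h \<alpha> \<le> sq_norm \<alpha>" by (simp add: sq_norm_def)
  then show ?thesis using loc_norm_nonneg[OF assms, of \<alpha>] by linarith
qed

lemma form_diff: "\<alpha> - \<beta> = (\<lambda>p v. 1 * \<alpha> p v + (- 1) * (\<beta> p v :: complex))"
  by (simp add: fun_eq_iff)

lemma L2_diff: "\<alpha> \<in> L2 \<Longrightarrow> \<beta> \<in> L2 \<Longrightarrow> \<alpha> - \<beta> \<in> L2"
  unfolding form_diff by (rule L2_lincomb)

lemma form_ip_diff:
  assumes "\<alpha> \<in> L2" "\<beta> \<in> L2" "\<gamma> \<in> L2"
  shows "form_ip (\<alpha> - \<beta>) \<gamma> = form_ip \<alpha> \<gamma> - form_ip \<beta> \<gamma>"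
  unfolding form_diff form_ip_lincomb[OF assms] by simp

lemma form_ip_lincomb2:
  assumes "\<alpha> \<in> L2" "\<beta> \<in> L2" "\<gamma> \<in> L2"
  shows "form_ip \<gamma> (\<lambda>p v. s * \<alpha> p v + t * \<beta> p v) = cnj s * form_ip \<gamma> \<alpha> + cnj t * form_ip \<gamma> \<beta>"
  unfolding form_ip_cnj[of \<gamma> "\<lambda>p v. s * \<alpha> p v + t * \<beta> p v"] form_ip_cnj[of \<gamma> \<alpha>] form_ip_cnj[of \<gamma> \<beta>]
    form_ip_lincomb[OF assms] by simp

lemma sq_norm_lincomb:
  assumes "\<alpha> \<in> L2" "\<beta> \<in> L2"
  shows "sq_norm (\<lambda>p v. 1 * \<alpha> p v + s * \<beta> p v) = sq_norm \<alpha> + 2 * Re (cnj s * form_ip \<alpha> \<beta>) + (norm s)\<^sup>2 * sq_norm \<beta>"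
proof -
  let ?g = "\<lambda>p v. 1 * \<alpha> p v + s * \<beta> p v"
  have g: "?g \<in> L2" by (rule L2_lincomb[OF assms])
  have "complex_of_real (sq_norm ?g) = form_ip ?g ?g" by (simp add: form_ip_self)
  also have "\<dots> = (form_ip \<alpha> \<alpha> + cnj s * form_ip \<alpha> \<beta>) + s * (form_ip \<beta> \<alpha> + cnj s * form_ip \<beta> \<beta>)"
    unfolding form_ip_lincomb[OF assms g] form_ip_lincomb2[OF assms assms(1)] form_ip_lincomb2[OF assms assms(2)] by simp
  also have "\<dots> = of_real (sq_norm \<alpha>) + (cnj s * form_ip \<alpha> \<beta> + cnj (cnj s * form_ip \<alpha> \<beta>)) + of_real ((norm s)\<^sup>2 * sq_norm \<beta>)"
    unfolding form_ip_cnj[of \<beta> \<alpha>] form_ip_self of_real_mult complex_norm_square by (simp add: algebra_simps)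
  also have "cnj s * form_ip \<alpha> \<beta> + cnj (cnj s * form_ip \<alpha> \<beta>) = of_real (2 * Re (cnj s * form_ip \<alpha> \<beta>))"
    by (rule complex_add_cnj)
  finally have "complex_of_real (sq_norm ?g) = of_real (sq_norm \<alpha> + 2 * Re (cnj s * form_ip \<alpha> \<beta>) + (norm s)\<^sup>2 * sq_norm \<beta>)"
    by simp
  then show ?thesis by (simp only: of_real_eq_iff)
qed

text \<open>The perturbation is a real multiple \<open>- t\<close> of
  \<open>form_ip \<alpha> \<beta>\<close>, the phase that lowers the norm fastest. It serves both
  Cauchy-Schwarz and the estimate for minimising sequences.\<close>

lemma sq_norm_perturb:
  assumes "\<alpha> \<in> L2" "\<beta> \<in> L2"
  shows "sq_norm (\<lambda>p v. 1 * \<alpha> p v + (- of_real t * form_ip \<alpha> \<beta>) * \<beta> p v) =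
    sq_norm \<alpha> - 2 * t * (norm (form_ip \<alpha> \<beta>))\<^sup>2 + t\<^sup>2 * (norm (form_ip \<alpha> \<beta>))\<^sup>2 * sq_norm \<beta>"
proof -
  have eq: "cnj (- of_real t * form_ip \<alpha> \<beta>) * form_ip \<alpha> \<beta> = of_real (- t * (norm (form_ip \<alpha> \<beta>))\<^sup>2)"
  proof -
    have "cnj (- of_real t * z) * z = of_real (- t * (norm z)\<^sup>2)" for z
      by (simp only: of_real_mult complex_norm_square complex_cnj_mult complex_cnj_minus complex_cnj_complex_of_real
          of_real_minus) (simp add: mult_ac)
    then show ?thesis .
  qed
  show ?thesis
    unfolding sq_norm_lincomb[OF assms] eq by (simp add: norm_mult power_mult_distrib)
qed

lemma form_ip_cauchy_schwarz:
  assumes "\<alpha> \<in> L2" "\<beta> \<in> L2"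
  shows "(norm (form_ip \<alpha> \<beta>))\<^sup>2 \<le> sq_norm \<alpha> * sq_norm \<beta>"
proof -
  let ?z = "(norm (form_ip \<alpha> \<beta>))\<^sup>2"
  have *: "0 \<le> sq_norm \<alpha> - 2 * t * ?z + t\<^sup>2 * ?z * sq_norm \<beta>" for t
    using sq_norm_nonneg unfolding sq_norm_perturb[OF assms, of t, symmetric] .
  show ?thesis
  proof (cases "sq_norm \<beta> = 0")
    \<comment> \<open>Forms are not identified almost everywhere, so \<open>sq_norm\<close> is a
      seminorm. For a null \<open>\<beta>\<close> the quadratic in \<open>t\<close> degenerates to a
      line, and a large \<open>t\<close> rules out a nonzero product.\<close>
    case True
    have "?z = 0"
    proof (rule ccontr)
      assume "?z \<noteq> 0"
      then have "?z > 0" by simp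
      have "2 * ((sq_norm \<alpha> + 1) / ?z) * ?z = 2 * (sq_norm \<alpha> + 1)" using \<open>?z \<noteq> 0\<close> by simp
      moreover have "0 \<le> sq_norm \<alpha> - 2 * ((sq_norm \<alpha> + 1) / ?z) * ?z"
        using *[of "(sq_norm \<alpha> + 1) / ?z"] unfolding True by simp
      ultimately have "0 \<le> sq_norm \<alpha> - 2 * (sq_norm \<alpha> + 1)" by (simp only:)
      then show False using sq_norm_nonneg[of \<alpha>] by simp
    qed
    then show ?thesis using True by simp
  next
    case False
    then have p: "sq_norm \<beta> > 0" using sq_norm_nonneg[of \<beta>] by linarith
    have "0 \<le> sq_norm \<alpha> - ?z / sq_norm \<beta>"
      using *[of "1 / sq_norm \<beta>"] p by (simp add: field_simps power2_eq_square)
    then show ?thesis using p by (simp add: field_simps)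
  qed
qed

lemma sq_norm_diff_commute: "sq_norm (\<alpha> - \<beta>) = sq_norm (\<beta> - \<alpha>)"
proof -
  have "coeff01 A c (\<alpha> - \<beta>) x = - coeff01 A c (\<beta> - \<alpha>) x" for c x by (simp add: coeff01_def)
  then show ?thesis by (simp add: sq_norm_def loc_norm_def)
qed

lemma weight_measurable:
  assumes "(c, h) \<in> pou" shows "weight c h \<in> borel_measurable borel"
proof -
  have "(\<lambda>x. Re (indicator (img c) x *\<^sub>R complex_of_real (h (param c x)))) \<in> borel_measurable lborel"
    using pou_measurable[OF pou_mem(2,1)[OF assms]] unfolding set_borel_measurable_def
    by (rule measurable_compose) (intro borel_measurable_continuous_onI continuous_intros)
  then show ?thesis by (simp add: weight_def[abs_def])
qed

lemma weight_coeff_measurable: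
  assumes ch: "(c, h) \<in> pou" and m: "\<omega> \<in> measurable_forms"
  shows "(\<lambda>x. weight c h x * (norm (coeff01 A c \<omega> x))\<^sup>2) \<in> borel_measurable borel"
proof -
  have [measurable]: "(\<lambda>x. indicator (img c) x *\<^sub>R coeff01 A c \<omega> x) \<in> borel_measurable borel"
    using coeff_measurable[OF m pou_mem(1)[OF ch]] by (simp add: set_borel_measurable_def)
  have [measurable]: "weight c h \<in> borel_measurable borel" by (rule weight_measurable[OF ch])
  have "(\<lambda>x. weight c h x * (norm (indicator (img c) x *\<^sub>R coeff01 A c \<omega> x))\<^sup>2) \<in> borel_measurable borel"
    by measurable
  also have "(\<lambda>x. weight c h x * (norm (indicator (img c) x *\<^sub>R coeff01 A c \<omega> x))\<^sup>2) =
      (\<lambda>x. weight c h x * (norm (coeff01 A c \<omega> x))\<^sup>2)"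
    by (auto simp: fun_eq_iff weight_def indicator_def)
  finally show ?thesis .
qed

lemma nn_loc_norm:
  assumes "\<alpha> \<in> L2" "(c, h) \<in> pou"
  shows "(\<integral>\<^sup>+x. ennreal (weight c h x * (norm (coeff01 A c \<alpha> x))\<^sup>2) \<partial>lborel) = ennreal (loc_norm c h \<alpha>)"
  unfolding loc_norm_def
  by (rule nn_integral_eq_integral[OF loc_norm_integrable[OF assms]]) (use weight_nonneg[OF assms(2)] in simp)

lemma L2I_nn:
  assumes m: "\<omega> \<in> measurable_forms"
    and b: "\<And>c h. (c, h) \<in> pou \<Longrightarrow> (\<integral>\<^sup>+x. ennreal (weight c h x * (norm (coeff01 A c \<omega> x))\<^sup>2) \<partial>lborel) \<le> ennreal B"
    and B: "0 \<le> B"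
  shows "\<omega> \<in> L2" and "sq_norm \<omega> \<le> 2 * real (card pou) * B"
proof -
  have i: "integrable lborel (\<lambda>x. weight c h x * (norm (coeff01 A c \<omega> x))\<^sup>2)" if ch: "(c, h) \<in> pou" for c h
  proof (rule integrableI_bounded)
    have "norm (weight c h x * (norm (coeff01 A c \<omega> x))\<^sup>2) = weight c h x * (norm (coeff01 A c \<omega> x))\<^sup>2" for x
      using weight_nonneg[OF ch, of x] by (simp add: abs_mult)
    then show "(\<integral>\<^sup>+x. ennreal (norm (weight c h x * (norm (coeff01 A c \<omega> x))\<^sup>2)) \<partial>lborel) < \<infinity>"
      using b[OF ch] by (simp add: ennreal_less_top le_less_trans)
  qed (use weight_coeff_measurable[OF ch m] in simp)
  show L: "\<omega> \<in> L2"
  proof (rule measurable_L2I(1)[OF m])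
    fix c h assume ch: "(c, h) \<in> pou"
    show "set_integrable lborel (img c) (\<lambda>x. of_real (h (param c x)) * (coeff01 A c \<omega> x * cnj (coeff01 A c \<omega> x)))"
      unfolding set_integrable_def weight_integrand complex_of_real_integrable_eq by (rule i[OF ch])
  qed
  have "loc_norm c h \<omega> \<le> B" if ch: "(c, h) \<in> pou" for c h
    using b[OF ch] nn_loc_norm[OF L ch] B by simp
  then have "(\<Sum>(c, h)\<in>pou. loc_norm c h \<omega>) \<le> (\<Sum>(c, h)\<in>pou. B)"
    by (intro sum_mono) auto
  then show "sq_norm \<omega> \<le> 2 * real (card pou) * B" by (simp add: sq_norm_def case_prod_unfold)
qed

text \<open>The limit is formed with the single number \<open>Y k p 1\<close> that determines a
  (0,1)-covector, so one formula works on the whole curve. Where the sequence diverges the value 0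
  keeps the type and the measurability.\<close>

lemma pointwise_limit_form:
  assumes Y: "\<And>k. Y k \<in> measurable_forms"
  defines "\<omega> \<equiv> \<lambda>p v. (if convergent (\<lambda>k. Y k p 1) then lim (\<lambda>k. Y k p 1) else 0) * cnj v"
  shows "\<omega> \<in> measurable_forms"
    and "c \<in> charts A \<Longrightarrow> x \<in> img c \<Longrightarrow> convergent (\<lambda>k. coeff01 A c (Y k) x) \<Longrightarrow>
      (\<lambda>k. coeff01 A c (Y k) x) \<longlonglongrightarrow> coeff01 A c \<omega> x"
proof -
  have Yc: "coeff01 A c (Y k) x = Y k (param c x) 1 * cnj (frame c x)" for c k x
  proof -
    obtain w where "\<And>v. Y k (param c x) v = w * cnj v"
      using type01_measurable[OF Y[of k], of "param c x"] unfolding type01_def by blast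
    then show ?thesis by (simp add: coeff01_eq)
  qed
  have conv: "convergent (\<lambda>k. coeff01 A c (Y k) x) \<longleftrightarrow> convergent (\<lambda>k. Y k (param c x) 1)"
    if "c \<in> charts A" "x \<in> img c" for c x
    unfolding Yc using frame_nonzero[OF that] by (simp add: convergent_mult_const_right_iff)
  have l: "(\<lambda>k. coeff01 A c (Y k) x) \<longlonglongrightarrow> coeff01 A c \<omega> x"
    if "c \<in> charts A" "x \<in> img c" "convergent (\<lambda>k. coeff01 A c (Y k) x)" for c x
  proof -
    have cv: "convergent (\<lambda>k. Y k (param c x) 1)" using conv that by blast
    then have "(\<lambda>k. Y k (param c x) 1) \<longlonglongrightarrow> lim (\<lambda>k. Y k (param c x) 1)" by (simp add: convergent_LIMSEQ_iff)
    then have "(\<lambda>k. Y k (param c x) 1 * cnj (frame c x)) \<longlonglongrightarrow> lim (\<lambda>k. Y k (param c x) 1) * cnj (frame c x)"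
      by (intro tendsto_mult tendsto_const)
    then show ?thesis using cv unfolding Yc by (simp add: coeff01_eq \<omega>_def)
  qed
  then show "c \<in> charts A \<Longrightarrow> x \<in> img c \<Longrightarrow> convergent (\<lambda>k. coeff01 A c (Y k) x) \<Longrightarrow>
      (\<lambda>k. coeff01 A c (Y k) x) \<longlonglongrightarrow> coeff01 A c \<omega> x" .
  have "set_borel_measurable lborel (img c) (coeff01 A c \<omega>)" if c: "c \<in> charts A" for c
  proof -
    let ?f = "\<lambda>k x. indicator (img c) x *\<^sub>R coeff01 A c (Y k) x"
    have f[measurable]: "?f k \<in> borel_measurable lborel" for k
      using coeff_measurable[OF Y c] by (simp add: set_borel_measurable_def)
    have C: "{x \<in> space lborel. Cauchy (\<lambda>k. ?f k x)} \<in> sets lborel"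
      by (rule sets_Collect_Cauchy) (rule f)
    have L: "(\<lambda>x. lim (\<lambda>k. ?f k x)) \<in> borel_measurable lborel"
      by (rule borel_measurable_lim_metric) (rule f)
    have "(\<lambda>x. if x \<in> {x \<in> space lborel. Cauchy (\<lambda>k. ?f k x)} then lim (\<lambda>k. ?f k x) else 0) \<in> borel_measurable lborel"
      by (rule measurable_If_set[OF L]) (use C in auto)
    also have "(\<lambda>x. if x \<in> {x \<in> space lborel. Cauchy (\<lambda>k. ?f k x)} then lim (\<lambda>k. ?f k x) else 0) =
      (\<lambda>x. indicator (img c) x *\<^sub>R coeff01 A c \<omega> x)"
    proof
      fix x
      show "(if x \<in> {x \<in> space lborel. Cauchy (\<lambda>k. ?f k x)} then lim (\<lambda>k. ?f k x) else 0) = indicator (img c) x *\<^sub>R coeff01 A c \<omega> x"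
      proof (cases "x \<in> img c")
        case True
        show ?thesis
        proof (cases "convergent (\<lambda>k. coeff01 A c (Y k) x)")
          case cv: True
          then have "Cauchy (\<lambda>k. coeff01 A c (Y k) x)" by (simp add: Cauchy_convergent_iff)
          then show ?thesis using True limI[OF l[OF c True cv]] by simp
        next
          case False
          then have "\<not> Cauchy (\<lambda>k. coeff01 A c (Y k) x)" by (simp add: Cauchy_convergent_iff)
          then show ?thesis using True False conv[OF c True] by (simp add: coeff01_eq \<omega>_def)
        qed
      qed simp
    qed
    finally show ?thesis by (simp add: set_borel_measurable_def)
  qed
  moreover have "type01 (\<omega> p)" for p unfolding type01_def \<omega>_def by blast
  ultimately show "\<omega> \<in> measurable_forms" by (simp add: measurable_forms_def)
qed

lemma measurable_forms_diff:
  assumes "\<alpha> \<in> measurable_forms" "\<beta> \<in> measurable_forms"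
  shows "\<alpha> - \<beta> \<in> measurable_forms"
proof -
  have "set_borel_measurable lborel (img c) (coeff01 A c (\<alpha> - \<beta>))" if c: "c \<in> charts A" for c
  proof -
    have "(\<lambda>x. indicator (img c) x *\<^sub>R coeff01 A c \<alpha> x - indicator (img c) x *\<^sub>R coeff01 A c \<beta> x) \<in> borel_measurable lborel"
      using coeff_measurable[OF assms(1) c] coeff_measurable[OF assms(2) c]
      unfolding set_borel_measurable_def by (rule borel_measurable_diff)
    then show ?thesis by (simp add: set_borel_measurable_def coeff01_def[abs_def] scaleR_diff_right)
  qed
  moreover have "type01 ((\<alpha> - \<beta>) p)" for p
    unfolding form_diff using type01_lincomb assms type01_measurable by blast
  ultimately show ?thesis by (simp add: measurable_forms_def)
qed

text \<open>A rapidly Cauchy subsequence converges almost everywhere on each positive weight, and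
  Fatou's lemma bounds the distance of every late \<open>X m\<close> to the limit form. This covers
  the full sequence, not just the subsequence.\<close>

theorem L2_complete:
  fixes X :: "nat \<Rightarrow> 'a form1"
  assumes X: "\<And>n. X n \<in> L2"
    and Cauchy: "\<And>e. e > 0 \<Longrightarrow> \<exists>N. \<forall>m\<ge>N. \<forall>n\<ge>N. sq_norm (X m - X n) < e"
  shows "\<exists>\<omega>\<in>L2. \<forall>e>0. \<exists>N. \<forall>n\<ge>N. sq_norm (X n - \<omega>) < e"
proof -
  have "\<exists>r :: nat \<Rightarrow> nat. strict_mono r \<and> (\<forall>k. \<forall>m\<ge>r k. \<forall>n\<ge>r k. sq_norm (X m - X n) < (1 / 4) ^ k)"
  proof -
    obtain R :: "nat \<Rightarrow> nat" where R: "\<And>k m n. m \<ge> R k \<Longrightarrow> n \<ge> R k \<Longrightarrow> sq_norm (X m - X n) < (1 / 4) ^ k"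
    proof -
      have "\<forall>k. \<exists>N. \<forall>m\<ge>N. \<forall>n\<ge>N. sq_norm (X m - X n) < (1 / 4) ^ k"
        using Cauchy by simp
      from choice[OF this] show ?thesis using that by blast
    qed
    \<comment> \<open>Summing the thresholds and adding \<open>k\<close> makes the indices strictly
      increasing while keeping them above \<open>R k\<close>.\<close>
    let ?r = "\<lambda>k::nat. (\<Sum>j\<le>k. R j) + k"
    have "strict_mono ?r" by (rule strict_mono_Suc_iff[THEN iffD2]) simp
    moreover have "R k \<le> ?r k" for k using member_le_sum[of k "{..k}" R] by simp
    then have "\<forall>k. \<forall>m\<ge>?r k. \<forall>n\<ge>?r k. sq_norm (X m - X n) < (1 / 4) ^ k"
      using R order_trans by blast
    ultimately show ?thesis by blast
  qed
  then obtain r where r: "strict_mono r" "\<And>k m n. m \<ge> r k \<Longrightarrow> n \<ge> r k \<Longrightarrow> sq_norm (X m - X n) < (1 / 4) ^ k"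
    by blast
  define Y where "Y k = X (r k)" for k
  have YL: "Y k \<in> L2" for k by (simp add: Y_def X)
  then have Ym: "Y k \<in> measurable_forms" for k by (rule L2_measurable)
  have Yf: "sq_norm (Y (Suc k) - Y k) < (1 / 4) ^ k" for k
    unfolding Y_def using r by (intro r(2)) (auto simp: strict_mono_less_eq)
  define \<omega> where "\<omega> = (\<lambda>p v. (if convergent (\<lambda>k. Y k p 1) then lim (\<lambda>k. Y k p 1) else 0) * cnj v)"
  have \<omega>m: "\<omega> \<in> measurable_forms"
    and \<omega>l: "\<And>c x. c \<in> charts A \<Longrightarrow> x \<in> img c \<Longrightarrow> convergent (\<lambda>k. coeff01 A c (Y k) x) \<Longrightarrow>
      (\<lambda>k. coeff01 A c (Y k) x) \<longlonglongrightarrow> coeff01 A c \<omega> x"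
    unfolding \<omega>_def by (rule pointwise_limit_form[OF Ym]; assumption)+
  have ae: "AE x in lborel. weight c h x > 0 \<longrightarrow> (\<lambda>k. coeff01 A c (Y k) x) \<longlonglongrightarrow> coeff01 A c \<omega> x"
    if ch: "(c, h) \<in> pou" for c h
  proof -
    have c: "c \<in> charts A" by (rule pou_mem(1)[OF ch])
    have [measurable]: "weight c h \<in> borel_measurable borel" by (rule weight_measurable[OF ch])
    let ?f = "\<lambda>k x. indicator (img c) x *\<^sub>R coeff01 A c (Y k) x"
    \<comment> \<open>In the weighted measure the increments have norm \<open>loc_norm\<close>.
      Convergence is obtained where the weight is positive, and elsewhere the integrand is
      0.\<close>
    let ?M = "density lborel (\<lambda>x. ennreal (weight c h x))"
    have f: "?f k \<in> borel_measurable lborel" for k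
      using coeff_measurable[OF Ym c] by (simp add: set_borel_measurable_def)
    have [measurable]: "?f k \<in> borel_measurable borel" for k using f by simp
    have "AE x in ?M. convergent (\<lambda>k. ?f k x)"
    proof (rule AE_convergent_of_fast_Cauchy)
      show "?f k \<in> borel_measurable ?M" for k using f by simp
      fix k
      have "(\<integral>\<^sup>+x. ennreal ((norm (?f (Suc k) x - ?f k x))\<^sup>2) \<partial>?M)
        = (\<integral>\<^sup>+x. ennreal (weight c h x) * ennreal ((norm (?f (Suc k) x - ?f k x))\<^sup>2) \<partial>lborel)"
        by (subst nn_integral_density) auto
      also have "\<dots> = (\<integral>\<^sup>+x. ennreal (weight c h x * (norm (coeff01 A c (Y (Suc k) - Y k) x))\<^sup>2) \<partial>lborel)"
        using weight_nonneg[OF ch]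
        by (intro nn_integral_cong) (auto simp: weight_def indicator_def coeff01_def simp flip: ennreal_mult)
      also have "\<dots> = ennreal (loc_norm c h (Y (Suc k) - Y k))"
        by (rule nn_loc_norm[OF L2_diff[OF YL YL] ch])
      also have "\<dots> \<le> ennreal ((1 / 4) ^ k)"
        using loc_norm_le[OF ch, of "Y (Suc k) - Y k"] Yf[of k] by (intro ennreal_leI) linarith
      finally show "(\<integral>\<^sup>+x. ennreal ((norm (?f (Suc k) x - ?f k x))\<^sup>2) \<partial>?M) \<le> ennreal ((1 / 4) ^ k)" .
    qed
    then have "AE x in lborel. 0 < ennreal (weight c h x) \<longrightarrow> convergent (\<lambda>k. ?f k x)"
      by (subst (asm) AE_density) auto
    then show ?thesis
    proof eventually_elim
      case (elim x)
      show ?case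
      proof
        assume w: "weight c h x > 0"
        then have x: "x \<in> img c" by (cases "x \<in> img c") (auto simp: weight_def)
        then have "convergent (\<lambda>k. coeff01 A c (Y k) x)" using elim w by simp
        then show "(\<lambda>k. coeff01 A c (Y k) x) \<longlonglongrightarrow> coeff01 A c \<omega> x" by (rule \<omega>l[OF c x])
      qed
    qed
  qed
  have key: "X m - \<omega> \<in> L2 \<and> sq_norm (X m - \<omega>) \<le> 2 * real (card pou) * (1 / 4) ^ k" if m: "m \<ge> r k" for m k
  proof -
    have b: "(\<integral>\<^sup>+x. ennreal (weight c h x * (norm (coeff01 A c (X m - \<omega>) x))\<^sup>2) \<partial>lborel) \<le> ennreal ((1 / 4) ^ k)"
      if ch: "(c, h) \<in> pou" for c h
    proof -
      let ?u = "\<lambda>j x. ennreal (weight c h x * (norm (coeff01 A c (X m - Y j) x))\<^sup>2)"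
      have "(\<integral>\<^sup>+x. ennreal (weight c h x * (norm (coeff01 A c (X m - \<omega>) x))\<^sup>2) \<partial>lborel) \<le> (\<integral>\<^sup>+x. liminf (\<lambda>j. ?u j x) \<partial>lborel)"
      proof (rule nn_integral_mono_AE)
        show "AE x in lborel. ennreal (weight c h x * (norm (coeff01 A c (X m - \<omega>) x))\<^sup>2) \<le> liminf (\<lambda>j. ?u j x)"
          using ae[OF ch]
        proof eventually_elim
          case (elim x)
          show ?case
          proof (cases "weight c h x > 0")
            case True
            have "(\<lambda>j. ?u j x) \<longlonglongrightarrow> ennreal (weight c h x * (norm (coeff01 A c (X m - \<omega>) x))\<^sup>2)"
              using elim True unfolding coeff01_def
              by (intro tendsto_intros tendsto_ennrealI) (auto intro!: tendsto_intros)
            then show ?thesis by (simp add: lim_imp_Liminf)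
          next
            case False
            then have "weight c h x = 0" using weight_nonneg[OF ch, of x] by linarith
            then show ?thesis by simp
          qed
        qed
      qed
      also have "\<dots> \<le> liminf (\<lambda>j. \<integral>\<^sup>+x. ?u j x \<partial>lborel)"
        by (rule nn_integral_liminf)
          (use weight_coeff_measurable[OF ch measurable_forms_diff[OF L2_measurable[OF X] Ym]] in simp)
      also have "\<dots> \<le> ennreal ((1 / 4) ^ k)"
      proof -
        have "\<forall>\<^sub>F j in sequentially. (\<integral>\<^sup>+x. ?u j x \<partial>lborel) \<le> ennreal ((1 / 4) ^ k)"
          using eventually_ge_at_top[of k]
        proof eventually_elim
          case (elim j)
          have "sq_norm (X m - Y j) < (1 / 4) ^ k"
            unfolding Y_def using m elim r(1) by (intro r(2)) (auto simp: strict_mono_less_eq)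
          then have "loc_norm c h (X m - Y j) \<le> (1 / 4) ^ k"
            using loc_norm_le[OF ch, of "X m - Y j"] by linarith
          then show ?case using nn_loc_norm[OF L2_diff[OF X YL] ch] by (simp add: ennreal_leI)
        qed
        then show ?thesis by (intro Liminf_le) (auto elim: eventually_mono)
      qed
      finally show ?thesis .
    qed
    show ?thesis
      using L2I_nn[OF measurable_forms_diff[OF L2_measurable[OF X] \<omega>m] b] by simp
  qed
  have "\<omega> = X (r 0) - (X (r 0) - \<omega>)" by (simp add: fun_eq_iff)
  then have \<omega>L: "\<omega> \<in> L2" using L2_diff[OF X, of "X (r 0) - \<omega>" "r 0"] key[of 0 "r 0"] by auto
  have "\<exists>N. \<forall>n\<ge>N. sq_norm (X n - \<omega>) < e" if e: "e > 0" for e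
  proof -
    have "(\<lambda>k. 2 * real (card pou) * (1 / 4) ^ k) \<longlonglongrightarrow> 2 * real (card pou) * 0"
      by (intro tendsto_mult tendsto_const LIMSEQ_power_zero) simp
    then have "\<forall>\<^sub>F k in sequentially. 2 * real (card pou) * (1 / 4) ^ k < e"
      by (rule order_tendstoD) (use e in simp)
    then obtain k where "2 * real (card pou) * (1 / 4) ^ k < e" by (auto simp: eventually_sequentially)
    then show ?thesis using key le_less_trans by (intro exI[of _ "r k"]) blast
  qed
  with \<omega>L show ?thesis by blast
qed

end

section \<open>Harmonic forms\<close>

lemma negligible_AE_lborel:
  assumes "negligible S" shows "AE x in lborel. x \<notin> S"
proof -
  have "S \<in> null_sets lebesgue" using assms by (simp add: negligible_iff_null_sets)
  then have "AE x in lebesgue. x \<notin> S" by (rule AE_not_in)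
  then show ?thesis by (simp add: AE_completion_iff)
qed

context compact_curve
begin

lemma Cinf_lincomb:
  fixes f g :: "'a \<Rightarrow> complex"
  assumes "f \<in> Cinf A" "g \<in> Cinf A" shows "(\<lambda>p. s * f p + t * g p) \<in> Cinf A"
  unfolding Cinf_def
proof (intro CollectI ballI)
  fix c assume c: "c \<in> charts A"
  have "smooth_on (img c) (\<lambda>x. s * (f \<circ> param c) x + t * (g \<circ> param c) x)"
    by (intro smooth_on_add smooth_on_mult smooth_on_const charts_open c Cinf_smooth assms)
  then show "smooth_on (img c) ((\<lambda>p. s * f p + t * g p) \<circ> param c)" by (simp add: comp_def)
qed

lemma dbar_lincomb:
  assumes f: "f \<in> Cinf A" and g: "g \<in> Cinf A"
  shows "dbar A (\<lambda>p. s * f p + t * g p) = (\<lambda>p v. s * dbar A f p v + t * dbar A g p v)"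
proof (intro ext)
  fix p v
  let ?a = "chart_at A p" and ?x = "coord (chart_at A p) p"
  have x: "?x \<in> img ?a" using chart_param(4)[OF chart_at(3) chart_at(2)] .
  have df: "((f \<circ> param ?a) has_derivative frechet_derivative (f \<circ> param ?a) (at ?x)) (at ?x)"
    by (rule smooth_on_has_derivative[OF Cinf_smooth[OF f chart_at(3)] x])
  have dg: "((g \<circ> param ?a) has_derivative frechet_derivative (g \<circ> param ?a) (at ?x)) (at ?x)"
    by (rule smooth_on_has_derivative[OF Cinf_smooth[OF g chart_at(3)] x])
  have "((\<lambda>x. s * (f \<circ> param ?a) x + t * (g \<circ> param ?a) x) has_derivative
      (\<lambda>v. s * frechet_derivative (f \<circ> param ?a) (at ?x) v + t * frechet_derivative (g \<circ> param ?a) (at ?x) v)) (at ?x)"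
    by (intro has_derivative_add has_derivative_mult_right df dg)
  then have "frechet_derivative ((\<lambda>p. s * f p + t * g p) \<circ> param ?a) (at ?x) =
      (\<lambda>v. s * frechet_derivative (f \<circ> param ?a) (at ?x) v + t * frechet_derivative (g \<circ> param ?a) (at ?x) v)"
    unfolding comp_def by (rule frechet_derivative_at[symmetric])
  then show "dbar A (\<lambda>p. s * f p + t * g p) p v = s * dbar A f p v + t * dbar A g p v"
    unfolding dbar_def differential_def by (simp add: field_simps)
qed

lemma dbar_L2: "f \<in> Cinf A \<Longrightarrow> dbar A f \<in> L2"
  by (intro A01_L2 dbar_A01)

lemma zero_Cinf: "(\<lambda>p. 0 :: complex) \<in> Cinf A"
  by (simp add: Cinf_def comp_def)

definition dbar_closure :: "'a form1 set" where
  "dbar_closure = {\<omega> \<in> L2. \<forall>e>0. \<exists>f\<in>Cinf A. sq_norm (\<omega> - dbar A f) < e}"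

lemma norm2_triangle: "(norm (a + b))\<^sup>2 \<le> 2 * (norm a)\<^sup>2 + 2 * (norm b)\<^sup>2" for a b :: complex
proof -
  have "(norm (a + b))\<^sup>2 \<le> (norm a + norm b)\<^sup>2" by (intro power_mono norm_triangle_ineq) simp
  also have "\<dots> \<le> 2 * (norm a)\<^sup>2 + 2 * (norm b)\<^sup>2"
    using sum_squares_bound[of "norm a" "norm b"] by (simp add: power2_sum)
  finally show ?thesis .
qed

lemma small_imp_zero: "(\<And>e. e > 0 \<Longrightarrow> (norm z)\<^sup>2 \<le> B * e) \<Longrightarrow> z = 0" for z :: complex
proof (rule ccontr)
  assume h: "\<And>e. e > 0 \<Longrightarrow> (norm z)\<^sup>2 \<le> B * e" and "z \<noteq> 0"
  then have p: "(norm z)\<^sup>2 > 0" by simp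
  let ?e = "(norm z)\<^sup>2 / (2 * (\<bar>B\<bar> + 1))"
  have "(norm z)\<^sup>2 \<le> B * ?e" by (rule h) (use p in simp)
  also have "\<dots> \<le> (\<bar>B\<bar> + 1) * ?e" using p by (intro mult_right_mono) auto
  also have "\<dots> = (norm z)\<^sup>2 / 2" by (simp add: field_simps)
  finally show False using p by simp
qed

text \<open>Minimise the distance from \<open>u\<close> to the image of dbar. The parallelogram law
  makes a minimising sequence Cauchy, near minimality makes its remainders nearly orthogonal to the
  image, and both properties pass to the limit supplied by completeness.\<close>

theorem dbar_projection:
  assumes u: "u \<in> L2"
  shows "\<exists>v\<in>dbar_closure. \<forall>f\<in>Cinf A. form_ip (u - v) (dbar A f) = 0"
proof -
  let ?N = "\<lambda>f. sq_norm (u - dbar A f)"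
  define d where "d = Inf (?N ` Cinf A)"
  have bdd: "bdd_below (?N ` Cinf A)" using sq_norm_nonneg by (intro bdd_belowI[of _ 0]) auto
  have d_le: "d \<le> ?N f" if "f \<in> Cinf A" for f
    unfolding d_def using that bdd by (intro cInf_lower) auto
  have "\<exists>f. f \<in> Cinf A \<and> ?N f < d + 1 / real (Suc n)" for n
  proof -
    have "Inf (?N ` Cinf A) < d + 1 / real (Suc n)" by (simp add: d_def)
    then show ?thesis using zero_Cinf by (subst (asm) cInf_less_iff[OF _ bdd]) auto
  qed
  then obtain F where F: "\<And>n. F n \<in> Cinf A" "\<And>n. ?N (F n) < d + 1 / real (Suc n)" by metis
  have orth: "(norm (form_ip (u - dbar A (F n)) (dbar A f)))\<^sup>2 \<le> (sq_norm (dbar A f) + 1) * (1 / real (Suc n))"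
    if f: "f \<in> Cinf A" for f n
  proof -
    let ?a = "u - dbar A (F n)" and ?b = "dbar A f"
    let ?z = "form_ip ?a ?b"
    \<comment> \<open>A bound for \<open>sq_norm ?b\<close> that stays positive for null
      \<open>?b\<close>, so that the step size \<open>1 / B\<close> is defined.\<close>
    define B where "B = sq_norm ?b + 1"
    have B: "B > 0" "sq_norm ?b \<le> B" using sq_norm_nonneg[of ?b] by (auto simp: B_def)
    have ab: "?a \<in> L2" "?b \<in> L2"
      by (rule L2_diff[OF u dbar_L2[OF F(1)]]) (rule dbar_L2[OF f])
    let ?s = "- of_real (1 / B) * ?z"
    have eq: "(\<lambda>p v. 1 * ?a p v + ?s * ?b p v) = u - dbar A (\<lambda>p. 1 * F n p + (- ?s) * f p)"
      unfolding dbar_lincomb[OF F(1) f] by (simp add: fun_eq_iff algebra_simps)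
    have "d \<le> sq_norm (\<lambda>p v. 1 * ?a p v + ?s * ?b p v)"
      unfolding eq by (rule d_le[OF Cinf_lincomb[OF F(1) f]])
    also have "\<dots> = sq_norm ?a - 2 * (1 / B) * (norm ?z)\<^sup>2 + (1 / B)\<^sup>2 * (norm ?z)\<^sup>2 * sq_norm ?b"
      by (rule sq_norm_perturb[OF ab])
    also have "\<dots> \<le> sq_norm ?a - 2 * (1 / B) * (norm ?z)\<^sup>2 + (1 / B)\<^sup>2 * (norm ?z)\<^sup>2 * B"
      using B by (intro add_left_mono mult_left_mono) auto
    also have "\<dots> = sq_norm ?a - (norm ?z)\<^sup>2 / B"
      using B(1) by (simp add: field_simps power2_eq_square)
    finally have "(norm ?z)\<^sup>2 / B \<le> sq_norm ?a - d" by simp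
    also have "\<dots> \<le> 1 / real (Suc n)" using F(2)[of n] by linarith
    finally show ?thesis using B(1) unfolding B_def[symmetric] by (simp add: field_simps)
  qed
  have para: "sq_norm (dbar A (F m) - dbar A (F n)) \<le> 2 / real (Suc m) + 2 / real (Suc n)" for m n
  proof -
    let ?a = "u - dbar A (F m)" and ?b = "u - dbar A (F n)"
    have ab: "?a \<in> L2" "?b \<in> L2" by (rule L2_diff[OF u dbar_L2[OF F(1)]])+
    have "dbar A (F m) - dbar A (F n) = (\<lambda>p v. 1 * ?b p v + (- 1) * ?a p v)" by (simp add: fun_eq_iff)
    then have 1: "sq_norm (dbar A (F m) - dbar A (F n)) = sq_norm ?b - 2 * Re (form_ip ?b ?a) + sq_norm ?a"
      using sq_norm_lincomb[OF ab(2,1), of "-1"] by simp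
    \<comment> \<open>The midpoint of two approximants is again in the image, so its distance from
      \<open>u\<close> is at least \<open>d\<close>; this is the lower bound in the parallelogram
      argument.\<close>
    have eq: "(\<lambda>p v. (1 / 2) * ?b p v + (1 / 2) * ?a p v) = u - dbar A (\<lambda>p. (1 / 2) * F m p + (1 / 2) * F n p)"
      unfolding dbar_lincomb[OF F(1) F(1)] by (simp add: fun_eq_iff field_simps)
    have "d \<le> sq_norm (\<lambda>p v. (1 / 2) * ?b p v + (1 / 2) * ?a p v)"
      unfolding eq by (rule d_le[OF Cinf_lincomb[OF F(1) F(1)]])
    also have "\<dots> = (1 / 4) * (sq_norm ?b + 2 * Re (form_ip ?b ?a) + sq_norm ?a)"
    proof -
      let ?g = "\<lambda>p v. 1 * ?b p v + 1 * ?a p v"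
      have co: "coeff01 A c (\<lambda>p v. (1 / 2) * ?b p v + (1 / 2) * ?a p v) x = (1 / 2) * coeff01 A c ?g x" for c x
        by (simp add: coeff01_def field_simps)
      have ln: "loc_norm c h (\<lambda>p v. (1 / 2) * ?b p v + (1 / 2) * ?a p v) = (1 / 4) * loc_norm c h ?g" for c h
      proof -
        have "loc_norm c h (\<lambda>p v. (1 / 2) * ?b p v + (1 / 2) * ?a p v) =
            (\<integral>x. (1 / 4) * (weight c h x * (norm (coeff01 A c ?g x))\<^sup>2) \<partial>lborel)"
          unfolding loc_norm_def co by (intro Bochner_Integration.integral_cong refl) (simp add: norm_divide power_divide)
        also have "\<dots> = (1 / 4) * loc_norm c h ?g" unfolding loc_norm_def by (rule integral_mult_right_zero)
        finally show ?thesis .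
      qed
      then have "sq_norm (\<lambda>p v. (1 / 2) * ?b p v + (1 / 2) * ?a p v) = (1 / 4) * sq_norm ?g"
        unfolding sq_norm_def ln case_prod_unfold sum_distrib_left[symmetric] by (simp only: mult.left_commute)
      also have "sq_norm ?g = sq_norm ?b + 2 * Re (form_ip ?b ?a) + sq_norm ?a"
        using sq_norm_lincomb[OF ab(2,1), of 1] by simp
      finally show ?thesis .
    qed
    finally have "4 * d \<le> sq_norm ?b + 2 * Re (form_ip ?b ?a) + sq_norm ?a" by simp
    then show ?thesis unfolding 1 using F(2)[of m] F(2)[of n] by simp
  qed
  have lim: "\<exists>N. \<forall>n\<ge>N. 1 / real (Suc n) < e" if "e > 0" for e
    using order_tendstoD(2)[OF LIMSEQ_Suc[OF lim_1_over_n] that] by (simp add: eventually_sequentially)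
  have "\<exists>v\<in>L2. \<forall>e>0. \<exists>N. \<forall>n\<ge>N. sq_norm (dbar A (F n) - v) < e"
  proof (rule L2_complete)
    show "dbar A (F n) \<in> L2" for n by (rule dbar_L2[OF F(1)])
    fix e :: real assume "e > 0"
    then obtain N where N: "\<forall>n\<ge>N. 1 / real (Suc n) < e / 4" using lim[of "e / 4"] by auto
    have "sq_norm (dbar A (F m) - dbar A (F n)) < e" if "m \<ge> N" "n \<ge> N" for m n
      using para[of m n] N[rule_format, OF that(1)] N[rule_format, OF that(2)] by simp
    then show "\<exists>N. \<forall>m\<ge>N. \<forall>n\<ge>N. sq_norm (dbar A (F m) - dbar A (F n)) < e" by blast
  qed
  then obtain v where v: "v \<in> L2" "\<And>e. e > 0 \<Longrightarrow> \<exists>N. \<forall>n\<ge>N. sq_norm (dbar A (F n) - v) < e" by blast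
  have "v \<in> dbar_closure"
    unfolding dbar_closure_def using v F(1) sq_norm_diff_commute[of v] by auto (metis order_refl)
  moreover have "form_ip (u - v) (dbar A f) = 0" if f: "f \<in> Cinf A" for f
  proof (rule small_imp_zero[where B="2 * (sq_norm (dbar A f) + 1) + 2 * sq_norm (dbar A f)"])
    fix e :: real assume e: "e > 0"
    obtain N1 where N1: "\<forall>n\<ge>N1. 1 / real (Suc n) < e" using lim[OF e] by blast
    obtain N2 where N2: "\<forall>n\<ge>N2. sq_norm (dbar A (F n) - v) < e" using v(2)[OF e] by blast
    define n where "n = max N1 N2"
    have n: "1 / real (Suc n) < e" "sq_norm (dbar A (F n) - v) < e" using N1 N2 by (auto simp: n_def)
    have L: "u - dbar A (F n) \<in> L2" "dbar A (F n) - v \<in> L2" "dbar A f \<in> L2"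
      using u v(1) F(1) f dbar_L2 L2_diff by auto
    have "u - v = (\<lambda>p w. 1 * (u - dbar A (F n)) p w + 1 * (dbar A (F n) - v) p w)" by (simp add: fun_eq_iff)
    then have "form_ip (u - v) (dbar A f) = form_ip (u - dbar A (F n)) (dbar A f) + form_ip (dbar A (F n) - v) (dbar A f)"
      using form_ip_lincomb[OF L, of 1 1] by simp
    then have "(norm (form_ip (u - v) (dbar A f)))\<^sup>2 \<le>
        2 * (norm (form_ip (u - dbar A (F n)) (dbar A f)))\<^sup>2 + 2 * (norm (form_ip (dbar A (F n) - v) (dbar A f)))\<^sup>2"
      using norm2_triangle by simp
    also have "\<dots> \<le> 2 * ((sq_norm (dbar A f) + 1) * e) + 2 * (e * sq_norm (dbar A f))"
    proof (intro add_mono mult_left_mono)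
      show "(norm (form_ip (u - dbar A (F n)) (dbar A f)))\<^sup>2 \<le> (sq_norm (dbar A f) + 1) * e"
        by (rule order_trans[OF orth[OF f] mult_left_mono]) (use n sq_norm_nonneg[of "dbar A f"] in auto)
      show "(norm (form_ip (dbar A (F n) - v) (dbar A f)))\<^sup>2 \<le> e * sq_norm (dbar A f)"
        by (rule order_trans[OF form_ip_cauchy_schwarz[OF L(2,3)] mult_right_mono]) (use n sq_norm_nonneg in auto)
    qed auto
    finally show "(norm (form_ip (u - v) (dbar A f)))\<^sup>2 \<le> (2 * (sq_norm (dbar A f) + 1) + 2 * sq_norm (dbar A f)) * e"
      by (simp add: algebra_simps)
  qed
  ultimately show ?thesis by blast
qed

definition harmonic :: "'a form1 set" where
  "harmonic = {\<omega> \<in> L2. \<forall>f\<in>Cinf A. form_ip \<omega> (dbar A f) = 0}"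

lemma harmonic_L2: "\<omega> \<in> harmonic \<Longrightarrow> \<omega> \<in> L2"
  by (simp add: harmonic_def)

lemma harmonic_lincomb:
  assumes "\<alpha> \<in> harmonic" "\<beta> \<in> harmonic" shows "(\<lambda>p v. s * \<alpha> p v + t * \<beta> p v) \<in> harmonic"
  using assms form_ip_lincomb[of \<alpha> \<beta>] dbar_L2 L2_lincomb by (simp add: harmonic_def)

lemma harmonic_orth_closure:
  assumes h: "\<omega> \<in> harmonic" and v: "v \<in> dbar_closure"
  shows "form_ip \<omega> v = 0"
proof (rule small_imp_zero[where B="sq_norm \<omega>"])
  fix e :: real assume "e > 0"
  then obtain f where f: "f \<in> Cinf A" "sq_norm (v - dbar A f) < e" using v by (auto simp: dbar_closure_def)
  have L: "\<omega> \<in> L2" "v \<in> L2" "dbar A f \<in> L2" using h v f dbar_L2 by (auto simp: harmonic_def dbar_closure_def)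
  have "form_ip \<omega> (v - dbar A f) = form_ip \<omega> v"
    using form_ip_lincomb2[OF L(2,3,1), of 1 "-1"] h f by (simp add: form_diff harmonic_def)
  then have "(norm (form_ip \<omega> v))\<^sup>2 \<le> sq_norm \<omega> * sq_norm (v - dbar A f)"
    using form_ip_cauchy_schwarz[OF L(1) L2_diff[OF L(2,3)]] by simp
  also have "\<dots> \<le> sq_norm \<omega> * e" using f sq_norm_nonneg by (intro mult_left_mono) auto
  finally show "(norm (form_ip \<omega> v))\<^sup>2 \<le> sq_norm \<omega> * e" .
qed

text \<open>Being orthogonal to the image of \<open>\<partial>\<bar>\<close> means being weakly antiholomorphic in each chart.\<close>

lemma harmonic_weak:
  assumes h: "\<omega> \<in> harmonic" and c: "c \<in> charts A" and f: "f \<in> test_functions (img c)"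
  shows "(\<integral>y. coeff01 A c \<omega> y * ddz f y \<partial>lborel) = 0"
proof -
  let ?g = "\<lambda>z. cnj (f z)"
  have g: "?g \<in> test_functions (img c)" by (rule test_functions_cnj[OF f])
  have dg: "cnj (ddzbar ?g y) = ddz f y" for y
  proof -
    have "?g differentiable (at y)"
      using smooth_on_differentiable[OF test_functions_smooth[OF g]] by blast
    from ddz_cnj[OF this] show ?thesis by simp
  qed
  have "0 = form_ip \<omega> (form01_of_coeff A c (ddzbar ?g))"
    using h ext_fun_Cinf[OF c g] dbar_ext_fun[OF c g] by (auto simp: harmonic_def)
  also have "\<dots> = 2 * (\<integral>y. coeff01 A c \<omega> y * cnj (ddzbar ?g y) \<partial>lborel)"
    by (rule form_ip_form01[OF harmonic_L2[OF h] c test_functions_ddzbar[OF g]])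
  finally show ?thesis by (simp add: dg)
qed

lemma coeff_set_integrable:
  assumes w: "\<omega> \<in> L2" and c: "c \<in> charts A" and K: "compact K" "K \<subseteq> img c"
  shows "set_integrable lborel K (coeff01 A c \<omega>)"
proof -
  have "set_integrable lborel K (\<lambda>x. coeff01 A c \<omega> x * cnj 1)"
  proof (rule set_integrable_product)
    show "set_integrable lborel K (\<lambda>x. coeff01 A c \<omega> x * cnj (coeff01 A c \<omega> x))" using w c K by (auto simp: L2_def)
    show "set_integrable lborel K (\<lambda>x. 1 * cnj 1 :: complex)"
      unfolding set_integrable_def by (rule borel_integrable_compact[OF K(1)]) auto
    show "set_borel_measurable lborel K (coeff01 A c \<omega>)"
      by (rule set_borel_measurable_subset[OF coeff_measurable[OF L2_measurable[OF w] c] _ K(2)])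
        (use K in \<open>simp add: compact_imp_closed\<close>)
    show "set_borel_measurable lborel K (\<lambda>x. 1 :: complex)"
      unfolding set_borel_measurable_def using K by (auto simp: compact_imp_closed)
  qed
  then show ?thesis by simp
qed

lemma harmonic_reproduced_locally:
  assumes h: "\<omega> \<in> harmonic" and c: "c \<in> charts A" and k: "reproducing_kernel r k" and b: "cball x0 (2 * r) \<subseteq> img c"
  shows "\<exists>V. open V \<and> x0 \<in> V \<and> V \<subseteq> ball x0 r \<and>
    (AE x in lborel. x \<in> V \<longrightarrow> coeff01 A c \<omega> x = (\<integral>y. coeff01 A c \<omega> y * k (x - y) \<partial>lborel))"
  using k coeff_set_integrable[OF harmonic_L2[OF h] c compact_cball b] harmonic_weak[OF h c] b
  unfolding reproducing_kernel_def by blast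

text \<open>One kernel serves every centre in \<open>K\<close>, so the local almost-everywhere
  identities have the same form and a finite subcover glues them.\<close>

lemma harmonic_reproduced:
  assumes h: "\<omega> \<in> harmonic" and c: "c \<in> charts A" and k: "reproducing_kernel r k"
    and K: "compact K" "\<And>x. x \<in> K \<Longrightarrow> cball x (2 * r) \<subseteq> img c"
  shows "AE x in lborel. x \<in> K \<longrightarrow> coeff01 A c \<omega> x = (\<integral>y. coeff01 A c \<omega> y * k (x - y) \<partial>lborel)"
proof -
  let ?P = "\<lambda>x. coeff01 A c \<omega> x = (\<integral>y. coeff01 A c \<omega> y * k (x - y) \<partial>lborel)"
  obtain V where V: "\<And>x. x \<in> K \<Longrightarrow> open (V x)" "\<And>x. x \<in> K \<Longrightarrow> x \<in> V x" "\<And>x. x \<in> K \<Longrightarrow> AE y in lborel. y \<in> V x \<longrightarrow> ?P y"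
  proof -
    have "\<forall>x\<in>K. \<exists>V. open V \<and> x \<in> V \<and> V \<subseteq> ball x r \<and> (AE y in lborel. y \<in> V \<longrightarrow> ?P y)"
      using harmonic_reproduced_locally[OF h c k K(2)] by blast
    from bchoice[OF this] show ?thesis using that by blast
  qed
  obtain X where X: "X \<subseteq> K" "finite X" "K \<subseteq> (\<Union>x\<in>X. V x)"
    by (rule compactE_image[OF K(1), of K V]) (use V(1,2) in blast, use V(2) in blast, rule that)
  have "AE y in lborel. \<forall>x\<in>X. y \<in> V x \<longrightarrow> ?P y"
    using X V(3) by (intro AE_finite_allI) auto
  then show ?thesis by eventually_elim (use X(3) in blast)
qed

text \<open>Evaluation of harmonic forms is represented by forms of bounded norm.\<close>

lemma kernel_form:
  assumes k: "reproducing_kernel r k" and c: "c \<in> charts A" and x: "cball x (2 * r) \<subseteq> img c" and r: "0 < r"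
  defines "\<kappa> \<equiv> form01_of_coeff A c (\<lambda>y. cnj (k (x - y)))"
  shows "\<kappa> \<in> L2" "\<And>\<omega>. \<omega> \<in> L2 \<Longrightarrow> form_ip \<omega> \<kappa> = 2 * (\<integral>y. coeff01 A c \<omega> y * k (x - y) \<partial>lborel)"
    and "sq_norm \<kappa> = 2 * (\<integral>y. (norm (k y))\<^sup>2 \<partial>lborel)"
proof -
  have kt: "k \<in> test_functions (ball 0 r)" using k by (simp add: reproducing_kernel_def)
  have "(\<lambda>y. x - y) ` ball 0 r \<subseteq> img c"
  proof -
    have "(\<lambda>y. x - y) ` ball 0 r \<subseteq> cball x (2 * r)" using r by (auto simp: dist_norm)
    then show ?thesis using x by blast
  qed
  then have t: "(\<lambda>y. cnj (k (x - y))) \<in> test_functions (img c)"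
    by (intro test_functions_cnj test_functions_reflect_into[OF kt])
  show L: "\<kappa> \<in> L2" unfolding \<kappa>_def by (rule A01_L2[OF form01_A01[OF c t]])
  show ip: "form_ip \<omega> \<kappa> = 2 * (\<integral>y. coeff01 A c \<omega> y * k (x - y) \<partial>lborel)" if "\<omega> \<in> L2" for \<omega>
    unfolding \<kappa>_def using form_ip_form01[OF that c t] by simp
  have "complex_of_real (sq_norm \<kappa>) = 2 * (\<integral>y. coeff01 A c \<kappa> y * k (x - y) \<partial>lborel)"
    using ip[OF L] by (simp add: form_ip_self)
  also have "(\<integral>y. coeff01 A c \<kappa> y * k (x - y) \<partial>lborel) = (\<integral>y. complex_of_real ((norm (k (x - y)))\<^sup>2) \<partial>lborel)"
  proof (intro Bochner_Integration.integral_cong refl)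
    fix y
    show "coeff01 A c \<kappa> y * k (x - y) = complex_of_real ((norm (k (x - y)))\<^sup>2)"
    proof (cases "y \<in> img c")
      case True
      then show ?thesis unfolding \<kappa>_def coeff01_form01_same[OF c True] complex_norm_square by simp
    next
      case False
      then show ?thesis using test_functions_outside[OF t False] by simp
    qed
  qed
  also have "\<dots> = (\<integral>y. complex_of_real ((norm (k y))\<^sup>2) \<partial>lborel)"
    by (rule lborel_integral_reflect(1))
  also have "\<dots> = of_real (\<integral>y. (norm (k y))\<^sup>2 \<partial>lborel)" by (rule integral_complex_of_real)
  finally have "complex_of_real (sq_norm \<kappa>) = of_real (2 * (\<integral>y. (norm (k y))\<^sup>2 \<partial>lborel))" by simp
  then show "sq_norm \<kappa> = 2 * (\<integral>y. (norm (k y))\<^sup>2 \<partial>lborel)" by (simp only: of_real_eq_iff)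
qed

section \<open>Orthonormal families and finite dimension\<close>

definition form_sum :: "(nat \<Rightarrow> complex) \<Rightarrow> (nat \<Rightarrow> 'a form1) \<Rightarrow> nat \<Rightarrow> 'a form1" where
  "form_sum a e n = (\<lambda>p v. \<Sum>j<n. a j * e j p v)"

lemma form_sum_Suc: "form_sum a e (Suc n) = (\<lambda>p v. 1 * form_sum a e n p v + a n * e n p v)"
  by (simp add: form_sum_def)

lemma zero_harmonic: "(\<lambda>p v. 0) \<in> harmonic"
proof -
  have "dbar A (\<lambda>p. 0) \<in> L2" by (rule dbar_L2[OF zero_Cinf])
  from L2_lincomb[OF this this, of 0 0] have z: "(\<lambda>p v. 0) \<in> L2" by simp
  from form_ip_lincomb[OF z z, of _ 0 0] show ?thesis using z dbar_L2 by (simp add: harmonic_def)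
qed

lemma form_sum_harmonic: "(\<And>j. j < n \<Longrightarrow> e j \<in> harmonic) \<Longrightarrow> form_sum a e n \<in> harmonic"
proof (induction n)
  case 0 then show ?case by (simp add: form_sum_def zero_harmonic)
next
  case (Suc n) then show ?case unfolding form_sum_Suc by (intro harmonic_lincomb) auto
qed

lemma form_sum_L2: "(\<And>j. j < n \<Longrightarrow> e j \<in> L2) \<Longrightarrow> form_sum a e n \<in> L2"
proof (induction n)
  case 0 then show ?case using harmonic_L2[OF zero_harmonic] by (simp add: form_sum_def)
next
  case (Suc n) then show ?case unfolding form_sum_Suc by (intro L2_lincomb) auto
qed

lemma form_ip_sum:
  assumes "\<And>j. j < n \<Longrightarrow> e j \<in> L2" "\<gamma> \<in> L2"
  shows "form_ip (form_sum a e n) \<gamma> = (\<Sum>j<n. a j * form_ip (e j) \<gamma>)"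
  using assms(1)
proof (induction n)
  case 0
  have z: "(\<lambda>p v. 0) \<in> L2" by (rule harmonic_L2[OF zero_harmonic])
  from form_ip_lincomb[OF z z assms(2), of 0 0] show ?case by (simp add: form_sum_def)
next
  case (Suc n)
  have "form_sum a e n \<in> L2" "e n \<in> L2" using Suc.prems form_sum_L2[of n e] by auto
  from form_ip_lincomb[OF this assms(2), of 1 "a n"] show ?case
    unfolding form_sum_Suc using Suc by simp
qed

definition orthonormal :: "(nat \<Rightarrow> 'a form1) \<Rightarrow> nat \<Rightarrow> bool" where
  "orthonormal e n \<longleftrightarrow> (\<forall>j<n. e j \<in> L2) \<and> (\<forall>i<n. \<forall>j<n. form_ip (e i) (e j) = (if i = j then 1 else 0))"

lemma form_sum_ip_orthonormal:
  assumes e: "orthonormal e n" and j: "j < n"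
  shows "form_ip (form_sum a e n) (e j) = a j"
proof -
  have "form_ip (form_sum a e n) (e j) = (\<Sum>i<n. a i * form_ip (e i) (e j))"
    by (rule form_ip_sum) (use e j in \<open>auto simp: orthonormal_def\<close>)
  also have "\<dots> = (\<Sum>i<n. if i = j then a i else 0)"
    by (intro sum.cong) (use e j in \<open>auto simp: orthonormal_def\<close>)
  finally show ?thesis using j by simp
qed

lemma bessel:
  assumes e: "orthonormal e n" and u: "u \<in> L2"
  shows "(\<Sum>j<n. (norm (form_ip u (e j)))\<^sup>2) \<le> sq_norm u"
proof -
  let ?a = "\<lambda>j. form_ip u (e j)"
  let ?s = "form_sum ?a e n" and ?S = "\<Sum>j<n. (norm (?a j))\<^sup>2"
  have eL: "\<And>j. j < n \<Longrightarrow> e j \<in> L2" using e by (simp add: orthonormal_def)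
  have s: "?s \<in> L2" by (rule form_sum_L2[OF eL])
  have su: "form_ip ?s u = of_real ?S"
  proof -
    have "form_ip ?s u = (\<Sum>j<n. ?a j * form_ip (e j) u)" by (rule form_ip_sum[OF eL u])
    also have "\<dots> = of_real ?S"
      unfolding of_real_sum
      by (intro sum.cong refl) (simp only: complex_norm_square form_ip_cnj[of "e _" u])
    finally show ?thesis .
  qed
  then have us: "form_ip u ?s = of_real ?S" using form_ip_cnj[of u ?s] by simp
  have "form_ip ?s ?s = (\<Sum>j<n. ?a j * form_ip (e j) ?s)" by (rule form_ip_sum[OF eL s])
  also have "\<dots> = of_real ?S"
    unfolding of_real_sum
    by (intro sum.cong refl) (simp add: complex_norm_square form_ip_cnj[of "e _" ?s] form_sum_ip_orthonormal[OF e] del: of_real_power)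
  finally have ss: "sq_norm ?s = ?S" by (simp only: form_ip_self of_real_eq_iff)
  have "sq_norm (\<lambda>p v. 1 * u p v + (- 1) * ?s p v) = sq_norm u - 2 * ?S + ?S"
    unfolding sq_norm_lincomb[OF u s] us ss by simp
  then show ?thesis using sq_norm_nonneg[of "\<lambda>p v. 1 * u p v + (- 1) * ?s p v"] by linarith
qed

lemma pou_support:
  assumes "(c, h) \<in> pou"
  shows "\<exists>K. compact K \<and> K \<subseteq> img c \<and> (\<forall>x\<in>img c. x \<notin> K \<longrightarrow> h (param c x) = 0)"
proof -
  have c: "c \<in> charts A" by (rule pou_mem(1)[OF assms])
  let ?P = "closure {p. h p \<noteq> 0}"
  have "compact ?P" using compact_Int_closed[OF compact_UNIV, of ?P] by simp
  moreover have "continuous_on ?P (coord c)"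
    using charts_is_chart[OF c] pou_mem(4)[OF assms] by (auto simp: is_chart_def homeomorphism_def intro: continuous_on_subset)
  ultimately have "compact (coord c ` ?P)" by (rule compact_continuous_image[rotated])
  moreover have "coord c ` ?P \<subseteq> img c" using pou_mem(4)[OF assms] by (auto simp: img_def)
  moreover have "h (param c x) = 0" if "x \<in> img c" "x \<notin> coord c ` ?P" for x
  proof (rule ccontr)
    assume "h (param c x) \<noteq> 0"
    then have "param c x \<in> {p. h p \<noteq> 0}" by simp
    then have "param c x \<in> ?P" by (rule subsetD[OF closure_subset])
    then have "coord c (param c x) \<in> coord c ` ?P" by blast
    then show False using that chart_param(2)[OF c] by auto
  qed
  ultimately show ?thesis by blast
qed

text \<open>The coefficient of a harmonic form at \<open>x\<close> is its product with a kernel form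
  whose norm does not depend on \<open>x\<close>. Bessel's inequality bounds the sum of the squared
  coefficients of any orthonormal family at \<open>x\<close> independently of its length;
  integrating over the curve turns the sum into that length. The exceptional null sets are harmless
  because each family is finite.\<close>

theorem harmonic_finite_dim:
  "\<exists>B. \<forall>e n. orthonormal e n \<and> (\<forall>j<n. e j \<in> harmonic) \<longrightarrow> real n \<le> B"
proof -
  have "\<exists>B. \<forall>e n. orthonormal e n \<and> (\<forall>j<n. e j \<in> harmonic) \<longrightarrow> (\<Sum>j<n. loc_norm (fst t) (snd t) (e j)) \<le> B"
    if "t \<in> pou" for t
  proof -
    obtain c h where t: "t = (c, h)" by (rule prod.exhaust)
    have ch: "(c, h) \<in> pou" using that t by simp
    have c: "c \<in> charts A" by (rule pou_mem(1)[OF ch])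
    obtain K where K: "compact K" "K \<subseteq> img c" "\<And>x. x \<in> img c \<Longrightarrow> x \<notin> K \<Longrightarrow> h (param c x) = 0"
      using pou_support[OF ch] by blast
    obtain d where d0: "0 < d" "(\<Union>x\<in>K. ball x d) \<subseteq> img c"
      by (rule compact_subset_open_imp_ball_epsilon_subset[OF K(1) charts_open(2)[OF c] K(2)])
    have d: "0 < d" "\<And>x. x \<in> K \<Longrightarrow> ball x d \<subseteq> img c" using d0 by (auto simp only: UN_subset_iff)
    \<comment> \<open>Kernels of radius \<open>r\<close> need the closed ball of radius
      \<open>2 * r = d / 2\<close> inside the chart.\<close>
    define r where "r = d / 4"
    have r1: "0 < r" using d(1) by (simp add: r_def)
    have r2: "cball x (2 * r) \<subseteq> img c" if "x \<in> K" for x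
    proof -
      have "cball x (2 * r) \<subseteq> ball x d" using d(1) by (auto simp: r_def)
      then show ?thesis using d(2)[OF that] by blast
    qed
    note r = r1 r2
    obtain k where k: "reproducing_kernel r k" using ex_reproducing_kernel[OF r(1)] by blast
    define C where "C = (\<integral>y. (norm (k y))\<^sup>2 \<partial>lborel)"
    have C0: "0 \<le> C" unfolding C_def by (intro integral_nonneg_AE) auto
    have "(\<Sum>j<n. loc_norm c h (e j)) \<le> C * measure lborel K"
      if e: "orthonormal e n" "\<And>j. j < n \<Longrightarrow> e j \<in> harmonic" for e n
    proof -
      have eL: "e j \<in> L2" if "j < n" for j using e(2)[OF that] by (rule harmonic_L2)
      have "AE x in lborel. \<forall>j\<in>{..<n}. x \<in> K \<longrightarrow> coeff01 A c (e j) x = (\<integral>y. coeff01 A c (e j) y * k (x - y) \<partial>lborel)"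
        using harmonic_reproduced[OF e(2) c k K(1) r(2)] by (intro AE_finite_allI) auto
      then have ae: "AE x in lborel. (\<Sum>j<n. weight c h x * (norm (coeff01 A c (e j) x))\<^sup>2) \<le> C * indicator K x"
      proof eventually_elim
        case (elim x)
        show ?case
        proof (cases "x \<in> K")
          case True
          let ?\<kappa> = "form01_of_coeff A c (\<lambda>y. cnj (k (x - y)))"
          note kf = kernel_form[OF k c r(2)[OF True] r(1)]
          \<comment> \<open>The division by 2 undoes the factor 2 in \<open>form_ip\<close>.\<close>
          have nk: "norm (coeff01 A c (e j) x) = norm (form_ip ?\<kappa> (e j)) / 2" if "j < n" for j
            using elim True that kf(2)[OF eL[OF that]] form_ip_cnj[of ?\<kappa> "e j"] by (simp add: norm_mult)
          have "(\<Sum>j<n. (norm (coeff01 A c (e j) x))\<^sup>2) = (\<Sum>j<n. (norm (form_ip ?\<kappa> (e j)))\<^sup>2 / 4)"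
            by (intro sum.cong refl) (simp add: nk power_divide)
          also have "\<dots> = (\<Sum>j<n. (norm (form_ip ?\<kappa> (e j)))\<^sup>2) / 4" by (simp only: sum_divide_distrib)
          also have "\<dots> \<le> sq_norm ?\<kappa> / 4" using bessel[OF e(1) kf(1)] by simp
          also have "\<dots> \<le> C" unfolding kf(3) C_def[symmetric] using C0 by simp
          finally have S: "(\<Sum>j<n. (norm (coeff01 A c (e j) x))\<^sup>2) \<le> C" .
          have w: "0 \<le> weight c h x" "weight c h x \<le> 1"
            using weight_nonneg[OF ch] pou_le_1[OF ch] by (auto simp: weight_def indicator_def)
          have "weight c h x * (\<Sum>j<n. (norm (coeff01 A c (e j) x))\<^sup>2) \<le> 1 * C"
            using S w by (intro mult_mono) (auto intro: sum_nonneg)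
          then show ?thesis using True by (simp add: sum_distrib_left)
        next
          case False
          then have "weight c h x = 0" using K(3) by (auto simp: weight_def indicator_def)
          then show ?thesis using False by simp
        qed
      qed
      have iK: "integrable lborel (\<lambda>x. C * indicator K x :: real)"
        using K(1) emeasure_compact_finite[OF K(1)] by (intro integrable_mult_right integrable_real_indicator) (auto simp: compact_imp_closed)
      have ij: "integrable lborel (\<lambda>x. weight c h x * (norm (coeff01 A c (e j) x))\<^sup>2)" if "j \<in> {..<n}" for j
        using loc_norm_integrable[OF eL ch] that by simp
      have "(\<Sum>j<n. loc_norm c h (e j)) = (\<integral>x. (\<Sum>j<n. weight c h x * (norm (coeff01 A c (e j) x))\<^sup>2) \<partial>lborel)"
        unfolding loc_norm_def by (rule Bochner_Integration.integral_sum[symmetric]) (rule ij)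
      also have "\<dots> \<le> (\<integral>x. C * indicator K x \<partial>lborel)"
        by (rule integral_mono_AE[OF Bochner_Integration.integrable_sum[OF ij] iK ae])
      also have "\<dots> = C * measure lborel K" using K(1) by (simp add: compact_imp_closed)
      finally show ?thesis .
    qed
    then show ?thesis unfolding t fst_conv snd_conv by blast
  qed
  then have "\<forall>t\<in>pou. \<exists>B. \<forall>e n. orthonormal e n \<and> (\<forall>j<n. e j \<in> harmonic) \<longrightarrow> (\<Sum>j<n. loc_norm (fst t) (snd t) (e j)) \<le> B"
    by blast
  from bchoice[OF this] obtain B where B: "\<And>t e n. t \<in> pou \<Longrightarrow> orthonormal e n \<Longrightarrow> (\<forall>j<n. e j \<in> harmonic) \<Longrightarrow> (\<Sum>j<n. loc_norm (fst t) (snd t) (e j)) \<le> B t"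
    by blast
  have "real n \<le> 2 * (\<Sum>t\<in>pou. B t)" if e: "orthonormal e n" "\<forall>j<n. e j \<in> harmonic" for e n
  proof -
    have "sq_norm (e j) = 1" if "j < n" for j
    proof -
      have "complex_of_real (sq_norm (e j)) = of_real 1"
        using e(1) that form_ip_self[of "e j"] by (simp add: orthonormal_def)
      then show ?thesis by (simp only: of_real_eq_iff)
    qed
    then have "real n = (\<Sum>j<n. sq_norm (e j))" by simp
    also have "\<dots> = 2 * (\<Sum>t\<in>pou. \<Sum>j<n. loc_norm (fst t) (snd t) (e j))"
      unfolding sq_norm_def case_prod_unfold sum_distrib_left[symmetric] by (subst sum.swap) (rule refl)
    also have "\<dots> \<le> 2 * (\<Sum>t\<in>pou. B t)"
      using B e by (intro mult_left_mono sum_mono) auto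
    finally show ?thesis .
  qed
  then show ?thesis by blast
qed

text \<open>Take an orthonormal family of maximal length. A harmonic form whose residual had
  positive norm would, after normalising that residual, extend the family. Expansions therefore hold
  up to forms of norm 0.\<close>

theorem harmonic_basis:
  obtains e n where "orthonormal e n" "\<And>j. j < n \<Longrightarrow> e j \<in> harmonic"
    "\<And>\<omega>. \<omega> \<in> harmonic \<Longrightarrow> sq_norm (\<omega> - form_sum (\<lambda>j. form_ip \<omega> (e j)) e n) = 0"
proof -
  let ?P = "\<lambda>n. \<exists>e. orthonormal e n \<and> (\<forall>j<n. e j \<in> harmonic)"
  obtain B where B: "\<And>e n. orthonormal e n \<Longrightarrow> (\<forall>j<n. e j \<in> harmonic) \<Longrightarrow> real n \<le> B"
    using harmonic_finite_dim by blast
  have bound: "\<forall>n. ?P n \<longrightarrow> n \<le> nat \<lceil>B\<rceil>"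
  proof (intro allI impI)
    fix n assume "?P n"
    then have "real n \<le> B" using B by blast
    then show "n \<le> nat \<lceil>B\<rceil>" by linarith
  qed
  have "?P 0" by (simp add: orthonormal_def)
  from GreatestI_nat[of ?P, OF this] bound have "?P (Greatest ?P)" by blast
  then obtain e where e: "orthonormal e (Greatest ?P)" "\<forall>j<Greatest ?P. e j \<in> harmonic" by blast
  define n where "n = Greatest ?P"
  have e: "orthonormal e n" "\<And>j. j < n \<Longrightarrow> e j \<in> harmonic" using e by (auto simp: n_def)
  have max: "\<not> ?P (Suc n)"
  proof
    assume "?P (Suc n)"
    then have "Suc n \<le> Greatest ?P" using Greatest_le_nat[of ?P "Suc n"] bound by blast
    then show False by (simp add: n_def)
  qed
  have "sq_norm (\<omega> - form_sum (\<lambda>j. form_ip \<omega> (e j)) e n) = 0" if w: "\<omega> \<in> harmonic" for \<omega>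
  proof (rule ccontr)
    let ?s = "form_sum (\<lambda>j. form_ip \<omega> (e j)) e n"
    let ?g = "\<omega> - ?s"
    assume "sq_norm ?g \<noteq> 0"
    then have p: "sq_norm ?g > 0" using sq_norm_nonneg[of ?g] by linarith
    have s: "?s \<in> harmonic" by (rule form_sum_harmonic[OF e(2)])
    have g: "?g \<in> harmonic" unfolding form_diff by (rule harmonic_lincomb[OF w s])
    have eL: "e j \<in> L2" if "j < n" for j using e(2)[OF that] by (rule harmonic_L2)
    have go: "form_ip ?g (e j) = 0" if "j < n" for j
      using form_ip_diff[OF harmonic_L2[OF w] harmonic_L2[OF s] eL[OF that]] form_sum_ip_orthonormal[OF e(1) that] by simp
    let ?a = "complex_of_real (1 / sqrt (sq_norm ?g))"
    \<comment> \<open>The term with coefficient 0 gives the scalar multiple the shape of a linear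
      combination, to which the linearity lemmas apply.\<close>
    define f where "f = (\<lambda>p v. ?a * ?g p v + 0 * ?g p v)"
    have f: "f \<in> harmonic" unfolding f_def by (rule harmonic_lincomb[OF g g])
    have fo: "form_ip f \<gamma> = ?a * form_ip ?g \<gamma>" if "\<gamma> \<in> L2" for \<gamma>
      unfolding f_def form_ip_lincomb[OF harmonic_L2[OF g] harmonic_L2[OF g] that] by simp
    have gf: "form_ip ?g f = cnj ?a * form_ip ?g ?g"
      unfolding f_def form_ip_lincomb2[OF harmonic_L2[OF g] harmonic_L2[OF g] harmonic_L2[OF g]] by simp
    have "form_ip f f = ?a * (cnj ?a * form_ip ?g ?g)" unfolding fo[OF harmonic_L2[OF f]] gf ..
    also have "\<dots> = of_real (1 / sqrt (sq_norm ?g) * (1 / sqrt (sq_norm ?g)) * sq_norm ?g)"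
      unfolding form_ip_self by (simp only: complex_cnj_complex_of_real of_real_mult mult.assoc)
    also have "1 / sqrt (sq_norm ?g) * (1 / sqrt (sq_norm ?g)) * sq_norm ?g = 1" using p by simp
    finally have ff: "form_ip f f = 1" by simp
    have fe: "form_ip f (e j) = 0" "form_ip (e j) f = 0" if "j < n" for j
      using fo[OF eL[OF that]] go[OF that] form_ip_cnj[of "e j" f] by auto
    have "orthonormal (e(n := f)) (Suc n)"
      using e(1) ff fe harmonic_L2[OF f] by (auto simp: orthonormal_def less_Suc_eq)
    moreover have "\<forall>j<Suc n. (e(n := f)) j \<in> harmonic" using e(2) f by (auto simp: less_Suc_eq)
    ultimately show False using max by blast
  qed
  with e show ?thesis using that by blast
qed

end

section \<open>Equality almost everywhere, and smooth representatives of harmonic forms\<close>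

context compact_curve
begin

text \<open>Transition maps are differentiable, so they carry null sets to null sets.\<close>

lemma AE_transition:
  assumes c: "c \<in> charts A" and d: "d \<in> charts A" and P: "AE y in lborel. y \<in> img c \<longrightarrow> P y"
  shows "AE x in lborel. x \<in> overlap d c \<longrightarrow> P (transition d c x)"
proof -
  note cc = charts_is_chart[OF c] charts_is_chart[OF d]
  obtain N where N: "{y \<in> space lborel. \<not> (y \<in> img c \<longrightarrow> P y)} \<subseteq> N" "emeasure lborel N = 0" "N \<in> sets lborel"
    using P by (rule AE_E)
  then have "N \<in> null_sets lborel" by auto
  then have "negligible N" by (simp add: negligible_iff_null_sets null_sets_completionI)
  then have nN: "negligible (N \<inter> overlap c d)" by (rule negligible_subset) auto
  have "(transition c d) differentiable_on (N \<inter> overlap c d)"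
  proof -
    have "(transition c d) differentiable (at x)" if "x \<in> overlap c d" for x
      using smooth_on_differentiable[OF smooth_on_transition[OF c d] that] .
    then show ?thesis by (auto simp: differentiable_on_def intro: differentiable_at_withinI)
  qed
  then have "negligible (transition c d ` (N \<inter> overlap c d))"
    by (intro negligible_differentiable_image_negligible[OF _ nN]) auto
  then have "AE x in lborel. x \<notin> transition c d ` (N \<inter> overlap c d)" by (rule negligible_AE_lborel)
  then show ?thesis
  proof eventually_elim
    case (elim x)
    show ?case
    proof (intro impI, rule ccontr)
      assume x: "x \<in> overlap d c" and nP: "\<not> P (transition d c x)"
      have y: "transition d c x \<in> overlap c d" by (rule transition_mem[OF cc(2,1) x])
      then have "transition d c x \<in> N" using N(1) nP overlap_subset[of c d] by auto
      moreover have "transition c d (transition d c x) = x"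
        using x cc by (auto simp: mem_overlap is_chart_param)
      ultimately show False using elim y by (metis IntI imageI)
    qed
  qed
qed

definition form_ae_eq :: "'a form1 \<Rightarrow> 'a form1 \<Rightarrow> bool" where
  "form_ae_eq \<alpha> \<beta> \<longleftrightarrow> (\<forall>d\<in>charts A. AE x in lborel. x \<in> img d \<longrightarrow> coeff01 A d \<alpha> x = coeff01 A d \<beta> x)"

text \<open>Each weighted integral vanishes separately; the resulting null sets are carried to the
  chart \<open>d\<close>, and at every point some member of the finite partition is nonzero.\<close>

lemma sq_norm_zero_imp_ae_zero:
  assumes g: "\<gamma> \<in> L2" and z: "sq_norm \<gamma> = 0" and d: "d \<in> charts A"
  shows "AE x in lborel. x \<in> img d \<longrightarrow> coeff01 A d \<gamma> x = 0"
proof -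
  have "AE x in lborel. x \<in> overlap d (fst t) \<longrightarrow> snd t (param d x) \<noteq> 0 \<longrightarrow> coeff01 A d \<gamma> x = 0" if t: "t \<in> pou" for t
  proof -
    obtain c h where ct: "t = (c, h)" by (rule prod.exhaust)
    have ch: "(c, h) \<in> pou" using t ct by simp
    have c: "c \<in> charts A" by (rule pou_mem(1)[OF ch])
    have "loc_norm c h \<gamma> = 0"
      using loc_norm_le[OF ch, of \<gamma>] loc_norm_nonneg[OF ch, of \<gamma>] z by simp
    then have "AE x in lborel. weight c h x * (norm (coeff01 A c \<gamma> x))\<^sup>2 = 0"
      unfolding loc_norm_def
      by (subst (asm) integral_nonneg_eq_0_iff_AE[OF loc_norm_integrable[OF g ch]])
        (use weight_nonneg[OF ch] in auto)
    then have "AE y in lborel. y \<in> img c \<longrightarrow> h (param c y) \<noteq> 0 \<longrightarrow> coeff01 A c \<gamma> y = 0"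
      by eventually_elim (auto simp: weight_def)
    from AE_transition[OF c d this]
    show ?thesis
    proof eventually_elim
      case (elim x)
      show ?case
      proof (intro impI)
        assume x: "x \<in> overlap d (fst t)" "snd t (param d x) \<noteq> 0"
        then have xo: "x \<in> overlap d c" by (simp add: ct)
        have "param c (transition d c x) = param d x"
          using xo d c by (auto simp: mem_overlap charts_is_chart chart_param)
        then have "coeff01 A c \<gamma> (transition d c x) = 0" using elim xo x by (simp add: ct)
        then show "coeff01 A d \<gamma> x = 0" using coeff01_transition[OF d c xo type01_L2[OF g]] by simp
      qed
    qed
  qed
  then have "AE x in lborel. \<forall>t\<in>pou. x \<in> overlap d (fst t) \<longrightarrow> snd t (param d x) \<noteq> 0 \<longrightarrow> coeff01 A d \<gamma> x = 0"
    by (intro AE_finite_allI finite_pou) auto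
  then show ?thesis
  proof eventually_elim
    case (elim x)
    show ?case
    proof
      assume x: "x \<in> img d"
      have "\<exists>t\<in>pou. snd t (param d x) \<noteq> 0"
      proof (rule ccontr)
        assume "\<not> (\<exists>t\<in>pou. snd t (param d x) \<noteq> 0)"
        then have "(\<Sum>(c, h)\<in>pou. h (param d x)) = 0" by (intro sum.neutral) auto
        then show False by (simp add: pou_sum)
      qed
      then obtain t where t: "t \<in> pou" "snd t (param d x) \<noteq> 0" by blast
      then have "param d x \<in> dom (fst t)" using pou_outside[of "fst t" "snd t" "param d x"] by auto
      then have "x \<in> overlap d (fst t)" using x by (simp add: mem_overlap charts_is_chart d)
      then show "coeff01 A d \<gamma> x = 0" using elim t by blast
    qed
  qed
qed

lemma sq_norm_zero_imp_ae_eq: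
  assumes "\<alpha> \<in> L2" "\<beta> \<in> L2" "sq_norm (\<alpha> - \<beta>) = 0"
  shows "form_ae_eq \<alpha> \<beta>"
proof -
  have "coeff01 A d (\<alpha> - \<beta>) x = coeff01 A d \<alpha> x - coeff01 A d \<beta> x" for d x by (simp add: coeff01_def)
  then show ?thesis
    using sq_norm_zero_imp_ae_zero[OF L2_diff[OF assms(1,2)] assms(3)] by (auto simp: form_ae_eq_def)
qed

lemma ae_eq_imp_sq_norm_zero:
  assumes "form_ae_eq \<alpha> \<beta>" shows "sq_norm (\<alpha> - \<beta>) = 0"
proof -
  have "loc_norm c h (\<alpha> - \<beta>) = 0" if ch: "(c, h) \<in> pou" for c h
  proof -
    have "AE x in lborel. weight c h x * (norm (coeff01 A c (\<alpha> - \<beta>) x))\<^sup>2 = 0"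
      using assms pou_mem(1)[OF ch] unfolding form_ae_eq_def
      by (auto dest!: bspec elim!: eventually_mono simp: weight_def coeff01_def indicator_def)
    then show ?thesis unfolding loc_norm_def by (rule integral_eq_zero_AE)
  qed
  then show ?thesis by (auto simp: sq_norm_def intro!: sum.neutral)
qed

lemma form_ip_cong_ae:
  assumes "\<alpha> \<in> L2" "\<beta> \<in> L2" "\<gamma> \<in> L2" "form_ae_eq \<alpha> \<beta>"
  shows "form_ip \<alpha> \<gamma> = form_ip \<beta> \<gamma>"
proof -
  have "(norm (form_ip (\<alpha> - \<beta>) \<gamma>))\<^sup>2 \<le> sq_norm (\<alpha> - \<beta>) * sq_norm \<gamma>"
    by (rule form_ip_cauchy_schwarz[OF L2_diff[OF assms(1,2)] assms(3)])
  then have "form_ip (\<alpha> - \<beta>) \<gamma> = 0" using ae_eq_imp_sq_norm_zero[OF assms(4)] by simp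
  then show ?thesis using form_ip_diff[OF assms(1-3)] by simp
qed

lemma A01_lincomb:
  assumes "\<alpha> \<in> A01 A" "\<beta> \<in> A01 A" shows "(\<lambda>p v. s * \<alpha> p v + t * \<beta> p v) \<in> A01 A"
proof -
  have "smooth_on (img c) (coeff01 A c (\<lambda>p v. s * \<alpha> p v + t * \<beta> p v))" if c: "c \<in> charts A" for c
    unfolding coeff01_lincomb[abs_def]
    by (intro smooth_on_add smooth_on_mult smooth_on_const charts_open c) (use assms c in \<open>auto simp: A01_def\<close>)
  moreover have "type01 (\<lambda>v. s * \<alpha> p v + t * \<beta> p v)" for p
    by (rule type01_lincomb) (use assms in \<open>auto simp: A01_def\<close>)
  ultimately show ?thesis by (simp add: A01_def)
qed

lemma A01_fun_mult:
  assumes f: "f \<in> Cinf A" and w: "\<omega> \<in> A01 A" shows "fun_mult f \<omega> \<in> A01 A"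
proof -
  have "smooth_on (img c) (coeff01 A c (fun_mult f \<omega>))" if c: "c \<in> charts A" for c
    unfolding coeff01_fun_mult[abs_def]
    by (intro smooth_on_mult charts_open c Cinf_smooth[OF f c, unfolded comp_def]) (use w c in \<open>auto simp: A01_def\<close>)
  moreover have "type01 (fun_mult f \<omega> p)" for p by (rule type01_fun_mult) (use w in \<open>simp add: A01_def\<close>)
  ultimately show ?thesis by (simp add: A01_def)
qed

text \<open>Partitions of unity are subordinate to charts, so a property found on a small open set
  has to become a property of a whole chart; shrinking the domain leaves the coefficients
  unchanged.\<close>

lemma restrict_chart:
  assumes c: "c \<in> charts A" and V: "open V"
  defines "c' \<equiv> (dom c \<inter> coord c -` V, coord c)"
  shows "c' \<in> charts A" "img c' = img c \<inter> V" "\<And>x. x \<in> img c' \<Longrightarrow> param c' x = param c x"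
    and "\<And>x \<omega>. (\<And>p. type01 (\<omega> p)) \<Longrightarrow> x \<in> img c' \<Longrightarrow> coeff01 A c' \<omega> x = coeff01 A c \<omega> x"
proof -
  note cc = charts_is_chart[OF c]
  show im: "img c' = img c \<inter> V" by (auto simp: img_def c'_def)
  show par: "param c' x = param c x" if x: "x \<in> img c'" for x
  proof -
    have x': "x \<in> img c" "x \<in> V" using x im by auto
    have inj: "inj_on (coord c) (dom c)" by (rule inj_on_inverseI[of _ "param c"]) (rule is_chart_param(3)[OF cc])
    have "param c x \<in> dom c'" "coord c (param c x) = x"
      using is_chart_param(1,2)[OF cc x'(1)] x' by (auto simp: c'_def)
    then have "inv_into (dom c') (coord c) x = param c x"
      by (intro inv_into_f_eq) (use inj in \<open>auto simp: c'_def intro: inj_on_subset\<close>)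
    then show ?thesis by (simp add: param_def c'_def)
  qed
  have cont: "continuous_on (dom c) (coord c)" using cc by (simp add: is_chart_def homeomorphism_def)
  have o: "open (dom c \<inter> coord c -` V)"
    using continuous_open_preimage[OF cont charts_open(1)[OF c] V] .
  have "homeomorphism (dom c') (img c') (coord c') (param c')"
  proof (rule homeomorphismI)
    show "continuous_on (dom c') (coord c')" using cont by (auto simp: c'_def intro: continuous_on_subset)
    have "continuous_on (img c') (param c)" by (rule continuous_on_subset[OF param_continuous[OF cc]]) (simp add: im)
    then show "continuous_on (img c') (param c')" by (rule continuous_on_eq) (simp add: par)
    show "coord c' ` dom c' \<subseteq> img c'" by (simp add: img_def)
    show "param c' ` img c' \<subseteq> dom c'"
    proof (rule image_subsetI)
      fix x assume x: "x \<in> img c'"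
      then have "x \<in> img c" "x \<in> V" using im by auto
      then show "param c' x \<in> dom c'" unfolding par[OF x] using is_chart_param(1,2)[OF cc] by (auto simp: c'_def)
    qed
    show "param c' (coord c' p) = p" if "p \<in> dom c'" for p
    proof -
      have "coord c p \<in> img c'" using that by (auto simp: img_def c'_def)
      then show ?thesis using par that is_chart_param(3)[OF cc] by (auto simp: c'_def)
    qed
    show "coord c' (param c' x) = x" if "x \<in> img c'" for x
      using par[OF that] that im is_chart_param(2)[OF cc] by (auto simp: c'_def)
  qed
  then have ic: "is_chart c'"
    using o im open_Int[OF charts_open(2)[OF c] V] by (simp add: is_chart_def) (simp add: c'_def)
  have "compatible c' d" if d: "d \<in> A" for d
  proof -
    have cd: "compatible c d" using c d by (auto simp: charts_def)
    have s1: "coord c' ` (dom c' \<inter> dom d) \<subseteq> coord c ` (dom c \<inter> dom d)" "coord c' ` (dom c' \<inter> dom d) \<subseteq> img c'"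
      by (auto simp: c'_def img_def)
    have "(coord d \<circ> param c) holomorphic_on coord c' ` (dom c' \<inter> dom d)"
      using cd s1 holomorphic_on_subset unfolding compatible_def by blast
    then have "(coord d \<circ> param c') holomorphic_on coord c' ` (dom c' \<inter> dom d)"
      by (rule holomorphic_transform) (use s1 par in auto)
    moreover have "(coord c' \<circ> param d) holomorphic_on coord d ` (dom c' \<inter> dom d)"
    proof -
      have "(coord c \<circ> param d) holomorphic_on coord d ` (dom c \<inter> dom d)" using cd by (simp add: compatible_def)
      then have "(coord c \<circ> param d) holomorphic_on coord d ` (dom c' \<inter> dom d)"
        by (rule holomorphic_on_subset) (auto simp: c'_def)
      then show ?thesis by (simp add: c'_def)
    qed
    ultimately show ?thesis by (simp add: compatible_def)
  qed
  then show ch: "c' \<in> charts A" using ic by (simp add: charts_def)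
  show "coeff01 A c' \<omega> x = coeff01 A c \<omega> x" if t: "\<And>p. type01 (\<omega> p)" and x: "x \<in> img c'" for x \<omega>
  proof -
    have xo: "x \<in> overlap c' c"
      using x is_chart_param(1)[OF ic x] unfolding mem_overlap[OF ic] by (auto simp: c'_def)
    have id: "transition c' c y = y" if "y \<in> img c'" for y
      using par[OF that] that im is_chart_param(2)[OF cc] by auto
    have "((\<lambda>z. z) has_field_derivative 1) (at x)" by (rule DERIV_ident)
    then have "(transition c' c has_field_derivative 1) (at x)"
      by (rule has_field_derivative_transform_within_open[OF _ charts_open(2)[OF ch] x]) (simp only: id)
    then have "deriv (transition c' c) x = 1" by (rule DERIV_imp_deriv)
    then show ?thesis using coeff01_transition[OF ch c xo t] id[OF x] by simp
  qed
qed

lemma bump_test_function: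
  fixes h :: "'a \<Rightarrow> real"
  assumes c: "c \<in> charts A" and h: "h \<in> Cinf A" "closure {p. h p \<noteq> 0} \<subseteq> dom c"
  shows "(\<lambda>x. if x \<in> img c then complex_of_real (h (param c x)) else 0) \<in> test_functions (img c)"
proof -
  let ?P = "closure {p. h p \<noteq> 0}" and ?g = "\<lambda>x. if x \<in> img c then complex_of_real (h (param c x)) else 0"
  let ?K = "coord c ` ?P"
  have "compact ?P" using compact_Int_closed[OF compact_UNIV, of ?P] by simp
  moreover have "continuous_on ?P (coord c)"
    using charts_is_chart[OF c] h(2) by (auto simp: is_chart_def homeomorphism_def intro: continuous_on_subset)
  ultimately have K: "compact ?K" by (rule compact_continuous_image[rotated])
  have Ki: "?K \<subseteq> img c" using h(2) by (auto simp: img_def)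
  have z: "?g x = 0" if "x \<notin> ?K" for x
  proof (cases "x \<in> img c")
    case True
    have "h (param c x) = 0"
    proof (rule ccontr)
      assume "h (param c x) \<noteq> 0"
      then have "param c x \<in> {p. h p \<noteq> 0}" by simp
      then have "param c x \<in> ?P" by (rule subsetD[OF closure_subset])
      then have "coord c (param c x) \<in> ?K" by blast
      then show False using that chart_param(2)[OF c True] by simp
    qed
    then show ?thesis by simp
  qed simp
  have "smooth_on UNIV ?g"
  proof (rule smooth_on_local)
    fix x :: complex
    show "\<exists>T. open T \<and> x \<in> T \<and> smooth_on T ?g"
    proof (cases "x \<in> img c")
      case True
      have "smooth_on (img c) (\<lambda>x. complex_of_real ((h \<circ> param c) x))"
        by (intro smooth_on_of_real charts_open c Cinf_smooth h)
      then have "smooth_on (img c) ?g" by (rule smooth_on_cong[OF charts_open(2)[OF c]]) simp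
      then show ?thesis using True charts_open(2)[OF c] by blast
    next
      case False
      have o: "open (- ?K)" using K by (simp add: compact_imp_closed open_Compl)
      have "smooth_on (- ?K) ?g" by (rule smooth_on_cong[OF o smooth_on_const[of _ 0]]) (use z in auto)
      then show ?thesis using False Ki o by blast
    qed
  qed
  then show ?thesis by (rule test_functionsI[OF _ K Ki]) (rule z)
qed

text \<open>The reproducing identity presents \<open>\<omega>\<close> near each point as a
  convolution with a test function, up to a null set. These local smooth coefficients are glued by a
  partition of unity subordinate to the charts that carry one.\<close>

theorem harmonic_smooth:
  assumes w: "\<omega> \<in> harmonic"
  shows "\<exists>s\<in>A01 A. form_ae_eq \<omega> s"
proof -
  have wt: "type01 (\<omega> p)" for p by (rule type01_L2[OF harmonic_L2[OF w]])
  define C where "C = {c \<in> charts A. \<exists>s. smooth_on (img c) s \<and> (AE x in lborel. x \<in> img c \<longrightarrow> coeff01 A c \<omega> x = s x)}"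
  have "\<exists>c\<in>C. p \<in> dom c" for p
  proof -
    let ?c = "chart_at A p"
    let ?x0 = "coord ?c p"
    have c: "?c \<in> charts A" by (rule chart_at(3))
    have x0: "?x0 \<in> img ?c" by (rule chart_param(4)[OF c chart_at(2)])
    obtain R where R: "0 < R" "cball ?x0 R \<subseteq> img ?c" using charts_open(2)[OF c] x0 open_contains_cball by blast
    define r where "r = R / 2"
    have r: "0 < r" "cball ?x0 (2 * r) \<subseteq> img ?c" using R by (auto simp: r_def)
    obtain k where k: "reproducing_kernel r k" using ex_reproducing_kernel[OF r(1)] by blast
    have kt: "k \<in> test_functions (ball 0 r)" using k by (simp add: reproducing_kernel_def)
    obtain V where V: "open V" "?x0 \<in> V" "V \<subseteq> ball ?x0 r"
      and ae: "AE x in lborel. x \<in> V \<longrightarrow> coeff01 A ?c \<omega> x = (\<integral>y. coeff01 A ?c \<omega> y * k (x - y) \<partial>lborel)"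
      using harmonic_reproduced_locally[OF w c k r(2)] by blast
    \<comment> \<open>The truncated coefficient is integrable over the plane, so its convolution is
      smooth everywhere; near the centre the kernel does not reach beyond the truncation.\<close>
    define w1 where "w1 = (\<lambda>y. indicator (cball ?x0 (2 * r)) y *\<^sub>R coeff01 A ?c \<omega> y)"
    have w1: "integrable lborel w1"
      using coeff_set_integrable[OF harmonic_L2[OF w] c compact_cball r(2)] by (simp add: w1_def set_integrable_def)
    let ?s = "\<lambda>x. \<integral>y. w1 y * k (x - y) \<partial>lborel"
    have s: "smooth_on S ?s" for S
      using smooth_on_convolution[OF w1 test_functions_mono[OF subset_UNIV kt]] by (rule smooth_on_subset) simp
    have eq: "coeff01 A ?c \<omega> y * k (x - y) = w1 y * k (x - y)" if "x \<in> V" for x y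
    proof (cases "x - y \<in> ball 0 r")
      case True
      have "dist ?x0 y \<le> dist ?x0 x + dist x y" by (rule dist_triangle)
      moreover have "dist ?x0 x < r" using V(3) that by (simp only: mem_ball[symmetric]) blast
      moreover have "dist x y < r" using True by (simp add: dist_norm norm_minus_commute)
      ultimately have "y \<in> cball ?x0 (2 * r)" by simp
      then show ?thesis by (simp add: w1_def)
    qed (simp add: test_functions_outside[OF kt])
    let ?c' = "(dom ?c \<inter> coord ?c -` V, coord ?c)"
    note rc = restrict_chart[OF c V(1)]
    have "AE x in lborel. x \<in> img ?c' \<longrightarrow> coeff01 A ?c' \<omega> x = ?s x"
      using ae
    proof eventually_elim
      case (elim x)
      show ?case
      proof
        assume x: "x \<in> img ?c'"
        then have "x \<in> V" using rc(2) by blast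
        then show "coeff01 A ?c' \<omega> x = ?s x" unfolding rc(4)[OF wt x] using elim eq by simp
      qed
    qed
    then have "?c' \<in> C" unfolding C_def using rc(1) s by blast
    moreover have "p \<in> dom ?c'" using V(2) chart_at(2) by simp
    ultimately show ?thesis by blast
  qed
  then have "(\<Union>c\<in>C. dom c) = UNIV" by blast
  moreover have "C \<subseteq> charts A" by (auto simp: C_def)
  ultimately obtain S where S: "partition_of_unity A S" "fst ` S \<subseteq> C"
    using ex_partition_of_unity by blast
  have fS: "finite S" using S(1) by (simp add: partition_of_unity_def)
  have S1: "fst t \<in> charts A" "snd t \<in> Cinf A" "closure {p. snd t p \<noteq> 0} \<subseteq> dom (fst t)" if "t \<in> S" for t
    using S(1) that unfolding partition_of_unity_def case_prod_unfold by blast+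
  have Ssum: "(\<Sum>t\<in>S. snd t p) = 1" for p using S(1) by (simp add: partition_of_unity_def case_prod_unfold)
  have "\<forall>t\<in>S. \<exists>s. smooth_on (img (fst t)) s \<and> (AE x in lborel. x \<in> img (fst t) \<longrightarrow> coeff01 A (fst t) \<omega> x = s x)"
    using S(2) by (auto simp: C_def)
  from bchoice[OF this] obtain s where s: "\<And>t. t \<in> S \<Longrightarrow> smooth_on (img (fst t)) (s t)"
    "\<And>t. t \<in> S \<Longrightarrow> AE x in lborel. x \<in> img (fst t) \<longrightarrow> coeff01 A (fst t) \<omega> x = s t x" by blast
  \<comment> \<open>The representative \<open>s t\<close> is smooth only on the image of its chart;
    the bump turns it into a test function that can be extended by zero.\<close>
  define g where "g t x = (if x \<in> img (fst t) then complex_of_real (snd t (param (fst t) x)) else 0) * s t x" for t x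
  have g: "g t \<in> test_functions (img (fst t))" if "t \<in> S" for t
    unfolding g_def[abs_def]
    by (rule test_functions_mult_smooth[OF bump_test_function[OF S1[OF that]] charts_open(2)[OF S1(1)[OF that]] s(1)[OF that]])
  define e where "e = (\<lambda>p v. \<Sum>t\<in>S. form01_of_coeff A (fst t) (g t) p v)"
  have e_part: "(\<lambda>p v. \<Sum>t\<in>T. form01_of_coeff A (fst t) (g t) p v) \<in> A01 A" if "T \<subseteq> S" for T
    using finite_subset[OF that fS] that
  proof (induction T)
    case empty
    from A01_lincomb[OF dbar_A01[OF zero_Cinf] dbar_A01[OF zero_Cinf], of 0 0] show ?case by simp
  next
    case (insert t T)
    then have t: "t \<in> S" by blast
    from A01_lincomb[OF form01_A01[OF S1(1)[OF t] g[OF t]] insert.IH, of 1 1] insert show ?case by simp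
  qed
  have eA: "e \<in> A01 A" unfolding e_def by (rule e_part) simp
  have "AE x in lborel. x \<in> img d \<longrightarrow> coeff01 A d \<omega> x = coeff01 A d e x" if d: "d \<in> charts A" for d
  proof -
    have "AE x in lborel. \<forall>t\<in>S. x \<in> overlap d (fst t) \<longrightarrow>
        coeff01 A (fst t) \<omega> (transition d (fst t) x) = s t (transition d (fst t) x)"
      by (intro AE_finite_allI fS AE_transition[OF S1(1) d s(2)])
    then show ?thesis
    proof eventually_elim
      case (elim x)
      show ?case
      proof
        assume x: "x \<in> img d"
        have ct: "coeff01 A d (form01_of_coeff A (fst t) (g t)) x = of_real (snd t (param d x)) * coeff01 A d \<omega> x" if t: "t \<in> S" for t
        proof (cases "x \<in> overlap d (fst t)")
          case True
          note cc = charts_is_chart[OF S1(1)[OF t]] charts_is_chart[OF d]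
          have y: "transition d (fst t) x \<in> img (fst t)"
            using transition_mem[OF cc(2,1) True] overlap_subset by blast
          have p: "param (fst t) (transition d (fst t) x) = param d x"
            using True cc by (auto simp: mem_overlap is_chart_param)
          have "g t (transition d (fst t) x) = of_real (snd t (param d x)) * coeff01 A (fst t) \<omega> (transition d (fst t) x)"
            unfolding g_def p using y elim t True by simp
          then show ?thesis
            unfolding coeff01_form01[OF S1(1)[OF t] d x] coeff01_transition[OF d S1(1)[OF t] True wt]
            using True by (simp add: mult_ac)
        next
          case False
          then have "param d x \<notin> dom (fst t)" using x by (simp add: mem_overlap charts_is_chart d)
          then have "param d x \<notin> closure {p. snd t p \<noteq> 0}" by (rule contra_subsetD[OF S1(3)[OF t]])
          then have "param d x \<notin> {p. snd t p \<noteq> 0}" by (rule contra_subsetD[OF closure_subset])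
          then show ?thesis using False by (simp add: coeff01_form01[OF S1(1)[OF t] d x])
        qed
        have "coeff01 A d e x = (\<Sum>t\<in>S. coeff01 A d (form01_of_coeff A (fst t) (g t)) x)"
          by (simp add: e_def coeff01_def)
        also have "\<dots> = (\<Sum>t\<in>S. of_real (snd t (param d x)) * coeff01 A d \<omega> x)"
          by (intro sum.cong refl ct)
        also have "\<dots> = of_real (\<Sum>t\<in>S. snd t (param d x)) * coeff01 A d \<omega> x"
          by (simp add: sum_distrib_right)
        finally show "coeff01 A d \<omega> x = coeff01 A d e x" by (simp add: Ssum)
      qed
    qed
  qed
  then show ?thesis using eA unfolding form_ae_eq_def by blast
qed

end

section \<open>Operators of finite rank\<close>

context compact_curve
begin

lemma form_ae_eq_refl: "form_ae_eq \<alpha> \<alpha>"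
  by (simp add: form_ae_eq_def)

lemma form_ae_eq_sym: "form_ae_eq \<alpha> \<beta> \<Longrightarrow> form_ae_eq \<beta> \<alpha>"
  by (simp add: form_ae_eq_def eq_commute)

lemma form_ae_eq_trans:
  assumes "form_ae_eq \<alpha> \<beta>" "form_ae_eq \<beta> \<gamma>" shows "form_ae_eq \<alpha> \<gamma>"
  unfolding form_ae_eq_def
proof
  fix d assume d: "d \<in> charts A"
  have "AE x in lborel. x \<in> img d \<longrightarrow> coeff01 A d \<alpha> x = coeff01 A d \<beta> x"
    "AE x in lborel. x \<in> img d \<longrightarrow> coeff01 A d \<beta> x = coeff01 A d \<gamma> x"
    using assms d by (auto simp: form_ae_eq_def)
  then show "AE x in lborel. x \<in> img d \<longrightarrow> coeff01 A d \<alpha> x = coeff01 A d \<gamma> x"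
    by eventually_elim simp
qed

lemma form_ae_eq_lincomb:
  assumes "form_ae_eq \<alpha> \<alpha>'" "form_ae_eq \<beta> \<beta>'"
  shows "form_ae_eq (\<lambda>p v. s * \<alpha> p v + t * \<beta> p v) (\<lambda>p v. s * \<alpha>' p v + t * \<beta>' p v)"
  unfolding form_ae_eq_def
proof
  fix d assume d: "d \<in> charts A"
  have "AE x in lborel. x \<in> img d \<longrightarrow> coeff01 A d \<alpha> x = coeff01 A d \<alpha>' x"
    "AE x in lborel. x \<in> img d \<longrightarrow> coeff01 A d \<beta> x = coeff01 A d \<beta>' x"
    using assms d by (auto simp: form_ae_eq_def)
  then show "AE x in lborel. x \<in> img d \<longrightarrow> coeff01 A d (\<lambda>p v. s * \<alpha> p v + t * \<beta> p v) x =
      coeff01 A d (\<lambda>p v. s * \<alpha>' p v + t * \<beta>' p v) x"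
    by eventually_elim (simp add: coeff01_lincomb)
qed

lemma form_ae_eq_fun_mult:
  assumes "form_ae_eq \<alpha> \<beta>" shows "form_ae_eq (fun_mult f \<alpha>) (fun_mult f \<beta>)"
  unfolding form_ae_eq_def
proof
  fix d assume d: "d \<in> charts A"
  have "AE x in lborel. x \<in> img d \<longrightarrow> coeff01 A d \<alpha> x = coeff01 A d \<beta> x"
    using assms d by (auto simp: form_ae_eq_def)
  then show "AE x in lborel. x \<in> img d \<longrightarrow> coeff01 A d (fun_mult f \<alpha>) x = coeff01 A d (fun_mult f \<beta>) x"
    by eventually_elim (simp add: coeff01_fun_mult)
qed

lemma form_ae_eq_imp_ae_eq:
  assumes t: "\<And>p. type01 (\<alpha> p)" "\<And>p. type01 (\<beta> p)" and e: "form_ae_eq \<alpha> \<beta>"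
  shows "ae_eq A \<alpha> \<beta>"
  unfolding ae_eq_def
proof
  fix d assume d: "d \<in> charts A"
  have "AE x in lborel. x \<in> img d \<longrightarrow> coeff01 A d \<alpha> x = coeff01 A d \<beta> x"
    using e d by (auto simp: form_ae_eq_def)
  then show "AE x in lborel. x \<in> img d \<longrightarrow> \<alpha> (param d x) = \<beta> (param d x)"
    by eventually_elim (intro impI form_eqI[where \<alpha> = \<alpha> and \<beta> = \<beta>, OF t d]; simp)
qed

lemma zero_L2: "(\<lambda>p v. 0) \<in> L2"
  by (rule harmonic_L2[OF zero_harmonic])

lemma form_ip_fun_mult: "form_ip (fun_mult f u) b = form_ip u (fun_mult (\<lambda>p. cnj (f p)) b)"
  by (simp add: form_ip_def coeff01_fun_mult mult_ac)

text \<open>A list of pairs encodes an element of the tensor product, so composition and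
  multiplication become operations on lists. The coefficient 1 keeps the recursive clause in the
  shape of the linear combination lemmas.\<close>

primrec finite_rank :: "('a form1 \<times> 'a form1) list \<Rightarrow> 'a form1 \<Rightarrow> 'a form1" where
  "finite_rank [] = (\<lambda>w p v. 0)"
| "finite_rank (t # L) = (\<lambda>w p v. form_ip w (snd t) * fst t p v + 1 * finite_rank L w p v)"

lemma finite_rank_A01:
  assumes "set L \<subseteq> A01 A \<times> A01 A" shows "finite_rank L w \<in> A01 A"
  using assms
proof (induction L)
  case Nil
  from A01_lincomb[OF dbar_A01[OF zero_Cinf] dbar_A01[OF zero_Cinf], of 0 0] show ?case by simp
next
  case (Cons t L)
  have "fst t \<in> A01 A" "finite_rank L w \<in> A01 A" using Cons by auto
  from A01_lincomb[OF this] show ?case by (simp only: finite_rank.simps)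
qed

lemma finite_rank_append: "finite_rank (L @ M) w = (\<lambda>p v. finite_rank L w p v + finite_rank M w p v)"
  by (induction L) (simp_all add: algebra_simps)

lemma finite_rank_lincomb:
  assumes L: "set L \<subseteq> A01 A \<times> A01 A" and a: "\<alpha> \<in> L2" "\<beta> \<in> L2"
  shows "finite_rank L (\<lambda>p v. s * \<alpha> p v + t * \<beta> p v) =
    (\<lambda>p v. s * finite_rank L \<alpha> p v + t * finite_rank L \<beta> p v)"
  using L
proof (induction L)
  case (Cons x L)
  have "snd x \<in> L2" using Cons.prems by (auto intro: A01_L2)
  then show ?case using Cons by (simp add: form_ip_lincomb[OF a] algebra_simps)
qed simp

lemma finite_rank_cong:
  assumes L: "set L \<subseteq> A01 A \<times> A01 A" and a: "\<alpha> \<in> L2" "\<beta> \<in> L2" "form_ae_eq \<alpha> \<beta>"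
  shows "finite_rank L \<alpha> = finite_rank L \<beta>"
  using L
proof (induction L)
  case (Cons x L)
  have "snd x \<in> L2" using Cons.prems by (auto intro: A01_L2)
  then show ?case using Cons by (simp add: form_ip_cong_ae[OF a(1,2) _ a(3)])
qed simp

lemma finite_rank_compose:
  assumes L: "set L \<subseteq> A01 A \<times> A01 A" and M: "set M \<subseteq> A01 A \<times> A01 A"
  shows "finite_rank L (finite_rank M u) = finite_rank (map (\<lambda>t. (finite_rank L (fst t), snd t)) M) u"
  using M
proof (induction M)
  case Nil
  from finite_rank_lincomb[OF L zero_L2 zero_L2, of 0 0] show ?case by simp
next
  case (Cons t M)
  have "fst t \<in> L2" "finite_rank M u \<in> L2" using Cons.prems by (auto intro: A01_L2 finite_rank_A01)
  then show ?case using Cons by (simp only: finite_rank.simps finite_rank_lincomb[OF L]) simp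
qed

lemma finite_rank_fun_mult:
  "finite_rank (map (\<lambda>t. (fun_mult f (fst t), snd t)) L) u = fun_mult f (finite_rank L u)"
  by (induction L) (simp_all add: fun_mult_def algebra_simps)

lemma finite_rank_fun_mult_arg:
  "finite_rank L (fun_mult f u) = finite_rank (map (\<lambda>t. (fst t, fun_mult (\<lambda>p. cnj (f p)) (snd t))) L) u"
  by (induction L) (simp_all add: form_ip_fun_mult)

text \<open>Only equality almost everywhere is asked of \<open>T\<close>, because the projection
  picks arbitrary representatives; the list itself consists of smooth forms.\<close>

definition smooth_finite_rank :: "('a form1 \<Rightarrow> 'a form1) \<Rightarrow> ('a form1 \<times> 'a form1) list \<Rightarrow> bool" where
  "smooth_finite_rank T L \<longleftrightarrow> set L \<subseteq> A01 A \<times> A01 A \<and>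
     (\<forall>u\<in>L2. T u \<in> L2 \<and> form_ae_eq (T u) (finite_rank L u))"

text \<open>The operator \<open>finite_rank L\<close> sees its argument through inner products
  alone, so it sends arguments that agree almost everywhere to identical forms. This absorbs the
  ambiguity of the inner operator.\<close>

lemma smooth_finite_rank_compose:
  assumes T: "smooth_finite_rank T L" and U: "smooth_finite_rank U M"
  shows "smooth_finite_rank (\<lambda>u. T (U u)) (map (\<lambda>t. (finite_rank L (fst t), snd t)) M)"
proof -
  have L: "set L \<subseteq> A01 A \<times> A01 A" and M: "set M \<subseteq> A01 A \<times> A01 A"
    using assms by (auto simp: smooth_finite_rank_def)
  have "T (U u) \<in> L2 \<and> form_ae_eq (T (U u)) (finite_rank (map (\<lambda>t. (finite_rank L (fst t), snd t)) M) u)"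
    if u: "u \<in> L2" for u
  proof -
    have Uu: "U u \<in> L2" "form_ae_eq (U u) (finite_rank M u)"
      using U u by (auto simp: smooth_finite_rank_def)
    have "T (U u) \<in> L2" "form_ae_eq (T (U u)) (finite_rank L (U u))"
      using T Uu by (auto simp: smooth_finite_rank_def)
    moreover have "finite_rank L (U u) = finite_rank L (finite_rank M u)"
      by (rule finite_rank_cong[OF L Uu(1) A01_L2[OF finite_rank_A01[OF M]] Uu(2)])
    ultimately show ?thesis by (simp add: finite_rank_compose[OF L M])
  qed
  moreover have "set (map (\<lambda>t. (finite_rank L (fst t), snd t)) M) \<subseteq> A01 A \<times> A01 A"
    using M finite_rank_A01[OF L] by auto
  ultimately show ?thesis by (simp add: smooth_finite_rank_def)
qed

lemma smooth_finite_rank_fun_mult: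
  assumes f: "f \<in> Cinf A" and T: "smooth_finite_rank T L"
  shows "smooth_finite_rank (\<lambda>u. fun_mult f (T u)) (map (\<lambda>t. (fun_mult f (fst t), snd t)) L)"
proof -
  have "set (map (\<lambda>t. (fun_mult f (fst t), snd t)) L) \<subseteq> A01 A \<times> A01 A"
    using T by (auto simp: smooth_finite_rank_def intro!: A01_fun_mult[OF f])
  then show ?thesis
    using T L2_fun_mult[OF f] form_ae_eq_fun_mult
    unfolding smooth_finite_rank_def finite_rank_fun_mult by blast
qed

lemma closure_Im_dbar_eq:
  assumes g: "riemannian_metric A g" "J_invariant g"
  shows "closure_Im_dbar A g = dbar_closure"
proof -
  have "Re (L2_inner A g (\<omega> - dbar A f) (\<omega> - dbar A f)) = sq_norm (\<omega> - dbar A f)"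
    if "\<omega> \<in> L2" "f \<in> Cinf A" for \<omega> f
  proof -
    have "type01 ((\<omega> - dbar A f) p)" for p by (rule type01_L2[OF L2_diff[OF that(1) dbar_L2[OF that(2)]]])
    from L2_inner_eq[OF g, of "\<omega> - dbar A f" "\<omega> - dbar A f", OF this this] show ?thesis
      by (simp add: form_ip_self)
  qed
  then show ?thesis unfolding closure_Im_dbar_def dbar_closure_def L2_forms_eq[OF g]
    by (intro Collect_cong conj_cong refl all_cong bex_cong) auto
qed

lemma dbar_in_closure: "f \<in> Cinf A \<Longrightarrow> dbar A f \<in> dbar_closure"
  unfolding dbar_closure_def
  using dbar_L2[of f] ae_eq_imp_sq_norm_zero[OF form_ae_eq_refl, of "dbar A f"] by (auto intro!: bexI[of _ f])

text \<open>The existence of an orthogonal decomposition makes the choice in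
  \<open>proj_Im_dbar\<close> a genuine projection. Its remainder is orthogonal to the closure, in
  particular to the image.\<close>

lemma proj_Im_dbar_decomposition:
  assumes g: "riemannian_metric A g" "J_invariant g" and u: "u \<in> L2"
  shows "proj_Im_dbar A g u \<in> dbar_closure" "u - proj_Im_dbar A g u \<in> harmonic"
proof -
  have cl: "w \<in> L2" if "w \<in> dbar_closure" for w using that by (simp add: dbar_closure_def)
  have ip: "L2_inner A g (u - v) w = form_ip (u - v) w" if "v \<in> dbar_closure" "w \<in> dbar_closure" for v w
    by (rule L2_inner_eq[OF g]) (rule type01_L2[OF L2_diff[OF u cl[OF that(1)]]], rule type01_L2[OF cl[OF that(2)]])
  let ?P = "\<lambda>v. v \<in> closure_Im_dbar A g \<and> (\<forall>w\<in>closure_Im_dbar A g. L2_inner A g (u - v) w = 0)"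
  obtain v0 where v0: "v0 \<in> dbar_closure" "\<forall>f\<in>Cinf A. form_ip (u - v0) (dbar A f) = 0"
    using dbar_projection[OF u] by blast
  have "u - v0 \<in> harmonic" using v0 L2_diff[OF u cl[OF v0(1)]] by (simp add: harmonic_def)
  then have "?P v0" using harmonic_orth_closure ip[OF v0(1)] v0(1) by (simp add: closure_Im_dbar_eq[OF g])
  then have "?P (Eps ?P)" by (rule someI[where P = ?P])
  then have P: "?P (proj_Im_dbar A g u)" unfolding proj_Im_dbar_def .
  then show v: "proj_Im_dbar A g u \<in> dbar_closure" by (simp add: closure_Im_dbar_eq[OF g])
  have "form_ip (u - proj_Im_dbar A g u) (dbar A f) = 0" if "f \<in> Cinf A" for f
    using P ip[OF v dbar_in_closure[OF that]] dbar_in_closure[OF that] by (simp add: closure_Im_dbar_eq[OF g])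
  then show "u - proj_Im_dbar A g u \<in> harmonic"
    using L2_diff[OF u cl[OF v]] by (simp add: harmonic_def)
qed

lemma form_sum_ae_eq:
  "(\<And>j. j < n \<Longrightarrow> form_ae_eq (e j) (s j)) \<Longrightarrow> form_ae_eq (form_sum a e n) (form_sum a s n)"
proof (induction n)
  case 0
  show ?case by (simp add: form_sum_def form_ae_eq_refl)
next
  case (Suc n)
  then show ?case unfolding form_sum_Suc by (intro form_ae_eq_lincomb) auto
qed

lemma finite_rank_form_sum:
  "finite_rank (map (\<lambda>j. (\<lambda>p v. k * s j p v, s j)) [0..<n]) u =
    (\<lambda>p v. k * form_sum (\<lambda>j. form_ip u (s j)) s n p v)"
proof (induction n)
  case 0
  show ?case by (simp add: form_sum_def)
next
  case (Suc n)
  have "map (\<lambda>j. (\<lambda>p v. k * s j p v, s j)) [0..<Suc n] =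
      map (\<lambda>j. (\<lambda>p v. k * s j p v, s j)) [0..<n] @ [(\<lambda>p v. k * s n p v, s n)]" by simp
  then show ?case unfolding finite_rank_append form_sum_Suc using Suc
    by (simp only: finite_rank_append) (simp add: algebra_simps)
qed

text \<open>The list is obtained before the metric, so one list describes \<open>F\<close> minus the
  identity for all J-invariant metrics.\<close>

lemma F_op_finite_rank:
  obtains L where "set L \<subseteq> A01 A \<times> A01 A"
    "\<And>g u. riemannian_metric A g \<Longrightarrow> J_invariant g \<Longrightarrow> u \<in> L2 \<Longrightarrow> F_op A g u \<in> L2"
    "\<And>g u. riemannian_metric A g \<Longrightarrow> J_invariant g \<Longrightarrow> u \<in> L2 \<Longrightarrow>
      form_ae_eq (F_op A g u) (\<lambda>p v. 1 * u p v + 1 * finite_rank L u p v)"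
proof -
  obtain e n where e: "orthonormal e n" "\<And>j. j < n \<Longrightarrow> e j \<in> harmonic"
    "\<And>\<omega>. \<omega> \<in> harmonic \<Longrightarrow> sq_norm (\<omega> - form_sum (\<lambda>j. form_ip \<omega> (e j)) e n) = 0"
    using harmonic_basis by blast
  have "\<forall>j\<in>{..<n}. \<exists>s. s \<in> A01 A \<and> form_ae_eq (e j) s" using harmonic_smooth[OF e(2)] by blast
  from bchoice[OF this] obtain s where s: "\<And>j. j < n \<Longrightarrow> s j \<in> A01 A" "\<And>j. j < n \<Longrightarrow> form_ae_eq (e j) (s j)"
    by auto
  \<comment> \<open>The coefficient \<open>-2\<close> comes from
    \<open>2 P - Id = Id - 2 (Id - P)\<close>, with \<open>Id - P\<close> expanded in smooth
    representatives of an orthonormal basis of the harmonic forms.\<close>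
  define L where "L = map (\<lambda>j. (\<lambda>p v. (-2) * s j p v, s j)) [0..<n]"
  have "(\<lambda>p v. (-2) * s j p v) \<in> A01 A" if "j < n" for j
    using A01_lincomb[OF s(1)[OF that] s(1)[OF that], of "-2" 0] by simp
  then have L: "set L \<subseteq> A01 A \<times> A01 A" using s(1) by (auto simp: L_def)
  have *: "F_op A g u \<in> L2 \<and> form_ae_eq (F_op A g u) (\<lambda>p v. 1 * u p v + 1 * finite_rank L u p v)"
    if g: "riemannian_metric A g" "J_invariant g" and u: "u \<in> L2" for g u
  proof -
    define v where "v = proj_Im_dbar A g u"
    define w where "w = u - v"
    have v: "v \<in> dbar_closure" and w: "w \<in> harmonic"
      using proj_Im_dbar_decomposition[OF g u] by (auto simp: v_def w_def)
    have vL: "v \<in> L2" using v by (simp add: dbar_closure_def)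
    have eL: "e j \<in> L2" if "j < n" for j by (rule harmonic_L2[OF e(2)[OF that]])
    have F: "F_op A g u = (\<lambda>p x. 1 * u p x + (-2) * w p x)"
      by (simp add: F_op_def fun_mult_def w_def v_def[symmetric] fun_eq_iff algebra_simps)
    have FL: "F_op A g u \<in> L2" unfolding F by (rule L2_lincomb[OF u harmonic_L2[OF w]])
    \<comment> \<open>The part of \<open>u\<close> in the closure of the image is orthogonal to
      \<open>e j\<close>, so the coefficients can be read off \<open>u\<close> itself, and null
      changes do not affect the product.\<close>
    have ip: "form_ip w (e j) = form_ip u (s j)" if j: "j < n" for j
    proof -
      have "form_ip v (e j) = 0"
        using form_ip_cnj[of v "e j"] harmonic_orth_closure[OF e(2)[OF j] v] by simp
      then have "form_ip w (e j) = form_ip u (e j)"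
        unfolding w_def form_ip_diff[OF u vL eL[OF j]] by simp
      also have "\<dots> = cnj (form_ip (e j) u)" by (rule form_ip_cnj)
      also have "\<dots> = cnj (form_ip (s j) u)"
        using form_ip_cong_ae[OF eL[OF j] A01_L2[OF s(1)[OF j]] u s(2)[OF j]] by simp
      also have "\<dots> = form_ip u (s j)" by (rule form_ip_cnj[symmetric])
      finally show ?thesis .
    qed
    have "form_ae_eq w (form_sum (\<lambda>j. form_ip w (e j)) e n)"
      by (rule sq_norm_zero_imp_ae_eq[OF harmonic_L2[OF w] form_sum_L2[OF eL] e(3)[OF w]])
    moreover have "form_sum (\<lambda>j. form_ip w (e j)) e n = form_sum (\<lambda>j. form_ip u (s j)) e n"
      unfolding form_sum_def by (intro ext sum.cong refl) (simp add: ip)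
    ultimately have "form_ae_eq w (form_sum (\<lambda>j. form_ip u (s j)) e n)" by simp
    then have "form_ae_eq w (form_sum (\<lambda>j. form_ip u (s j)) s n)"
      by (rule form_ae_eq_trans[OF _ form_sum_ae_eq[OF s(2)]])
    from form_ae_eq_lincomb[OF form_ae_eq_refl this]
    have "form_ae_eq (F_op A g u) (\<lambda>p x. 1 * u p x + (-2) * form_sum (\<lambda>j. form_ip u (s j)) s n p x)"
      unfolding F .
    then show ?thesis using FL unfolding L_def finite_rank_form_sum by simp
  qed
  show thesis by (rule that[OF L]) (use * in blast)+
qed

text \<open>The identity part of \<open>F\<close> commutes with multiplication by \<open>f\<close>;
  what remains is a difference of two finite rank operators.\<close>

lemma commutator_smooth_finite_rank:
  assumes g: "riemannian_metric A g" "J_invariant g" and f: "f \<in> Cinf A"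
  shows "\<exists>L. smooth_finite_rank (commutator (F_op A g) f) L"
proof -
  obtain L where L: "set L \<subseteq> A01 A \<times> A01 A" "\<And>u. u \<in> L2 \<Longrightarrow> F_op A g u \<in> L2"
    "\<And>u. u \<in> L2 \<Longrightarrow> form_ae_eq (F_op A g u) (\<lambda>p v. 1 * u p v + 1 * finite_rank L u p v)"
    by (rule F_op_finite_rank) (rule that, assumption, blast intro: g, blast intro: g)
  have fc: "(\<lambda>p. cnj (f p)) \<in> Cinf A"
    unfolding Cinf_def using smooth_on_cnj[OF charts_open(2) Cinf_smooth[OF f]] by (simp add: comp_def)
  have fm: "(\<lambda>p. - f p) \<in> Cinf A"
    unfolding Cinf_def using smooth_on_uminus[OF charts_open(2) Cinf_smooth[OF f]] by (simp add: comp_def)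
  \<comment> \<open>Multiplying the argument by \<open>f\<close> moves to the second slot as the
    adjoint \<open>cnj f\<close>; multiplying the result by \<open>- f\<close> acts on the first
    slot.\<close>
  define M where "M = map (\<lambda>t. (fst t, fun_mult (\<lambda>p. cnj (f p)) (snd t))) L @
    map (\<lambda>t. (fun_mult (\<lambda>p. - f p) (fst t), snd t)) L"
  have M: "set M \<subseteq> A01 A \<times> A01 A" using L(1) by (auto simp: M_def intro!: A01_fun_mult fc fm)
  have "commutator (F_op A g) f u \<in> L2 \<and> form_ae_eq (commutator (F_op A g) f u) (finite_rank M u)" if u: "u \<in> L2" for u
  proof -
    have fu: "fun_mult f u \<in> L2" by (rule L2_fun_mult[OF f u])
    have C: "commutator (F_op A g) f u = (\<lambda>p v. 1 * F_op A g (fun_mult f u) p v + (-1) * fun_mult f (F_op A g u) p v)"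
      by (simp add: commutator_def fun_eq_iff)
    have "commutator (F_op A g) f u \<in> L2"
      unfolding C by (rule L2_lincomb[OF L(2)[OF fu] L2_fun_mult[OF f L(2)[OF u]]])
    moreover have "form_ae_eq (commutator (F_op A g) f u)
      (\<lambda>p v. 1 * (1 * fun_mult f u p v + 1 * finite_rank L (fun_mult f u) p v) +
        (-1) * fun_mult f (\<lambda>p v. 1 * u p v + 1 * finite_rank L u p v) p v)"
      unfolding C by (rule form_ae_eq_lincomb[OF L(3)[OF fu] form_ae_eq_fun_mult[OF L(3)[OF u]]])
    moreover have "(\<lambda>p v. 1 * (1 * fun_mult f u p v + 1 * finite_rank L (fun_mult f u) p v) +
        (-1) * fun_mult f (\<lambda>p v. 1 * u p v + 1 * finite_rank L u p v) p v) = finite_rank M u"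
      unfolding M_def finite_rank_append finite_rank_fun_mult finite_rank_fun_mult_arg[symmetric]
      by (simp add: fun_mult_def algebra_simps)
    ultimately show ?thesis by simp
  qed
  then show ?thesis using M by (auto simp: smooth_finite_rank_def)
qed

end

lemma Op_add:
  assumes a: "smoothing_symbol a" and b: "smoothing_symbol b" and u: "u \<in> test_functions UNIV"
  shows "Op (\<lambda>p. a p + b p) u x = Op a u x + Op b u x"
proof -
  have i: "integrable lborel (\<lambda>\<xi>. cis (x \<bullet> \<xi>) * a (x, \<xi>) * fourier u \<xi>)" if sa: "smoothing_symbol a" for a
  proof -
    obtain C where C: "\<And>x \<xi>. norm (a (x, \<xi>)) \<le> C" using smoothing_symbol_decay[OF sa, of 0] by auto
    have "continuous_on UNIV a" by (rule smooth_on_continuous[OF smoothing_symbol_smooth[OF sa]])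
    then have "continuous_on UNIV (\<lambda>\<xi>. a (x, \<xi>))"
      by (rule continuous_on_compose2) (auto intro!: continuous_intros)
    then have "continuous_on UNIV (\<lambda>\<xi>. cis (x \<bullet> \<xi>) * a (x, \<xi>))"
      unfolding cis_conv_exp by (intro continuous_intros)
    then show ?thesis by (rule symbol_integrand_integrable[where C = C and N = 0, OF _ _ u]) (simp add: norm_mult C)
  qed
  show ?thesis
    using Bochner_Integration.integral_add[OF i[OF a] i[OF b]]
    by (simp add: Op_def algebra_simps add_divide_distrib)
qed

section \<open>Symbols and residues of finite rank operators, and uniqueness of the 2-form\<close>

context compact_curve
begin

text \<open>In a chart each pair of the list contributes a rank one operator with compactly
  supported smooth kernel, and its exact symbol is of the smoothing kind.\<close>

lemma finite_rank_symbol: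
  assumes c: "c \<in> charts A" and \<phi>: "\<phi> \<in> test_functions (img c)" and \<psi>: "\<psi> \<in> test_functions (img c)"
    and L: "set L \<subseteq> A01 A \<times> A01 A"
  shows "\<exists>a. smoothing_symbol a \<and> (\<forall>u\<in>test_functions UNIV. \<forall>x.
    Op a u x = \<phi> x * coeff01 A c (finite_rank L (form01_of_coeff A c (\<lambda>y. \<psi> y * u y))) x)"
  using L
proof (induction L)
  case Nil
  show ?case by (rule exI[of _ "\<lambda>p. 0"]) (simp add: smoothing_symbol_zero Op_def coeff01_def)
next
  case (Cons t L)
  then obtain a where a: "smoothing_symbol a" "\<And>u x. u \<in> test_functions UNIV \<Longrightarrow>
    Op a u x = \<phi> x * coeff01 A c (finite_rank L (form01_of_coeff A c (\<lambda>y. \<psi> y * u y))) x" by auto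
  have t: "fst t \<in> A01 A" "snd t \<in> A01 A" using Cons.prems by auto
  then have sm: "smooth_on (img c) (coeff01 A c (fst t))" "smooth_on (img c) (coeff01 A c (snd t))"
    using c by (auto simp: A01_def)
  note o = charts_open(2)[OF c]
  define \<alpha> where "\<alpha> = (\<lambda>x. \<phi> x * coeff01 A c (fst t) x)"
  \<comment> \<open>The factor 2 is that of \<open>form_ip\<close>, and the conjugate appears
    because the listed form stands in the second argument.\<close>
  define \<beta> where "\<beta> = (\<lambda>y. \<psi> y * (2 * cnj (coeff01 A c (snd t) y)))"
  have \<alpha>: "\<alpha> \<in> test_functions UNIV"
    unfolding \<alpha>_def by (rule test_functions_mono[OF subset_UNIV test_functions_mult_smooth[OF \<phi> o sm(1)]])
  have "smooth_on (img c) (\<lambda>y. 2 * cnj (coeff01 A c (snd t) y))"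
    by (intro smooth_on_mult smooth_on_const smooth_on_cnj o sm)
  then have \<beta>: "\<beta> \<in> test_functions UNIV"
    unfolding \<beta>_def by (intro test_functions_mono[OF subset_UNIV test_functions_mult_smooth[OF \<psi> o]])
  let ?s = "\<lambda>(x, \<xi>). \<alpha> x * cis (- (x \<bullet> \<xi>)) * fourier (\<lambda>y. \<beta> (- y)) \<xi>"
  have s: "smoothing_symbol ?s" by (rule smoothing_symbol.single[OF \<alpha> test_functions_reflect[OF \<beta>, of 0, unfolded diff_0]])
  have "Op (\<lambda>p. ?s p + a p) u x = \<phi> x * coeff01 A c (finite_rank (t # L) (form01_of_coeff A c (\<lambda>y. \<psi> y * u y))) x"
    if u: "u \<in> test_functions UNIV" for u x
  proof -
    let ?w = "form01_of_coeff A c (\<lambda>y. \<psi> y * u y)"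
    have \<psi>u: "(\<lambda>y. \<psi> y * u y) \<in> test_functions (img c)"
      by (rule test_functions_mult_smooth[OF \<psi> o test_functions_smooth[OF u]])
    have "form_ip ?w (snd t) = cnj (form_ip (snd t) ?w)" by (rule form_ip_cnj)
    also have "\<dots> = 2 * cnj (\<integral>x. coeff01 A c (snd t) x * cnj (\<psi> x * u x) \<partial>lborel)"
      unfolding form_ip_form01[OF A01_L2[OF t(2)] c \<psi>u] by simp
    also have "\<dots> = 2 * (\<integral>x. cnj (coeff01 A c (snd t) x * cnj (\<psi> x * u x)) \<partial>lborel)"
      by (simp only: Bochner_Integration.integral_cnj)
    also have "\<dots> = (\<integral>x. 2 * cnj (coeff01 A c (snd t) x * cnj (\<psi> x * u x)) \<partial>lborel)" by simp
    also have "\<dots> = (\<integral>y. \<beta> y * u y \<partial>lborel)"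
      by (intro Bochner_Integration.integral_cong refl) (simp add: \<beta>_def)
    finally have "Op ?s u x = \<phi> x * (form_ip ?w (snd t) * coeff01 A c (fst t) x)"
      unfolding Op_smoothing_single[OF \<alpha> \<beta> u] by (simp add: \<alpha>_def)
    then show ?thesis
      unfolding Op_add[OF s a(1) u] a(2)[OF u] finite_rank.simps coeff01_lincomb by (simp add: distrib_left)
  qed
  then show ?case using smoothing_symbol.add[OF s a(1)] by blast
qed

theorem Wres_finite_rank:
  assumes T: "smooth_finite_rank T L"
  shows "Wres A T = 0"
proof (rule Wres_smoothing[OF _ _ ex_partition_of_unity_atlas])
  have L: "set L \<subseteq> A01 A \<times> A01 A" and TL: "\<And>u. u \<in> L2 \<Longrightarrow> T u \<in> L2"
    and Te: "\<And>u. u \<in> L2 \<Longrightarrow> form_ae_eq (T u) (finite_rank L u)"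
    using T by (auto simp: smooth_finite_rank_def)
  {
    fix \<alpha> \<beta> s t assume "\<alpha> \<in> A01 A" "\<beta> \<in> A01 A"
    then have a: "\<alpha> \<in> L2" "\<beta> \<in> L2" by (auto intro: A01_L2)
    let ?l = "\<lambda>p v. s * \<alpha> p v + t * \<beta> p v"
    have l: "?l \<in> L2" by (rule L2_lincomb[OF a])
    have "form_ae_eq (T ?l) (\<lambda>p v. s * finite_rank L \<alpha> p v + t * finite_rank L \<beta> p v)"
      using Te[OF l] unfolding finite_rank_lincomb[OF L a] .
    from form_ae_eq_trans[OF this form_ae_eq_sym[OF form_ae_eq_lincomb[OF Te[OF a(1)] Te[OF a(2)]]]]
    show "ae_eq A (T ?l) (\<lambda>p v. s * T \<alpha> p v + t * T \<beta> p v)"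
      by (rule form_ae_eq_imp_ae_eq[rotated 2])
        (rule type01_L2[OF TL[OF l]], rule type01_L2[OF L2_lincomb[OF TL[OF a(1)] TL[OF a(2)]]])
  next
    fix c \<phi> \<psi> assume c: "c \<in> charts A" and \<phi>: "\<phi> \<in> test_functions (img c)" and \<psi>: "\<psi> \<in> test_functions (img c)"
    obtain a where a: "smoothing_symbol a" "\<And>u x. u \<in> test_functions UNIV \<Longrightarrow>
      Op a u x = \<phi> x * coeff01 A c (finite_rank L (form01_of_coeff A c (\<lambda>y. \<psi> y * u y))) x"
      using finite_rank_symbol[OF c \<phi> \<psi> L] by blast
    have "AE x in lborel. \<phi> x * coeff01 A c (T (form01_of_coeff A c (\<lambda>y. \<psi> y * u y))) x = Op a u x"
      if u: "u \<in> test_functions UNIV" for u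
    proof -
      let ?w = "form01_of_coeff A c (\<lambda>y. \<psi> y * u y)"
      have "?w \<in> L2"
        by (rule A01_L2[OF form01_A01[OF c test_functions_mult_smooth[OF \<psi> charts_open(2)[OF c] test_functions_smooth[OF u]]]])
      from Te[OF this] have "AE x in lborel. x \<in> img c \<longrightarrow> coeff01 A c (T ?w) x = coeff01 A c (finite_rank L ?w) x"
        using c by (auto simp: form_ae_eq_def)
      then show ?thesis
      proof eventually_elim
        case (elim x)
        then show ?case using test_functions_outside[OF \<phi>, of x] by (cases "x \<in> img c") (simp_all add: a(2)[OF u])
      qed
    qed
    then show "\<exists>a. smoothing_symbol a \<and> local_symbol A T c \<phi> \<psi> a"
      using a(1) unfolding local_symbol_def by blast
  }
qed

lemma Wres_commutators:
  assumes g: "riemannian_metric A g1" "J_invariant g1" "riemannian_metric A g2" "J_invariant g2"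
    and f: "f0 \<in> Cinf A" "f1 \<in> Cinf A" "f2 \<in> Cinf A"
  shows "Wres A (\<lambda>u. fun_mult f0 (commutator (F_op A g1) f1 (commutator (F_op A g2) f2 u))) = 0"
proof -
  obtain L M where "smooth_finite_rank (commutator (F_op A g1) f1) L" "smooth_finite_rank (commutator (F_op A g2) f2) M"
    using commutator_smooth_finite_rank[OF g(1,2) f(2)] commutator_smooth_finite_rank[OF g(3,4) f(3)] by blast
  from Wres_finite_rank[OF smooth_finite_rank_fun_mult[OF f(1) smooth_finite_rank_compose[OF this]]]
  show ?thesis .
qed

lemma form_integral_pou:
  "form_integral A \<eta> = (\<Sum>(c,h)\<in>pou. LINT x : img c | lborel. of_real (h (param c x)) * coeff2 A c \<eta> x)"
  by (simp add: form_integral_def density_integral_def pou_def)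

text \<open>Testing against \<open>cnj w / g(1,1)\<close>, where \<open>\<eta> = w dx \<and> dy\<close> in the preferred charts, makes the
  integral the squared norm of \<open>\<eta>\<close> for the metric \<open>g\<close>.\<close>

lemma form_integral_zero_imp_zero:
  assumes g: "riemannian_metric A g" "J_invariant g" and \<eta>: "\<eta> \<in> smooth_2forms A"
    and z: "\<And>f. f \<in> Cinf A \<Longrightarrow> form_integral A (\<lambda>p u v. f p * \<eta> p u v) = 0"
  shows "\<eta> = (\<lambda>p u v. 0)"
proof -
  define W where "W p = \<eta> p 1 \<i>" for p
  have W: "\<eta> p u v = W p * of_real (dxdy u v)" for p u v
  proof -
    obtain w where w: "\<And>u v. \<eta> p u v = w * of_real (dxdy u v)" using \<eta> unfolding smooth_2forms_def by blast
    then have "W p = w" by (simp add: W_def dxdy_def)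
    then show ?thesis using w by simp
  qed
  \<comment> \<open>The squared length of a coordinate vector, which is smooth in the chart. The
    test function below divides by \<open>g p 1 1\<close>, taken in the preferred frame; written
    through \<open>G\<close> and the coefficient of \<open>\<eta>\<close>, the area factors of the
    frame cancel and its smoothness becomes visible.\<close>
  define G where "G c x = g (param c x) (vec_of_chart A c x 1) (vec_of_chart A c x 1)" for c x
  have G: "G c x = g (param c x) 1 1 * (norm (frame c x))\<^sup>2" for c x
    unfolding G_def vec_of_chart_frame mult_1_right by (rule J_invariant_metric(4)[OF g])
  have gp: "g p 1 1 > 0" for p by (rule J_invariant_metric(3)[OF g])
  have dxdy_frame: "dxdy (k * 1) (k * \<i>) = (norm k)\<^sup>2" for k
    unfolding cmod_power2 by (simp add: dxdy_def power2_eq_square)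
  have co: "coeff2 A c \<eta> x = W (param c x) * of_real ((norm (frame c x))\<^sup>2)" for c x
    unfolding coeff2_def vec_of_chart_frame W dxdy_frame ..
  have Gpos: "G c x > 0" if "c \<in> charts A" "x \<in> img c" for c x
    unfolding G using gp frame_nonzero[OF that] by simp
  define f where "f p = cnj (W p) / of_real (g p 1 1)" for p
  have fc: "f (param c x) = cnj (coeff2 A c \<eta> x) / of_real (G c x)" if "c \<in> charts A" "x \<in> img c" for c x
    unfolding co G f_def using frame_nonzero[OF that] by simp
  have smG: "smooth_on (img c) (G c)" and smE: "smooth_on (img c) (coeff2 A c \<eta>)" if "c \<in> charts A" for c
    using g(1) \<eta> that by (auto simp: riemannian_metric_def smooth_2forms_def G_def[abs_def])
  have "f \<in> Cinf A"
  proof -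
    have "smooth_on (img c) (f \<circ> param c)" if c: "c \<in> charts A" for c
    proof (rule smooth_on_cong[OF charts_open(2)[OF c]])
      show "smooth_on (img c) (\<lambda>x. cnj (coeff2 A c \<eta> x) / of_real (G c x))"
        by (intro smooth_on_divide smooth_on_cnj smooth_on_of_real charts_open(2) c smG smE)
          (use Gpos[OF c] in force)
    qed (simp add: fc[OF c])
    then show ?thesis by (simp add: Cinf_def)
  qed
  note int0 = z[OF this]
  define q where "q c x = (norm (coeff2 A c \<eta> x))\<^sup>2 / G c x" for c x
  have cq: "continuous_on (img c) (q c)" if c: "c \<in> charts A" for c
    unfolding q_def by (intro continuous_intros smooth_on_continuous smG smE c) (use Gpos[OF c] in force)
  define I where "I t = (\<integral>x. weight (fst t) (snd t) x * q (fst t) x \<partial>lborel)" for t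
  have q0: "0 \<le> weight c h x * q c x" if ch: "(c, h) \<in> pou" for c h x
    using weight_nonneg[OF ch, of x] Gpos[OF pou_mem(1)[OF ch], of x]
    by (cases "x \<in> img c") (auto simp: q_def weight_def)
  have "form_integral A (\<lambda>p u v. f p * \<eta> p u v) = (\<Sum>t\<in>pou. of_real (I t))"
    unfolding form_integral_pou
  proof (intro sum.cong refl)
    fix t assume "t \<in> pou"
    obtain c h where t: "t = (c, h)" by (rule prod.exhaust)
    have c: "c \<in> charts A" using \<open>t \<in> pou\<close> pou_mem(1) t by blast
    have co': "coeff2 A c (\<lambda>p u v. f p * \<eta> p u v) x = of_real (q c x)" if "x \<in> img c" for x
    proof -
      have "coeff2 A c (\<lambda>p u v. f p * \<eta> p u v) x = f (param c x) * coeff2 A c \<eta> x" by (simp add: coeff2_def)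
      also have "\<dots> = (coeff2 A c \<eta> x * cnj (coeff2 A c \<eta> x)) / of_real (G c x)"
        unfolding fc[OF c that] by simp
      also have "\<dots> = of_real (q c x)" unfolding q_def complex_norm_square[symmetric] by simp
      finally show ?thesis .
    qed
    have "(LINT x : img c | lborel. of_real (h (param c x)) * coeff2 A c (\<lambda>p u v. f p * \<eta> p u v) x) =
      (\<integral>x. of_real (weight c h x * q c x) \<partial>lborel)"
      unfolding set_lebesgue_integral_def
      by (intro Bochner_Integration.integral_cong refl) (auto simp: weight_def indicator_def co')
    then show "(case t of (c, h) \<Rightarrow> LINT x : img c | lborel. of_real (h (param c x)) *
        coeff2 A c (\<lambda>p u v. f p * \<eta> p u v) x) = of_real (I t)"
      by (simp only: t I_def prod.case fst_conv snd_conv integral_complex_of_real)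
  qed
  then have "(\<Sum>t\<in>pou. I t) = 0" using int0 by (simp flip: of_real_sum)
  moreover have I0: "0 \<le> I t" if "t \<in> pou" for t
    unfolding I_def by (intro integral_nonneg_AE AE_I2 q0) (use that in simp)
  ultimately have I: "I t = 0" if "t \<in> pou" for t
    using sum_nonneg_eq_0_iff[OF finite_pou I0] that by simp
  \<comment> \<open>A nonnegative integrand with zero integral vanishes almost everywhere, and by
    continuity at every point of the chart.\<close>
  have zero: "h (param c x) * q c x = 0" if ch: "(c, h) \<in> pou" and x: "x \<in> img c" for c h x
  proof -
    note c = pou_mem(1)[OF ch]
    have ch': "continuous_on (img c) (\<lambda>x. h (param c x))"
      using smooth_on_continuous[OF Cinf_smooth[OF pou_mem(2)[OF ch] c]] by (simp add: comp_def)
    have cont: "continuous_on (img c) (\<lambda>x. h (param c x) * q c x)"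
      by (intro continuous_intros ch' cq[OF c])
    obtain K where K: "compact K" "K \<subseteq> img c" "\<And>x. x \<in> img c \<Longrightarrow> x \<notin> K \<Longrightarrow> h (param c x) = 0"
      using pou_support[OF ch] by blast
    have "integrable lborel (\<lambda>x. indicator K x *\<^sub>R (h (param c x) * q c x))"
      by (rule borel_integrable_compact[OF K(1) continuous_on_subset[OF cont K(2)]])
    also have "(\<lambda>x. indicator K x *\<^sub>R (h (param c x) * q c x)) = (\<lambda>x. weight c h x * q c x)"
      using K(2,3) by (auto simp: weight_def indicator_def fun_eq_iff)
    finally have int: "integrable lborel (\<lambda>x. weight c h x * q c x)" .
    have "AE x in lborel. weight c h x * q c x = 0"
      using I[OF ch] integral_nonneg_eq_0_iff_AE[OF int AE_I2[OF q0[OF ch]]] by (simp add: I_def)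
    then have "AE x in lborel. x \<in> img c \<longrightarrow> h (param c x) * q c x = 0"
      by eventually_elim (auto simp: weight_def)
    from AE_eq_imp_eq_on_open[OF charts_open(2)[OF c] cont continuous_on_const this x] show ?thesis .
  qed
  have "W p = 0" for p
  proof -
    have "\<exists>t\<in>pou. snd t p \<noteq> 0"
    proof (rule ccontr)
      assume "\<not> (\<exists>t\<in>pou. snd t p \<noteq> 0)"
      then have "(\<Sum>(c, h)\<in>pou. h p) = 0" by (intro sum.neutral) auto
      then show False by (simp add: pou_sum)
    qed
    then obtain c h where ch: "(c, h) \<in> pou" "h p \<noteq> 0" by auto
    note c = pou_mem(1)[OF ch(1)]
    have p: "p \<in> dom c" using pou_outside[OF ch(1)] ch(2) by blast
    have x: "coord c p \<in> img c" "param c (coord c p) = p"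
      using is_chart_param(3,4)[OF charts_is_chart[OF c] p] by auto
    have "q c (coord c p) = 0" using zero[OF ch(1) x(1)] ch(2) by (simp add: x(2))
    then have "coeff2 A c \<eta> (coord c p) = 0" using Gpos[OF c x(1)] by (simp add: q_def)
    then show ?thesis using frame_nonzero[OF c x(1)] by (simp add: co x(2))
  qed
  then show ?thesis by (simp add: fun_eq_iff W)
qed

end

theorem theorem7p1:
  fixes A :: "'a::{t2_space, second_countable_topology} chart set"
    and g1 g2 :: "'a metric"
    and f1 f2 :: "'a \<Rightarrow> complex"
  assumes "complex_atlas A"
    and "compact (UNIV :: 'a set)"
    and "connected (UNIV :: 'a set)"
    and "riemannian_metric A g1" and "J_invariant g1"
    and "riemannian_metric A g2" and "J_invariant g2"
    and "f1 \<in> Cinf A" and "f2 \<in> Cinf A"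
  shows "Omega A g1 g2 f1 f2 = (\<lambda>p u v. 0)"
proof -
  interpret compact_curve A by standard (fact assms)+
  note W = Wres_commutators[OF assms(4-7) _ assms(8,9)]
  show ?thesis unfolding Omega_def
  \<comment> \<open>Zero is a candidate because all residues vanish. Any other candidate integrates
    to 0 against every smooth function, and the metric \<open>g1\<close> supplies the norm that then
    forces it to be 0.\<close>
  proof (rule the_equality)
    have "(\<lambda>p u v. 0) \<in> smooth_2forms A"
      by (auto simp: smooth_2forms_def coeff2_def[abs_def] intro: exI[of _ 0])
    moreover have "form_integral A (\<lambda>p u v. f p * 0) = 0" for f :: "'a \<Rightarrow> complex"
      by (simp add: form_integral_def density_integral_def coeff2_def case_prod_unfold)
    ultimately show "(\<lambda>p u v. 0) \<in> smooth_2forms A \<and> (\<forall>f0\<in>Cinf A.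
        Wres A (\<lambda>u. fun_mult f0 (commutator (F_op A g1) f1 (commutator (F_op A g2) f2 u))) =
        form_integral A (\<lambda>p u v. f0 p * 0))" using W by simp
  next
    fix \<eta> assume "\<eta> \<in> smooth_2forms A \<and> (\<forall>f0\<in>Cinf A.
        Wres A (\<lambda>u. fun_mult f0 (commutator (F_op A g1) f1 (commutator (F_op A g2) f2 u))) =
        form_integral A (\<lambda>p u v. f0 p * \<eta> p u v))"
    then show "\<eta> = (\<lambda>p u v. 0)"
      by (intro form_integral_zero_imp_zero[OF assms(4,5)]) (use W in auto)
  qed
qed

end
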